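(* Under rerandomization with tiers of factorial effects ($\text{ReFMT}_\text{F}$) with thresholds $a_1,\dots,a_H>0$, and under the regularity conditions (i)–(iii) below, $$\hat{\boldsymbol{\tau}}-\boldsymbol{\tau}\mid\mathcal{T}_F\ \dot\sim\ (\boldsymbol{V}^{\perp}_{\tau\tau})^{1/2}\boldsymbol{\varepsilon}+\sum_{h=1}^H(\boldsymbol{W}^{\parallel}_{\tau\tau}[h])^{1/2}_{LF_h}\boldsymbol{\zeta}_{LF_h,a_h},$$ where $\boldsymbol{\varepsilon}\sim\mathcal{N}(\boldsymbol{0},\boldsymbol{I}_F),\boldsymbol{\zeta}_{LF_1,a_1},\dots,\boldsymbol{\zeta}_{LF_H,a_H}$ are jointly independent.
   Context: Setup ($2^K$ factorial experiment, finite population). $K\ge1$ two-level factors, $Q=2^K$ treatment combinations $q=1,\dots,Q$; combination $q$ sets factor $k$ at $\iota_k(q)\in\{-1,+1\}$, bijectively onto $\{-1,+1\}^K$. $F=Q-1$ factorial effects, one per nonempty $A\subseteq\{1,\dots,K\}$, enumerated $f=1,\dots,F$, with $g_{fq}=\prod_{k\in A}\iota_k(q)$; $\boldsymbol{b}_q=(g_{1q},\dots,g_{Fq})'$. Units $i=1,\dots,n$ have fixed potential outcomes $Y_i(q)$ and covariates $\boldsymbol{x}_i\in\mathbb{R}^L$; $\bar Y(q),\bar{\boldsymbol{x}}$ means; $\boldsymbol{\tau}=2^{-(K-1)}\sum_q\boldsymbol{b}_q\bar Y(q)$. Finite-population (co)variances with divisor $n-1$: $S_{qk}$ between $Y(q),Y(k)$;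 $\boldsymbol{S}_{xx}$ of $\boldsymbol{x}$; $\boldsymbol{S}_{q,x}$ between $Y(q),\boldsymbol{x}$. $Y_i^{\perp}(q)=Y_i(q)-\bar Y(q)-\boldsymbol{S}_{q,x}\boldsymbol{S}_{xx}^{-1}(\boldsymbol{x}_i-\bar{\boldsymbol{x}})$, $\boldsymbol{\tau}_i^{\perp}=2^{-(K-1)}\sum_q\boldsymbol{b}_qY_i^{\perp}(q)$, $S^{\perp}_{qq}$ and $\boldsymbol{S}^{\perp}_{\tau\tau}$ their finite-population variances, $\boldsymbol{V}^{\perp}_{\tau\tau}=2^{-2(K-1)}\sum_qn_q^{-1}\boldsymbol{b}_q\boldsymbol{b}_q'S^{\perp}_{qq}-n^{-1}\boldsymbol{S}^{\perp}_{\tau\tau}$. CRFE: fixed $n_q\ge1$, $\sum n_q=n$; $\boldsymbol{Z}$ uniform over assignments with $n_q$ units in combination $q$; $\hat{\bar Y}(q),\hat{\bar{\boldsymbol{x}}}(q)$ group-$q$ means of observed outcomes $Y_i(Z_i)$ and covariates; $\hat{\boldsymbol{\tau}}=2^{-(K-1)}\sum_q\boldsymbol{b}_q\hat{\bar Y}(q)$. Tiers: partition $\{1,\dots,F\}$ into disjoint nonempty $\mathcal{F}_1,\dots,\mathcal{F}_H$, $F_h=|\mathcal{F}_h|$, $\mathcal{F}_{\overline h}=\bigcup_{l\le h}\mathcal{F}_l$. $\tilde{\boldsymbol{B}}=2^{-2(K-1)}\sum_qn_q^{-1}\boldsymbol{b}_q\boldsymbol{b}_q'$; for index sets $\mathcal{I},\mathcal{J}$,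 $\boldsymbol{b}_q[\mathcal{I}]$ is the subvector and $\tilde{\boldsymbol{B}}[\mathcal{I},\mathcal{J}]$ the submatrix. Define $\boldsymbol{c}_q[1]=\boldsymbol{b}_q[\mathcal{F}_1]$ and for $h\ge2$, $\boldsymbol{c}_q[h]=\boldsymbol{b}_q[\mathcal{F}_h]-\tilde{\boldsymbol{B}}[\mathcal{F}_h,\mathcal{F}_{\overline{h-1}}]\{\tilde{\boldsymbol{B}}[\mathcal{F}_{\overline{h-1}},\mathcal{F}_{\overline{h-1}}]\}^{-1}\boldsymbol{b}_q[\mathcal{F}_{\overline{h-1}}]$. Let $\hat{\boldsymbol{\theta}}_x[h]=2^{-(K-1)}\sum_q\boldsymbol{c}_q[h]\otimes\hat{\bar{\boldsymbol{x}}}(q)$, $\boldsymbol{W}_{\tau x}[h]=2^{-2(K-1)}\sum_qn_q^{-1}(\boldsymbol{b}_q\boldsymbol{c}_q[h]')\otimes\boldsymbol{S}_{q,x}$, $\boldsymbol{W}_{x\tau}[h]=\boldsymbol{W}_{\tau x}[h]'$, $\boldsymbol{W}_{xx}[h]=2^{-2(K-1)}\sum_qn_q^{-1}(\boldsymbol{c}_q[h]\boldsymbol{c}_q[h]')\otimes\boldsymbol{S}_{xx}$, $\boldsymbol{W}^{\parallel}_{\tau\tau}[h]=\boldsymbol{W}_{\tau x}[h]\boldsymbol{W}_{xx}[h]^{-1}\boldsymbol{W}_{x\tau}[h]$, and $M_h=\hat{\boldsymbol{\theta}}_x[h]'\boldsymbol{W}_{xx}[h]^{-1}\hat{\boldsymbol{\theta}}_x[h]$.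 $\text{ReFMT}_\text{F}$ accepts an assignment iff $M_h\le a_h$ for all $h$; $\mathcal{T}_F$ is this event, and the distribution under $\text{ReFMT}_\text{F}$ is the CRFE distribution conditional on $\mathcal{T}_F$. Matrix roots: $\boldsymbol{A}^{1/2}$ symmetric PSD root; $\boldsymbol{A}^{1/2}_p$ any $m\times p$ matrix with $\boldsymbol{A}^{1/2}_p(\boldsymbol{A}^{1/2}_p)'=\boldsymbol{A}$ ($p\ge\mathrm{rank}\,\boldsymbol{A}$). $\boldsymbol{\zeta}_{m,a}\sim\boldsymbol{D}\mid\boldsymbol{D}'\boldsymbol{D}\le a$, $\boldsymbol{D}\sim\mathcal{N}(\boldsymbol{0},\boldsymbol{I}_m)$. Regularity conditions, as $n\to\infty$, for all $q\ne k$: (i) $n_q/n$ has a positive limit; (ii) $S_{qq},S_{qk},\boldsymbol{S}_{xx},\boldsymbol{S}_{q,x}$ have limits, $\boldsymbol{S}_{xx}$ and its limit nonsingular; (iii) $\max_i|Y_i(q)-\bar Y(q)|^2/n\to0$, $\max_i\|\boldsymbol{x}_i-\bar{\boldsymbol{x}}\|_2^2/n\to0$. $\boldsymbol{A}_n\dot\sim\boldsymbol{B}_n$ means $\sqrt n\boldsymbol{A}_n$ and $\sqrt n\boldsymbol{B}_n$ converge weakly to the same distribution. *)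

theory Defs
  imports "HOL-Probability.Probability"
begin

text \<open>Vectors are functions nat => real, matrices nat => nat => real; dimensions
are carried explicitly and only the entries with indices below the dimension matter.\<close>

type_synonym rvec = "nat \<Rightarrow> real"
type_synonym rmat = "nat \<Rightarrow> nat \<Rightarrow> real"

definition mmul :: "nat \<Rightarrow> rmat \<Rightarrow> rmat \<Rightarrow> rmat" where
  "mmul k A B = (\<lambda>i j. \<Sum>l<k. A i l * B l j)"

definition mtr :: "rmat \<Rightarrow> rmat" where
  "mtr A = (\<lambda>i j. A j i)"

definition outer :: "rvec \<Rightarrow> rvec \<Rightarrow> rmat" where
  "outer u v = (\<lambda>i j. u i * v j)"

definition is_inverse :: "nat \<Rightarrow> rmat \<Rightarrow> rmat \<Rightarrow> bool" where
  "is_inverse d A B \<longleftrightarrow>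
     (\<forall>i<d. \<forall>j<d. mmul d A B i j = (if i = j then 1 else 0)) \<and>
     (\<forall>i j. \<not> (i < d \<and> j < d) \<longrightarrow> B i j = 0)"

text \<open>Inverse of the d x d matrix A (meaningful when A is nonsingular).\<close>
definition minv :: "nat \<Rightarrow> rmat \<Rightarrow> rmat" where
  "minv d A = (THE B. is_inverse d A B)"

definition nonsingular :: "nat \<Rightarrow> rmat \<Rightarrow> bool" where
  "nonsingular d A \<longleftrightarrow> (\<exists>B. is_inverse d A B)"

definition kron :: "nat \<Rightarrow> nat \<Rightarrow> rmat \<Rightarrow> rmat \<Rightarrow> rmat" where
  "kron r c A B = (\<lambda>i j. A (i div r) (j div c) * B (i mod r) (j mod c))"

definition kronv :: "nat \<Rightarrow> rvec \<Rightarrow> rvec \<Rightarrow> rvec" where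
  "kronv r u v = (\<lambda>i. u (i div r) * v (i mod r))"

definition sel :: "nat set \<Rightarrow> nat \<Rightarrow> nat" where
  "sel I j = sorted_list_of_set I ! j"

definition subvec :: "nat set \<Rightarrow> rvec \<Rightarrow> rvec" where
  "subvec I v = (\<lambda>j. v (sel I j))"

definition submat :: "nat set \<Rightarrow> nat set \<Rightarrow> rmat \<Rightarrow> rmat" where
  "submat I J M = (\<lambda>i j. M (sel I i) (sel J j))"

definition pmean :: "nat \<Rightarrow> (nat \<Rightarrow> real) \<Rightarrow> real" where
  "pmean n u = (\<Sum>i<n. u i) / real n"

definition pcov :: "nat \<Rightarrow> (nat \<Rightarrow> real) \<Rightarrow> (nat \<Rightarrow> real) \<Rightarrow> real" where
  "pcov n u v = (\<Sum>i<n. (u i - pmean n u) * (v i - pmean n v)) / (real n - 1)"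

text \<open>Units i < n; Y i q is the potential outcome of unit i under combination q;
x i l is covariate l of unit i.\<close>

definition Sxx :: "nat \<Rightarrow> (nat \<Rightarrow> nat \<Rightarrow> real) \<Rightarrow> rmat" where
  "Sxx n x = (\<lambda>l l'. pcov n (\<lambda>i. x i l) (\<lambda>i. x i l'))"

definition Sqx :: "nat \<Rightarrow> (nat \<Rightarrow> nat \<Rightarrow> real) \<Rightarrow> (nat \<Rightarrow> nat \<Rightarrow> real) \<Rightarrow> nat \<Rightarrow> nat \<Rightarrow> real" where
  "Sqx n Y x q l = pcov n (\<lambda>i. Y i q) (\<lambda>i. x i l)"

text \<open>iota q k is the level (+1 or -1) of factor k (k < K) in combination q (q < 2^K);
eff f (f < 2^K - 1) is the nonempty factor set of factorial effect f.
g_{fq} = geff iota eff f q; the vector b_q is (\<lambda>f. geff iota eff f q).\<close>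

definition geff :: "(nat \<Rightarrow> nat \<Rightarrow> real) \<Rightarrow> (nat \<Rightarrow> nat set) \<Rightarrow> nat \<Rightarrow> nat \<Rightarrow> real" where
  "geff iota eff f q = (\<Prod>k\<in>eff f. iota q k)"

definition taupop :: "nat \<Rightarrow> (nat \<Rightarrow> nat \<Rightarrow> real) \<Rightarrow> (nat \<Rightarrow> nat set) \<Rightarrow> nat \<Rightarrow> (nat \<Rightarrow> nat \<Rightarrow> real) \<Rightarrow> rvec" where
  "taupop K iota eff n Y = (\<lambda>f. (1 / 2 ^ (K - 1)) * (\<Sum>q<2^K. geff iota eff f q * pmean n (\<lambda>i. Y i q)))"

text \<open>Assignments: Z i is the combination of unit i (i < n); Z i = 0 for i >= n (normalisation).\<close>
definition assignments :: "nat \<Rightarrow> nat \<Rightarrow> (nat \<Rightarrow> nat) \<Rightarrow> (nat \<Rightarrow> nat) set" where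
  "assignments Q n nq = {Z. (\<forall>i<n. Z i < Q) \<and> (\<forall>i. n \<le> i \<longrightarrow> Z i = 0) \<and>
                              (\<forall>q<Q. card {i. i < n \<and> Z i = q} = nq q)}"

definition Yhat :: "nat \<Rightarrow> (nat \<Rightarrow> nat \<Rightarrow> real) \<Rightarrow> (nat \<Rightarrow> nat) \<Rightarrow> (nat \<Rightarrow> nat) \<Rightarrow> nat \<Rightarrow> real" where
  "Yhat n Y nq Z q = (\<Sum>i\<in>{i. i < n \<and> Z i = q}. Y i (Z i)) / real (nq q)"

definition xhat :: "nat \<Rightarrow> (nat \<Rightarrow> nat \<Rightarrow> real) \<Rightarrow> (nat \<Rightarrow> nat) \<Rightarrow> (nat \<Rightarrow> nat) \<Rightarrow> nat \<Rightarrow> rvec" where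
  "xhat n x nq Z q = (\<lambda>l. (\<Sum>i\<in>{i. i < n \<and> Z i = q}. x i l) / real (nq q))"

definition tauhat :: "nat \<Rightarrow> (nat \<Rightarrow> nat \<Rightarrow> real) \<Rightarrow> (nat \<Rightarrow> nat set) \<Rightarrow> nat \<Rightarrow> (nat \<Rightarrow> nat \<Rightarrow> real)
    \<Rightarrow> (nat \<Rightarrow> nat) \<Rightarrow> (nat \<Rightarrow> nat) \<Rightarrow> rvec" where
  "tauhat K iota eff n Y nq Z = (\<lambda>f. (1 / 2 ^ (K - 1)) * (\<Sum>q<2^K. geff iota eff f q * Yhat n Y nq Z q))"

definition Tbar :: "(nat \<Rightarrow> nat set) \<Rightarrow> nat \<Rightarrow> nat set" where
  "Tbar T h = (\<Union>l\<in>{1..h}. T l)"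

definition Btil :: "nat \<Rightarrow> (nat \<Rightarrow> nat \<Rightarrow> real) \<Rightarrow> (nat \<Rightarrow> nat set) \<Rightarrow> (nat \<Rightarrow> nat) \<Rightarrow> rmat" where
  "Btil K iota eff nq = (\<lambda>f f'. (1 / 2 ^ (2 * (K - 1))) *
      (\<Sum>q<2^K. (1 / real (nq q)) * geff iota eff f q * geff iota eff f' q))"

definition cvec :: "nat \<Rightarrow> (nat \<Rightarrow> nat \<Rightarrow> real) \<Rightarrow> (nat \<Rightarrow> nat set) \<Rightarrow> (nat \<Rightarrow> nat) \<Rightarrow> (nat \<Rightarrow> nat set)
    \<Rightarrow> nat \<Rightarrow> nat \<Rightarrow> rvec" where
  "cvec K iota eff nq T h q =
     (let b = (\<lambda>f. geff iota eff f q) in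
      if h \<le> 1 then subvec (T 1) b
      else (let P = Tbar T (h - 1); p = card P; B = Btil K iota eff nq in
            (\<lambda>j. subvec (T h) b j -
                 (\<Sum>k<p. \<Sum>k'<p. submat (T h) P B j k * minv p (submat P P B) k k' * subvec P b k'))))"

definition thetax :: "nat \<Rightarrow> (nat \<Rightarrow> nat \<Rightarrow> real) \<Rightarrow> (nat \<Rightarrow> nat set) \<Rightarrow> (nat \<Rightarrow> nat) \<Rightarrow> (nat \<Rightarrow> nat set)
    \<Rightarrow> nat \<Rightarrow> nat \<Rightarrow> (nat \<Rightarrow> nat \<Rightarrow> real) \<Rightarrow> (nat \<Rightarrow> nat) \<Rightarrow> nat \<Rightarrow> rvec" where
  "thetax K iota eff nq T L n x Z h = (\<lambda>i. (1 / 2 ^ (K - 1)) *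
      (\<Sum>q<2^K. kronv L (cvec K iota eff nq T h q) (xhat n x nq Z q) i))"

definition Wtx :: "nat \<Rightarrow> (nat \<Rightarrow> nat \<Rightarrow> real) \<Rightarrow> (nat \<Rightarrow> nat set) \<Rightarrow> (nat \<Rightarrow> nat) \<Rightarrow> (nat \<Rightarrow> nat set)
    \<Rightarrow> nat \<Rightarrow> nat \<Rightarrow> (nat \<Rightarrow> nat \<Rightarrow> real) \<Rightarrow> (nat \<Rightarrow> nat \<Rightarrow> real) \<Rightarrow> nat \<Rightarrow> rmat" where
  "Wtx K iota eff nq T L n Y x h = (\<lambda>i j. (1 / 2 ^ (2 * (K - 1))) *
      (\<Sum>q<2^K. (1 / real (nq q)) *
          kron 1 L (outer (\<lambda>f. geff iota eff f q) (cvec K iota eff nq T h q)) (\<lambda>_ l. Sqx n Y x q l) i j))"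

definition Wxx :: "nat \<Rightarrow> (nat \<Rightarrow> nat \<Rightarrow> real) \<Rightarrow> (nat \<Rightarrow> nat set) \<Rightarrow> (nat \<Rightarrow> nat) \<Rightarrow> (nat \<Rightarrow> nat set)
    \<Rightarrow> nat \<Rightarrow> nat \<Rightarrow> (nat \<Rightarrow> nat \<Rightarrow> real) \<Rightarrow> nat \<Rightarrow> rmat" where
  "Wxx K iota eff nq T L n x h = (\<lambda>i j. (1 / 2 ^ (2 * (K - 1))) *
      (\<Sum>q<2^K. (1 / real (nq q)) *
          kron L L (outer (cvec K iota eff nq T h q) (cvec K iota eff nq T h q)) (Sxx n x) i j))"

definition Wpar :: "nat \<Rightarrow> (nat \<Rightarrow> nat \<Rightarrow> real) \<Rightarrow> (nat \<Rightarrow> nat set) \<Rightarrow> (nat \<Rightarrow> nat) \<Rightarrow> (nat \<Rightarrow> nat set)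
    \<Rightarrow> nat \<Rightarrow> nat \<Rightarrow> (nat \<Rightarrow> nat \<Rightarrow> real) \<Rightarrow> (nat \<Rightarrow> nat \<Rightarrow> real) \<Rightarrow> nat \<Rightarrow> rmat" where
  "Wpar K iota eff nq T L n Y x h =
     (let d = L * card (T h); W = Wtx K iota eff nq T L n Y x h in
      mmul d (mmul d W (minv d (Wxx K iota eff nq T L n x h))) (mtr W))"

definition Mstat :: "nat \<Rightarrow> (nat \<Rightarrow> nat \<Rightarrow> real) \<Rightarrow> (nat \<Rightarrow> nat set) \<Rightarrow> (nat \<Rightarrow> nat) \<Rightarrow> (nat \<Rightarrow> nat set)
    \<Rightarrow> nat \<Rightarrow> nat \<Rightarrow> (nat \<Rightarrow> nat \<Rightarrow> real) \<Rightarrow> (nat \<Rightarrow> nat) \<Rightarrow> nat \<Rightarrow> real" where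
  "Mstat K iota eff nq T L n x Z h =
     (let d = L * card (T h); th = thetax K iota eff nq T L n x Z h;
          Wi = minv d (Wxx K iota eff nq T L n x h) in
      \<Sum>i<d. \<Sum>j<d. th i * Wi i j * th j)"

definition accepted :: "nat \<Rightarrow> (nat \<Rightarrow> nat \<Rightarrow> real) \<Rightarrow> (nat \<Rightarrow> nat set) \<Rightarrow> (nat \<Rightarrow> nat) \<Rightarrow> (nat \<Rightarrow> nat set)
    \<Rightarrow> nat \<Rightarrow> (nat \<Rightarrow> real) \<Rightarrow> nat \<Rightarrow> nat \<Rightarrow> (nat \<Rightarrow> nat \<Rightarrow> real) \<Rightarrow> (nat \<Rightarrow> nat) set" where
  "accepted K iota eff nq T H a L n x =
     {Z \<in> assignments (2^K) n nq. \<forall>h\<in>{1..H}. Mstat K iota eff nq T L n x Z h \<le> a h}"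

definition refmt_pmf :: "nat \<Rightarrow> (nat \<Rightarrow> nat \<Rightarrow> real) \<Rightarrow> (nat \<Rightarrow> nat set) \<Rightarrow> (nat \<Rightarrow> nat) \<Rightarrow> (nat \<Rightarrow> nat set)
    \<Rightarrow> nat \<Rightarrow> (nat \<Rightarrow> real) \<Rightarrow> nat \<Rightarrow> nat \<Rightarrow> (nat \<Rightarrow> nat \<Rightarrow> real) \<Rightarrow> (nat \<Rightarrow> nat) pmf" where
  "refmt_pmf K iota eff nq T H a L n x = pmf_of_set (accepted K iota eff nq T H a L n x)"

definition Yperp :: "nat \<Rightarrow> nat \<Rightarrow> (nat \<Rightarrow> nat \<Rightarrow> real) \<Rightarrow> (nat \<Rightarrow> nat \<Rightarrow> real) \<Rightarrow> nat \<Rightarrow> nat \<Rightarrow> real" where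
  "Yperp n L Y x i q = Y i q - pmean n (\<lambda>i. Y i q) -
     (\<Sum>l<L. \<Sum>l'<L. Sqx n Y x q l * minv L (Sxx n x) l l' * (x i l' - pmean n (\<lambda>i. x i l')))"

definition tauperp :: "nat \<Rightarrow> (nat \<Rightarrow> nat \<Rightarrow> real) \<Rightarrow> (nat \<Rightarrow> nat set) \<Rightarrow> nat \<Rightarrow> nat
    \<Rightarrow> (nat \<Rightarrow> nat \<Rightarrow> real) \<Rightarrow> (nat \<Rightarrow> nat \<Rightarrow> real) \<Rightarrow> nat \<Rightarrow> rvec" where
  "tauperp K iota eff n L Y x i = (\<lambda>f. (1 / 2 ^ (K - 1)) *
      (\<Sum>q<2^K. geff iota eff f q * Yperp n L Y x i q))"

definition Vperp :: "nat \<Rightarrow> (nat \<Rightarrow> nat \<Rightarrow> real) \<Rightarrow> (nat \<Rightarrow> nat set) \<Rightarrow> (nat \<Rightarrow> nat) \<Rightarrow> nat \<Rightarrow> nat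
    \<Rightarrow> (nat \<Rightarrow> nat \<Rightarrow> real) \<Rightarrow> (nat \<Rightarrow> nat \<Rightarrow> real) \<Rightarrow> rmat" where
  "Vperp K iota eff nq n L Y x = (\<lambda>f f'.
     (1 / 2 ^ (2 * (K - 1))) *
       (\<Sum>q<2^K. (1 / real (nq q)) * geff iota eff f q * geff iota eff f' q *
                  pcov n (\<lambda>i. Yperp n L Y x i q) (\<lambda>i. Yperp n L Y x i q))
     - pcov n (\<lambda>i. tauperp K iota eff n L Y x i f) (\<lambda>i. tauperp K iota eff n L Y x i f') / real n)"

definition std_normal_vec :: "nat \<Rightarrow> (nat \<Rightarrow> real) measure" where
  "std_normal_vec d = PiM {..<d} (\<lambda>_. std_normal_distribution)"

definition trunc_normal_vec :: "nat \<Rightarrow> real \<Rightarrow> (nat \<Rightarrow> real) measure" where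
  "trunc_normal_vec d a = uniform_measure (std_normal_vec d)
      {v \<in> space (std_normal_vec d). (\<Sum>i<d. (v i)\<^sup>2) \<le> a}"

definition limit_joint :: "nat \<Rightarrow> nat \<Rightarrow> (nat \<Rightarrow> nat set) \<Rightarrow> nat \<Rightarrow> (nat \<Rightarrow> real)
    \<Rightarrow> (nat \<Rightarrow> nat \<Rightarrow> real) measure" where
  "limit_joint F L T H a = PiM {..H}
     (\<lambda>h. if h = 0 then std_normal_vec F else trunc_normal_vec (L * card (T h)) (a h))"

definition weak_conv_to :: "(nat \<Rightarrow> 'a::topological_space measure) \<Rightarrow> 'a measure \<Rightarrow> bool" where
  "weak_conv_to Ms M \<longleftrightarrow>
     (\<forall>\<phi> :: 'a \<Rightarrow> real. continuous_on UNIV \<phi> \<longrightarrow> bounded (range \<phi>) \<longrightarrow>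
        (\<lambda>m. \<integral>z. \<phi> z \<partial>(Ms m)) \<longlonglongrightarrow> (\<integral>z. \<phi> z \<partial>M))"

text \<open>Two sequences of laws (of the already sqrt n - scaled quantities) converge weakly
to the same probability distribution.\<close>
definition same_weak_limit :: "(nat \<Rightarrow> 'a::topological_space measure) \<Rightarrow> (nat \<Rightarrow> 'a measure) \<Rightarrow> bool" where
  "same_weak_limit Ms Ns \<longleftrightarrow>
     (\<exists>\<mu>. prob_space \<mu> \<and> sets \<mu> = sets borel \<and> weak_conv_to Ms \<mu> \<and> weak_conv_to Ns \<mu>)"

end

theory Submission
  imports Defs "HOL-Real_Asymp.Real_Asymp"
begin

text \<open>
  Swapping the treatments of two random units makes a linear statistic of the assignment part of an
  exchangeable pair; the resulting Stein identity, applied to \<open>exp (i t S)\<close>, is a perturbed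
  differential equation for the characteristic function and yields the combinatorial central limit
  theorem for all linear combinations of the estimated effects and of the imbalance statistics.
  Approximating continuous functions by trigonometric polynomials turns this into joint weak
  convergence, and conditioning on the acceptance region is continuous because its boundary is a
  null set for the Gaussian limit.

  In the limit, the imbalances of different tiers are independent because the contrasts are
  block-orthogonal, and the linear part of the estimated effects lies in their span because the
  contrasts together with the vector of group sizes span all functions of the treatment. An
  orthogonal change of basis lets the standardised imbalances realise any prescribed root of the
  explained covariance. Hence the rerandomized law converges to the law built from any roots of the
  limiting covariances, so that all subsequential limits of the second sequence agree.
\<close>


section \<open>Linear statistics of random assignments\<close>

definition linear_stat :: "nat \<Rightarrow> (nat \<Rightarrow> nat \<Rightarrow> real) \<Rightarrow> (nat \<Rightarrow> nat) \<Rightarrow> real" where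
  "linear_stat n a Z = (\<Sum>i<n. a i (Z i))"

definition swap_units :: "nat \<Rightarrow> nat \<Rightarrow> (nat \<Rightarrow> nat) \<Rightarrow> nat \<Rightarrow> nat" where
  "swap_units i j Z = Z(i := Z j, j := Z i)"

definition swap_diff :: "(nat \<Rightarrow> nat \<Rightarrow> real) \<Rightarrow> (nat \<Rightarrow> nat) \<Rightarrow> nat \<Rightarrow> nat \<Rightarrow> real" where
  "swap_diff a Z i j = a i (Z j) + a j (Z i) - a i (Z i) - a j (Z j)"

lemma swap_units_swap_units: "swap_units i j (swap_units i j Z) = Z"
  by (auto simp: swap_units_def fun_eq_iff)

lemma finite_assignments: "finite (assignments Q n nq)"
proof (rule finite_subset)
  show "assignments Q n nq \<subseteq> {Z. \<forall>i. (i \<in> {..<n} \<longrightarrow> Z i \<in> {..<Q}) \<and> (i \<notin> {..<n} \<longrightarrow> Z i = 0)}"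
    by (auto simp: assignments_def)
  show "finite {Z::nat \<Rightarrow> nat. \<forall>i. (i \<in> {..<n} \<longrightarrow> Z i \<in> {..<Q}) \<and> (i \<notin> {..<n} \<longrightarrow> Z i = 0)}"
    by (rule finite_set_of_finite_funs) auto
qed

lemma assignments_nonempty: "assignments Q (\<Sum>q<Q. nq q) nq \<noteq> {}"
proof (induction Q)
  case 0
  have "(\<lambda>_. 0) \<in> assignments 0 0 nq" by (auto simp: assignments_def)
  then show ?case by auto
next
  case (Suc Q)
  let ?n = "\<Sum>q<Q. nq q"
  from Suc obtain Z where Z: "Z \<in> assignments Q ?n nq" by blast
  then have Zq: "\<And>i. i < ?n \<Longrightarrow> Z i < Q" and Zc: "\<And>q. q < Q \<Longrightarrow> card {i. i < ?n \<and> Z i = q} = nq q"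
    by (auto simp: assignments_def)
  define Z' where "Z' i = (if i < ?n then Z i else if i < ?n + nq Q then Q else 0)" for i
  have "card {i. i < ?n + nq Q \<and> Z' i = q} = nq q" if "q < Suc Q" for q
  proof (cases "q = Q")
    case True
    have "{i. i < ?n + nq Q \<and> Z' i = q} = {?n..<?n + nq Q}"
      using Zq True by (auto simp: Z'_def not_less less_imp_neq split: if_splits)
    then show ?thesis using True by simp
  next
    case False
    then have "{i. i < ?n + nq Q \<and> Z' i = q} = {i. i < ?n \<and> Z i = q}"
      using that by (auto simp: Z'_def)
    then show ?thesis using Zc[of q] False that by simp
  qed
  moreover have "\<forall>i<?n + nq Q. Z' i < Suc Q" "\<forall>i. ?n + nq Q \<le> i \<longrightarrow> Z' i = 0"
    using Zq by (simp_all add: Z'_def less_SucI)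
  ultimately have "Z' \<in> assignments (Suc Q) (\<Sum>q<Suc Q. nq q) nq"
    by (simp add: assignments_def)
  then show ?case by blast
qed

lemma swap_units_assignments:
  assumes "i < n" "j < n" "Z \<in> assignments Q n nq"
  shows "swap_units i j Z \<in> assignments Q n nq"
proof -
  define t where "t k = (if k = i then j else if k = j then i else k)" for k
  have "card {k. k < n \<and> swap_units i j Z k = q} = card {k. k < n \<and> Z k = q}" for q
  proof (rule bij_betw_same_card)
    show "bij_betw t {k. k < n \<and> swap_units i j Z k = q} {k. k < n \<and> Z k = q}"
      by (rule bij_betw_byWitness[where f' = t])
        (use assms in \<open>auto simp: t_def swap_units_def split: if_splits\<close>)
  qed
  then show ?thesis
    using assms by (auto simp: assignments_def swap_units_def)
qed

lemma linear_stat_swap_units: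
  assumes "i < n" "j < n"
  shows "linear_stat n a (swap_units i j Z) = linear_stat n a Z + swap_diff a Z i j"
proof -
  have "linear_stat n a (swap_units i j Z) - linear_stat n a Z = (\<Sum>k<n. a k (swap_units i j Z k) - a k (Z k))"
    by (simp add: linear_stat_def sum_subtractf)
  also have "\<dots> = (\<Sum>k\<in>{i,j}. a k (swap_units i j Z k) - a k (Z k))"
    by (rule sum.mono_neutral_right) (use assms in \<open>auto simp: swap_units_def\<close>)
  also have "\<dots> = swap_diff a Z i j"
    by (cases "i = j") (auto simp: swap_units_def swap_diff_def)
  finally show ?thesis by simp
qed

lemma sum_assigned:
  assumes "Z \<in> assignments Q n nq"
  shows "(\<Sum>j<n. f (Z j)) = (\<Sum>q<Q. real (nq q) * f q)"
proof -
  have "(\<Sum>j<n. f (Z j)) = (\<Sum>q<Q. \<Sum>j\<in>{j\<in>{..<n}. Z j = q}. f (Z j))"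
    by (rule sum.group[symmetric]) (use assms in \<open>auto simp: assignments_def\<close>)
  also have "\<dots> = (\<Sum>q<Q. real (nq q) * f q)"
  proof (rule sum.cong[OF refl])
    fix q assume "q \<in> {..<Q}"
    then have "card {j\<in>{..<n}. Z j = q} = nq q"
      using assms by (simp add: assignments_def)
    moreover have "(\<Sum>j\<in>{j\<in>{..<n}. Z j = q}. f (Z j)) = (\<Sum>j\<in>{j\<in>{..<n}. Z j = q}. f q)"
      by (rule sum.cong) auto
    ultimately show "(\<Sum>j\<in>{j\<in>{..<n}. Z j = q}. f (Z j)) = real (nq q) * f q" by simp
  qed
  finally show ?thesis .
qed

lemma sum_swap_diff:
  assumes "Z \<in> assignments Q n nq" and cen: "\<forall>q<Q. (\<Sum>i<n. a i q) = 0"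
  shows "(\<Sum>i<n. \<Sum>j<n. swap_diff a Z i j) = - 2 * real n * linear_stat n a Z"
proof -
  have Zq: "Z j < Q" if "j < n" for j using assms that by (auto simp: assignments_def)
  have 0: "(\<Sum>j<n. \<Sum>i<n. a i (Z j)) = 0"
    by (rule sum.neutral) (use Zq cen in auto)
  have 1: "(\<Sum>i<n. \<Sum>j<n. a i (Z j)) = 0"
    by (subst sum.swap) (rule 0)
  show ?thesis
    using 0 1 by (simp add: swap_diff_def sum_subtractf sum.distrib linear_stat_def flip: sum_distrib_left)
qed

lemma eq_neg_self_imp_zero:
  fixes x :: "'b::real_vector"
  assumes "x = - x"
  shows "x = 0"
proof -
  have "x + x = 0" using assms by (metis add.right_inverse)
  then have "2 *\<^sub>R x = 0" by (simp add: scaleR_2)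
  then show ?thesis by simp
qed

text \<open>Swapping the treatments of two units is an involution on the assignments, so that
  \<open>(S, S + swap_diff)\<close> is an exchangeable pair; averaging its antisymmetric functional
  \<open>swap_diff (f(S + swap_diff) + f(S))\<close> over all pairs of units gives a Stein identity.\<close>

lemma stein_identity:
  fixes f :: "real \<Rightarrow> 'b::real_vector"
  assumes cen: "\<forall>q<Q. (\<Sum>i<n. a i q) = 0"
  shows "(4 * real n) *\<^sub>R (\<Sum>Z\<in>assignments Q n nq. linear_stat n a Z *\<^sub>R f (linear_stat n a Z)) =
    (\<Sum>Z\<in>assignments Q n nq. \<Sum>i<n. \<Sum>j<n.
       swap_diff a Z i j *\<^sub>R (f (linear_stat n a Z + swap_diff a Z i j) - f (linear_stat n a Z)))"
proof -
  let ?W = "assignments Q n nq"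
  let ?S = "linear_stat n a"
  have X: "(\<Sum>Z\<in>?W. swap_diff a Z i j *\<^sub>R (f (?S Z + swap_diff a Z i j) + f (?S Z))) = 0" (is "?X = 0")
    if ij: "i < n" "j < n" for i j
  proof -
    have dls: "swap_diff a (swap_units i j Z) i j = - swap_diff a Z i j" for Z
      by (auto simp: swap_diff_def swap_units_def)
    have "?X = (\<Sum>Z\<in>?W. swap_diff a (swap_units i j Z) i j *\<^sub>R (f (?S (swap_units i j Z) + swap_diff a (swap_units i j Z) i j) + f (?S (swap_units i j Z))))"
      by (rule sum.reindex_bij_witness[of _ "swap_units i j" "swap_units i j"])
        (use ij in \<open>auto simp: swap_units_swap_units swap_units_assignments\<close>)
    also have "\<dots> = (\<Sum>Z\<in>?W. - (swap_diff a Z i j *\<^sub>R (f (?S Z + swap_diff a Z i j) + f (?S Z))))"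
      by (intro sum.cong refl) (use ij in \<open>simp add: dls linear_stat_swap_units add.commute\<close>)
    also have "\<dots> = - ?X" by (rule sum_negf)
    finally show ?thesis by (rule eq_neg_self_imp_zero)
  qed
  have "(\<Sum>Z\<in>?W. \<Sum>i<n. \<Sum>j<n. swap_diff a Z i j *\<^sub>R (f (?S Z + swap_diff a Z i j) - f (?S Z)))
    = (\<Sum>Z\<in>?W. \<Sum>i<n. \<Sum>j<n. swap_diff a Z i j *\<^sub>R (f (?S Z + swap_diff a Z i j) + f (?S Z)) - 2 *\<^sub>R (swap_diff a Z i j *\<^sub>R f (?S Z)))"
    by (intro sum.cong refl) (simp add: scaleR_add_right scaleR_diff_right scaleR_2 del: scaleR_scaleR)
  also have "\<dots> = (\<Sum>Z\<in>?W. \<Sum>i<n. \<Sum>j<n. swap_diff a Z i j *\<^sub>R (f (?S Z + swap_diff a Z i j) + f (?S Z)))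
      - 2 *\<^sub>R (\<Sum>Z\<in>?W. \<Sum>i<n. \<Sum>j<n. swap_diff a Z i j *\<^sub>R f (?S Z))"
    by (simp add: sum_subtractf scaleR_sum_right)
  also have "(\<Sum>Z\<in>?W. \<Sum>i<n. \<Sum>j<n. swap_diff a Z i j *\<^sub>R (f (?S Z + swap_diff a Z i j) + f (?S Z)))
      = (\<Sum>i<n. \<Sum>Z\<in>?W. \<Sum>j<n. swap_diff a Z i j *\<^sub>R (f (?S Z + swap_diff a Z i j) + f (?S Z)))"
    by (rule sum.swap)
  also have "\<dots> = (\<Sum>i<n. \<Sum>j<n. \<Sum>Z\<in>?W. swap_diff a Z i j *\<^sub>R (f (?S Z + swap_diff a Z i j) + f (?S Z)))"
    by (intro sum.cong refl) (rule sum.swap)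
  also have "\<dots> = 0" using X by simp
  also have "(\<Sum>Z\<in>?W. \<Sum>i<n. \<Sum>j<n. swap_diff a Z i j *\<^sub>R f (?S Z)) = (\<Sum>Z\<in>?W. (- 2 * real n * ?S Z) *\<^sub>R f (?S Z))"
    by (intro sum.cong refl) (simp only: scaleR_sum_left[symmetric] sum_swap_diff[OF _ cen])
  also have "0 - 2 *\<^sub>R \<dots> = (4 * real n) *\<^sub>R (\<Sum>Z\<in>?W. ?S Z *\<^sub>R f (?S Z))"
    by (simp add: scaleR_sum_right sum_negf mult.assoc)
  finally show ?thesis ..
qed

lemma sum_four_squares: "(x + y - z - (w::real))\<^sup>2 \<le> 4 * (x\<^sup>2 + y\<^sup>2 + z\<^sup>2 + w\<^sup>2)"
proof -
  have "4 * (x\<^sup>2 + y\<^sup>2 + z\<^sup>2 + w\<^sup>2) - (x + y - z - w)\<^sup>2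
     = (x - y)\<^sup>2 + (x + z)\<^sup>2 + (x + w)\<^sup>2 + (y + z)\<^sup>2 + (y + w)\<^sup>2 + (z - w)\<^sup>2"
    by (simp add: power2_eq_square algebra_simps)
  also have "\<dots> \<ge> 0" by simp
  finally show ?thesis by simp
qed

lemma linear_stat_second_moment_eq:
  assumes cen: "\<forall>q<Q. (\<Sum>i<n. a i q) = 0"
  shows "4 * real n * (\<Sum>Z\<in>assignments Q n nq. (linear_stat n a Z)\<^sup>2) =
    (\<Sum>Z\<in>assignments Q n nq. \<Sum>i<n. \<Sum>j<n. (swap_diff a Z i j)\<^sup>2)"
  using stein_identity[OF cen, where nq = nq and f = "\<lambda>x. x"] by (simp add: power2_eq_square)

lemma linear_stat_second_moment_le:
  assumes cen: "\<forall>q<Q. (\<Sum>i<n. a i q) = 0"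
  shows "(\<Sum>Z\<in>assignments Q n nq. (linear_stat n a Z)\<^sup>2) \<le>
    real (card (assignments Q n nq)) * (4 * (\<Sum>i<n. \<Sum>q<Q. (a i q)\<^sup>2))"
proof (cases "n = 0")
  case True
  then show ?thesis by (simp add: linear_stat_def)
next
  case False
  let ?W = "assignments Q n nq"
  let ?A = "\<lambda>i. \<Sum>q<Q. (a i q)\<^sup>2"
  have le: "(\<Sum>i<n. \<Sum>j<n. (swap_diff a Z i j)\<^sup>2) \<le> 16 * real n * (\<Sum>i<n. ?A i)" if Z: "Z \<in> ?W" for Z
  proof -
    have Zq: "Z j < Q" if "j < n" for j using Z that by (auto simp: assignments_def)
    have bnd: "(a i (Z j))\<^sup>2 \<le> ?A i" if "j < n" for i j
      using member_le_sum[of "Z j" "{..<Q}" "\<lambda>q. (a i q)\<^sup>2"] Zq[OF that] by simp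
    have "(\<Sum>i<n. \<Sum>j<n. (swap_diff a Z i j)\<^sup>2) \<le> (\<Sum>i<n. \<Sum>j<n. 4 * (?A i + ?A j + ?A i + ?A j))"
    proof (intro sum_mono)
      fix i j assume "i \<in> {..<n}" "j \<in> {..<n}"
      then show "(swap_diff a Z i j)\<^sup>2 \<le> 4 * (?A i + ?A j + ?A i + ?A j)"
        unfolding swap_diff_def
        using sum_four_squares[of "a i (Z j)" "a j (Z i)" "a i (Z i)" "a j (Z j)"]
          bnd[of j i] bnd[of i j] bnd[of i i] bnd[of j j] by simp
    qed
    also have "\<dots> = 16 * real n * (\<Sum>i<n. ?A i)"
      by (simp add: sum.distrib flip: sum_distrib_left)
    finally show ?thesis .
  qed
  have "4 * real n * (\<Sum>Z\<in>?W. (linear_stat n a Z)\<^sup>2) \<le> (\<Sum>Z\<in>?W. 16 * real n * (\<Sum>i<n. ?A i))"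
    unfolding linear_stat_second_moment_eq[OF cen] by (rule sum_mono) (rule le)
  also have "\<dots> = 4 * real n * (real (card ?W) * (4 * (\<Sum>i<n. ?A i)))" by simp
  finally show ?thesis using False by simp
qed

definition pairvar :: "nat \<Rightarrow> nat \<Rightarrow> (nat \<Rightarrow> nat) \<Rightarrow> (nat \<Rightarrow> nat \<Rightarrow> real) \<Rightarrow> nat \<Rightarrow> nat \<Rightarrow> real" where
  "pairvar n Q nq a i q = (\<Sum>r<Q. real (nq r) / real n * (a i r - a i q)\<^sup>2)"

definition crossdiff :: "nat \<Rightarrow> (nat \<Rightarrow> nat \<Rightarrow> real) \<Rightarrow> (nat \<Rightarrow> nat) \<Rightarrow> nat \<Rightarrow> nat \<Rightarrow> real" where
  "crossdiff n a Z q r = linear_stat n (\<lambda>i s. if s = q then a i r - a i q else 0) Z"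

lemma sum_swap22:
  "(\<Sum>q\<in>A. \<Sum>r\<in>B. \<Sum>i\<in>C. \<Sum>j\<in>D. h q r i j) = (\<Sum>i\<in>C. \<Sum>j\<in>D. \<Sum>q\<in>A. \<Sum>r\<in>B. h q r i j)"
proof -
  have "(\<Sum>q\<in>A. \<Sum>r\<in>B. \<Sum>i\<in>C. \<Sum>j\<in>D. h q r i j) = (\<Sum>q\<in>A. \<Sum>i\<in>C. \<Sum>j\<in>D. \<Sum>r\<in>B. h q r i j)"
  proof (intro sum.cong refl)
    fix q
    have "(\<Sum>r\<in>B. \<Sum>i\<in>C. \<Sum>j\<in>D. h q r i j) = (\<Sum>i\<in>C. \<Sum>r\<in>B. \<Sum>j\<in>D. h q r i j)" by (rule sum.swap)
    also have "\<dots> = (\<Sum>i\<in>C. \<Sum>j\<in>D. \<Sum>r\<in>B. h q r i j)"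
      by (intro sum.cong refl) (rule sum.swap)
    finally show "(\<Sum>r\<in>B. \<Sum>i\<in>C. \<Sum>j\<in>D. h q r i j) = (\<Sum>i\<in>C. \<Sum>j\<in>D. \<Sum>r\<in>B. h q r i j)" .
  qed
  also have "\<dots> = (\<Sum>i\<in>C. \<Sum>q\<in>A. \<Sum>j\<in>D. \<Sum>r\<in>B. h q r i j)" by (rule sum.swap)
  also have "\<dots> = (\<Sum>i\<in>C. \<Sum>j\<in>D. \<Sum>q\<in>A. \<Sum>r\<in>B. h q r i j)"
    by (intro sum.cong refl) (rule sum.swap)
  finally show ?thesis .
qed

lemma sum_swap_diff_squares:
  assumes Z: "Z \<in> assignments Q n nq" and n: "n > 0"
  shows "(\<Sum>i<n. \<Sum>j<n. (swap_diff a Z i j)\<^sup>2) =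
    2 * real n * linear_stat n (pairvar n Q nq a) Z
    + 2 * (\<Sum>q<Q. \<Sum>r<Q. crossdiff n a Z q r * crossdiff n a Z r q)"
proof -
  have Zq: "Z j < Q" if "j < n" for j using Z that by (auto simp: assignments_def)
  let ?d = "\<lambda>i j. a i (Z j) - a i (Z i)"
  have sq: "(\<Sum>i<n. \<Sum>j<n. (?d i j)\<^sup>2) = real n * linear_stat n (pairvar n Q nq a) Z"
  proof -
    have "(\<Sum>i<n. \<Sum>j<n. (?d i j)\<^sup>2) = (\<Sum>i<n. \<Sum>r<Q. real (nq r) * (a i r - a i (Z i))\<^sup>2)"
      by (rule sum.cong[OF refl], rule sum_assigned[OF Z])
    then show ?thesis using n by (simp add: linear_stat_def pairvar_def sum_distrib_left)
  qed
  have cross: "(\<Sum>q<Q. \<Sum>r<Q. crossdiff n a Z q r * crossdiff n a Z r q) = (\<Sum>i<n. \<Sum>j<n. ?d i j * ?d j i)"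
  proof -
    have "(\<Sum>q<Q. \<Sum>r<Q. crossdiff n a Z q r * crossdiff n a Z r q)
      = (\<Sum>q<Q. \<Sum>r<Q. \<Sum>i<n. \<Sum>j<n. (if Z i = q then a i r - a i q else 0) * (if Z j = r then a j q - a j r else 0))"
      by (simp add: crossdiff_def linear_stat_def sum_product)
    also have "\<dots> = (\<Sum>i<n. \<Sum>j<n. \<Sum>q<Q. \<Sum>r<Q. (if Z i = q then a i r - a i q else 0) * (if Z j = r then a j q - a j r else 0))"
      by (rule sum_swap22)
    also have "\<dots> = (\<Sum>i<n. \<Sum>j<n. ?d i j * ?d j i)"
    proof (intro sum.cong refl)
      fix i j assume ij: "i \<in> {..<n}" "j \<in> {..<n}"
      have "(\<Sum>q<Q. \<Sum>r<Q. (if Z i = q then a i r - a i q else 0) * (if Z j = r then a j q - a j r else 0))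
         = (\<Sum>q<Q. if Z i = q then (\<Sum>r<Q. if Z j = r then (a i r - a i q) * (a j q - a j r) else 0) else 0)"
      proof (rule sum.cong[OF refl])
        fix q
        show "(\<Sum>r<Q. (if Z i = q then a i r - a i q else 0) * (if Z j = r then a j q - a j r else 0))
          = (if Z i = q then (\<Sum>r<Q. if Z j = r then (a i r - a i q) * (a j q - a j r) else 0) else 0)"
        proof (cases "Z i = q")
          case True
          show ?thesis unfolding True if_P[OF refl] by (rule sum.cong[OF refl]) simp
        qed simp
      qed
      also have "\<dots> = ?d i j * ?d j i"
      proof -
        have "(\<Sum>r<Q. if Z k = r then X r else 0) = X (Z k)" if "k < n" for k and X :: "nat \<Rightarrow> real"
          using Zq[OF that] by simp
        then show ?thesis using ij by (simp only: lessThan_iff)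
      qed
      finally show "(\<Sum>q<Q. \<Sum>r<Q. (if Z i = q then a i r - a i q else 0) * (if Z j = r then a j q - a j r else 0))
        = ?d i j * ?d j i" .
    qed
    finally show ?thesis .
  qed
  have sq': "(\<Sum>i<n. \<Sum>j<n. (?d j i)\<^sup>2) = (\<Sum>i<n. \<Sum>j<n. (?d i j)\<^sup>2)" by (rule sum.swap)
  have "(\<Sum>i<n. \<Sum>j<n. (swap_diff a Z i j)\<^sup>2) = (\<Sum>i<n. \<Sum>j<n. (?d i j)\<^sup>2 + (?d j i)\<^sup>2 + 2 * (?d i j * ?d j i))"
    by (intro sum.cong refl) (simp add: swap_diff_def power2_eq_square algebra_simps)
  also have "\<dots> = (\<Sum>i<n. \<Sum>j<n. (?d i j)\<^sup>2) + (\<Sum>i<n. \<Sum>j<n. (?d j i)\<^sup>2) + 2 * (\<Sum>i<n. \<Sum>j<n. ?d i j * ?d j i)"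
    by (simp only: sum.distrib sum_distrib_left)
  also have "\<dots> = 2 * real n * linear_stat n (pairvar n Q nq a) Z + 2 * (\<Sum>i<n. \<Sum>j<n. ?d i j * ?d j i)"
    unfolding sq' sq by simp
  finally show ?thesis unfolding cross .
qed

text \<open>For arrays with centred columns, this is \<open>(n - 1)/n\<close> times the covariance of the two linear
  statistics under complete randomization.\<close>

definition cov_form :: "nat \<Rightarrow> nat \<Rightarrow> (nat \<Rightarrow> nat) \<Rightarrow> (nat \<Rightarrow> nat \<Rightarrow> real) \<Rightarrow> (nat \<Rightarrow> nat \<Rightarrow> real) \<Rightarrow> real" where
  "cov_form n Q nq a b = (\<Sum>i<n. (\<Sum>q<Q. real (nq q) / real n * a i q * b i q)
     - (\<Sum>q<Q. real (nq q) / real n * a i q) * (\<Sum>q<Q. real (nq q) / real n * b i q))"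

lemma mean_pairvar:
  assumes nq: "(\<Sum>q<Q. nq q) = n" and n: "n > 0"
  shows "(\<Sum>q<Q. real (nq q) / real n * (\<Sum>i<n. pairvar n Q nq a i q)) = 2 * cov_form n Q nq a a"
proof -
  define p where "p q = real (nq q) / real n" for q
  have p1: "(\<Sum>q<Q. p q) = 1"
    using n nq by (simp add: p_def flip: sum_divide_distrib of_nat_sum)
  have "(\<Sum>q<Q. p q * (\<Sum>i<n. pairvar n Q nq a i q)) = (\<Sum>i<n. \<Sum>q<Q. p q * pairvar n Q nq a i q)"
    unfolding sum_distrib_left by (rule sum.swap)
  also have "\<dots> = (\<Sum>i<n. 2 * ((\<Sum>q<Q. p q * a i q * a i q) - (\<Sum>q<Q. p q * a i q) * (\<Sum>q<Q. p q * a i q)))"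
  proof (intro sum.cong refl)
    fix i
    have "(\<Sum>q<Q. p q * pairvar n Q nq a i q)
      = (\<Sum>q<Q. \<Sum>r<Q. p q * (p r * a i r * a i r) + p r * (p q * a i q * a i q)
           - 2 * ((p q * a i q) * (p r * a i r)))"
      unfolding pairvar_def p_def[symmetric] sum_distrib_left
      by (intro sum.cong refl) (simp add: power2_eq_square algebra_simps)
    also have "\<dots> = 2 * ((\<Sum>q<Q. p q * a i q * a i q) - (\<Sum>q<Q. p q * a i q) * (\<Sum>q<Q. p q * a i q))"
    proof -
      have 1: "(\<Sum>q<Q. \<Sum>r<Q. p q * (p r * a i r * a i r)) = (\<Sum>q<Q. p q * a i q * a i q)"
        unfolding sum_product[symmetric] p1 by simp
      have 2: "(\<Sum>q<Q. \<Sum>r<Q. p r * (p q * a i q * a i q)) = (\<Sum>q<Q. p q * a i q * a i q)"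
        by (subst sum.swap) (rule 1)
      have 3: "(\<Sum>q<Q. \<Sum>r<Q. 2 * ((p q * a i q) * (p r * a i r))) = 2 * ((\<Sum>q<Q. p q * a i q) * (\<Sum>q<Q. p q * a i q))"
        unfolding sum_product by (simp only: sum_distrib_left)
      show ?thesis
        by (simp only: sum_subtractf sum.distrib 1 2 3) simp
    qed
    finally show "(\<Sum>q<Q. p q * pairvar n Q nq a i q) = 2 * ((\<Sum>q<Q. p q * a i q * a i q) - (\<Sum>q<Q. p q * a i q) * (\<Sum>q<Q. p q * a i q))" .
  qed
  finally show ?thesis by (simp add: cov_form_def sum_distrib_left p_def)
qed

lemma iexp_linear_approx: "cmod (iexp x - 1 - \<i> * of_real x) \<le> x\<^sup>2 / 2"
  using iexp_approx1[of x 1] by (simp add: power2_eq_square diff_diff_eq)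

lemma square_diff_le: "(x - y)\<^sup>2 \<le> 2 * (x\<^sup>2 + (y::real)\<^sup>2)"
proof -
  have "2 * (x\<^sup>2 + y\<^sup>2) - (x - y)\<^sup>2 = (x + y)\<^sup>2" by (simp add: power2_eq_square algebra_simps)
  then show ?thesis using zero_le_power2[of "x + y"] by linarith
qed

context
  fixes Q n :: nat and nq :: "nat \<Rightarrow> nat" and a :: "nat \<Rightarrow> nat \<Rightarrow> real" and M :: real
  assumes cen: "\<forall>q<Q. (\<Sum>i<n. a i q) = 0"
    and n: "n > 0" and nq: "(\<Sum>q<Q. nq q) = n"
    and M: "\<And>i q. i < n \<Longrightarrow> q < Q \<Longrightarrow> \<bar>a i q\<bar> \<le> M"
begin

private abbreviation "W \<equiv> assignments Q n nq"
private abbreviation "s2 \<equiv> cov_form n Q nq a a"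
private definition "A i = (\<Sum>q<Q. (a i q)\<^sup>2)"
private definition "A0 = (\<Sum>i<n. A i)"
private definition "D Z = (\<Sum>i<n. \<Sum>j<n. (swap_diff a Z i j)\<^sup>2) / (4 * real n)"

private lemma Q0: "Q > 0" using nq n by (cases Q) auto

private lemma M0: "M \<ge> 0" using M[OF n Q0] by linarith

private lemma A_ge: "q < Q \<Longrightarrow> (a i q)\<^sup>2 \<le> A i"
  using member_le_sum[of q "{..<Q}" "\<lambda>q. (a i q)\<^sup>2"] by (simp add: A_def)

private lemma A_nonneg: "A i \<ge> 0" "A0 \<ge> 0"
  by (auto simp: A_def A0_def intro!: sum_nonneg)

private lemma card_pos: "real (card W) > 0"
  using assignments_nonempty[where nq = nq and Q = Q] nq by (simp add: card_gt_0_iff finite_assignments)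

private lemma diff_sq_le: "q < Q \<Longrightarrow> r < Q \<Longrightarrow> (a i r - a i q)\<^sup>2 \<le> 4 * A i"
  using square_diff_le[of "a i r" "a i q"] A_ge[of r i] A_ge[of q i] by simp

private lemma p1: "(\<Sum>q<Q. real (nq q) / real n) = 1"
  using n nq by (simp flip: sum_divide_distrib of_nat_sum)

private lemma pairvar_le: "q < Q \<Longrightarrow> pairvar n Q nq a i q \<le> 4 * A i"
proof -
  assume q: "q < Q"
  have "pairvar n Q nq a i q \<le> (\<Sum>r<Q. real (nq r) / real n * (4 * A i))"
    unfolding pairvar_def by (intro sum_mono mult_left_mono diff_sq_le) (use q in auto)
  also have "\<dots> = 4 * A i" by (simp only: sum_distrib_right[symmetric] p1 mult_1)
  finally show ?thesis .
qed

private lemma pairvar_nonneg: "pairvar n Q nq a i q \<ge> 0"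
  by (auto simp: pairvar_def intro!: sum_nonneg)

private lemma pairvar_le_M: "i < n \<Longrightarrow> q < Q \<Longrightarrow> pairvar n Q nq a i q \<le> 4 * M\<^sup>2"
proof -
  assume iq: "i < n" "q < Q"
  have "pairvar n Q nq a i q \<le> (\<Sum>r<Q. real (nq r) / real n * (4 * M\<^sup>2))"
    unfolding pairvar_def
  proof (intro sum_mono mult_left_mono)
    fix r assume "r \<in> {..<Q}"
    then have "(a i r)\<^sup>2 \<le> M\<^sup>2" "(a i q)\<^sup>2 \<le> M\<^sup>2"
      using M[of i r] M[of i q] iq abs_le_square_iff[of "a i r" M] abs_le_square_iff[of "a i q" M] M0 by auto
    then show "(a i r - a i q)\<^sup>2 \<le> 4 * M\<^sup>2" using square_diff_le[of "a i r" "a i q"] by simp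
  qed auto
  also have "\<dots> = 4 * M\<^sup>2" by (simp only: sum_distrib_right[symmetric] p1 mult_1)
  finally show ?thesis .
qed

private lemma sum_abs_linear_part:
  "(\<Sum>Z\<in>W. \<bar>linear_stat n (pairvar n Q nq a) Z - 2 * s2\<bar>) \<le> real (card W) * (8 * M * sqrt (real Q * A0))"
proof -
  let ?g = "pairvar n Q nq a"
  define g' where "g' i q = ?g i q - (\<Sum>k<n. ?g k q) / real n" for i q
  have eq: "linear_stat n ?g Z - 2 * s2 = linear_stat n g' Z" if Z: "Z \<in> W" for Z
  proof -
    have "(\<Sum>i<n. (\<Sum>k<n. ?g k (Z i)) / real n) = (\<Sum>q<Q. real (nq q) * ((\<Sum>k<n. ?g k q) / real n))"
      by (rule sum_assigned[OF Z])
    also have "\<dots> = 2 * s2" unfolding mean_pairvar[OF nq n, symmetric] by simp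
    finally show ?thesis by (simp add: linear_stat_def g'_def sum_subtractf)
  qed
  have cen': "\<forall>q<Q. (\<Sum>i<n. g' i q) = 0" using n by (simp add: g'_def sum_subtractf)
  have var: "(\<Sum>i<n. (g' i q)\<^sup>2) \<le> (\<Sum>i<n. (?g i q)\<^sup>2)" for q
  proof -
    define \<mu> where "\<mu> = (\<Sum>k<n. ?g k q) / real n"
    have "(\<Sum>i<n. (g' i q)\<^sup>2) = (\<Sum>i<n. (?g i q)\<^sup>2 - 2 * \<mu> * ?g i q + \<mu>\<^sup>2)"
      by (intro sum.cong refl) (simp add: g'_def \<mu>_def[symmetric] power2_eq_square algebra_simps)
    also have "\<dots> = (\<Sum>i<n. (?g i q)\<^sup>2) - 2 * \<mu> * (\<Sum>i<n. ?g i q) + real n * \<mu>\<^sup>2"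
      by (simp add: sum.distrib sum_subtractf sum_distrib_left)
    also have "(\<Sum>i<n. ?g i q) = real n * \<mu>" using n by (simp add: \<mu>_def)
    also have "(\<Sum>i<n. (?g i q)\<^sup>2) - 2 * \<mu> * (real n * \<mu>) + real n * \<mu>\<^sup>2 = (\<Sum>i<n. (?g i q)\<^sup>2) - real n * \<mu>\<^sup>2"
      by (simp add: power2_eq_square)
    finally show ?thesis by simp
  qed
  have "(\<Sum>q<Q. \<Sum>i<n. (g' i q)\<^sup>2) \<le> (\<Sum>q<Q. \<Sum>i<n. (?g i q)\<^sup>2)" by (rule sum_mono) (rule var)
  also have "\<dots> \<le> (\<Sum>q<Q. \<Sum>i<n. 4 * M\<^sup>2 * (4 * A i))"
  proof (intro sum_mono)
    fix q i assume "q \<in> {..<Q}" "i \<in> {..<n}"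
    then have "?g i q * ?g i q \<le> (4 * M\<^sup>2) * (4 * A i)"
      by (intro mult_mono[OF pairvar_le_M pairvar_le] pairvar_nonneg) auto
    then show "(?g i q)\<^sup>2 \<le> 4 * M\<^sup>2 * (4 * A i)" by (simp add: power2_eq_square)
  qed
  also have "\<dots> = 16 * M\<^sup>2 * (real Q * A0)"
    by (simp add: A0_def flip: sum_distrib_left)
  finally have g2: "(\<Sum>i<n. \<Sum>q<Q. (g' i q)\<^sup>2) \<le> 16 * M\<^sup>2 * (real Q * A0)"
    by (subst sum.swap)
  have "(\<Sum>Z\<in>W. \<bar>linear_stat n g' Z\<bar>)\<^sup>2 \<le> (\<Sum>Z\<in>W. \<bar>linear_stat n g' Z\<bar>\<^sup>2) * card W"
    by (rule sum_squared_le_sum_of_squares)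
  also have "\<dots> \<le> (real (card W) * (4 * (16 * M\<^sup>2 * (real Q * A0)))) * card W"
    using linear_stat_second_moment_le[OF cen', of nq] g2 card_pos
    by (intro mult_right_mono) (auto elim!: order_trans)
  also have "\<dots> = (real (card W) * (8 * M * sqrt (real Q * A0)))\<^sup>2"
    using A_nonneg by (simp add: power_mult_distrib power2_eq_square[of "real (card W)"])
  finally have "(\<Sum>Z\<in>W. \<bar>linear_stat n g' Z\<bar>) \<le> real (card W) * (8 * M * sqrt (real Q * A0))"
    by (rule power2_le_imp_le) (use A_nonneg M0 in auto)
  then show ?thesis using eq by simp
qed

private lemma sum_abs_cross_part:
  assumes "q < Q" "r < Q"
  shows "(\<Sum>Z\<in>W. \<bar>crossdiff n a Z q r * crossdiff n a Z r q\<bar>) \<le> real (card W) * (16 * A0)"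
proof -
  have m2: "(\<Sum>Z\<in>W. (crossdiff n a Z q r)\<^sup>2) \<le> real (card W) * (16 * A0)" if "q < Q" "r < Q" for q r
  proof -
    let ?b = "\<lambda>i s. if s = q then a i r - a i q else 0"
    have cen': "\<forall>s<Q. (\<Sum>i<n. ?b i s) = 0" 
    proof -
      have "(\<Sum>i<n. ?b i s) = (if s = q then (\<Sum>i<n. a i r) - (\<Sum>i<n. a i q) else 0)" for s
        by (simp add: sum_subtractf)
      then show ?thesis using cen that by simp
    qed
    have "(\<Sum>i<n. \<Sum>s<Q. (?b i s)\<^sup>2) = (\<Sum>i<n. (a i r - a i q)\<^sup>2)"
    proof (rule sum.cong[OF refl])
      fix i
      have "(\<Sum>s<Q. (?b i s)\<^sup>2) = (\<Sum>s<Q. if s = q then (a i r - a i q)\<^sup>2 else 0)"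
        by (rule sum.cong) auto
      then show "(\<Sum>s<Q. (?b i s)\<^sup>2) = (a i r - a i q)\<^sup>2" using that by simp
    qed
    also have "\<dots> \<le> (\<Sum>i<n. 4 * A i)" using that by (intro sum_mono diff_sq_le) auto
    also have "\<dots> = 4 * A0" by (simp add: A0_def sum_distrib_left)
    finally have "4 * (\<Sum>i<n. \<Sum>s<Q. (?b i s)\<^sup>2) \<le> 16 * A0" by simp
    then show ?thesis using linear_stat_second_moment_le[OF cen', of nq]
      unfolding crossdiff_def by (meson mult_left_mono of_nat_0_le_iff order_trans)
  qed
  have "(\<Sum>Z\<in>W. \<bar>crossdiff n a Z q r * crossdiff n a Z r q\<bar>)
      \<le> (\<Sum>Z\<in>W. ((crossdiff n a Z q r)\<^sup>2 + (crossdiff n a Z r q)\<^sup>2) / 2)"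
  proof (rule sum_mono)
    fix Z
    show "\<bar>crossdiff n a Z q r * crossdiff n a Z r q\<bar> \<le> ((crossdiff n a Z q r)\<^sup>2 + (crossdiff n a Z r q)\<^sup>2) / 2"
      using sum_squares_bound[of "\<bar>crossdiff n a Z q r\<bar>" "\<bar>crossdiff n a Z r q\<bar>"]
      by (simp add: abs_mult)
  qed
  also have "\<dots> = ((\<Sum>Z\<in>W. (crossdiff n a Z q r)\<^sup>2) + (\<Sum>Z\<in>W. (crossdiff n a Z r q)\<^sup>2)) / 2"
    by (simp add: sum.distrib sum_divide_distrib add_divide_distrib)
  also have "\<dots> \<le> real (card W) * (16 * A0)"
    using add_mono[OF m2[OF assms] m2[OF assms(2,1)]] by (simp add: mult_ac)
  finally show ?thesis .
qed

private lemma sum_abs_D: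
  "(\<Sum>Z\<in>W. \<bar>D Z - s2\<bar>) \<le> real (card W) * (4 * M * sqrt (real Q * A0) + 8 * (real Q)\<^sup>2 * A0 / real n)"
proof -
  let ?c = "\<lambda>Z q r. crossdiff n a Z q r * crossdiff n a Z r q"
  have D: "D Z - s2 = (linear_stat n (pairvar n Q nq a) Z - 2 * s2) / 2 + (\<Sum>q<Q. \<Sum>r<Q. ?c Z q r) / (2 * real n)"
    if "Z \<in> W" for Z
    unfolding D_def sum_swap_diff_squares[OF that n] using n by (simp add: field_simps)
  have "(\<Sum>Z\<in>W. \<bar>D Z - s2\<bar>) \<le> (\<Sum>Z\<in>W. \<bar>linear_stat n (pairvar n Q nq a) Z - 2 * s2\<bar> / 2
     + (\<Sum>q<Q. \<Sum>r<Q. \<bar>?c Z q r\<bar>) / (2 * real n))"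
  proof (rule sum_mono)
    fix Z assume Z: "Z \<in> W"
    have "\<bar>\<Sum>q<Q. \<Sum>r<Q. ?c Z q r\<bar> \<le> (\<Sum>q<Q. \<Sum>r<Q. \<bar>?c Z q r\<bar>)"
      by (rule order_trans[OF sum_abs]) (intro sum_mono sum_abs)
    then have "\<bar>(\<Sum>q<Q. \<Sum>r<Q. ?c Z q r) / (2 * real n)\<bar> \<le> (\<Sum>q<Q. \<Sum>r<Q. \<bar>?c Z q r\<bar>) / (2 * real n)"
      by (simp add: abs_divide divide_right_mono)
    then show "\<bar>D Z - s2\<bar> \<le> \<bar>linear_stat n (pairvar n Q nq a) Z - 2 * s2\<bar> / 2
     + (\<Sum>q<Q. \<Sum>r<Q. \<bar>?c Z q r\<bar>) / (2 * real n)"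
      unfolding D[OF Z] by (intro order_trans[OF abs_triangle_ineq] add_mono) simp_all
  qed
  also have "\<dots> = (\<Sum>Z\<in>W. \<bar>linear_stat n (pairvar n Q nq a) Z - 2 * s2\<bar>) / 2
     + (\<Sum>Z\<in>W. \<Sum>q<Q. \<Sum>r<Q. \<bar>?c Z q r\<bar>) / (2 * real n)"
    by (simp add: sum.distrib sum_divide_distrib)
  also have "(\<Sum>Z\<in>W. \<Sum>q<Q. \<Sum>r<Q. \<bar>?c Z q r\<bar>) = (\<Sum>q<Q. \<Sum>Z\<in>W. \<Sum>r<Q. \<bar>?c Z q r\<bar>)" by (rule sum.swap)
  also have "\<dots> = (\<Sum>q<Q. \<Sum>r<Q. \<Sum>Z\<in>W. \<bar>?c Z q r\<bar>)" by (intro sum.cong refl) (rule sum.swap)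
  also have "\<dots> \<le> (\<Sum>q<Q. \<Sum>r<Q. real (card W) * (16 * A0))"
    by (intro sum_mono sum_abs_cross_part) auto
  also have "\<dots> = real (card W) * (16 * (real Q)\<^sup>2 * A0)" by (simp add: power2_eq_square)
  finally have "(\<Sum>Z\<in>W. \<bar>D Z - s2\<bar>) \<le> (\<Sum>Z\<in>W. \<bar>linear_stat n (pairvar n Q nq a) Z - 2 * s2\<bar>) / 2
     + real (card W) * (16 * (real Q)\<^sup>2 * A0) / (2 * real n)"
    using n by (simp add: divide_right_mono)
  also have "\<dots> \<le> real (card W) * (8 * M * sqrt (real Q * A0)) / 2 + real (card W) * (16 * (real Q)\<^sup>2 * A0) / (2 * real n)"
    using sum_abs_linear_part by (simp add: mult_ac)
  finally show ?thesis by (simp add: algebra_simps)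
qed

private lemma sum_D: "(\<Sum>Z\<in>W. D Z) \<le> real (card W) * (4 * A0)"
proof -
  have "4 * real n * (\<Sum>Z\<in>W. (linear_stat n a Z)\<^sup>2) = (\<Sum>Z\<in>W. 4 * real n * D Z)"
    unfolding linear_stat_second_moment_eq[OF cen] D_def using n by simp
  then have "(\<Sum>Z\<in>W. D Z) = (\<Sum>Z\<in>W. (linear_stat n a Z)\<^sup>2)" using n by (simp flip: sum_distrib_left)
  then show ?thesis using linear_stat_second_moment_le[OF cen, of nq] by (simp add: A0_def A_def)
qed

private definition "E = 8 * M * A0 + (4 * M * sqrt (real Q * A0) + 8 * (real Q)\<^sup>2 * A0 / real n)"

private lemma char_ode:
  assumes t: "0 \<le> t" "t \<le> 1"
  shows "cmod ((\<Sum>Z\<in>W. \<i> * of_real (linear_stat n a Z) * iexp (t * linear_stat n a Z))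
      + of_real (t * s2) * (\<Sum>Z\<in>W. iexp (t * linear_stat n a Z))) \<le> real (card W) * E"
proof -
  let ?S = "linear_stat n a"
  let ?d = "\<lambda>Z i j. swap_diff a Z i j"
  define R where "R Z = (\<Sum>i<n. \<Sum>j<n. of_real (?d Z i j) * (iexp (t * ?d Z i j) - 1 - \<i> * of_real (t * ?d Z i j)))" for Z
  have "(4 * real n) *\<^sub>R (\<Sum>Z\<in>W. ?S Z *\<^sub>R iexp (t * ?S Z)) =
     (\<Sum>Z\<in>W. \<Sum>i<n. \<Sum>j<n. ?d Z i j *\<^sub>R (iexp (t * (?S Z + ?d Z i j)) - iexp (t * ?S Z)))"
    by (rule stein_identity[OF cen])
  also have "\<dots> = (\<Sum>Z\<in>W. iexp (t * ?S Z) * (\<Sum>i<n. \<Sum>j<n. of_real (?d Z i j) * (iexp (t * ?d Z i j) - 1)))"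
    unfolding sum_distrib_left
    by (intro sum.cong refl) (simp add: scaleR_conv_of_real exp_add distrib_left algebra_simps)
  also have "\<dots> = (\<Sum>Z\<in>W. iexp (t * ?S Z) * (R Z + \<i> * of_real (4 * real n * t * D Z)))"
  proof (rule sum.cong[OF refl], rule arg_cong2[where f = "(*)", OF refl])
    fix Z
    have "(\<Sum>i<n. \<Sum>j<n. complex_of_real (?d Z i j) * (iexp (t * ?d Z i j) - 1))
       = (\<Sum>i<n. \<Sum>j<n. of_real (?d Z i j) * (iexp (t * ?d Z i j) - 1 - \<i> * of_real (t * ?d Z i j))
            + \<i> * of_real t * of_real ((?d Z i j)\<^sup>2))"
      by (intro sum.cong refl) (simp add: power2_eq_square algebra_simps)
    also have "\<dots> = R Z + \<i> * of_real t * of_real (\<Sum>i<n. \<Sum>j<n. (?d Z i j)\<^sup>2)"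
      by (simp only: R_def sum.distrib of_real_sum sum_distrib_left)
    also have "of_real (\<Sum>i<n. \<Sum>j<n. (?d Z i j)\<^sup>2) = complex_of_real (4 * real n * D Z)"
      using n by (simp add: D_def)
    finally show "(\<Sum>i<n. \<Sum>j<n. complex_of_real (?d Z i j) * (iexp (t * ?d Z i j) - 1))
      = R Z + \<i> * of_real (4 * real n * t * D Z)" by (simp add: mult_ac)
  qed
  finally have st: "4 * of_nat n * (\<Sum>Z\<in>W. of_real (?S Z) * iexp (t * ?S Z))
     = (\<Sum>Z\<in>W. iexp (t * ?S Z) * (R Z + \<i> * of_real (4 * real n * t * D Z)))"
    by (simp add: scaleR_conv_of_real)
  have "(\<Sum>Z\<in>W. \<i> * of_real (?S Z) * iexp (t * ?S Z)) + of_real (t * s2) * (\<Sum>Z\<in>W. iexp (t * ?S Z))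
     = \<i> / (4 * of_nat n) * (4 * of_nat n * (\<Sum>Z\<in>W. of_real (?S Z) * iexp (t * ?S Z)))
        + of_real (t * s2) * (\<Sum>Z\<in>W. iexp (t * ?S Z))"
    using n by (simp add: sum_distrib_left mult.assoc)
  also have "\<dots> = (\<Sum>Z\<in>W. iexp (t * ?S Z) * (\<i> * R Z / (4 * of_nat n) + of_real (t * (s2 - D Z))))"
    unfolding st unfolding sum_distrib_left sum.distrib[symmetric]
    by (intro sum.cong refl) (use n in \<open>simp add: field_simps\<close>)
  finally have eq: "(\<Sum>Z\<in>W. \<i> * of_real (?S Z) * iexp (t * ?S Z)) + of_real (t * s2) * (\<Sum>Z\<in>W. iexp (t * ?S Z))
     = (\<Sum>Z\<in>W. iexp (t * ?S Z) * (\<i> * R Z / (4 * of_nat n) + of_real (t * (s2 - D Z))))" .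
  have "cmod \<dots> \<le> (\<Sum>Z\<in>W. 2 * M * D Z + \<bar>D Z - s2\<bar>)"
  proof (rule sum_norm_le)
    fix Z assume Z: "Z \<in> W"
    have Zq: "Z j < Q" if "j < n" for j using Z that by (auto simp: assignments_def)
    have "cmod (R Z) \<le> (\<Sum>i<n. \<Sum>j<n. 2 * M * (?d Z i j)\<^sup>2)"
      unfolding R_def
    proof (intro sum_norm_le)
      fix i j assume "i \<in> {..<n}" "j \<in> {..<n}"
      then have d: "\<bar>?d Z i j\<bar> \<le> 4 * M"
        using M[of i "Z j"] M[of j "Z i"] M[of i "Z i"] M[of j "Z j"] Zq unfolding swap_diff_def by auto
      have "cmod (of_real (?d Z i j) * (iexp (t * ?d Z i j) - 1 - \<i> * of_real (t * ?d Z i j)))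
         \<le> \<bar>?d Z i j\<bar> * ((t * ?d Z i j)\<^sup>2 / 2)"
        unfolding norm_mult norm_of_real by (intro mult_left_mono iexp_linear_approx) auto
      also have "\<dots> \<le> (4 * M) * ((?d Z i j)\<^sup>2 / 2)"
      proof (intro mult_mono d)
        have "t\<^sup>2 \<le> 1" using t by (simp add: power_le_one)
        then show "(t * ?d Z i j)\<^sup>2 / 2 \<le> (?d Z i j)\<^sup>2 / 2"
          by (simp add: power_mult_distrib mult_left_le_one_le)
      qed (use M0 in auto)
      finally show "cmod (of_real (?d Z i j) * (iexp (t * ?d Z i j) - 1 - \<i> * of_real (t * ?d Z i j)))
         \<le> 2 * M * (?d Z i j)\<^sup>2" by simp
    qed
    also have "\<dots> = 2 * M * (4 * real n * D Z)"
      using n by (simp add: D_def flip: sum_distrib_left)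
    finally have R: "cmod (R Z) \<le> 2 * M * (4 * real n * D Z)" .
    have "cmod (iexp (t * ?S Z) * (\<i> * R Z / (4 * of_nat n) + of_real (t * (s2 - D Z))))
       = cmod (\<i> * R Z / (4 * of_nat n) + of_real (t * (s2 - D Z)))"
      by (simp only: norm_mult norm_exp_i_times mult_1)
    also have "\<dots> \<le> cmod (R Z) / (4 * real n) + t * \<bar>s2 - D Z\<bar>"
    proof (rule order_trans[OF norm_triangle_ineq], rule add_mono)
      show "cmod (\<i> * R Z / (4 * of_nat n)) \<le> cmod (R Z) / (4 * real n)"
        by (simp add: norm_divide norm_mult)
      show "cmod (of_real (t * (s2 - D Z))) \<le> t * \<bar>s2 - D Z\<bar>"
        using t by (simp only: norm_of_real abs_mult abs_of_nonneg)
    qed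
    also have "\<dots> \<le> 2 * M * D Z + 1 * \<bar>s2 - D Z\<bar>"
      using R n t by (intro add_mono mult_right_mono) (auto simp: field_simps)
    finally show "cmod (iexp (t * ?S Z) * (\<i> * R Z / (4 * of_nat n) + of_real (t * (s2 - D Z)))) \<le> 2 * M * D Z + \<bar>D Z - s2\<bar>"
      by (simp add: abs_minus_commute)
  qed
  also have "\<dots> = 2 * M * (\<Sum>Z\<in>W. D Z) + (\<Sum>Z\<in>W. \<bar>D Z - s2\<bar>)" by (simp add: sum.distrib sum_distrib_left)
  also have "\<dots> \<le> 2 * M * (real (card W) * (4 * A0)) + real (card W) * (4 * M * sqrt (real Q * A0) + 8 * (real Q)\<^sup>2 * A0 / real n)"
    using M0 by (intro add_mono mult_left_mono sum_D sum_abs_D) auto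
  also have "\<dots> = real (card W) * E" by (simp add: E_def algebra_simps)
  finally show ?thesis using eq by simp
qed

lemma combinatorial_clt_bound:
  "cmod ((\<Sum>Z\<in>assignments Q n nq. iexp (linear_stat n a Z)) / of_nat (card (assignments Q n nq))
       - of_real (exp (- cov_form n Q nq a a / 2)))
   \<le> 8 * M * (\<Sum>i<n. \<Sum>q<Q. (a i q)\<^sup>2)
     + (4 * M * sqrt (real Q * (\<Sum>i<n. \<Sum>q<Q. (a i q)\<^sup>2))
        + 8 * (real Q)\<^sup>2 * (\<Sum>i<n. \<Sum>q<Q. (a i q)\<^sup>2) / real n)"
proof -
  let ?S = "linear_stat n a"
  let ?c = "of_nat (card W) :: complex"
  have c0: "?c \<noteq> 0" using card_pos by (metis less_irrefl of_nat_0 of_nat_eq_0_iff)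
  have E0: "E \<ge> 0" using M0 A_nonneg by (simp add: E_def)
  have s20: "s2 \<ge> 0"
  proof -
    have "2 * s2 \<ge> 0" unfolding mean_pairvar[OF nq n, symmetric]
      by (intro sum_nonneg mult_nonneg_nonneg pairvar_nonneg) auto
    then show ?thesis by simp
  qed
  define f where "f z = (\<Sum>Z\<in>W. exp (\<i> * of_real (?S Z) * z)) / ?c * exp (of_real s2 * z\<^sup>2 / 2)" for z
  define f' where "f' z = ((\<Sum>Z\<in>W. \<i> * of_real (?S Z) * exp (\<i> * of_real (?S Z) * z))
      + z * of_real s2 * (\<Sum>Z\<in>W. exp (\<i> * of_real (?S Z) * z))) / ?c * exp (of_real s2 * z\<^sup>2 / 2)" for z
  have der: "(f has_field_derivative f' z) (at z within X)" for z X
  proof -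
    have d1: "((\<lambda>z. \<Sum>Z\<in>W. exp (\<i> * of_real (?S Z) * z)) has_field_derivative
        (\<Sum>Z\<in>W. \<i> * of_real (?S Z) * exp (\<i> * of_real (?S Z) * z))) (at z within X)"
      by (intro DERIV_sum) (auto intro!: derivative_eq_intros)
    have d2: "((\<lambda>z. exp (of_real s2 * z\<^sup>2 / 2)) has_field_derivative
        exp (of_real s2 * z\<^sup>2 / 2) * (of_real s2 * z)) (at z within X)"
      by (auto intro!: derivative_eq_intros)
    show ?thesis
      unfolding f_def f'_def
      by (rule DERIV_cong[OF DERIV_mult[OF DERIV_cdivide[OF d1] d2]])
        (use c0 in \<open>simp add: add_divide_distrib algebra_simps\<close>)
  qed
  have f10: "cmod (f 1 - f 0) \<le> (exp (s2 / 2) * E) * cmod (1 - 0)"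
  proof (rule field_differentiable_bound[where S = "closed_segment 0 1"])
    fix z :: complex assume "z \<in> closed_segment 0 1"
    then obtain t where t: "0 \<le> t" "t \<le> 1" "z = of_real t"
      by (auto simp: closed_segment_def scaleR_conv_of_real)
    have "cmod (f' z) = cmod ((\<Sum>Z\<in>W. \<i> * of_real (?S Z) * iexp (t * ?S Z))
      + of_real (t * s2) * (\<Sum>Z\<in>W. iexp (t * ?S Z))) / real (card W) * exp (s2 * t\<^sup>2 / 2)"
      unfolding f'_def t(3) by (simp add: norm_mult norm_divide mult_ac flip: of_real_power)
    also have "\<dots> \<le> (real (card W) * E) / real (card W) * exp (s2 / 2)"
    proof (intro mult_mono divide_right_mono char_ode t(1,2))
      have "s2 * t\<^sup>2 \<le> s2" using s20 t by (simp add: mult_left_le power_le_one)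
      then show "exp (s2 * t\<^sup>2 / 2) \<le> exp (s2 / 2)" by simp
    qed (use E0 in auto)
    also have "\<dots> = exp (s2 / 2) * E" using card_pos by simp
    finally show "cmod (f' z) \<le> exp (s2 / 2) * E" .
  qed (auto intro: der)
  have b: "cmod ((\<Sum>Z\<in>W. iexp (?S Z)) / ?c * of_real (exp (s2 / 2)) - 1) \<le> exp (s2 / 2) * E"
  proof -
    have "exp (complex_of_real s2 / 2) = of_real (exp (s2 / 2))"
      by (simp flip: exp_of_real)
    then show ?thesis using f10 c0 by (simp add: f_def)
  qed
  have "cmod ((\<Sum>Z\<in>W. iexp (?S Z)) / ?c - of_real (exp (- s2 / 2)))
     = cmod (((\<Sum>Z\<in>W. iexp (?S Z)) / ?c * of_real (exp (s2 / 2)) - 1) * of_real (exp (- s2 / 2)))"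
  proof -
    have "of_real (exp (s2 / 2)) * complex_of_real (exp (- s2 / 2)) = 1"
      by (simp flip: of_real_mult exp_add)
    then show ?thesis by (simp add: left_diff_distrib mult.assoc)
  qed
  also have "\<dots> \<le> (exp (s2 / 2) * E) * exp (- s2 / 2)"
    using mult_right_mono[OF b, of "exp (- s2 / 2)"] by (simp add: norm_mult)
  also have "\<dots> = E" by (simp add: mult_ac flip: exp_add)
  finally show ?thesis by (simp add: E_def A0_def A_def)
qed

end

lemma combinatorial_clt:
  fixes N :: "nat \<Rightarrow> nat" and nq :: "nat \<Rightarrow> nat \<Rightarrow> nat" and a :: "nat \<Rightarrow> nat \<Rightarrow> nat \<Rightarrow> real"
  assumes cen: "\<And>m q. q < Q \<Longrightarrow> (\<Sum>i<N m. a m i q) = 0"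
    and nq: "\<And>m. (\<Sum>q<Q. nq m q) = N m"
    and N: "filterlim N at_top sequentially"
    and M: "\<And>m i q. i < N m \<Longrightarrow> q < Q \<Longrightarrow> \<bar>a m i q\<bar> \<le> M m" and M0: "M \<longlonglongrightarrow> 0"
    and A: "\<And>m. (\<Sum>i<N m. \<Sum>q<Q. (a m i q)\<^sup>2) \<le> A"
    and s2: "(\<lambda>m. cov_form (N m) Q (nq m) (a m) (a m)) \<longlonglongrightarrow> s2"
  shows "(\<lambda>m. (\<Sum>Z\<in>assignments Q (N m) (nq m). iexp (linear_stat (N m) (a m) Z)) /
      of_nat (card (assignments Q (N m) (nq m)))) \<longlonglongrightarrow> of_real (exp (- s2 / 2))"
proof -
  let ?psi = "\<lambda>m. (\<Sum>Z\<in>assignments Q (N m) (nq m). iexp (linear_stat (N m) (a m) Z)) /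
      of_nat (card (assignments Q (N m) (nq m))) :: complex"
  define B where "B m = 8 * M m * A + (4 * M m * sqrt (real Q * A) + 8 * (real Q)\<^sup>2 * A / real (N m))" for m
  have A0: "A \<ge> 0" by (rule order_trans[OF _ A[of 0]]) (auto intro!: sum_nonneg)
  have bound: "eventually (\<lambda>m. norm (?psi m - of_real (exp (- cov_form (N m) Q (nq m) (a m) (a m) / 2))) \<le> B m) sequentially"
    using filterlim_at_top[THEN iffD1, OF N, rule_format, of 1]
  proof eventually_elim
    case (elim m0)
    define m where "m = m0"
    have elim: "N m > 0" using elim by (simp add: m_def)
    let ?A = "\<Sum>i<N m. \<Sum>q<Q. (a m i q)\<^sup>2"
    have Q: "Q > 0" using nq[of m] elim by (cases Q) auto
    have Mm: "M m \<ge> 0" using M[OF elim Q] by linarith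
    have "norm (?psi m - of_real (exp (- cov_form (N m) Q (nq m) (a m) (a m) / 2)))
      \<le> 8 * M m * ?A + (4 * M m * sqrt (real Q * ?A) + 8 * (real Q)\<^sup>2 * ?A / real (N m))"
      by (rule combinatorial_clt_bound) (use cen nq M elim in auto)
    also have "\<dots> \<le> B m"
      unfolding B_def using A[of m] Mm
      by (intro add_mono mult_left_mono divide_right_mono) (auto intro!: mult_left_mono)
    finally show ?case by (simp add: m_def)
  qed
  have iN: "(\<lambda>m. 1 / real (N m)) \<longlonglongrightarrow> 0"
    using filterlim_compose[OF lim_inverse_n N] by (simp add: inverse_eq_divide)
  have "(\<lambda>m. 8 * M m * A + (4 * M m * sqrt (real Q * A) + (8 * (real Q)\<^sup>2 * A) * (1 / real (N m)))) \<longlonglongrightarrow>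
     8 * 0 * A + (4 * 0 * sqrt (real Q * A) + (8 * (real Q)\<^sup>2 * A) * 0)"
    by (intro tendsto_intros M0 iN)
  then have B: "B \<longlonglongrightarrow> 0" by (simp add: B_def[abs_def])
  have "(\<lambda>m. ?psi m - of_real (exp (- cov_form (N m) Q (nq m) (a m) (a m) / 2))) \<longlonglongrightarrow> 0"
    by (rule Lim_null_comparison[OF bound B])
  moreover have "(\<lambda>m. complex_of_real (exp (- cov_form (N m) Q (nq m) (a m) (a m) / 2))) \<longlonglongrightarrow> of_real (exp (- s2 / 2))"
    by (intro tendsto_intros s2) auto
  ultimately show ?thesis using tendsto_add by fastforce
qed

section \<open>Convergence of characteristic functions in finitely many coordinates\<close>

inductive trigpoly :: "'i set \<Rightarrow> (('i \<Rightarrow> real) \<Rightarrow> real) \<Rightarrow> bool" for I where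
  cos: "trigpoly I (\<lambda>x. c * cos ((\<Sum>k\<in>I. t k * x k) + b))"
| add: "trigpoly I f \<Longrightarrow> trigpoly I g \<Longrightarrow> trigpoly I (\<lambda>x. f x + g x)"

lemma trigpoly_const: "trigpoly I (\<lambda>_. c)"
  using trigpoly.cos[of I c "\<lambda>_. 0" 0] by simp

lemma trigpoly_sin:
  assumes "finite I" "k \<in> I"
  shows "trigpoly I (\<lambda>x. sin (s * x k))"
proof -
  have "(\<Sum>j\<in>I. (if j = k then s else 0) * x j) = s * x k" for x
  proof -
    have "(\<Sum>j\<in>I. (if j = k then s else 0) * x j) = (\<Sum>j\<in>I. if j = k then s * x j else 0)"
      by (rule sum.cong) auto
    then show ?thesis using assms by simp
  qed
  then have "(\<lambda>x. 1 * cos ((\<Sum>j\<in>I. (if j = k then s else 0) * x j) + - (pi / 2))) = (\<lambda>x. sin (s * x k))"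
    by (simp add: fun_eq_iff cos_diff)
  with trigpoly.cos[of I 1 "\<lambda>j. if j = k then s else 0" "- (pi / 2)"] show ?thesis by metis
qed

lemma trigpoly_mult:
  assumes "trigpoly I f" "trigpoly I g"
  shows "trigpoly I (\<lambda>x. f x * g x)"
  using assms(1)
proof induction
  case (cos c t b)
  from assms(2) show ?case
  proof induction
    case (cos c' t' b')
    have "(\<lambda>x. c * cos ((\<Sum>k\<in>I. t k * x k) + b) * (c' * cos ((\<Sum>k\<in>I. t' k * x k) + b')))
      = (\<lambda>x. c * c' / 2 * cos ((\<Sum>k\<in>I. (t k - t' k) * x k) + (b - b'))
           + c * c' / 2 * cos ((\<Sum>k\<in>I. (t k + t' k) * x k) + (b + b')))" (is "?l = ?r")
    proof
      fix x
      let ?u = "(\<Sum>k\<in>I. t k * x k) + b" and ?v = "(\<Sum>k\<in>I. t' k * x k) + b'"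
      have u: "(\<Sum>k\<in>I. (t k - t' k) * x k) + (b - b') = ?u - ?v"
        "(\<Sum>k\<in>I. (t k + t' k) * x k) + (b + b') = ?u + ?v"
        by (simp_all add: algebra_simps sum_subtractf sum.distrib)
      have "c * cos v * (c' * cos w) = c * c' / 2 * cos (v - w) + c * c' / 2 * cos (v + w)" for v w
      proof -
        have "c * cos v * (c' * cos w) = c * c' * (cos v * cos w)" by simp
        also have "\<dots> = c * c' / 2 * (cos (v - w) + cos (v + w))" unfolding cos_times_cos by simp
        finally show ?thesis by (simp only: distrib_left)
      qed
      then show "?l x = ?r x" unfolding u .
    qed
    then show ?case by (simp only: trigpoly.add[OF trigpoly.cos trigpoly.cos])
  next
    case (add f g)
    show ?case using trigpoly.add[OF add.IH] by (simp only: distrib_left)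
  qed
next
  case (add f g)
  show ?case using trigpoly.add[OF add.IH] by (simp only: distrib_right)
qed

lemma compact_cube:
  "compact {y :: 'i \<Rightarrow> real. \<forall>k. (k \<in> I \<longrightarrow> \<bar>y k\<bar> \<le> 1) \<and> (k \<notin> I \<longrightarrow> y k = 0)}"
proof -
  have "{y :: 'i \<Rightarrow> real. \<forall>k. (k \<in> I \<longrightarrow> \<bar>y k\<bar> \<le> 1) \<and> (k \<notin> I \<longrightarrow> y k = 0)}
    = PiE UNIV (\<lambda>k. if k \<in> I then {-1..1} else {0})"
    by (auto simp: PiE_UNIV_domain abs_le_iff Pi_iff split: if_splits)
  moreover have "compactin (product_topology (\<lambda>_. euclidean) UNIV) (PiE UNIV (\<lambda>k. if k \<in> I then {-1..1} else {0::real}))"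
    by (auto simp: compactin_PiE)
  ultimately show ?thesis by (simp add: euclidean_product_topology)
qed

text \<open>Substituting \<open>x = (2r/pi) arcsin y\<close> turns the test function on the box of radius \<open>r\<close> into one on
  the unit cube, and a polynomial in \<open>y = sin (pi x/(2r))\<close> is a trigonometric polynomial in \<open>x\<close>,
  so the approximation stays bounded off the box.\<close>

lemma trigpoly_approximation:
  fixes \<phi> :: "('i::countable \<Rightarrow> real) \<Rightarrow> real"
  assumes fin: "finite I" and cont: "continuous_on UNIV \<phi>" and B: "\<And>x. \<bar>\<phi> x\<bar> \<le> B"
    and e: "e > 0" and r: "r > 0"
  shows "\<exists>p. trigpoly I p \<and>
    (\<forall>x. (\<forall>k. k \<notin> I \<longrightarrow> x k = 0) \<longrightarrow> \<bar>\<phi> x - p x\<bar> \<le> e + 2 * B * (\<Sum>k\<in>I. (x k)\<^sup>2) / r\<^sup>2)"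
proof -
  define S where "S = {y :: 'i \<Rightarrow> real. \<forall>k. (k \<in> I \<longrightarrow> \<bar>y k\<bar> \<le> 1) \<and> (k \<notin> I \<longrightarrow> y k = 0)}"
  define s where "s = pi / (2 * r)"
  have s: "s > 0" using r by (simp add: s_def)
  define h where "h x = (\<lambda>k. if k \<in> I then sin (s * x k) else 0)" for x :: "'i \<Rightarrow> real"
  define \<psi> where "\<psi> y = \<phi> (\<lambda>k. arcsin (y k) / s)" for y
  have hS: "h x \<in> S" for x by (auto simp: h_def S_def)
  define P where "P g \<longleftrightarrow> continuous_on UNIV g \<and> trigpoly I (\<lambda>x. g (h x))" for g :: "('i \<Rightarrow> real) \<Rightarrow> real"
  have "\<exists>g. P g \<and> (\<forall>x\<in>S. \<bar>\<psi> x - g x\<bar> < e)"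
  proof (rule Stone_Weierstrass_HOL[where P = P])
    show "compact S" unfolding S_def by (rule compact_cube)
    show "continuous_on S \<psi>"
      unfolding \<psi>_def
    proof (rule continuous_on_compose2[OF cont])
      show "continuous_on S (\<lambda>y k. arcsin (y k) / s)"
      proof (rule continuous_on_coordinatewise_then_product)
        fix k
        have "continuous_on S (\<lambda>y. arcsin (y k))"
        proof (rule continuous_on_arcsin)
          show "continuous_on S (\<lambda>y. y k)"
            by (rule continuous_on_subset[OF continuous_on_product_coordinates]) auto
          show "\<forall>y\<in>S. - 1 \<le> y k \<and> y k \<le> 1"
            by (cases "k \<in> I") (auto simp: S_def abs_le_iff minus_le_iff)
        qed
        then show "continuous_on S (\<lambda>y. arcsin (y k) / s)"
          using s by (intro continuous_on_divide continuous_on_const) auto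
      qed
    qed auto
    show "\<exists>f. P f \<and> f x \<noteq> f y" if "x \<in> S \<and> y \<in> S \<and> x \<noteq> y" for x y
    proof -
      from that obtain k where k: "x k \<noteq> y k" by auto
      with that have "k \<in> I" by (auto simp: S_def)
      then have "P (\<lambda>x. x k)"
        using trigpoly_sin[OF fin, of k s] by (simp add: P_def h_def continuous_on_product_coordinates)
      with k show ?thesis by blast
    qed
  qed (use e in \<open>auto simp: P_def trigpoly_const intro: trigpoly.add trigpoly_mult continuous_intros
        elim: continuous_on_subset\<close>)
  then obtain g where g: "P g" "\<And>x. x \<in> S \<Longrightarrow> \<bar>\<psi> x - g x\<bar> < e" by blast
  have "\<bar>\<phi> x - g (h x)\<bar> \<le> e + 2 * B * (\<Sum>k\<in>I. (x k)\<^sup>2) / r\<^sup>2" if x0: "\<forall>k. k \<notin> I \<longrightarrow> x k = 0" for x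
  proof (cases "\<forall>k\<in>I. \<bar>x k\<bar> \<le> r")
    case True
    have "arcsin (h x k) / s = x k" for k
    proof (cases "k \<in> I")
      case k: True
      have "\<bar>s * x k\<bar> \<le> s * r" using True k s by (simp add: abs_mult)
      then have "\<bar>s * x k\<bar> \<le> pi / 2" using r by (simp add: s_def)
      then have "arcsin (sin (s * x k)) = s * x k" by (intro arcsin_sin) linarith+
      then show ?thesis using k s by (simp add: h_def)
    qed (use x0 in \<open>simp add: h_def\<close>)
    then have "\<psi> (h x) = \<phi> x" by (simp add: \<psi>_def)
    then have "\<bar>\<phi> x - g (h x)\<bar> < e" using g(2)[OF hS[of x]] by simp
    moreover have "0 \<le> 2 * B * (\<Sum>k\<in>I. (x k)\<^sup>2) / r\<^sup>2"
      using B[of x] by (auto intro!: divide_nonneg_nonneg mult_nonneg_nonneg sum_nonneg)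
    ultimately show ?thesis by linarith
  next
    case False
    then obtain k where k: "k \<in> I" "r < \<bar>x k\<bar>" by auto
    have B0: "B \<ge> 0" using B[of x] by linarith
    have "r\<^sup>2 \<le> (x k)\<^sup>2" using k r by (metis abs_le_square_iff abs_of_pos less_imp_le)
    also have "\<dots> \<le> (\<Sum>k\<in>I. (x k)\<^sup>2)" by (rule member_le_sum) (use k fin in auto)
    finally have "1 \<le> (\<Sum>k\<in>I. (x k)\<^sup>2) / r\<^sup>2" using r by simp
    then have "2 * B * 1 \<le> 2 * B * ((\<Sum>k\<in>I. (x k)\<^sup>2) / r\<^sup>2)" using B0 by (intro mult_left_mono) auto
    moreover have "\<bar>\<phi> x - g (h x)\<bar> \<le> 2 * B + e"
      using g(2)[OF hS[of x]] B[of x] B[of "\<lambda>k. arcsin (h x k) / s"] unfolding \<psi>_def by linarith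
    ultimately show ?thesis by simp
  qed
  then show ?thesis using g(1) unfolding P_def by blast
qed

lemma trigpoly_bounded: "trigpoly I p \<Longrightarrow> \<exists>B. \<forall>x. \<bar>p x\<bar> \<le> B"
proof (induction rule: trigpoly.induct)
  case (cos c t b)
  have "\<bar>c * cos ((\<Sum>k\<in>I. t k * x k) + b)\<bar> \<le> \<bar>c\<bar>" for x
    by (simp add: abs_mult mult_left_le)
  then show ?case by blast
next
  case (add f g)
  then obtain B C where "\<And>x. \<bar>f x\<bar> \<le> B" "\<And>x. \<bar>g x\<bar> \<le> C" by blast
  then have "\<bar>f x + g x\<bar> \<le> B + C" for x by (meson abs_triangle_ineq add_mono order_trans)
  then show ?case by blast
qed

lemma trigpoly_measurable:
  assumes "trigpoly I p" "\<And>k. k \<in> I \<Longrightarrow> (\<lambda>w. X w k) \<in> borel_measurable M"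
  shows "(\<lambda>w. p (X w)) \<in> borel_measurable M"
  using assms(1) by (induction rule: trigpoly.induct) (use assms(2) in \<open>auto intro!: borel_measurable_sum borel_measurable_times borel_measurable_const borel_measurable_add measurable_compose[OF _ borel_measurable_cos]\<close>)

lemma (in prob_space) trigpoly_integrable:
  assumes "trigpoly I p" "\<And>k. k \<in> I \<Longrightarrow> (\<lambda>w. X w k) \<in> borel_measurable M"
  shows "integrable M (\<lambda>w. p (X w))"
proof -
  obtain B where "\<And>x. \<bar>p x\<bar> \<le> B" using trigpoly_bounded[OF assms(1)] by blast
  then show ?thesis
    by (intro integrable_const_bound[where B = B] trigpoly_measurable[OF assms]) auto
qed

lemma (in prob_space) expectation_trigpoly_approximation:
  fixes X :: "'a \<Rightarrow> 'i::countable \<Rightarrow> real"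
  assumes fin: "finite I" and cont: "continuous_on UNIV \<phi>" and B: "\<And>x. \<bar>\<phi> x\<bar> \<le> B"
    and X: "\<And>k. k \<in> I \<Longrightarrow> (\<lambda>w. X w k) \<in> borel_measurable M"
    and X0: "\<And>w k. k \<notin> I \<Longrightarrow> X w k = 0"
    and int: "\<And>k. k \<in> I \<Longrightarrow> integrable M (\<lambda>w. (X w k)\<^sup>2)"
    and C: "\<And>k. k \<in> I \<Longrightarrow> expectation (\<lambda>w. (X w k)\<^sup>2) \<le> C"
    and p: "trigpoly I p"
    and app: "\<And>x. (\<forall>k. k \<notin> I \<longrightarrow> x k = 0) \<Longrightarrow> \<bar>\<phi> x - p x\<bar> \<le> e + D * (\<Sum>k\<in>I. (x k)\<^sup>2)"
    and D: "D \<ge> 0"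
  shows "\<bar>expectation (\<lambda>w. \<phi> (X w)) - expectation (\<lambda>w. p (X w))\<bar> \<le> e + D * (real (card I) * C)"
proof -
  have "X \<in> borel_measurable M"
  proof (rule measurable_coordinatewise_then_product)
    fix k show "(\<lambda>w. X w k) \<in> borel_measurable M"
      using X X0 by (cases "k \<in> I") simp_all
  qed
  then have m: "(\<lambda>w. \<phi> (X w)) \<in> borel_measurable M"
    by (rule measurable_compose) (rule borel_measurable_continuous_onI[OF cont])
  have i1: "integrable M (\<lambda>w. \<phi> (X w))"
    by (rule integrable_const_bound[where B = B]) (use B m in auto)
  have i2: "integrable M (\<lambda>w. p (X w))" by (rule trigpoly_integrable[OF p X])
  have "\<bar>expectation (\<lambda>w. \<phi> (X w)) - expectation (\<lambda>w. p (X w))\<bar> = \<bar>expectation (\<lambda>w. \<phi> (X w) - p (X w))\<bar>"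
    using i1 i2 by simp
  also have "\<dots> \<le> expectation (\<lambda>w. \<bar>\<phi> (X w) - p (X w)\<bar>)" by (rule integral_abs_bound)
  also have "\<dots> \<le> expectation (\<lambda>w. e + D * (\<Sum>k\<in>I. (X w k)\<^sup>2))"
    by (rule integral_mono) (use i1 i2 int app X0 in \<open>auto intro!: integrable_sum\<close>)
  also have "\<dots> = e + D * (\<Sum>k\<in>I. expectation (\<lambda>w. (X w k)\<^sup>2))"
    using int by (simp add: prob_space)
  also have "\<dots> \<le> e + D * (real (card I) * C)"
    using sum_bounded_above[of I "\<lambda>k. expectation (\<lambda>w. (X w k)\<^sup>2)" C] C D
    by (intro add_left_mono mult_left_mono) auto
  finally show ?thesis .
qed

theorem multivariate_levy:
  fixes M :: "nat \<Rightarrow> 'a measure" and M' :: "'b measure"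
    and X :: "nat \<Rightarrow> 'a \<Rightarrow> 'i::countable \<Rightarrow> real" and X' :: "'b \<Rightarrow> 'i \<Rightarrow> real" and \<phi> :: "('i \<Rightarrow> real) \<Rightarrow> real"
  assumes fin: "finite I"
    and M: "\<And>m. prob_space (M m)" and M': "prob_space M'"
    and X: "\<And>m k. k \<in> I \<Longrightarrow> (\<lambda>w. X m w k) \<in> borel_measurable (M m)"
    and X': "\<And>k. k \<in> I \<Longrightarrow> (\<lambda>w. X' w k) \<in> borel_measurable M'"
    and X0: "\<And>m w k. k \<notin> I \<Longrightarrow> X m w k = 0" and X'0: "\<And>w k. k \<notin> I \<Longrightarrow> X' w k = 0"
    and int: "\<And>m k. k \<in> I \<Longrightarrow> integrable (M m) (\<lambda>w. (X m w k)\<^sup>2)"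
    and int': "\<And>k. k \<in> I \<Longrightarrow> integrable M' (\<lambda>w. (X' w k)\<^sup>2)"
    and C: "\<And>m k. k \<in> I \<Longrightarrow> (\<integral>w. (X m w k)\<^sup>2 \<partial>M m) \<le> C"
    and char: "\<And>t b. (\<lambda>m. \<integral>w. cos ((\<Sum>k\<in>I. t k * X m w k) + b) \<partial>M m) \<longlonglongrightarrow> (\<integral>w. cos ((\<Sum>k\<in>I. t k * X' w k) + b) \<partial>M')"
    and cont: "continuous_on UNIV \<phi>" and B: "\<And>x. \<bar>\<phi> x\<bar> \<le> B"
  shows "(\<lambda>m. \<integral>w. \<phi> (X m w) \<partial>M m) \<longlonglongrightarrow> (\<integral>w. \<phi> (X' w) \<partial>M')"
proof -
  have conv: "(\<lambda>m. \<integral>w. p (X m w) \<partial>M m) \<longlonglongrightarrow> (\<integral>w. p (X' w) \<partial>M')" if "trigpoly I p" for p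
    using that
  proof (induction rule: trigpoly.induct)
    case (cos c t b)
    show ?case using tendsto_mult_left[OF char[of t b], of c] by simp
  next
    case (add f g)
    have "(\<integral>w. f (X m w) + g (X m w) \<partial>M m) = (\<integral>w. f (X m w) \<partial>M m) + (\<integral>w. g (X m w) \<partial>M m)" for m
      by (intro Bochner_Integration.integral_add prob_space.trigpoly_integrable[OF M, where I = I and X = "X m"] add X)
    moreover have "(\<integral>w. f (X' w) + g (X' w) \<partial>M') = (\<integral>w. f (X' w) \<partial>M') + (\<integral>w. g (X' w) \<partial>M')"
      by (intro Bochner_Integration.integral_add prob_space.trigpoly_integrable[OF M', where I = I and X = X'] add X')
    ultimately show ?case using add by (auto intro: tendsto_add)
  qed
  define C' where "C' = (\<Sum>k\<in>I. \<integral>w. (X' w k)\<^sup>2 \<partial>M')"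
  have C': "(\<integral>w. (X' w k)\<^sup>2 \<partial>M') \<le> C'" if "k \<in> I" for k
    unfolding C'_def by (rule member_le_sum) (use that fin in auto)
  define c where "c = real (card I) * (\<bar>C\<bar> + \<bar>C'\<bar>)"
  have c: "c \<ge> 0" by (simp add: c_def)
  have B0: "B \<ge> 0" using B[of undefined] by linarith
  show ?thesis
  proof (rule LIMSEQ_I)
    fix ee :: real assume ee: "ee > 0"
    define e where "e = ee / 6"
    have e: "e > 0" using ee by (simp add: e_def)
    define r where "r = sqrt (2 * B * c / e + 1)"
    have r2: "r\<^sup>2 = 2 * B * c / e + 1" unfolding r_def using B0 c e by (intro real_sqrt_pow2) auto
    have r: "r > 0" using B0 c e by (simp add: r_def add_nonneg_pos)
    obtain p where p: "trigpoly I p"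
      and app: "\<And>x. (\<forall>k. k \<notin> I \<longrightarrow> x k = 0) \<Longrightarrow> \<bar>\<phi> x - p x\<bar> \<le> e + 2 * B / r\<^sup>2 * (\<Sum>k\<in>I. (x k)\<^sup>2)"
      using trigpoly_approximation[OF fin cont B e r] by auto
    have small: "2 * B / r\<^sup>2 * c \<le> e"
    proof -
      have "2 * B * c \<le> e * r\<^sup>2" unfolding r2 using e by (simp add: field_simps)
      then show ?thesis using r by (simp add: field_simps)
    qed
    have D: "2 * B / r\<^sup>2 \<ge> 0" using B0 by simp
    have cC: "2 * B / r\<^sup>2 * (real (card I) * C) \<le> e" "2 * B / r\<^sup>2 * (real (card I) * C') \<le> e"
    proof -
      have "real (card I) * C \<le> c" "real (card I) * C' \<le> c" unfolding c_def by (auto intro!: mult_left_mono)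
      then show "2 * B / r\<^sup>2 * (real (card I) * C) \<le> e" "2 * B / r\<^sup>2 * (real (card I) * C') \<le> e"
        using mult_left_mono[OF _ D] small by (meson order_trans)+
    qed
    have a: "\<bar>(\<integral>w. \<phi> (X m w) \<partial>M m) - (\<integral>w. p (X m w) \<partial>M m)\<bar> \<le> 2 * e" for m
      using prob_space.expectation_trigpoly_approximation[where X = "X m", OF M fin cont B X X0 int C p app D] cC(1) by simp
    have a': "\<bar>(\<integral>w. \<phi> (X' w) \<partial>M') - (\<integral>w. p (X' w) \<partial>M')\<bar> \<le> 2 * e"
      using prob_space.expectation_trigpoly_approximation[where X = X', OF M' fin cont B X' X'0 int' C' p app D] cC(2) by simp
    obtain n0 where n0: "\<And>m. m \<ge> n0 \<Longrightarrow> \<bar>(\<integral>w. p (X m w) \<partial>M m) - (\<integral>w. p (X' w) \<partial>M')\<bar> < e"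
      using LIMSEQ_D[OF conv[OF p] e] by auto
    show "\<exists>n0. \<forall>m\<ge>n0. norm ((\<integral>w. \<phi> (X m w) \<partial>M m) - (\<integral>w. \<phi> (X' w) \<partial>M')) < ee"
    proof (intro exI allI impI)
      fix m assume "m \<ge> n0"
      then show "norm ((\<integral>w. \<phi> (X m w) \<partial>M m) - (\<integral>w. \<phi> (X' w) \<partial>M')) < ee"
        using n0[of m] a[of m] a' e unfolding e_def real_norm_def by linarith
    qed
  qed
qed

section \<open>Gaussian vectors and truncation\<close>

definition gauss_joint :: "nat \<Rightarrow> (nat \<Rightarrow> nat) \<Rightarrow> (nat \<Rightarrow> nat \<Rightarrow> real) measure" where
  "gauss_joint H d = PiM {..H} (\<lambda>h. std_normal_vec (d h))"

lemma prob_space_std_normal: "prob_space std_normal_distribution"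
  using real_dist_normal_dist by (simp add: real_distribution_def)

lemma product_prob_space_std_normal: "product_prob_space (\<lambda>_::'i. std_normal_distribution)"
  by (intro product_prob_spaceI prob_space_std_normal)

lemma prob_space_std_normal_vec: "prob_space (std_normal_vec d)"
  unfolding std_normal_vec_def by (intro prob_space_PiM prob_space_std_normal)

lemma product_prob_space_std_normal_vec: "product_prob_space (\<lambda>h::'i. std_normal_vec (d h))"
  by (intro product_prob_spaceI prob_space_std_normal_vec)

lemma prob_space_gauss_joint: "prob_space (gauss_joint H d)"
  unfolding gauss_joint_def by (intro prob_space_PiM prob_space_std_normal_vec)

lemma measurable_std_normal_vec_coord: "j < d \<Longrightarrow> (\<lambda>v. v j) \<in> borel_measurable (std_normal_vec d)"
  unfolding std_normal_vec_def
  using measurable_component_singleton[of j "{..<d}" "\<lambda>_. std_normal_distribution"] by simp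

lemma measurable_gauss_joint_coord:
  assumes "h \<le> H" "j < d h"
  shows "(\<lambda>\<omega>. \<omega> h j) \<in> borel_measurable (gauss_joint H d)"
proof -
  have "(\<lambda>\<omega>. \<omega> h) \<in> measurable (gauss_joint H d) (std_normal_vec (d h))"
    unfolding gauss_joint_def using assms by (intro measurable_component_singleton) auto
  from measurable_compose[OF this measurable_std_normal_vec_coord[OF assms(2)]] show ?thesis .
qed

lemma char_std_normal_vec:
  "(CLINT v|std_normal_vec d. iexp (\<Sum>j<d. w j * v j)) = of_real (exp (- (\<Sum>j<d. (w j)\<^sup>2) / 2))"
proof -
  interpret product_prob_space "\<lambda>_::nat. std_normal_distribution"
    by (rule product_prob_space_std_normal)
  have "(CLINT v|std_normal_vec d. iexp (\<Sum>j<d. w j * v j)) = (CLINT v|PiM {..<d} (\<lambda>_. std_normal_distribution). (\<Prod>j<d. iexp (w j * v j)))"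
    unfolding std_normal_vec_def by (intro Bochner_Integration.integral_cong refl) (simp add: sum_distrib_left exp_sum)
  also have "\<dots> = (\<Prod>j<d. CLINT x|std_normal_distribution. iexp (w j * x))"
    by (rule product_integral_prod) (auto intro!: prob_space.integrable_iexp[OF prob_space_std_normal])
  also have "\<dots> = (\<Prod>j<d. of_real (exp (- (w j)\<^sup>2 / 2)))"
    unfolding char_def[symmetric] char_std_normal_distribution ..
  also have "\<dots> = of_real (\<Prod>j<d. exp (- (w j)\<^sup>2 / 2))" by simp
  also have "(\<Prod>j<d. exp (- (w j)\<^sup>2 / 2)) = exp (- (\<Sum>j<d. (w j)\<^sup>2) / 2)"
    by (simp add: exp_sum[symmetric] sum_negf sum_divide_distrib)
  finally show ?thesis .
qed

lemma char_gauss_joint: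
  "(CLINT \<omega>|gauss_joint H d. iexp (\<Sum>h\<le>H. \<Sum>j<d h. w h j * \<omega> h j)) = of_real (exp (- (\<Sum>h\<le>H. \<Sum>j<d h. (w h j)\<^sup>2) / 2))"
proof -
  interpret product_prob_space "\<lambda>h::nat. std_normal_vec (d h)"
    by (rule product_prob_space_std_normal_vec)
  have "(CLINT \<omega>|gauss_joint H d. iexp (\<Sum>h\<le>H. \<Sum>j<d h. w h j * \<omega> h j))
     = (CLINT \<omega>|PiM {..H} (\<lambda>h. std_normal_vec (d h)). (\<Prod>h\<le>H. iexp (\<Sum>j<d h. w h j * \<omega> h j)))"
    unfolding gauss_joint_def by (intro Bochner_Integration.integral_cong refl) (simp add: sum_distrib_left exp_sum)
  also have "\<dots> = (\<Prod>h\<le>H. CLINT v|std_normal_vec (d h). iexp (\<Sum>j<d h. w h j * v j))"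
  proof (rule product_integral_prod)
    fix h
    show "complex_integrable (std_normal_vec (d h)) (\<lambda>v. iexp (\<Sum>j<d h. w h j * v j))"
    proof -
      have m: "(\<lambda>v. \<Sum>j<d h. w h j * v j) \<in> borel_measurable (std_normal_vec (d h))"
        by (intro borel_measurable_sum borel_measurable_times borel_measurable_const measurable_std_normal_vec_coord) auto
      show ?thesis
        by (rule prob_space.integrable_iexp[OF prob_space_std_normal_vec])
          (rule measurable_compose[OF m borel_measurable_continuous_onI[OF continuous_on_of_real[OF continuous_on_id]]], simp)
    qed
  qed auto
  also have "\<dots> = of_real (\<Prod>h\<le>H. exp (- (\<Sum>j<d h. (w h j)\<^sup>2) / 2))" unfolding char_std_normal_vec by simp
  also have "(\<Prod>h\<le>H. exp (- (\<Sum>j<d h. (w h j)\<^sup>2) / 2)) = exp (- (\<Sum>h\<le>H. \<Sum>j<d h. (w h j)\<^sup>2) / 2)"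
    by (simp add: exp_sum[symmetric] sum_negf sum_divide_distrib)
  finally show ?thesis .
qed

lemma gauss_joint_square_integrable:
  assumes "h \<le> H" "j < d h"
  shows "integrable (gauss_joint H d) (\<lambda>\<omega>. (\<omega> h j)\<^sup>2)"
proof -
  have "integrable (std_normal_vec (d h)) (\<lambda>v. (v j)\<^sup>2)"
  proof -
    have "distr (PiM {..<d h} (\<lambda>_. std_normal_distribution)) std_normal_distribution (\<lambda>v. v j) = std_normal_distribution"
      by (rule distr_PiM_component) (use assms prob_space_std_normal in auto)
    then have "integrable (distr (std_normal_vec (d h)) std_normal_distribution (\<lambda>v. v j)) (\<lambda>x. x\<^sup>2)"
      using integrable_std_normal_distribution_moment[of 2] by (simp only: std_normal_vec_def)
    then show ?thesis
      by (rule integrable_distr[rotated]) (use assms in \<open>auto simp: std_normal_vec_def intro!: measurable_component_singleton\<close>)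
  qed
  moreover have "distr (gauss_joint H d) (std_normal_vec (d h)) (\<lambda>\<omega>. \<omega> h) = std_normal_vec (d h)"
    unfolding gauss_joint_def by (rule distr_PiM_component) (use assms prob_space_std_normal_vec in auto)
  ultimately have "integrable (distr (gauss_joint H d) (std_normal_vec (d h)) (\<lambda>\<omega>. \<omega> h)) (\<lambda>v. (v j)\<^sup>2)" by simp
  then show ?thesis
    by (rule integrable_distr[rotated]) (use assms in \<open>auto simp: gauss_joint_def intro!: measurable_component_singleton\<close>)
qed

lemma std_normal_finite_null: "finite A \<Longrightarrow> emeasure std_normal_distribution A = 0"
proof -
  assume "finite A"
  then have "A \<in> null_sets lborel" by (rule finite_imp_null_set_lborel)
  then have "A \<in> null_sets std_normal_distribution"
    by (intro absolutely_continuousI_density[THEN absolutely_continuous_def[THEN iffD1], THEN subsetD]) auto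
  then show ?thesis by auto
qed

lemma AE_std_normal_vec_sphere:
  assumes "a > 0"
  shows "AE v in std_normal_vec d. (\<Sum>j<d. (v j)\<^sup>2) \<noteq> a"
proof (cases d)
  case 0
  then show ?thesis using assms by simp
next
  case (Suc d')
  interpret product_prob_space "\<lambda>_::nat. std_normal_distribution"
    by (rule product_prob_space_std_normal)
  let ?P = "PiM (insert d' {..<d'}) (\<lambda>_. std_normal_distribution)"
  have I: "{..<d} = insert d' {..<d'}" using Suc by auto
  define A where "A = {v \<in> space ?P. (\<Sum>j<d. (v j)\<^sup>2) = a}"
  have coord: "(\<lambda>v. v j) \<in> borel_measurable ?P" if "j < d" for j
    using measurable_std_normal_vec_coord[OF that] unfolding std_normal_vec_def I .
  have A: "A \<in> sets ?P"
  proof -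
    have "(\<lambda>v. \<Sum>j<d. (v j)\<^sup>2) \<in> borel_measurable ?P"
      by (intro borel_measurable_sum borel_measurable_power coord) auto
    then have "(\<lambda>v. \<Sum>j<d. (v j)\<^sup>2) -` {a} \<inter> space ?P \<in> sets ?P" by (rule measurable_sets) auto
    then show ?thesis by (simp add: A_def vimage_def Int_def conj_commute)
  qed
  have "emeasure ?P A = (\<integral>\<^sup>+v. indicator A v \<partial>?P)" using A by simp
  also have "\<dots> = (\<integral>\<^sup>+v. (\<integral>\<^sup>+y. indicator A (v(d' := y)) \<partial>std_normal_distribution) \<partial>PiM {..<d'} (\<lambda>_. std_normal_distribution))"
    by (rule product_nn_integral_insert) (use A in auto)
  also have "\<dots> = (\<integral>\<^sup>+v. 0 \<partial>PiM {..<d'} (\<lambda>_. std_normal_distribution))"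
  proof (rule nn_integral_cong)
    fix v assume "v \<in> space (PiM {..<d'} (\<lambda>_::nat. std_normal_distribution))"
    define s where "s = (\<Sum>j<d'. (v j)\<^sup>2)"
    let ?F = "{sqrt (a - s), - sqrt (a - s)}"
    have "(indicator A (v(d' := y)) :: ennreal) \<le> indicator ?F y" for y
    proof (cases "v(d' := y) \<in> A")
      case True
      have "(\<Sum>j<d'. ((v(d' := y)) j)\<^sup>2) = s" unfolding s_def by (rule sum.cong) auto
      with True have "s + y\<^sup>2 = a" unfolding A_def Suc by simp
      then have "\<bar>y\<bar> = sqrt (a - s)" by (metis add_diff_cancel_left' real_sqrt_abs)
      then show ?thesis by (auto simp: indicator_def)
    qed simp
    then have "(\<integral>\<^sup>+y. indicator A (v(d' := y)) \<partial>std_normal_distribution) \<le> (\<integral>\<^sup>+y. indicator ?F y \<partial>std_normal_distribution)"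
      by (rule nn_integral_mono)
    also have "\<dots> = emeasure std_normal_distribution ?F" by (rule nn_integral_indicator) simp
    also have "\<dots> = 0" by (rule std_normal_finite_null) simp
    finally show "(\<integral>\<^sup>+y. indicator A (v(d' := y)) \<partial>std_normal_distribution) = 0" by simp
  qed
  finally have "emeasure ?P A = 0" by simp
  then have "A \<in> null_sets ?P" using A by (simp add: null_sets_def)
  then have "AE v in ?P. v \<notin> A" by (rule AE_not_in)
  then have "AE v in ?P. (\<Sum>j<d. (v j)\<^sup>2) \<noteq> a"
    by (rule AE_mp) (rule AE_I2, simp add: A_def)
  moreover have "std_normal_vec d = ?P" by (simp only: std_normal_vec_def I)
  ultimately show ?thesis by (simp only:)
qed

lemma AE_gauss_joint_sphere:
  assumes "h \<le> H" "a > 0"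
  shows "AE \<omega> in gauss_joint H d. (\<Sum>j<d h. (\<omega> h j)\<^sup>2) \<noteq> a"
  unfolding gauss_joint_def
  by (rule AE_PiM_component[where P = "\<lambda>v. (\<Sum>j<d h. (v j)\<^sup>2) \<noteq> a"])
    (use assms prob_space_std_normal_vec AE_std_normal_vec_sphere in auto)

definition normal_ball :: "nat \<Rightarrow> real \<Rightarrow> (nat \<Rightarrow> real) set" where
  "normal_ball d a = {v \<in> space (std_normal_vec d). (\<Sum>j<d. (v j)\<^sup>2) \<le> a}"

lemma normal_ball_sets: "normal_ball d a \<in> sets (std_normal_vec d)"
proof -
  have "(\<lambda>v. \<Sum>j<d. (v j)\<^sup>2) \<in> borel_measurable (std_normal_vec d)"
    by (intro borel_measurable_sum borel_measurable_power measurable_std_normal_vec_coord) auto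
  then have "(\<lambda>v. \<Sum>j<d. (v j)\<^sup>2) -` {..a} \<inter> space (std_normal_vec d) \<in> sets (std_normal_vec d)" by (rule measurable_sets) auto
  then show ?thesis by (simp add: normal_ball_def vimage_def Int_def conj_commute)
qed

lemma std_normal_interval_pos:
  assumes "c > 0"
  shows "emeasure std_normal_distribution {-c..c} > 0"
proof (rule ccontr)
  assume "\<not> ?thesis"
  then have "emeasure std_normal_distribution {-c..c} = 0" by simp
  then have "(\<integral>\<^sup>+x. ennreal (std_normal_density x) * indicator {-c..c} x \<partial>lborel) = 0"
    by (subst (asm) emeasure_density) auto
  then have "AE x in lborel. ennreal (std_normal_density x) * indicator {-c..c} x = 0"
    by (subst (asm) nn_integral_0_iff_AE) auto
  moreover have "ennreal (std_normal_density x) \<noteq> 0" for x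
    using normal_density_pos[of 1 0 x] by (simp add: ennreal_eq_0_iff not_le)
  ultimately have "AE x in lborel. x \<notin> {-c..c}" by (auto simp: indicator_def)
  then have "emeasure lborel {-c..c} = 0"
    by (subst (asm) AE_iff_measurable[of "{-c..c}"]) auto
  then show False using assms by simp
qed

lemma normal_ball_pos:
  assumes "a > 0"
  shows "measure (std_normal_vec d) (normal_ball d a) > 0"
proof -
  interpret product_prob_space "\<lambda>_::nat. std_normal_distribution"
    by (rule product_prob_space_std_normal)
  interpret V: prob_space "std_normal_vec d" by (rule prob_space_std_normal_vec)
  define c where "c = sqrt (a / (real d + 1))"
  have c: "c > 0" using assms by (simp add: c_def)
  have "PiE {..<d} (\<lambda>_. {-c..c}) \<subseteq> normal_ball d a"
  proof
    fix v assume v: "v \<in> PiE {..<d} (\<lambda>_. {-c..c})"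
    have "(\<Sum>j<d. (v j)\<^sup>2) \<le> (\<Sum>j<d. c\<^sup>2)"
    proof (rule sum_mono)
      fix j assume "j \<in> {..<d}"
      then have "\<bar>v j\<bar> \<le> \<bar>c\<bar>" using v by (force simp: PiE_def Pi_def abs_le_iff)
      then show "(v j)\<^sup>2 \<le> c\<^sup>2" by (simp add: abs_le_square_iff)
    qed
    also have "\<dots> = real d * (a / (real d + 1))" using assms by (simp add: c_def)
    also have "\<dots> \<le> a" using assms by (simp add: field_simps)
    finally show "v \<in> normal_ball d a"
      using v by (auto simp: normal_ball_def std_normal_vec_def space_PiM PiE_def)
  qed
  then have "emeasure (std_normal_vec d) (PiE {..<d} (\<lambda>_. {-c..c})) \<le> emeasure (std_normal_vec d) (normal_ball d a)"
    by (intro emeasure_mono normal_ball_sets)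
  moreover have "emeasure (std_normal_vec d) (PiE {..<d} (\<lambda>_. {-c..c})) = (\<Prod>j<d. emeasure std_normal_distribution {-c..c})"
    unfolding std_normal_vec_def by (rule emeasure_PiM) auto
  moreover have "(\<Prod>j<d. emeasure std_normal_distribution {-c..c}) \<noteq> 0"
  proof -
    have "x ^ d \<noteq> 0" if "x > 0" for x :: ennreal using that by simp
    from this[OF std_normal_interval_pos[OF c]] show ?thesis by (simp only: prod_constant card_lessThan not_False_eq_True)
  qed
  ultimately have "emeasure (std_normal_vec d) (normal_ball d a) \<noteq> 0" by (simp only: le_zero_eq) fastforce
  then have "emeasure (std_normal_vec d) (normal_ball d a) > 0" by (simp add: zero_less_iff_neq_zero)
  then show ?thesis by (simp add: V.emeasure_eq_measure)
qed

definition gauss_acc :: "nat \<Rightarrow> (nat \<Rightarrow> nat) \<Rightarrow> (nat \<Rightarrow> real) \<Rightarrow> (nat \<Rightarrow> nat \<Rightarrow> real) set" where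
  "gauss_acc H d a = PiE {..H} (\<lambda>h. if h = 0 then space (std_normal_vec (d h)) else normal_ball (d h) (a h))"

lemma gauss_acc_sets: "gauss_acc H d a \<in> sets (gauss_joint H d)"
  unfolding gauss_acc_def gauss_joint_def by (intro sets_PiM_I_finite) (auto intro: normal_ball_sets)

lemma gauss_acc_iff:
  assumes "\<omega> \<in> space (gauss_joint H d)"
  shows "\<omega> \<in> gauss_acc H d a \<longleftrightarrow> (\<forall>h\<in>{1..H}. (\<Sum>j<d h. (\<omega> h j)\<^sup>2) \<le> a h)"
proof -
  have "\<omega> \<in> extensional {..H}" "\<And>h. h \<le> H \<Longrightarrow> \<omega> h \<in> space (std_normal_vec (d h))"
    using assms by (auto simp: gauss_joint_def space_PiM PiE_iff)
  then show ?thesis by (auto simp: gauss_acc_def PiE_iff normal_ball_def)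
qed

lemma gauss_joint_PiE:
  assumes "\<And>h. h \<le> H \<Longrightarrow> B h \<in> sets (std_normal_vec (d h))"
  shows "measure (gauss_joint H d) (PiE {..H} B) = (\<Prod>h\<le>H. measure (std_normal_vec (d h)) (B h))"
proof -
  interpret product_prob_space "\<lambda>h::nat. std_normal_vec (d h)"
    by (rule product_prob_space_std_normal_vec)
  have "emeasure (gauss_joint H d) (PiE {..H} B) = (\<Prod>h\<le>H. emeasure (std_normal_vec (d h)) (B h))"
    unfolding gauss_joint_def by (rule emeasure_PiM) (use assms in auto)
  also have "\<dots> = (\<Prod>h\<le>H. ennreal (measure (std_normal_vec (d h)) (B h)))"
    by (simp add: finite_measure.emeasure_eq_measure[OF prob_space.finite_measure[OF prob_space_std_normal_vec]])
  also have "\<dots> = ennreal (\<Prod>h\<le>H. measure (std_normal_vec (d h)) (B h))"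
    by (rule prod_ennreal) simp
  finally show ?thesis by (rule measure_eq_emeasure_eq_ennreal[rotated]) (simp add: prod_nonneg)
qed

lemma gauss_acc_measure:
  "measure (gauss_joint H d) (gauss_acc H d a) =
    (\<Prod>h\<le>H. measure (std_normal_vec (d h)) (if h = 0 then space (std_normal_vec (d h)) else normal_ball (d h) (a h)))"
  unfolding gauss_acc_def by (rule gauss_joint_PiE) (auto intro: normal_ball_sets)

lemma gauss_acc_pos:
  assumes "\<forall>h\<in>{1..H}. a h > 0"
  shows "measure (gauss_joint H d) (gauss_acc H d a) > 0"
  unfolding gauss_acc_measure
proof (rule prod_pos)
  fix h assume "h \<in> {..H}"
  then show "0 < measure (std_normal_vec (d h)) (if h = 0 then space (std_normal_vec (d h)) else normal_ball (d h) (a h))"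
    using assms normal_ball_pos[of "a h" "d h"] prob_space.prob_space[OF prob_space_std_normal_vec] by auto
qed

lemma limit_joint_eq:
  assumes a: "\<forall>h\<in>{1..H}. a h > 0" and d0: "d 0 = F" and d: "\<forall>h\<in>{1..H}. d h = L * card (T h)"
  shows "limit_joint F L T H a = uniform_measure (gauss_joint H d) (gauss_acc H d a)"
proof -
  define M where "M h = (if h \<in> {1..H} then uniform_measure (std_normal_vec (d h)) (normal_ball (d h) (a h)) else std_normal_vec (d h))" for h
  have eq: "limit_joint F L T H a = PiM {..H} M"
    unfolding limit_joint_def
    by (rule PiM_cong) (use d0 d in \<open>auto simp: M_def trunc_normal_vec_def normal_ball_def Suc_le_eq\<close>)
  have M: "prob_space (M h)" for h
  proof (cases "h \<in> {1..H}")
    case True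
    then have pos: "measure (std_normal_vec (d h)) (normal_ball (d h) (a h)) > 0" using a by (intro normal_ball_pos) auto
    interpret V: prob_space "std_normal_vec (d h)" by (rule prob_space_std_normal_vec)
    have "emeasure (std_normal_vec (d h)) (normal_ball (d h) (a h)) \<noteq> 0"
      using pos by (simp add: V.emeasure_eq_measure)
    then have "prob_space (uniform_measure (std_normal_vec (d h)) (normal_ball (d h) (a h)))"
      by (rule prob_space_uniform_measure) (simp add: V.emeasure_eq_measure)
    then show ?thesis using True by (simp add: M_def)
  qed (auto simp: M_def prob_space_std_normal_vec)
  interpret P: product_prob_space M by (intro product_prob_spaceI M)
  interpret G: prob_space "gauss_joint H d" by (rule prob_space_gauss_joint)
  let ?B = "\<lambda>h. if h = 0 then space (std_normal_vec (d h)) else normal_ball (d h) (a h)"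
  have setsM: "sets (M h) = sets (std_normal_vec (d h))" for h by (simp add: M_def)
  have "uniform_measure (gauss_joint H d) (gauss_acc H d a) = PiM {..H} M"
  proof (rule P.PiM_eqI)
    show "sets (uniform_measure (gauss_joint H d) (gauss_acc H d a)) = sets (PiM {..H} M)"
      by (simp add: gauss_joint_def) (rule sets_PiM_cong, auto simp: setsM)
    fix A assume "\<And>h. h \<in> {..H} \<Longrightarrow> A h \<in> sets (M h)"
    then have A: "\<And>h. h \<in> {..H} \<Longrightarrow> A h \<in> sets (std_normal_vec (d h))" by (simp add: setsM)
    have B: "?B h \<in> sets (std_normal_vec (d h))" for h by (auto intro: normal_ball_sets)
    have PA: "PiE {..H} A \<in> sets (gauss_joint H d)"
      unfolding gauss_joint_def using A by (intro sets_PiM_I_finite) auto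
    have int: "gauss_acc H d a \<inter> PiE {..H} A = PiE {..H} (\<lambda>h. ?B h \<inter> A h)"
      unfolding gauss_acc_def by (rule PiE_Int)
    have "measure (gauss_joint H d) (gauss_acc H d a \<inter> PiE {..H} A) = (\<Prod>h\<le>H. measure (std_normal_vec (d h)) (?B h \<inter> A h))"
      unfolding int by (rule gauss_joint_PiE) (use A B in auto)
    then have "measure (gauss_joint H d) (gauss_acc H d a \<inter> PiE {..H} A) / measure (gauss_joint H d) (gauss_acc H d a)
      = (\<Prod>h\<le>H. measure (std_normal_vec (d h)) (?B h \<inter> A h) / measure (std_normal_vec (d h)) (?B h))"
      unfolding gauss_acc_measure by (simp add: prod_dividef)
    also have "\<dots> = (\<Prod>h\<le>H. measure (M h) (A h))"
    proof (rule prod.cong[OF refl])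
      fix h assume h: "h \<in> {..H}"
      interpret V: prob_space "std_normal_vec (d h)" by (rule prob_space_std_normal_vec)
      show "measure (std_normal_vec (d h)) (?B h \<inter> A h) / measure (std_normal_vec (d h)) (?B h) = measure (M h) (A h)"
      proof (cases "h = 0")
        case True
        have "space (std_normal_vec (d h)) \<inter> A h = A h" using sets.sets_into_space[OF A[OF h]] by auto
        then show ?thesis using True V.prob_space by (simp add: M_def)
      next
        case False
        then have h1: "h \<in> {1..H}" using h by auto
        have pos: "measure (std_normal_vec (d h)) (normal_ball (d h) (a h)) > 0" using a h1 by (intro normal_ball_pos) auto
        then have "emeasure (std_normal_vec (d h)) (normal_ball (d h) (a h)) \<noteq> 0" by (simp add: V.emeasure_eq_measure)
        then have "measure (uniform_measure (std_normal_vec (d h)) (normal_ball (d h) (a h))) (A h)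
           = measure (std_normal_vec (d h)) (normal_ball (d h) (a h) \<inter> A h) / measure (std_normal_vec (d h)) (normal_ball (d h) (a h))"
          using A[OF h] by (intro measure_uniform_measure) (auto simp: V.emeasure_eq_measure)
        then show ?thesis using False h1 by (simp add: M_def)
      qed
    qed
    finally have "measure (gauss_joint H d) (gauss_acc H d a \<inter> PiE {..H} A) / measure (gauss_joint H d) (gauss_acc H d a)
       = (\<Prod>h\<le>H. measure (M h) (A h))" .
    moreover have "emeasure (uniform_measure (gauss_joint H d) (gauss_acc H d a)) (PiE {..H} A)
      = ennreal (measure (gauss_joint H d) (gauss_acc H d a \<inter> PiE {..H} A) / measure (gauss_joint H d) (gauss_acc H d a))"
      using gauss_acc_sets PA gauss_acc_pos[OF a, of d]
      by (simp add: G.emeasure_eq_measure divide_ennreal)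
    moreover have "(\<Prod>h\<le>H. emeasure (M h) (A h)) = ennreal (\<Prod>h\<le>H. measure (M h) (A h))"
      using prob_space.finite_measure[OF M] by (simp add: finite_measure.emeasure_eq_measure prod_ennreal)
    ultimately show "emeasure (uniform_measure (gauss_joint H d) (gauss_acc H d a)) (PiE {..H} A) = (\<Prod>h\<in>{..H}. emeasure (M h) (A h))"
      by simp
  qed simp
  then show ?thesis using eq by simp
qed

lemma integral_uniform_measure_prob:
  fixes f :: "'a \<Rightarrow> real"
  assumes "prob_space M" "A \<in> sets M" "measure M A > 0" "f \<in> borel_measurable M"
  shows "(\<integral>x. f x \<partial>uniform_measure M A) = (\<integral>x. f x * indicator A x \<partial>M) / measure M A"
proof -
  interpret prob_space M by fact
  have "uniform_measure M A = density M (\<lambda>x. ennreal (indicator A x / measure M A))"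
    unfolding uniform_measure_def
  proof (intro density_cong AE_I2)
    fix x
    show "indicator A x / emeasure M A = ennreal (indicator A x / measure M A)"
      using assms(3) by (auto simp: emeasure_eq_measure divide_ennreal indicator_def simp flip: ennreal_1)
  qed (use assms in auto)
  then have "(\<integral>x. f x \<partial>uniform_measure M A) = (\<integral>x. (indicator A x / measure M A) * f x \<partial>M)"
    using assms by (simp add: integral_density)
  also have "\<dots> = (\<integral>x. (f x * indicator A x) / measure M A \<partial>M)"
    by (intro Bochner_Integration.integral_cong refl) simp
  finally show ?thesis by simp
qed

section \<open>Joint and conditional limits of linear statistics\<close>

definition block_index :: "nat \<Rightarrow> (nat \<Rightarrow> nat) \<Rightarrow> (nat \<times> nat) set" where
  "block_index H d = Sigma {..H} (\<lambda>h. {..<d h})"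

lemma finite_block_index: "finite (block_index H d)"
  by (simp add: block_index_def)

lemma block_index_iff: "(h, j) \<in> block_index H d \<longleftrightarrow> h \<le> H \<and> j < d h"
  by (simp add: block_index_def)

lemma sum_block_index: "(\<Sum>p\<in>block_index H d. f (fst p) (snd p)) = (\<Sum>h\<le>H. \<Sum>j<d h. f h j)"
  unfolding block_index_def by (subst sum.Sigma) (auto simp: case_prod_unfold)

lemma linear_stat_sum: "linear_stat n (\<lambda>i q. \<Sum>k\<in>I. t k * a k i q) Z = (\<Sum>k\<in>I. t k * linear_stat n (a k) Z)"
  unfolding linear_stat_def sum_distrib_left by (rule sum.swap)

lemma cov_form_sum_left:
  "cov_form n Q nq (\<lambda>i q. \<Sum>k\<in>I. t k * a k i q) b = (\<Sum>k\<in>I. t k * cov_form n Q nq (a k) b)"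
proof -
  let ?p = "\<lambda>q. real (nq q) / real n"
  have 1: "(\<Sum>q<Q. ?p q * (\<Sum>k\<in>I. t k * a k i q) * b i q) = (\<Sum>k\<in>I. t k * (\<Sum>q<Q. ?p q * a k i q * b i q))" for i
  proof -
    have "(\<Sum>q<Q. ?p q * (\<Sum>k\<in>I. t k * a k i q) * b i q) = (\<Sum>q<Q. \<Sum>k\<in>I. t k * (?p q * a k i q * b i q))"
      by (intro sum.cong refl) (simp add: sum_distrib_left sum_distrib_right mult_ac)
    also have "\<dots> = (\<Sum>k\<in>I. \<Sum>q<Q. t k * (?p q * a k i q * b i q))" by (rule sum.swap)
    finally show ?thesis by (simp only: sum_distrib_left)
  qed
  have 2: "(\<Sum>q<Q. ?p q * (\<Sum>k\<in>I. t k * a k i q)) = (\<Sum>k\<in>I. t k * (\<Sum>q<Q. ?p q * a k i q))" for i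
  proof -
    have "(\<Sum>q<Q. ?p q * (\<Sum>k\<in>I. t k * a k i q)) = (\<Sum>q<Q. \<Sum>k\<in>I. t k * (?p q * a k i q))"
      by (intro sum.cong refl) (simp add: sum_distrib_left mult_ac)
    also have "\<dots> = (\<Sum>k\<in>I. \<Sum>q<Q. t k * (?p q * a k i q))" by (rule sum.swap)
    finally show ?thesis by (simp only: sum_distrib_left)
  qed
  have "cov_form n Q nq (\<lambda>i q. \<Sum>k\<in>I. t k * a k i q) b = (\<Sum>i<n. \<Sum>k\<in>I. t k * ((\<Sum>q<Q. ?p q * a k i q * b i q)
      - (\<Sum>q<Q. ?p q * a k i q) * (\<Sum>q<Q. ?p q * b i q)))"
    unfolding cov_form_def 1 2
    by (intro sum.cong refl) (simp add: right_diff_distrib sum_subtractf sum_distrib_right mult.assoc)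
  also have "\<dots> = (\<Sum>k\<in>I. \<Sum>i<n. t k * ((\<Sum>q<Q. ?p q * a k i q * b i q)
      - (\<Sum>q<Q. ?p q * a k i q) * (\<Sum>q<Q. ?p q * b i q)))" by (rule sum.swap)
  finally show ?thesis by (simp only: cov_form_def sum_distrib_left)
qed

lemma cov_form_commute: "cov_form n Q nq a b = cov_form n Q nq b a"
  unfolding cov_form_def by (intro sum.cong refl) (simp add: mult_ac)

lemma cov_form_sum:
  "cov_form n Q nq (\<lambda>i q. \<Sum>k\<in>I. t k * a k i q) (\<lambda>i q. \<Sum>l\<in>J. s l * b l i q)
    = (\<Sum>k\<in>I. \<Sum>l\<in>J. t k * s l * cov_form n Q nq (a k) (b l))"
  unfolding cov_form_sum_left cov_form_commute[of n Q nq "a _"] cov_form_sum_left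
  by (simp add: sum_distrib_left mult.assoc cov_form_commute)

lemma sum_sq_le_card: "(\<Sum>k\<in>I. f k)\<^sup>2 \<le> real (card I) * (\<Sum>k\<in>I. (f k :: real)\<^sup>2)"
  using sum_squared_le_sum_of_squares[of f I] by (simp add: mult.commute)

text \<open>The coordinates \<open>(0, f)\<close> hold the estimated effects and \<open>(h, j)\<close> with \<open>h \<ge> 1\<close> the standardised
  imbalances of tier \<open>h\<close>.\<close>

locale array_limit =
  fixes Q :: nat and N :: "nat \<Rightarrow> nat" and nq :: "nat \<Rightarrow> nat \<Rightarrow> nat"
    and H :: nat and d :: "nat \<Rightarrow> nat"
    and av :: "nat \<Rightarrow> nat \<times> nat \<Rightarrow> nat \<Rightarrow> nat \<Rightarrow> real" and Lc :: "nat \<times> nat \<Rightarrow> nat \<times> nat \<Rightarrow> real"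
    and M :: "nat \<Rightarrow> real" and A :: real
  assumes cen: "\<And>m k q. k \<in> block_index H d \<Longrightarrow> q < Q \<Longrightarrow> (\<Sum>i<N m. av m k i q) = 0"
    and nq: "\<And>m. (\<Sum>q<Q. nq m q) = N m"
    and N: "filterlim N at_top sequentially"
    and Mx: "\<And>m k i q. k \<in> block_index H d \<Longrightarrow> i < N m \<Longrightarrow> q < Q \<Longrightarrow> \<bar>av m k i q\<bar> \<le> M m"
    and M0: "M \<longlonglongrightarrow> 0"
    and A: "\<And>m k. k \<in> block_index H d \<Longrightarrow> (\<Sum>i<N m. \<Sum>q<Q. (av m k i q)\<^sup>2) \<le> A"
    and cov: "\<And>k l. k \<in> block_index H d \<Longrightarrow> l \<in> block_index H d \<Longrightarrow>
      (\<lambda>m. cov_form (N m) Q (nq m) (av m k) (av m l)) \<longlonglongrightarrow> (\<Sum>p\<in>block_index H d. Lc k p * Lc l p)"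
begin

abbreviation "I \<equiv> block_index H d"
abbreviation "W m \<equiv> assignments Q (N m) (nq m)"
abbreviation "G \<equiv> gauss_joint H d"

definition V :: "nat \<Rightarrow> (nat \<Rightarrow> nat) \<Rightarrow> nat \<times> nat \<Rightarrow> real" where
  "V m Z k = (if k \<in> I then linear_stat (N m) (av m k) Z else 0)"

definition VL :: "(nat \<Rightarrow> nat \<Rightarrow> real) \<Rightarrow> nat \<times> nat \<Rightarrow> real" where
  "VL \<omega> k = (if k \<in> I then (\<Sum>p\<in>I. Lc k p * \<omega> (fst p) (snd p)) else 0)"

lemma W_ne: "W m \<noteq> {}"
  using assignments_nonempty[where nq = "nq m" and Q = Q] nq by simp

lemma card_W: "real (card (W m)) > 0"
  using W_ne by (simp add: card_gt_0_iff finite_assignments)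

lemma VL_measurable: "(\<lambda>\<omega>. VL \<omega> k) \<in> borel_measurable G"
proof (cases "k \<in> I")
  case True
  then show ?thesis unfolding VL_def
    by (auto intro!: borel_measurable_sum borel_measurable_times borel_measurable_const
        measurable_gauss_joint_coord simp: block_index_def)
qed (simp add: VL_def)

lemma VL_measurable': "VL \<in> borel_measurable G"
  by (rule measurable_coordinatewise_then_product) (rule VL_measurable)

lemma VL_square_integrable: "k \<in> I \<Longrightarrow> integrable G (\<lambda>\<omega>. (VL \<omega> k)\<^sup>2)"
proof (rule Bochner_Integration.integrable_bound)
  show "integrable G (\<lambda>\<omega>. real (card I) * (\<Sum>p\<in>I. (Lc k p)\<^sup>2 * (\<omega> (fst p) (snd p))\<^sup>2))"
    by (intro integrable_mult_right Bochner_Integration.integrable_sum gauss_joint_square_integrable)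
      (auto simp: block_index_def)
  assume k: "k \<in> I"
  show "AE \<omega> in G. norm ((VL \<omega> k)\<^sup>2) \<le> norm (real (card I) * (\<Sum>p\<in>I. (Lc k p)\<^sup>2 * (\<omega> (fst p) (snd p))\<^sup>2))"
  proof (rule AE_I2)
    fix \<omega>
    have "(VL \<omega> k)\<^sup>2 \<le> real (card I) * (\<Sum>p\<in>I. (Lc k p * \<omega> (fst p) (snd p))\<^sup>2)"
      using k by (simp add: VL_def sum_sq_le_card)
    then show "norm ((VL \<omega> k)\<^sup>2) \<le> norm (real (card I) * (\<Sum>p\<in>I. (Lc k p)\<^sup>2 * (\<omega> (fst p) (snd p))\<^sup>2))"
      by (simp add: power_mult_distrib abs_mult sum_nonneg)
  qed
qed (use VL_measurable in measurable)

lemma char_V: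
  "(\<lambda>m. (\<Sum>Z\<in>W m. iexp (\<Sum>k\<in>I. t k * V m Z k)) / of_nat (card (W m)))
     \<longlonglongrightarrow> of_real (exp (- (\<Sum>p\<in>I. (\<Sum>k\<in>I. t k * Lc k p)\<^sup>2) / 2))"
proof -
  define b where "b m i q = (\<Sum>k\<in>I. t k * av m k i q)" for m i q
  have eq: "(\<Sum>k\<in>I. t k * V m Z k) = linear_stat (N m) (b m) Z" for m Z
    unfolding b_def[abs_def] linear_stat_sum by (rule sum.cong) (auto simp: V_def)
  have "(\<lambda>m. (\<Sum>Z\<in>W m. iexp (linear_stat (N m) (b m) Z)) / of_nat (card (W m)))
     \<longlonglongrightarrow> of_real (exp (- (\<Sum>p\<in>I. (\<Sum>k\<in>I. t k * Lc k p)\<^sup>2) / 2))"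
  proof (rule combinatorial_clt[where M = "\<lambda>m. (\<Sum>k\<in>I. \<bar>t k\<bar>) * M m" and A = "real (card I) * (\<Sum>k\<in>I. (t k)\<^sup>2 * A)"])
    fix m q assume "q < Q"
    have "(\<Sum>i<N m. b m i q) = (\<Sum>k\<in>I. t k * (\<Sum>i<N m. av m k i q))"
      unfolding b_def sum_distrib_left by (rule sum.swap)
    then show "(\<Sum>i<N m. b m i q) = 0" using cen \<open>q < Q\<close> by simp
  next
    fix m i q assume iq: "i < N m" "q < Q"
    have "\<bar>b m i q\<bar> \<le> (\<Sum>k\<in>I. \<bar>t k\<bar> * \<bar>av m k i q\<bar>)"
      unfolding b_def by (rule order_trans[OF sum_abs]) (simp add: abs_mult)
    also have "\<dots> \<le> (\<Sum>k\<in>I. \<bar>t k\<bar> * M m)"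
      by (intro sum_mono mult_left_mono Mx) (use iq in auto)
    finally show "\<bar>b m i q\<bar> \<le> (\<Sum>k\<in>I. \<bar>t k\<bar>) * M m" by (simp add: sum_distrib_right)
  next
    show "(\<lambda>m. (\<Sum>k\<in>I. \<bar>t k\<bar>) * M m) \<longlonglongrightarrow> 0" using tendsto_mult_left[OF M0, of "\<Sum>k\<in>I. \<bar>t k\<bar>"] by simp
  next
    fix m
    have "(\<Sum>i<N m. \<Sum>q<Q. (b m i q)\<^sup>2) \<le> (\<Sum>i<N m. \<Sum>q<Q. real (card I) * (\<Sum>k\<in>I. (t k)\<^sup>2 * (av m k i q)\<^sup>2))"
    proof (intro sum_mono)
      fix i q
      show "(b m i q)\<^sup>2 \<le> real (card I) * (\<Sum>k\<in>I. (t k)\<^sup>2 * (av m k i q)\<^sup>2)"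
        using sum_sq_le_card[of "\<lambda>k. t k * av m k i q" I] by (simp add: b_def power_mult_distrib)
    qed
    also have "\<dots> = real (card I) * (\<Sum>i<N m. \<Sum>q<Q. \<Sum>k\<in>I. (t k)\<^sup>2 * (av m k i q)\<^sup>2)"
      by (simp only: sum_distrib_left)
    also have "(\<Sum>i<N m. \<Sum>q<Q. \<Sum>k\<in>I. (t k)\<^sup>2 * (av m k i q)\<^sup>2) = (\<Sum>i<N m. \<Sum>k\<in>I. \<Sum>q<Q. (t k)\<^sup>2 * (av m k i q)\<^sup>2)"
      by (intro sum.cong refl) (rule sum.swap)
    also have "\<dots> = (\<Sum>k\<in>I. \<Sum>i<N m. \<Sum>q<Q. (t k)\<^sup>2 * (av m k i q)\<^sup>2)" by (rule sum.swap)
    also have "\<dots> = (\<Sum>k\<in>I. (t k)\<^sup>2 * (\<Sum>i<N m. \<Sum>q<Q. (av m k i q)\<^sup>2))" by (simp only: sum_distrib_left)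
    also have "real (card I) * \<dots> \<le> real (card I) * (\<Sum>k\<in>I. (t k)\<^sup>2 * A)"
      using A by (intro mult_left_mono sum_mono) auto
    finally show "(\<Sum>i<N m. \<Sum>q<Q. (b m i q)\<^sup>2) \<le> real (card I) * (\<Sum>k\<in>I. (t k)\<^sup>2 * A)" .
  next
    have "(\<lambda>m. \<Sum>k\<in>I. \<Sum>l\<in>I. t k * t l * cov_form (N m) Q (nq m) (av m k) (av m l))
      \<longlonglongrightarrow> (\<Sum>k\<in>I. \<Sum>l\<in>I. t k * t l * (\<Sum>p\<in>I. Lc k p * Lc l p))"
      by (intro tendsto_sum tendsto_mult_left cov)
    also have "(\<lambda>m. \<Sum>k\<in>I. \<Sum>l\<in>I. t k * t l * cov_form (N m) Q (nq m) (av m k) (av m l))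
        = (\<lambda>m. cov_form (N m) Q (nq m) (b m) (b m))"
      unfolding b_def[abs_def] cov_form_sum ..
    also have "(\<Sum>k\<in>I. \<Sum>l\<in>I. t k * t l * (\<Sum>p\<in>I. Lc k p * Lc l p)) = (\<Sum>p\<in>I. (\<Sum>k\<in>I. t k * Lc k p)\<^sup>2)"
    proof -
      have "(\<Sum>p\<in>I. (\<Sum>k\<in>I. t k * Lc k p)\<^sup>2) = (\<Sum>p\<in>I. \<Sum>k\<in>I. \<Sum>l\<in>I. (t k * Lc k p) * (t l * Lc l p))"
        by (simp add: power2_eq_square sum_product)
      also have "\<dots> = (\<Sum>k\<in>I. \<Sum>p\<in>I. \<Sum>l\<in>I. (t k * Lc k p) * (t l * Lc l p))" by (rule sum.swap)
      also have "\<dots> = (\<Sum>k\<in>I. \<Sum>l\<in>I. \<Sum>p\<in>I. (t k * Lc k p) * (t l * Lc l p))"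
        by (rule sum.cong[OF refl], rule sum.swap)
      finally show ?thesis by (simp add: sum_distrib_left mult_ac)
    qed
    finally show "(\<lambda>m. cov_form (N m) Q (nq m) (b m) (b m)) \<longlonglongrightarrow> (\<Sum>p\<in>I. (\<Sum>k\<in>I. t k * Lc k p)\<^sup>2)" .
  qed (use nq N in auto)
  then show ?thesis unfolding eq .
qed

lemma char_VL:
  "(CLINT \<omega>|G. iexp (\<Sum>k\<in>I. t k * VL \<omega> k)) = of_real (exp (- (\<Sum>p\<in>I. (\<Sum>k\<in>I. t k * Lc k p)\<^sup>2) / 2))"
proof -
  define w where "w h j = (\<Sum>k\<in>I. t k * Lc k (h, j))" for h j
  have "(\<Sum>k\<in>I. t k * VL \<omega> k) = (\<Sum>h\<le>H. \<Sum>j<d h. w h j * \<omega> h j)" for \<omega>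
  proof -
    have "(\<Sum>k\<in>I. t k * VL \<omega> k) = (\<Sum>k\<in>I. \<Sum>p\<in>I. t k * Lc k p * \<omega> (fst p) (snd p))"
      by (rule sum.cong) (auto simp: VL_def sum_distrib_left mult.assoc)
    also have "\<dots> = (\<Sum>p\<in>I. \<Sum>k\<in>I. t k * Lc k p * \<omega> (fst p) (snd p))" by (rule sum.swap)
    also have "\<dots> = (\<Sum>p\<in>I. w (fst p) (snd p) * \<omega> (fst p) (snd p))"
      by (simp add: w_def sum_distrib_right)
    finally show ?thesis by (simp add: sum_block_index[where f = "\<lambda>h j. w h j * \<omega> h j"])
  qed
  moreover have "(\<Sum>h\<le>H. \<Sum>j<d h. (w h j)\<^sup>2) = (\<Sum>p\<in>I. (\<Sum>k\<in>I. t k * Lc k p)\<^sup>2)"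
    by (subst sum_block_index[symmetric]) (simp add: w_def)
  ultimately show ?thesis using char_gauss_joint[of H d w] by simp
qed

lemma cos_shift: "cos (s + b) = Re (iexp b * iexp s)"
  by (simp add: cis_conv_exp[symmetric] cis_mult add.commute)

lemma joint_clt:
  fixes \<phi> :: "(nat \<times> nat \<Rightarrow> real) \<Rightarrow> real"
  assumes cont: "continuous_on UNIV \<phi>" and B: "\<And>x. \<bar>\<phi> x\<bar> \<le> B"
  shows "(\<lambda>m. (\<Sum>Z\<in>W m. \<phi> (V m Z)) / real (card (W m))) \<longlonglongrightarrow> (\<integral>\<omega>. \<phi> (VL \<omega>) \<partial>G)"
proof -
  interpret G: prob_space G by (rule prob_space_gauss_joint)
  let ?P = "\<lambda>m. measure_pmf (pmf_of_set (W m))"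
  have avg: "(\<integral>Z. f Z \<partial>?P m) = (\<Sum>Z\<in>W m. f Z) / real (card (W m))" for f m
    by (rule integral_pmf_of_set[OF W_ne finite_assignments])
  have int: "integrable (?P m) f" for f :: "_ \<Rightarrow> real" and m
    by (rule integrable_measure_pmf_finite) (simp add: set_pmf_of_set[OF W_ne finite_assignments] finite_assignments)
  have "(\<lambda>m. \<integral>Z. \<phi> (V m Z) \<partial>?P m) \<longlonglongrightarrow> (\<integral>\<omega>. \<phi> (VL \<omega>) \<partial>G)"
  proof (rule multivariate_levy[where I = I and C = "4 * A" and B = B and X = V and X' = VL and M = ?P and M' = G])
    show "prob_space (?P m)" for m by (rule measure_pmf.prob_space_axioms)
    show "(\<integral>Z. (V m Z k)\<^sup>2 \<partial>?P m) \<le> 4 * A" if "k \<in> I" for m k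
    proof -
      have "(\<Sum>Z\<in>W m. (V m Z k)\<^sup>2) \<le> real (card (W m)) * (4 * (\<Sum>i<N m. \<Sum>q<Q. (av m k i q)\<^sup>2))"
        using linear_stat_second_moment_le[where Q = Q and n = "N m" and a = "av m k" and nq = "nq m"] cen that by (simp add: V_def)
      also have "\<dots> \<le> real (card (W m)) * (4 * A)" using A[OF that, of m] by (intro mult_left_mono) auto
      finally show ?thesis unfolding avg using card_W[of m] by (simp add: divide_le_eq mult.commute)
    qed
    show "(\<lambda>m. \<integral>Z. cos ((\<Sum>k\<in>I. t k * V m Z k) + b) \<partial>?P m) \<longlonglongrightarrow> (\<integral>\<omega>. cos ((\<Sum>k\<in>I. t k * VL \<omega> k) + b) \<partial>G)" for t b
    proof -
      have "(\<lambda>m. Re (iexp b * ((\<Sum>Z\<in>W m. iexp (\<Sum>k\<in>I. t k * V m Z k)) / of_nat (card (W m)))))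
         \<longlonglongrightarrow> Re (iexp b * (CLINT \<omega>|G. iexp (\<Sum>k\<in>I. t k * VL \<omega> k)))"
        unfolding char_VL by (intro tendsto_Re tendsto_mult_left char_V)
      also have "(\<lambda>m. Re (iexp b * ((\<Sum>Z\<in>W m. iexp (\<Sum>k\<in>I. t k * V m Z k)) / of_nat (card (W m)))))
         = (\<lambda>m. \<integral>Z. cos ((\<Sum>k\<in>I. t k * V m Z k) + b) \<partial>?P m)"
      proof
        fix m
        have "iexp b * ((\<Sum>Z\<in>W m. iexp (\<Sum>k\<in>I. t k * V m Z k)) / of_nat (card (W m)))
           = (\<Sum>Z\<in>W m. iexp b * iexp (\<Sum>k\<in>I. t k * V m Z k)) / of_real (real (card (W m)))"
          by (simp add: sum_distrib_left)
        then show "Re (iexp b * ((\<Sum>Z\<in>W m. iexp (\<Sum>k\<in>I. t k * V m Z k)) / of_nat (card (W m))))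
          = (\<integral>Z. cos ((\<Sum>k\<in>I. t k * V m Z k) + b) \<partial>?P m)"
          unfolding avg cos_shift by (simp only: Re_divide_of_real Re_sum)
      qed
      also have "Re (iexp b * (CLINT \<omega>|G. iexp (\<Sum>k\<in>I. t k * VL \<omega> k))) = (\<integral>\<omega>. cos ((\<Sum>k\<in>I. t k * VL \<omega> k) + b) \<partial>G)"
      proof -
        have m: "(\<lambda>\<omega>. \<Sum>k\<in>I. t k * VL \<omega> k) \<in> borel_measurable G"
          by (intro borel_measurable_sum borel_measurable_times borel_measurable_const VL_measurable)
        have i: "complex_integrable G (\<lambda>\<omega>. iexp (\<Sum>k\<in>I. t k * VL \<omega> k))"
          by (rule G.integrable_iexp)
            (rule measurable_compose[OF m borel_measurable_continuous_onI[OF continuous_on_of_real[OF continuous_on_id]]], simp)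
        have "iexp b * (CLINT \<omega>|G. iexp (\<Sum>k\<in>I. t k * VL \<omega> k)) = (CLINT \<omega>|G. iexp b * iexp (\<Sum>k\<in>I. t k * VL \<omega> k))"
          by simp
        then show ?thesis unfolding cos_shift
          using integral_Re[OF integrable_mult_right[OF i, of "iexp b"]] by simp
      qed
      finally show ?thesis .
    qed
    show "V m Z k = 0" if "k \<notin> I" for m Z k using that by (simp add: V_def)
    show "VL \<omega> k = 0" if "k \<notin> I" for \<omega> k using that by (simp add: VL_def)
  qed (auto simp: finite_block_index G.prob_space_axioms cont B int VL_square_integrable VL_measurable)
  then show ?thesis unfolding avg .
qed

end

definition ramp :: "real \<Rightarrow> real \<Rightarrow> real \<Rightarrow> real" where
  "ramp l u x = max 0 (min 1 ((u - x) / (u - l)))"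

lemma ramp_01: "0 \<le> ramp l u x" "ramp l u x \<le> 1"
  by (auto simp: ramp_def)

lemma ramp_1: "l < u \<Longrightarrow> x \<le> l \<Longrightarrow> ramp l u x = 1"
  by (simp add: ramp_def)

lemma ramp_0: "l < u \<Longrightarrow> u \<le> x \<Longrightarrow> ramp l u x = 0"
proof -
  assume "l < u" "u \<le> x"
  then have "(u - x) / (u - l) \<le> 0" by (simp add: divide_le_0_iff)
  then show ?thesis by (simp add: ramp_def)
qed

lemma continuous_ramp: "continuous_on UNIV f \<Longrightarrow> l < u \<Longrightarrow> continuous_on UNIV (\<lambda>x. ramp l u (f x))"
  unfolding ramp_def by (intro continuous_intros) auto

context array_limit
begin

definition block_square :: "nat \<Rightarrow> (nat \<times> nat \<Rightarrow> real) \<Rightarrow> real" where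
  "block_square h v = (\<Sum>j<d h. (v (h, j))\<^sup>2)"

definition soft_accept :: "(nat \<Rightarrow> real) \<Rightarrow> real \<Rightarrow> real \<Rightarrow> (nat \<times> nat \<Rightarrow> real) \<Rightarrow> real" where
  "soft_accept a l u v = (\<Prod>h\<in>{1..H}. ramp (a h * l) (a h * u) (block_square h v))"

lemma soft_accept_01: "0 \<le> soft_accept a l u v" "soft_accept a l u v \<le> 1"
  unfolding soft_accept_def by (auto intro!: prod_nonneg prod_le_1 ramp_01)

lemma soft_accept_1:
  assumes "\<forall>h\<in>{1..H}. a h > 0" "l < u" "\<forall>h\<in>{1..H}. block_square h v \<le> a h * l"
  shows "soft_accept a l u v = 1"
  unfolding soft_accept_def by (rule prod.neutral) (use assms in \<open>auto intro!: ramp_1\<close>)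

lemma soft_accept_0:
  assumes "\<forall>h\<in>{1..H}. a h > 0" "l < u" "h \<in> {1..H}" "block_square h v \<ge> a h * u"
  shows "soft_accept a l u v = 0"
  unfolding soft_accept_def
proof (rule prod_zero)
  have "ramp (a h * l) (a h * u) (block_square h v) = 0" using assms by (intro ramp_0) auto
  then show "\<exists>h\<in>{1..H}. ramp (a h * l) (a h * u) (block_square h v) = 0" using assms(3) by blast
qed simp

lemma continuous_soft_accept:
  assumes "\<forall>h\<in>{1..H}. a h > 0" "l < u"
  shows "continuous_on UNIV (soft_accept a l u)"
  unfolding soft_accept_def
  by (intro continuous_on_prod continuous_ramp)
    (use assms in \<open>auto simp: block_square_def intro!: continuous_on_sum continuous_on_power continuous_on_product_coordinates\<close>)

lemma conditional_clt:
  fixes \<phi> :: "(nat \<times> nat \<Rightarrow> real) \<Rightarrow> real"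
  assumes a: "\<forall>h\<in>{1..H}. a h > 0"
    and Lh: "\<And>h j p. h \<in> {1..H} \<Longrightarrow> j < d h \<Longrightarrow> p \<in> I \<Longrightarrow> Lc (h, j) p = (if p = (h, j) then 1 else 0)"
    and Ms: "\<And>m Z h. Z \<in> W m \<Longrightarrow> h \<in> {1..H} \<Longrightarrow> \<bar>Ms m Z h - block_square h (V m Z)\<bar> \<le> e m * block_square h (V m Z)"
    and e: "e \<longlonglongrightarrow> 0" and e0: "\<And>m. e m \<ge> 0"
    and cont: "continuous_on UNIV \<phi>" and B: "\<And>x. \<bar>\<phi> x\<bar> \<le> B"
  defines "acc m \<equiv> {Z \<in> W m. \<forall>h\<in>{1..H}. Ms m Z h \<le> a h}"
  shows "(\<lambda>m. (\<Sum>Z\<in>acc m. \<phi> (V m Z)) / real (card (acc m)))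
    \<longlonglongrightarrow> (\<integral>\<omega>. \<phi> (VL \<omega>) \<partial>uniform_measure G (gauss_acc H d a))"
    and "eventually (\<lambda>m. acc m \<noteq> {}) sequentially"
proof -
  interpret G: prob_space G by (rule prob_space_gauss_joint)
  let ?A = "gauss_acc H d a"
  have B0: "B \<ge> 0" using B[of undefined] by linarith
  have rrVL: "block_square h (VL \<omega>) = (\<Sum>j<d h. (\<omega> h j)\<^sup>2)" if "h \<in> {1..H}" for h \<omega>
    unfolding block_square_def
  proof (rule sum.cong[OF refl])
    fix j assume j: "j \<in> {..<d h}"
    have "(\<Sum>p\<in>I. Lc (h, j) p * \<omega> (fst p) (snd p)) = (\<Sum>p\<in>I. if p = (h, j) then \<omega> (fst p) (snd p) else 0)"
      by (rule sum.cong) (use Lh that j in auto)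
    also have "\<dots> = \<omega> h j" using that j by (simp add: finite_block_index block_index_iff)
    finally show "(VL \<omega> (h, j))\<^sup>2 = (\<omega> h j)\<^sup>2" using that j by (simp add: VL_def block_index_iff)
  qed
  define \<delta> where "\<delta> k = 1 / (real k + 3)" for k :: nat
  have \<delta>: "0 < \<delta> k" "\<delta> k \<le> 1 / 3" for k by (auto simp: \<delta>_def field_simps)
  have \<delta>0: "\<delta> \<longlonglongrightarrow> 0" unfolding \<delta>_def by real_asymp
  define Gp where "Gp k = soft_accept a (1 + \<delta> k) (1 + 2 * \<delta> k)" for k
  define Gm where "Gm k = soft_accept a (1 - 2 * \<delta> k) (1 - \<delta> k)" for k
  have Gcont: "continuous_on UNIV (Gp k)" "continuous_on UNIV (Gm k)" for k
    unfolding Gp_def Gm_def using \<delta>[of k] by (auto intro!: continuous_soft_accept a)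
  have G01: "0 \<le> Gp k v" "Gp k v \<le> 1" "0 \<le> Gm k v" "Gm k v \<le> 1" for k v
    by (auto simp: Gp_def Gm_def soft_accept_01)
  have meas: "(\<lambda>\<omega>. f (VL \<omega>)) \<in> borel_measurable G" if "continuous_on UNIV f" for f :: "_ \<Rightarrow> real"
    using VL_measurable' by (rule measurable_compose) (rule borel_measurable_continuous_onI[OF that])
  have integ: "integrable G (\<lambda>\<omega>. f (VL \<omega>))" if "continuous_on UNIV f" "\<And>v. \<bar>f v\<bar> \<le> c" for f :: "_ \<Rightarrow> real" and c
    by (rule G.integrable_const_bound[where B = c]) (use that meas in auto)
  have sandL: "Gm k (VL \<omega>) \<le> indicator ?A \<omega>" "indicator ?A \<omega> \<le> Gp k (VL \<omega>)" if \<omega>: "\<omega> \<in> space G" for k \<omega>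
  proof -
    show "Gm k (VL \<omega>) \<le> indicator ?A \<omega>"
    proof (cases "\<omega> \<in> ?A")
      case False
      then obtain h where h: "h \<in> {1..H}" "(\<Sum>j<d h. (\<omega> h j)\<^sup>2) > a h"
        using gauss_acc_iff[OF \<omega>, of a] by fastforce
      have "a h * (1 - \<delta> k) \<le> a h" using a h \<delta>[of k] by simp
      then have "Gm k (VL \<omega>) = 0" unfolding Gm_def
        using h \<delta>[of k] rrVL[OF h(1), of \<omega>] by (intro soft_accept_0[OF a, of _ _ h]) auto
      then show ?thesis by simp
    qed (use G01 in simp)
    show "indicator ?A \<omega> \<le> Gp k (VL \<omega>)"
    proof (cases "\<omega> \<in> ?A")
      case True
      have "Gp k (VL \<omega>) = 1"
        unfolding Gp_def
      proof (rule soft_accept_1[OF a])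
        show "\<forall>h\<in>{1..H}. block_square h (VL \<omega>) \<le> a h * (1 + \<delta> k)"
        proof
          fix h assume h: "h \<in> {1..H}"
          have "a h \<le> a h * (1 + \<delta> k)" using a h \<delta>[of k] by simp
          then show "block_square h (VL \<omega>) \<le> a h * (1 + \<delta> k)"
            using True gauss_acc_iff[OF \<omega>, of a] h rrVL[OF h, of \<omega>] by fastforce
        qed
      qed (use \<delta>[of k] in simp)
      then show ?thesis by simp
    qed (use G01 in simp)
  qed
  define \<rho> where "\<rho> k = (\<integral>\<omega>. Gp k (VL \<omega>) - Gm k (VL \<omega>) \<partial>G)" for k
  have \<rho>0: "\<rho> \<longlonglongrightarrow> 0"
  proof -
    have "(\<lambda>k. \<integral>\<omega>. Gp k (VL \<omega>) - Gm k (VL \<omega>) \<partial>G) \<longlonglongrightarrow> (\<integral>\<omega>. 0 \<partial>G)"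
    proof (rule integral_dominated_convergence[where w = "\<lambda>_. 1"])
      show "AE \<omega> in G. (\<lambda>k. Gp k (VL \<omega>) - Gm k (VL \<omega>)) \<longlonglongrightarrow> 0"
      proof -
        have "AE \<omega> in G. \<forall>h\<in>{1..H}. (\<Sum>j<d h. (\<omega> h j)\<^sup>2) \<noteq> a h"
          by (intro AE_finite_allI) (auto intro!: AE_gauss_joint_sphere simp: a)
        then show ?thesis
        proof eventually_elim
          case (elim \<omega>)
          show ?case
          proof (rule tendsto_eventually)
            show "eventually (\<lambda>k. Gp k (VL \<omega>) - Gm k (VL \<omega>) = 0) sequentially"
            proof (cases "\<forall>h\<in>{1..H}. block_square h (VL \<omega>) < a h")
              case True
              have "eventually (\<lambda>k. block_square h (VL \<omega>) < a h * (1 - 2 * \<delta> k)) sequentially" if h: "h \<in> {1..H}" for h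
              proof -
                have "(\<lambda>k. a h * (1 - 2 * \<delta> k)) \<longlonglongrightarrow> a h * (1 - 2 * 0)" by (intro tendsto_intros \<delta>0)
                then show ?thesis using True h by (intro order_tendstoD(1)) auto
              qed
              then have "eventually (\<lambda>k. \<forall>h\<in>{1..H}. block_square h (VL \<omega>) < a h * (1 - 2 * \<delta> k)) sequentially"
                by (simp add: eventually_ball_finite_distrib)
              then show ?thesis
              proof eventually_elim
                case (elim k)
                have "Gm k (VL \<omega>) = 1" unfolding Gm_def
                  using elim \<delta>[of k] by (intro soft_accept_1[OF a]) (auto intro: less_imp_le)
                moreover have "Gp k (VL \<omega>) = 1" unfolding Gp_def
                proof (intro soft_accept_1[OF a] ballI)
                  fix h assume h: "h \<in> {1..H}"
                  have "a h \<le> a h * (1 + \<delta> k)" using a h \<delta>[of k] by simp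
                  then show "block_square h (VL \<omega>) \<le> a h * (1 + \<delta> k)" using True h by fastforce
                qed (use \<delta>[of k] in simp)
                ultimately show ?case by simp
              qed
            next
              case False
              then obtain h where h: "h \<in> {1..H}" "block_square h (VL \<omega>) > a h"
                using elim rrVL by force
              have "(\<lambda>k. a h * (1 + 2 * \<delta> k)) \<longlonglongrightarrow> a h * (1 + 2 * 0)" by (intro tendsto_intros \<delta>0)
              then have "eventually (\<lambda>k. a h * (1 + 2 * \<delta> k) < block_square h (VL \<omega>)) sequentially"
                using h by (intro order_tendstoD(2)) auto
              then show ?thesis
              proof eventually_elim
                case (elim k)
                have "a h * (1 - \<delta> k) \<le> a h" using a h \<delta>[of k] by simp
                then have "Gm k (VL \<omega>) = 0" unfolding Gm_def
                  using h \<delta>[of k] by (intro soft_accept_0[OF a, of _ _ h]) auto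
                moreover have "Gp k (VL \<omega>) = 0" unfolding Gp_def
                  using h elim \<delta>[of k] by (intro soft_accept_0[OF a, of _ _ h]) auto
                ultimately show ?case by simp
              qed
            qed
          qed
        qed
      qed
      show "AE \<omega> in G. norm (Gp k (VL \<omega>) - Gm k (VL \<omega>)) \<le> 1" for k
      proof (rule AE_I2)
        fix \<omega>
        show "norm (Gp k (VL \<omega>) - Gm k (VL \<omega>)) \<le> 1"
          using G01[of k "VL \<omega>"] unfolding real_norm_def by linarith
      qed
    qed (auto intro!: meas continuous_on_diff Gcont)
    then show ?thesis by (simp add: \<rho>_def[abs_def])
  qed
  define ind where "ind m Z = (if Z \<in> acc m then 1 else 0 :: real)" for m Z
  have sandm: "eventually (\<lambda>m. \<forall>Z\<in>W m. Gm k (V m Z) \<le> ind m Z \<and> ind m Z \<le> Gp k (V m Z)) sequentially" for k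
  proof -
    have "eventually (\<lambda>m. e m < \<delta> k / 2) sequentially"
      using e \<delta>[of k] by (intro order_tendstoD(2)) auto
    then show ?thesis
    proof eventually_elim
      case (elim m)
      show ?case
      proof
        fix Z assume Z: "Z \<in> W m"
        have r0: "block_square h (V m Z) \<ge> 0" for h by (auto simp: block_square_def intro: sum_nonneg)
        have dk: "0 < \<delta> k" "\<delta> k \<le> 1 / 3" "0 \<le> e m" "e m < \<delta> k / 2" using \<delta>[of k] e0[of m] elim by auto
        show "Gm k (V m Z) \<le> ind m Z \<and> ind m Z \<le> Gp k (V m Z)"
        proof (cases "Z \<in> acc m")
          case True
          have "Gp k (V m Z) = 1" unfolding Gp_def
          proof (intro soft_accept_1[OF a] ballI)
            fix h assume h: "h \<in> {1..H}"
            let ?r = "block_square h (V m Z)"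
            have "?r * (1 - e m) \<le> Ms m Z h" using Ms[OF Z h] by (simp add: algebra_simps abs_le_iff)
            also have "\<dots> \<le> a h" using True h by (simp add: acc_def)
            finally have "?r * (1 - e m) * (1 + \<delta> k) \<le> a h * (1 + \<delta> k)" using dk by (intro mult_right_mono) auto
            moreover have "1 \<le> (1 - e m) * (1 + \<delta> k)"
            proof -
              have "e m * (1 + \<delta> k) \<le> (\<delta> k / 2) * 2" using dk by (intro mult_mono) auto
              then show ?thesis by (simp add: algebra_simps)
            qed
            then have "?r * 1 \<le> ?r * ((1 - e m) * (1 + \<delta> k))" using r0 by (intro mult_left_mono) auto
            ultimately show "?r \<le> a h * (1 + \<delta> k)" by (simp add: mult.assoc)
          qed (use dk in simp)
          then show ?thesis using True G01 by (simp add: ind_def)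
        next
          case False
          then obtain h where h: "h \<in> {1..H}" "Ms m Z h > a h" using Z by (force simp: acc_def)
          let ?r = "block_square h (V m Z)"
          have ah: "a h > 0" using a h by auto
          have "a h * (1 - \<delta> k) \<le> ?r"
          proof (rule ccontr)
            assume "\<not> ?thesis"
            then have "?r * (1 + e m) \<le> (a h * (1 - \<delta> k)) * (1 + e m)" using dk by (intro mult_right_mono) auto
            also have "\<dots> = a h * ((1 - \<delta> k) * (1 + e m))" by simp
            also have "(1 - \<delta> k) * (1 + e m) \<le> 1"
            proof -
              have "(1 - \<delta> k) * (1 + e m) = 1 - \<delta> k + e m - \<delta> k * e m" by (simp add: algebra_simps)
              also have "\<dots> \<le> 1" using dk mult_nonneg_nonneg[of "\<delta> k" "e m"] by linarith
              finally show ?thesis .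
            qed
            then have "a h * ((1 - \<delta> k) * (1 + e m)) \<le> a h * 1" using ah by (intro mult_left_mono) auto
            finally have "?r * (1 + e m) \<le> a h" by simp
            moreover have "Ms m Z h \<le> ?r * (1 + e m)" using Ms[OF Z h(1)] by (simp add: algebra_simps abs_le_iff)
            ultimately show False using h by simp
          qed
          then have "Gm k (V m Z) = 0" unfolding Gm_def using h dk by (intro soft_accept_0[OF a, of _ _ h]) auto
          then show ?thesis using False G01 by (simp add: ind_def)
        qed
      qed
    qed
  qed
  have main: "(\<lambda>m. (\<Sum>Z\<in>W m. \<psi> (V m Z) * ind m Z) / real (card (W m))) \<longlonglongrightarrow> (\<integral>\<omega>. \<psi> (VL \<omega>) * indicator ?A \<omega> \<partial>G)"
    if \<psi>: "continuous_on UNIV \<psi>" "\<And>v. \<bar>\<psi> v\<bar> \<le> C" for \<psi> :: "_ \<Rightarrow> real" and C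
  proof (rule LIMSEQ_I)
    fix \<epsilon> :: real assume \<epsilon>: "\<epsilon> > 0"
    have C0: "C \<ge> 0" using \<psi>(2)[of undefined] by linarith
    have "(\<lambda>k. C * \<rho> k) \<longlonglongrightarrow> C * 0" by (intro tendsto_intros \<rho>0)
    then have "eventually (\<lambda>k. C * \<rho> k < \<epsilon> / 6) sequentially" using \<epsilon> by (intro order_tendstoD(2)) auto
    then obtain k where k: "C * \<rho> k < \<epsilon> / 6" using eventually_happens by fastforce
    define X where "X m = (\<Sum>Z\<in>W m. \<psi> (V m Z) * Gm k (V m Z)) / real (card (W m))" for m
    define X' where "X' = (\<integral>\<omega>. \<psi> (VL \<omega>) * Gm k (VL \<omega>) \<partial>G)"
    define D where "D m = (\<Sum>Z\<in>W m. Gp k (V m Z) - Gm k (V m Z)) / real (card (W m))" for m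
    have cX: "continuous_on UNIV (\<lambda>v. \<psi> v * Gm k v)" by (intro continuous_on_mult \<psi> Gcont)
    have bX: "\<bar>\<psi> v * Gm k v\<bar> \<le> C" for v
      using mult_mono[OF \<psi>(2)[of v] G01(4)[of k v]] C0 G01(3)[of k v] by (simp add: abs_mult)
    have X: "X \<longlonglongrightarrow> X'" unfolding X_def[abs_def] X'_def by (rule joint_clt[OF cX bX])
    have D: "D \<longlonglongrightarrow> \<rho> k" unfolding D_def[abs_def] \<rho>_def
    proof (rule joint_clt)
      show "continuous_on UNIV (\<lambda>v. Gp k v - Gm k v)" by (intro continuous_on_diff Gcont)
      show "\<bar>Gp k v - Gm k v\<bar> \<le> 1" for v using G01[of k v] by linarith
    qed
    have "(\<lambda>m. C * D m) \<longlonglongrightarrow> C * \<rho> k" by (intro tendsto_intros D)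
    then have ev1: "eventually (\<lambda>m. C * D m < \<epsilon> / 6) sequentially" using k by (rule order_tendstoD(2))
    have ev2: "eventually (\<lambda>m. \<bar>X m - X'\<bar> < \<epsilon> / 6) sequentially"
      using tendstoD[OF X, of "\<epsilon> / 6"] \<epsilon> by (simp add: dist_real_def)
    have lim: "\<bar>(\<integral>\<omega>. \<psi> (VL \<omega>) * indicator ?A \<omega> \<partial>G) - X'\<bar> \<le> C * \<rho> k"
    proof -
      have i1: "integrable G (\<lambda>\<omega>. \<psi> (VL \<omega>) * indicator ?A \<omega>)"
        by (rule G.integrable_const_bound[where B = C])
          (use \<psi> C0 meas[OF \<psi>(1)] gauss_acc_sets in \<open>auto simp: indicator_def intro!: borel_measurable_times borel_measurable_indicator\<close>)
      have i2: "integrable G (\<lambda>\<omega>. \<psi> (VL \<omega>) * Gm k (VL \<omega>))" by (rule integ[OF cX bX])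
      have i3: "integrable G (\<lambda>\<omega>. C * (Gp k (VL \<omega>) - Gm k (VL \<omega>)))"
      proof (intro integrable_mult_right Bochner_Integration.integrable_diff)
        show "integrable G (\<lambda>\<omega>. Gp k (VL \<omega>))" by (rule integ[of _ 1]) (use Gcont G01 in auto)
        show "integrable G (\<lambda>\<omega>. Gm k (VL \<omega>))" by (rule integ[of _ 1]) (use Gcont G01 in auto)
      qed
      have "\<bar>(\<integral>\<omega>. \<psi> (VL \<omega>) * indicator ?A \<omega> \<partial>G) - X'\<bar> = \<bar>\<integral>\<omega>. \<psi> (VL \<omega>) * indicator ?A \<omega> - \<psi> (VL \<omega>) * Gm k (VL \<omega>) \<partial>G\<bar>"
        unfolding X'_def using i1 i2 by simp
      also have "\<dots> \<le> (\<integral>\<omega>. \<bar>\<psi> (VL \<omega>) * indicator ?A \<omega> - \<psi> (VL \<omega>) * Gm k (VL \<omega>)\<bar> \<partial>G)" by (rule integral_abs_bound)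
      also have "\<dots> \<le> (\<integral>\<omega>. C * (Gp k (VL \<omega>) - Gm k (VL \<omega>)) \<partial>G)"
      proof (rule integral_mono)
        fix \<omega> assume \<omega>: "\<omega> \<in> space G"
        have "\<bar>\<psi> (VL \<omega>) * indicator ?A \<omega> - \<psi> (VL \<omega>) * Gm k (VL \<omega>)\<bar> = \<bar>\<psi> (VL \<omega>)\<bar> * (indicator ?A \<omega> - Gm k (VL \<omega>))"
          using sandL(1)[OF \<omega>, of k] by (simp add: abs_mult flip: right_diff_distrib)
        also have "\<dots> \<le> C * (Gp k (VL \<omega>) - Gm k (VL \<omega>))"
          using sandL[OF \<omega>, of k] \<psi>(2)[of "VL \<omega>"] by (intro mult_mono) auto
        finally show "\<bar>\<psi> (VL \<omega>) * indicator ?A \<omega> - \<psi> (VL \<omega>) * Gm k (VL \<omega>)\<bar> \<le> C * (Gp k (VL \<omega>) - Gm k (VL \<omega>))" .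
      qed (use i1 i2 i3 in auto)
      finally show ?thesis by (simp add: \<rho>_def)
    qed
    have "eventually (\<lambda>m. norm ((\<Sum>Z\<in>W m. \<psi> (V m Z) * ind m Z) / real (card (W m)) - (\<integral>\<omega>. \<psi> (VL \<omega>) * indicator ?A \<omega> \<partial>G)) < \<epsilon>) sequentially"
      using ev1 ev2 sandm[of k]
    proof eventually_elim
      case (elim m)
      have "\<bar>(\<Sum>Z\<in>W m. \<psi> (V m Z) * ind m Z) / real (card (W m)) - X m\<bar>
         = \<bar>\<Sum>Z\<in>W m. \<psi> (V m Z) * (ind m Z - Gm k (V m Z))\<bar> / real (card (W m))"
        by (simp add: X_def right_diff_distrib sum_subtractf flip: diff_divide_distrib)
      also have "\<dots> \<le> (\<Sum>Z\<in>W m. C * (Gp k (V m Z) - Gm k (V m Z))) / real (card (W m))"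
      proof (rule divide_right_mono[OF order_trans[OF sum_abs sum_mono]])
        fix Z assume "Z \<in> W m"
        then have s: "Gm k (V m Z) \<le> ind m Z" "ind m Z \<le> Gp k (V m Z)" using elim by auto
        have "\<bar>\<psi> (V m Z) * (ind m Z - Gm k (V m Z))\<bar> = \<bar>\<psi> (V m Z)\<bar> * (ind m Z - Gm k (V m Z))"
          using s by (simp add: abs_mult)
        also have "\<dots> \<le> C * (Gp k (V m Z) - Gm k (V m Z))"
          using s \<psi>(2)[of "V m Z"] by (intro mult_mono) auto
        finally show "\<bar>\<psi> (V m Z) * (ind m Z - Gm k (V m Z))\<bar> \<le> C * (Gp k (V m Z) - Gm k (V m Z))" .
      qed simp
      also have "\<dots> = C * D m" by (simp add: D_def sum_distrib_left)
      finally show ?case using elim lim k \<epsilon> unfolding real_norm_def by linarith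
    qed
    then show "\<exists>no. \<forall>m\<ge>no. norm ((\<Sum>Z\<in>W m. \<psi> (V m Z) * ind m Z) / real (card (W m)) - (\<integral>\<omega>. \<psi> (VL \<omega>) * indicator ?A \<omega> \<partial>G)) < \<epsilon>"
      by (simp add: eventually_sequentially)
  qed
  have accW: "acc m \<subseteq> W m" for m by (auto simp: acc_def)
  have sum_ind: "(\<Sum>Z\<in>W m. f Z * ind m Z) = (\<Sum>Z\<in>acc m. f Z)" for f m
    unfolding ind_def using accW[of m]
    by (subst sum.mono_neutral_right[of "W m" "acc m"]) (auto simp: finite_assignments)
  define P where "P = measure G ?A"
  have P: "P > 0" unfolding P_def by (rule gauss_acc_pos[OF a])
  have c1: "(\<lambda>m. real (card (acc m)) / real (card (W m))) \<longlonglongrightarrow> P"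
  proof -
    have "(\<lambda>m. (\<Sum>Z\<in>W m. 1 * ind m Z) / real (card (W m))) \<longlonglongrightarrow> (\<integral>\<omega>. 1 * indicator ?A \<omega> \<partial>G)"
      by (rule main[of "\<lambda>_. 1" 1]) auto
    then show ?thesis unfolding sum_ind using gauss_acc_sets by (simp add: P_def)
  qed
  have ev: "eventually (\<lambda>m. real (card (acc m)) / real (card (W m)) > 0) sequentially"
    by (rule order_tendstoD(1)[OF c1 P])
  then show "eventually (\<lambda>m. acc m \<noteq> {}) sequentially"
    by (rule eventually_mono) auto
  have "(\<lambda>m. ((\<Sum>Z\<in>W m. \<phi> (V m Z) * ind m Z) / real (card (W m))) / (real (card (acc m)) / real (card (W m))))
    \<longlonglongrightarrow> (\<integral>\<omega>. \<phi> (VL \<omega>) * indicator ?A \<omega> \<partial>G) / P"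
    using P by (intro tendsto_divide main[OF cont B] c1) auto
  moreover have "((\<Sum>Z\<in>W m. \<phi> (V m Z) * ind m Z) / real (card (W m))) / (real (card (acc m)) / real (card (W m)))
     = (\<Sum>Z\<in>acc m. \<phi> (V m Z)) / real (card (acc m))" for m
    unfolding sum_ind using card_W[of m] by simp
  ultimately show "(\<lambda>m. (\<Sum>Z\<in>acc m. \<phi> (V m Z)) / real (card (acc m))) \<longlonglongrightarrow> (\<integral>\<omega>. \<phi> (VL \<omega>) \<partial>uniform_measure G ?A)"
    by (simp only: integral_uniform_measure_prob[OF G.prob_space_axioms gauss_acc_sets gauss_acc_pos[OF a] meas[OF cont]] P_def)
qed

end

section \<open>Real matrices with explicit dimension\<close>

definition mid :: rmat where
  "mid i j = (if i = j then 1 else 0)"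

lemma mmul_assoc: "mmul c (mmul d A B) C = mmul d A (mmul c B C)"
  by (auto simp: mmul_def fun_eq_iff sum_distrib_left sum_distrib_right mult.assoc intro: sum.swap)

lemma mmul_cong:
  "(\<And>k. k < d \<Longrightarrow> A i k = A' i k) \<Longrightarrow> (\<And>k. k < d \<Longrightarrow> B k j = B' k j) \<Longrightarrow> mmul d A B i j = mmul d A' B' i j"
  unfolding mmul_def by (rule sum.cong) auto

lemma mmul_mid_left: "i < d \<Longrightarrow> mmul d mid A i j = A i j"
  by (simp add: mmul_def mid_def if_distrib[where f = "\<lambda>x. x * _"] cong: if_cong)

lemma mmul_mid_right: "j < d \<Longrightarrow> mmul d A mid i j = A i j"
  by (simp add: mmul_def mid_def if_distrib[where f = "\<lambda>x. _ * x"] cong: if_cong)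

lemma mtr_mtr: "mtr (mtr A) = A"
  by (simp add: mtr_def)

lemma mtr_mmul: "mtr (mmul d A B) = mmul d (mtr B) (mtr A)"
  by (simp add: mtr_def mmul_def fun_eq_iff mult.commute)

definition bilin :: "nat \<Rightarrow> rmat \<Rightarrow> rvec \<Rightarrow> rvec \<Rightarrow> real" where
  "bilin d A u v = (\<Sum>i<d. \<Sum>j<d. u i * A i j * v j)"

lemma bilin_diff_left: "bilin d A (\<lambda>i. u i - w i) v = bilin d A u v - bilin d A w v"
  by (simp add: bilin_def algebra_simps sum_subtractf)

lemma bilin_scale_left: "bilin d A (\<lambda>i. c * u i) v = c * bilin d A u v"
  by (simp add: bilin_def sum_distrib_left mult.assoc)

lemma bilin_sum_left: "bilin d A (\<lambda>i. \<Sum>k\<in>K. u k i) v = (\<Sum>k\<in>K. bilin d A (u k) v)"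
proof -
  have "bilin d A (\<lambda>i. \<Sum>k\<in>K. u k i) v = (\<Sum>i<d. \<Sum>j<d. \<Sum>k\<in>K. u k i * A i j * v j)"
    by (simp add: bilin_def sum_distrib_right)
  also have "\<dots> = (\<Sum>i<d. \<Sum>k\<in>K. \<Sum>j<d. u k i * A i j * v j)"
    by (intro sum.cong refl) (rule sum.swap)
  also have "\<dots> = (\<Sum>k\<in>K. \<Sum>i<d. \<Sum>j<d. u k i * A i j * v j)" by (rule sum.swap)
  finally show ?thesis by (simp add: bilin_def)
qed

lemma bilin_commute:
  assumes "\<And>i j. i < d \<Longrightarrow> j < d \<Longrightarrow> A i j = A j i"
  shows "bilin d A u v = bilin d A v u"
proof -
  have "bilin d A u v = (\<Sum>j<d. \<Sum>i<d. u i * A i j * v j)" unfolding bilin_def by (rule sum.swap)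
  also have "\<dots> = bilin d A v u"
    unfolding bilin_def using assms by (intro sum.cong refl) (simp add: mult_ac)
  finally show ?thesis .
qed

definition posdef :: "nat \<Rightarrow> rmat \<Rightarrow> bool" where
  "posdef d A \<longleftrightarrow> (\<forall>i<d. \<forall>j<d. A i j = A j i) \<and> (\<forall>v. (\<exists>i<d. v i \<noteq> 0) \<longrightarrow> bilin d A v v > 0)"

lemma posdef_gram_schmidt:
  "posdef d A \<Longrightarrow> \<exists>C E. (\<forall>k<d. \<forall>l<d. bilin d A (C k) (C l) = mid k l) \<and> (\<forall>i<d. \<forall>j<d. mmul d E C i j = mid i j)"
proof (induction d)
  case 0
  then show ?case by simp
next
  case (Suc d)
  have sym: "A i j = A j i" if "i < Suc d" "j < Suc d" for i j
    using Suc.prems that by (auto simp: posdef_def)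
  have comm: "bilin (Suc d) A u v = bilin (Suc d) A v u" for u v
    by (rule bilin_commute) (rule sym)
  have ext: "bilin (Suc d) A u v = bilin d A u v" if "u d = 0" "v d = 0" for u v
    using that by (simp add: bilin_def)
  have extc: "bilin d A u v = bilin d A u' v'" if "\<And>i. i < d \<Longrightarrow> u i = u' i" "\<And>i. i < d \<Longrightarrow> v i = v' i" for u v u' v'
    unfolding bilin_def using that by (intro sum.cong refl) simp
  have "posdef d A"
    unfolding posdef_def
  proof (intro conjI allI impI)
    fix v :: rvec assume "\<exists>i<d. v i \<noteq> 0"
    then have "\<exists>i<Suc d. (v(d := 0)) i \<noteq> 0" by (metis fun_upd_other less_SucI nat_neq_iff)
    then have "bilin (Suc d) A (v(d := 0)) (v(d := 0)) > 0" using Suc.prems by (auto simp: posdef_def)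
    then show "bilin d A v v > 0" using extc[of "v(d := 0)" v "v(d := 0)" v] by (simp add: ext)
  qed (use sym in auto)
  then obtain C E where C: "\<forall>k<d. \<forall>l<d. bilin d A (C k) (C l) = mid k l"
    and E: "\<forall>i<d. \<forall>j<d. mmul d E C i j = mid i j" using Suc.IH by blast
  define c where "c k = (\<lambda>i. if i < d then C k i else 0)" for k
  define e where "e = (mid d :: rvec)"
  define \<gamma> where "\<gamma> k = bilin (Suc d) A (c k) e" for k
  define u where "u = (\<lambda>i. e i - (\<Sum>k<d. \<gamma> k * c k i))"
  have cc: "bilin (Suc d) A (c k) (c l) = mid k l" if "k < d" "l < d" for k l
    using C that ext[of "c k" "c l"] extc[of "c k" "C k" "c l" "C l"] by (simp add: c_def)
  have ud: "u d = 1" by (simp add: u_def e_def mid_def c_def)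
  have uv: "bilin (Suc d) A u v = bilin (Suc d) A e v - (\<Sum>k<d. \<gamma> k * bilin (Suc d) A (c k) v)" for v
    unfolding u_def bilin_diff_left bilin_sum_left bilin_scale_left ..
  have uc: "bilin (Suc d) A u (c l) = 0" if "l < d" for l
  proof -
    have "(\<Sum>k<d. \<gamma> k * bilin (Suc d) A (c k) (c l)) = (\<Sum>k<d. if k = l then \<gamma> l else 0)"
      by (rule sum.cong) (use cc that in \<open>auto simp: mid_def\<close>)
    then have "(\<Sum>k<d. \<gamma> k * bilin (Suc d) A (c k) (c l)) = \<gamma> l" using that by simp
    then show ?thesis using comm[of e "c l"] unfolding uv \<gamma>_def by simp
  qed
  define s where "s = bilin (Suc d) A u u"
  have s: "s > 0" using Suc.prems ud unfolding s_def posdef_def by (metis lessI zero_neq_one)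
  define C' where "C' k = (if k < d then c k else (\<lambda>i. (1 / sqrt s) * u i))" for k
  define E' where "E' i k = (if i < d then if k < d then E i k else 0 else if k < d then \<gamma> k else sqrt s)" for i k
  have "bilin (Suc d) A (C' k) (C' l) = mid k l" if kl: "k < Suc d" "l < Suc d" for k l
  proof -
    have right: "bilin (Suc d) A v (\<lambda>i. (1 / sqrt s) * u i) = (1 / sqrt s) * bilin (Suc d) A v u" for v
      unfolding comm[of v "\<lambda>i. (1 / sqrt s) * u i"] comm[of v u] by (rule bilin_scale_left)
    have cu: "bilin (Suc d) A (c k) u = 0" if "k < d" for k
      using uc[OF that] comm[of "c k" u] by simp
    have uu: "bilin (Suc d) A (\<lambda>i. (1 / sqrt s) * u i) (\<lambda>i. (1 / sqrt s) * u i) = 1"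
      unfolding right bilin_scale_left s_def[symmetric] using s by simp
    consider "k < d" "l < d" | "k < d" "l = d" | "k = d" "l < d" | "k = d" "l = d" using kl by linarith
    then show ?thesis
    proof cases
      case 1 then show ?thesis using cc by (simp add: C'_def)
    next
      case 2 then show ?thesis using cu right[of "c k"] by (simp add: C'_def mid_def)
    next
      case 3 then show ?thesis using uc bilin_scale_left[of "Suc d" A "1 / sqrt s" u "c l"] by (simp add: C'_def mid_def)
    next
      case 4 then show ?thesis using uu by (simp add: C'_def mid_def)
    qed
  qed
  moreover have "mmul (Suc d) E' C' i j = mid i j" if ij: "i < Suc d" "j < Suc d" for i j
  proof (cases "i < d")
    case True
    have "mmul (Suc d) E' C' i j = (\<Sum>k<d. E i k * c k j)"
      using True by (simp add: mmul_def E'_def C'_def)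
    also have "\<dots> = mid i j"
    proof (cases "j < d")
      case j: True
      then show ?thesis using E True by (simp add: mmul_def c_def)
    next
      case False
      then show ?thesis using True ij by (simp add: c_def mid_def)
    qed
    finally show ?thesis .
  next
    case False
    then have "i = d" using ij by simp
    then have "mmul (Suc d) E' C' i j = (\<Sum>k<d. \<gamma> k * c k j) + sqrt s * (1 / sqrt s * u j)"
      by (simp add: mmul_def E'_def C'_def)
    also have "\<dots> = (\<Sum>k<d. \<gamma> k * c k j) + u j" using s by simp
    also have "\<dots> = mid i j" using \<open>i = d\<close> by (simp add: u_def e_def)
    finally show ?thesis .
  qed
  ultimately show ?case by blast
qed

lemma bilin_mmul: "bilin d A (C k) (C l) = mmul d (mmul d C A) (mtr C) k l"
proof -
  have "bilin d A (C k) (C l) = (\<Sum>j<d. \<Sum>i<d. C k i * A i j * C l j)" unfolding bilin_def by (rule sum.swap)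
  then show ?thesis by (simp add: mmul_def mtr_def sum_distrib_right)
qed

lemma posdef_factor:
  assumes "posdef d A"
  obtains C E where "\<And>k l. k < d \<Longrightarrow> l < d \<Longrightarrow> mmul d (mmul d C A) (mtr C) k l = mid k l"
    "\<And>i j. i < d \<Longrightarrow> j < d \<Longrightarrow> mmul d E C i j = mid i j"
    "\<And>i j. i < d \<Longrightarrow> j < d \<Longrightarrow> mmul d A (mmul d (mtr C) C) i j = mid i j"
proof -
  obtain C E where C: "\<forall>k<d. \<forall>l<d. bilin d A (C k) (C l) = mid k l" and E: "\<forall>i<d. \<forall>j<d. mmul d E C i j = mid i j"
    using posdef_gram_schmidt[OF assms] by blast
  have C': "mmul d (mmul d C A) (mtr C) k l = mid k l" if "k < d" "l < d" for k l
    using C that by (simp add: bilin_mmul)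
  have AC: "mmul d A (mtr C) i k = E i k" if "i < d" "k < d" for i k
  proof -
    have "mmul d A (mtr C) i k = mmul d mid (mmul d A (mtr C)) i k" using that by (simp add: mmul_mid_left)
    also have "\<dots> = mmul d (mmul d E C) (mmul d A (mtr C)) i k"
      by (rule mmul_cong) (use E that in auto)
    also have "\<dots> = mmul d E (mmul d (mmul d C A) (mtr C)) i k" by (simp add: mmul_assoc)
    also have "\<dots> = mmul d E mid i k" by (rule mmul_cong) (use C' that in auto)
    finally show ?thesis using that by (simp add: mmul_mid_right)
  qed
  have "mmul d A (mmul d (mtr C) C) i j = mid i j" if "i < d" "j < d" for i j
  proof -
    have "mmul d A (mmul d (mtr C) C) i j = mmul d (mmul d A (mtr C)) C i j" by (simp add: mmul_assoc)
    also have "\<dots> = mmul d E C i j" by (rule mmul_cong) (use AC that in auto)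
    finally show ?thesis using E that by simp
  qed
  with C' E that show ?thesis by blast
qed

lemma symmetric_right_inverse_unique:
  assumes sym: "\<And>i j. i < d \<Longrightarrow> j < d \<Longrightarrow> A i j = A j i"
    and B: "\<And>i j. i < d \<Longrightarrow> j < d \<Longrightarrow> mmul d A B i j = mid i j"
    and B': "\<And>i j. i < d \<Longrightarrow> j < d \<Longrightarrow> mmul d A B' i j = mid i j"
    and ij: "i < d" "j < d"
  shows "B' i j = B j i"
proof -
  have L: "mmul d (mtr B) A i j = mid i j" if "i < d" "j < d" for i j
  proof -
    have "mmul d (mtr B) A i j = mmul d A B j i"
      unfolding mmul_def mtr_def using sym that by (intro sum.cong refl) (simp add: mult.commute)
    then show ?thesis using B that by (simp add: mid_def)
  qed
  have "B' i j = mmul d mid B' i j" using ij by (simp add: mmul_mid_left)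
  also have "\<dots> = mmul d (mmul d (mtr B) A) B' i j" by (rule mmul_cong) (use L ij in auto)
  also have "\<dots> = mmul d (mtr B) (mmul d A B') i j" by (simp add: mmul_assoc)
  also have "\<dots> = mmul d (mtr B) mid i j" by (rule mmul_cong) (use B' ij in auto)
  finally show ?thesis using ij by (simp add: mmul_mid_right mtr_def)
qed

text \<open>The predicate \<open>is_inverse\<close> only asks for a right inverse; for a symmetric matrix it is unique
  and two-sided.\<close>

lemma minv_symmetric:
  assumes sym: "\<And>i j. i < d \<Longrightarrow> j < d \<Longrightarrow> A i j = A j i" and ns: "nonsingular d A"
  shows "\<And>i j. i < d \<Longrightarrow> j < d \<Longrightarrow> mmul d A (minv d A) i j = mid i j"
    and "\<And>i j. i < d \<Longrightarrow> j < d \<Longrightarrow> mmul d (minv d A) A i j = mid i j"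
    and "\<And>i j. i < d \<Longrightarrow> j < d \<Longrightarrow> minv d A i j = minv d A j i"
    and "\<And>B i j. (\<And>i j. i < d \<Longrightarrow> j < d \<Longrightarrow> mmul d A B i j = mid i j) \<Longrightarrow> i < d \<Longrightarrow> j < d \<Longrightarrow> minv d A i j = B i j"
proof -
  have inv_mid: "is_inverse d A B \<longleftrightarrow> (\<forall>i<d. \<forall>j<d. mmul d A B i j = mid i j) \<and> (\<forall>i j. \<not> (i < d \<and> j < d) \<longrightarrow> B i j = 0)" for B
    by (simp add: is_inverse_def mid_def)
  obtain B where B: "is_inverse d A B" using ns by (auto simp: nonsingular_def)
  have uq: "B' i j = B j i" if "\<And>i j. i < d \<Longrightarrow> j < d \<Longrightarrow> mmul d A B i j = mid i j"
    "\<And>i j. i < d \<Longrightarrow> j < d \<Longrightarrow> mmul d A B' i j = mid i j" "i < d" "j < d" for B B' i j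
    by (rule symmetric_right_inverse_unique[where A = A and d = d]) (use sym that in auto)
  have uniq: "B' = B" if "is_inverse d A B'" for B'
  proof (intro ext)
    fix i j
    show "B' i j = B i j"
    proof (cases "i < d \<and> j < d")
      case True
      then have "B' i j = B j i" "B i j = B j i"
        using uq[of B B' i j] uq[of B B i j] B that by (auto simp: inv_mid)
      then show ?thesis by simp
    next
      case False
      then show ?thesis using B that by (simp add: inv_mid)
    qed
  qed
  have m: "minv d A = B" unfolding minv_def using B uniq by blast
  show R: "mmul d A (minv d A) i j = mid i j" if "i < d" "j < d" for i j
    using B that unfolding m inv_mid by blast
  show S: "minv d A i j = minv d A j i" if "i < d" "j < d" for i j
    by (rule uq) (use R that in auto)
  show "minv d A i j = B i j" if "\<And>i j. i < d \<Longrightarrow> j < d \<Longrightarrow> mmul d A B i j = mid i j" "i < d" "j < d" for B i j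
    unfolding S[OF that(2,3)] by (rule uq) (use R that in auto)
  show "mmul d (minv d A) A i j = mid i j" if "i < d" "j < d" for i j
  proof -
    have "mmul d (minv d A) A i j = mmul d A (minv d A) j i"
      unfolding mmul_def using sym S that by (intro sum.cong refl) (simp add: mult.commute)
    then show ?thesis using R that by (simp add: mid_def)
  qed
qed

lemma posdef_sym: "posdef d A \<Longrightarrow> i < d \<Longrightarrow> j < d \<Longrightarrow> A i j = A j i"
  by (auto simp: posdef_def)

lemma posdef_nonsingular: "posdef d A \<Longrightarrow> nonsingular d A"
proof -
  assume A: "posdef d A"
  obtain C E where "\<And>k l. k < d \<Longrightarrow> l < d \<Longrightarrow> mmul d (mmul d C A) (mtr C) k l = mid k l"
    "\<And>i j. i < d \<Longrightarrow> j < d \<Longrightarrow> mmul d E C i j = mid i j"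
    and C: "\<And>i j. i < d \<Longrightarrow> j < d \<Longrightarrow> mmul d A (mmul d (mtr C) C) i j = mid i j"
    by (rule posdef_factor[OF A]) blast
  define B where "B i j = (if i < d \<and> j < d then mmul d (mtr C) C i j else 0)" for i j
  have "mmul d A B i j = mid i j" if "i < d" "j < d" for i j
    using C[OF that] that unfolding mmul_def[of d A] by (simp add: B_def)
  then have "is_inverse d A B" by (simp add: is_inverse_def B_def mid_def)
  then show ?thesis by (auto simp: nonsingular_def)
qed

lemma psd_nonsingular_posdef:
  assumes sym: "\<And>i j. i < d \<Longrightarrow> j < d \<Longrightarrow> A i j = A j i"
    and psd: "\<And>v. bilin d A v v \<ge> 0" and ns: "nonsingular d A"
  shows "posdef d A"
  unfolding posdef_def
proof (intro conjI allI impI)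
  fix v :: rvec assume "\<exists>i<d. v i \<noteq> 0"
  then obtain i where i: "i < d" "v i \<noteq> 0" by auto
  show "bilin d A v v > 0"
  proof (rule ccontr)
    assume "\<not> ?thesis"
    then have v0: "bilin d A v v = 0" using psd[of v] by linarith
    have comm: "bilin d A x y = bilin d A y x" for x y
      by (rule bilin_commute) (rule sym)
    have wv: "bilin d A w v = 0" for w
    proof -
      have q: "bilin d A (\<lambda>i. v i - t * w i) (\<lambda>i. v i - t * w i) = t\<^sup>2 * bilin d A w w - 2 * t * bilin d A w v" for t
      proof -
        have r: "bilin d A x (\<lambda>i. v i - t * w i) = bilin d A x v - t * bilin d A x w" for x
          using bilin_diff_left[of d A v "\<lambda>i. t * w i" x] bilin_scale_left[of d A t w x] comm[of x] by simp
        show ?thesis unfolding r bilin_diff_left bilin_scale_left v0 comm[of v w]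
          by (simp add: power2_eq_square algebra_simps)
      qed
      have ww: "bilin d A w w \<ge> 0" by (rule psd)
      define b where "b = bilin d A w v"
      define t where "t = b / (bilin d A w w + 1)"
      have "0 \<le> t\<^sup>2 * bilin d A w w - 2 * t * b" using psd[of "\<lambda>i. v i - t * w i"] unfolding q b_def .
      also have "\<dots> \<le> t\<^sup>2 * (bilin d A w w + 1) - 2 * t * b" by (simp add: mult_left_mono)
      also have "t\<^sup>2 * (bilin d A w w + 1) = t * b"
        using ww by (simp add: t_def power2_eq_square)
      finally have "t * b \<le> 0" by (simp add: mult.commute)
      then have "b * b \<le> 0" using ww by (simp add: t_def divide_le_0_iff)
      then have "b = 0" by (auto simp: mult_le_0_iff)
      then show ?thesis by (simp add: b_def)
    qed
    have "bilin d A (minv d A i) v = (\<Sum>j<d. mmul d (minv d A) A i j * v j)"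
    proof -
      have "bilin d A (minv d A i) v = (\<Sum>j<d. \<Sum>k<d. minv d A i k * A k j * v j)"
        unfolding bilin_def by (rule sum.swap)
      then show ?thesis by (simp add: mmul_def sum_distrib_right)
    qed
    also have "\<dots> = (\<Sum>j<d. mid i j * v j)"
      using minv_symmetric(2)[OF sym ns] i by (intro sum.cong refl) auto
    also have "\<dots> = v i" using i mmul_mid_left[of i d "\<lambda>i _. v i"] by (simp add: mmul_def)
    finally show False using wv i by simp
  qed
qed (use sym in auto)

lemma inverse_tendsto:
  fixes A B :: "nat \<Rightarrow> rmat"
  assumes A: "\<And>i j. i < d \<Longrightarrow> j < d \<Longrightarrow> (\<lambda>m. A m i j) \<longlonglongrightarrow> A' i j"
    and B: "\<And>m i j. i < d \<Longrightarrow> j < d \<Longrightarrow> mmul d (A m) (B m) i j = mid i j"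
    and B': "\<And>i j. i < d \<Longrightarrow> j < d \<Longrightarrow> mmul d B' A' i j = mid i j"
    and ij: "i < d" "j < d"
  shows "(\<lambda>m. B m i j) \<longlonglongrightarrow> B' i j"
proof -
  define D where "D m = mmul d B' (\<lambda>k j. A' k j - A m k j)" for m
  have eq: "B m i j - B' i j = mmul d (D m) (B m) i j" if "i < d" "j < d" for m i j
  proof -
    have "mmul d (D m) (B m) i j = mmul d B' (mmul d (\<lambda>k j. A' k j - A m k j) (B m)) i j"
      by (simp add: D_def mmul_assoc)
    also have "\<dots> = mmul d B' (mmul d A' (B m)) i j - mmul d B' (mmul d (A m) (B m)) i j"
      by (simp add: mmul_def left_diff_distrib right_diff_distrib sum_subtractf)
    also have "mmul d B' (mmul d A' (B m)) i j = mmul d mid (B m) i j"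
      unfolding mmul_assoc[symmetric] by (rule mmul_cong) (use B' that in auto)
    also have "mmul d B' (mmul d (A m) (B m)) i j = mmul d B' mid i j"
      by (rule mmul_cong) (use B that in auto)
    finally show ?thesis using that by (simp add: mmul_mid_left mmul_mid_right)
  qed
  define e where "e m = (\<Sum>i<d. \<Sum>j<d. \<bar>D m i j\<bar>)" for m
  define b where "b m = (\<Sum>i<d. \<Sum>j<d. \<bar>B m i j\<bar>)" for m
  define b' where "b' = (\<Sum>i<d. \<Sum>j<d. \<bar>B' i j\<bar>)"
  have mem: "\<bar>M i j\<bar> \<le> (\<Sum>i<d. \<Sum>j<d. \<bar>M i j\<bar>)" if "i < d" "j < d" for M :: rmat and i j
  proof -
    have "\<bar>M i j\<bar> \<le> (\<Sum>j<d. \<bar>M i j\<bar>)" by (rule member_le_sum) (use that in auto)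
    also have "\<dots> \<le> (\<Sum>i<d. \<Sum>j<d. \<bar>M i j\<bar>)"
      by (rule member_le_sum[where f = "\<lambda>i. \<Sum>j<d. \<bar>M i j\<bar>"]) (use that in \<open>auto intro: sum_nonneg\<close>)
    finally show ?thesis .
  qed
  have e0: "e \<longlonglongrightarrow> 0"
  proof -
    have "(\<lambda>m. D m i j) \<longlonglongrightarrow> 0" if "i < d" "j < d" for i j
    proof -
      have "(\<lambda>m. \<Sum>k<d. B' i k * (A' k j - A m k j)) \<longlonglongrightarrow> (\<Sum>k<d. B' i k * (A' k j - A' k j))"
        by (intro tendsto_intros A) (use that in auto)
      then show ?thesis by (simp add: D_def mmul_def)
    qed
    then have "e \<longlonglongrightarrow> (\<Sum>i<d. \<Sum>j<d. 0)"
      unfolding e_def[abs_def] by (intro tendsto_sum tendsto_rabs_zero) auto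
    then show ?thesis by simp
  qed
  have diff: "\<bar>B m i j - B' i j\<bar> \<le> e m * b m" if "i < d" "j < d" for m i j
  proof -
    have "\<bar>B m i j - B' i j\<bar> \<le> (\<Sum>k<d. \<bar>D m i k\<bar> * \<bar>B m k j\<bar>)"
      unfolding eq[OF that] mmul_def by (rule order_trans[OF sum_abs]) (simp add: abs_mult)
    also have "\<dots> \<le> (\<Sum>k<d. \<bar>D m i k\<bar> * b m)"
      unfolding b_def by (intro sum_mono mult_left_mono mem) (use that in auto)
    also have "\<dots> = (\<Sum>k<d. \<bar>D m i k\<bar>) * b m" by (simp add: sum_distrib_right)
    also have "\<dots> \<le> e m * b m"
      unfolding e_def
      by (intro mult_right_mono member_le_sum[where f = "\<lambda>i. \<Sum>j<d. \<bar>D m i j\<bar>"])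
        (use that in \<open>auto simp: b_def intro: sum_nonneg\<close>)
    finally show ?thesis .
  qed
  have bb: "b m \<le> b' + real d * real d * (e m * b m)" for m
  proof -
    have "b m \<le> (\<Sum>i<d. \<Sum>j<d. \<bar>B' i j\<bar> + e m * b m)"
      unfolding b_def
    proof (intro sum_mono)
      fix i j assume "i \<in> {..<d}" "j \<in> {..<d}"
      then show "\<bar>B m i j\<bar> \<le> \<bar>B' i j\<bar> + e m * (\<Sum>i<d. \<Sum>j<d. \<bar>B m i j\<bar>)"
        using diff[of i j m] unfolding b_def by simp
    qed
    then show ?thesis by (simp add: sum.distrib b'_def)
  qed
  have b0: "b m \<ge> 0" "e m \<ge> 0" for m by (auto simp: b_def e_def intro!: sum_nonneg)
  have "(\<lambda>m. real d * real d * e m) \<longlonglongrightarrow> real d * real d * 0" by (intro tendsto_intros e0)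
  then have "eventually (\<lambda>m. real d * real d * e m < 1 / 2) sequentially"
    by (rule order_tendstoD) simp
  then have ev: "eventually (\<lambda>m. norm (B m i j - B' i j) \<le> e m * (2 * b')) sequentially"
  proof eventually_elim
    case (elim m)
    have "real d * real d * (e m * b m) \<le> 1 / 2 * b m"
      using mult_right_mono[of "real d * real d * e m" "1 / 2" "b m"] elim b0 by (simp add: mult.assoc)
    then have "b m \<le> 2 * b'" using bb[of m] by simp
    then have "e m * b m \<le> e m * (2 * b')" using b0 by (intro mult_left_mono) auto
    then show ?case using diff[OF ij, of m] by simp
  qed
  have "(\<lambda>m. e m * (2 * b')) \<longlonglongrightarrow> 0 * (2 * b')" by (intro tendsto_intros e0)
  then have "(\<lambda>m. e m * (2 * b')) \<longlonglongrightarrow> 0" by simp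
  from Lim_null_comparison[OF ev this] show ?thesis by (rule LIM_zero_cancel)
qed

definition orthogonal_mat :: "nat \<Rightarrow> rmat \<Rightarrow> bool" where
  "orthogonal_mat d U \<longleftrightarrow> (\<forall>i<d. \<forall>j<d. mmul d U (mtr U) i j = mid i j \<and> mmul d (mtr U) U i j = mid i j)"

lemma orthogonal_mat_mmul:
  assumes "orthogonal_mat d U" "orthogonal_mat d V"
  shows "orthogonal_mat d (mmul d U V)"
proof -
  have *: "mmul d (mmul d U V) (mtr (mmul d U V)) i j = mid i j"
    if "i < d" "j < d" and U: "\<forall>i<d. \<forall>j<d. mmul d U (mtr U) i j = mid i j"
      and V: "\<forall>i<d. \<forall>j<d. mmul d V (mtr V) i j = mid i j" for U V i j
  proof -
    have "mmul d (mmul d U V) (mtr (mmul d U V)) i j = mmul d U (mmul d (mmul d V (mtr V)) (mtr U)) i j"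
      by (simp add: mtr_mmul mmul_assoc)
    also have "\<dots> = mmul d U (mmul d mid (mtr U)) i j"
      by (intro mmul_cong refl) (use V that in auto)
    also have "\<dots> = mmul d U (mtr U) i j"
      by (rule mmul_cong) (use that in \<open>auto simp: mmul_mid_left\<close>)
    finally show ?thesis using U that by simp
  qed
  show ?thesis
    using *[of _ _ U V] *[of _ _ "mtr V" "mtr U"] assms
    unfolding orthogonal_mat_def by (simp add: mtr_mmul mtr_mtr)
qed

text \<open>Rows are matched one at a time by a reflection that fixes the rows matched before.\<close>

lemma gram_eq_imp_orthogonal_mat:
  assumes "\<And>f g. f < F \<Longrightarrow> g < F \<Longrightarrow> mmul d A (mtr A) f g = mmul d B (mtr B) f g"
  shows "\<exists>U. orthogonal_mat d U \<and> (\<forall>f<F. \<forall>k<d. A f k = mmul d B U f k)"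
  using assms
proof (induction F)
  case 0
  have "mtr mid = mid" by (auto simp: mtr_def mid_def fun_eq_iff)
  then have "orthogonal_mat d mid" by (simp add: orthogonal_mat_def mmul_mid_left)
  then show ?case by auto
next
  case (Suc F)
  then obtain U where U: "orthogonal_mat d U" and AU: "\<And>f k. f < F \<Longrightarrow> k < d \<Longrightarrow> A f k = mmul d B U f k"
    by (metis less_SucI)
  define r where "r k = mmul d B U F k" for k
  define n where "n k = r k - A F k" for k
  define q where "q = (\<Sum>k<d. (n k)\<^sup>2)"
  have BU: "(\<Sum>k<d. mmul d B U f k * mmul d B U g k) = (\<Sum>k<d. B f k * B g k)" for f g
  proof -
    have "(\<Sum>k<d. mmul d B U f k * mmul d B U g k) = mmul d (mmul d B U) (mtr (mmul d B U)) f g"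
      by (simp add: mmul_def[of d "mmul d B U"] mtr_def)
    also have "\<dots> = mmul d B (mmul d (mmul d U (mtr U)) (mtr B)) f g" by (simp add: mtr_mmul mmul_assoc)
    also have "\<dots> = mmul d B (mmul d mid (mtr B)) f g"
      by (intro mmul_cong refl) (use U in \<open>auto simp: orthogonal_mat_def\<close>)
    also have "\<dots> = mmul d B (mtr B) f g" by (rule mmul_cong) (auto simp: mmul_mid_left)
    finally show ?thesis by (simp add: mmul_def mtr_def)
  qed
  have gram: "(\<Sum>k<d. A f k * A g k) = (\<Sum>k<d. B f k * B g k)" if "f < Suc F" "g < Suc F" for f g
    using Suc.prems[OF that] by (simp add: mmul_def mtr_def)
  have rr: "(\<Sum>k<d. r k * r k) = (\<Sum>k<d. A F k * A F k)"
    unfolding r_def BU using gram[of F F] by simp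
  have Ar: "(\<Sum>k<d. A f k * n k) = 0" if "f < F" for f
  proof -
    have "(\<Sum>k<d. A f k * r k) = (\<Sum>k<d. mmul d B U f k * mmul d B U F k)"
      by (rule sum.cong) (use AU that in \<open>auto simp: r_def\<close>)
    also have "\<dots> = (\<Sum>k<d. A f k * A F k)" unfolding BU using gram[of f F] that by simp
    finally show ?thesis by (simp add: n_def right_diff_distrib sum_subtractf)
  qed
  have rn: "2 * (\<Sum>k<d. r k * n k) = q"
  proof -
    have "q = (\<Sum>k<d. r k * r k) - 2 * (\<Sum>k<d. r k * A F k) + (\<Sum>k<d. A F k * A F k)"
      by (simp add: q_def n_def power2_eq_square algebra_simps sum.distrib sum_subtractf sum_distrib_left)
    then show ?thesis by (simp add: rr n_def right_diff_distrib sum_subtractf)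
  qed
  show ?case
  proof (cases "q = 0")
    case True
    have "n k = 0" if "k < d" for k
      using True that unfolding q_def by (subst (asm) sum_nonneg_eq_0_iff) auto
    then have "A F k = mmul d B U F k" if "k < d" for k using that by (simp add: n_def r_def)
    then show ?thesis using U AU by (auto simp: less_Suc_eq)
  next
    case False
    define V where "V l k = mid l k - 2 * n l * n k / q" for l k
    have uV: "(\<Sum>l<d. u l * V l k) = u k - 2 * (\<Sum>l<d. u l * n l) * n k / q" if "k < d" for u k
    proof -
      have "(\<Sum>l<d. u l * V l k) = (\<Sum>l<d. u l * mid l k) - (\<Sum>l<d. 2 * (u l * n l) * n k / q)"
        by (simp add: V_def right_diff_distrib sum_subtractf mult_ac)
      also have "(\<Sum>l<d. u l * mid l k) = u k"
        using mmul_mid_right[OF that, of "\<lambda>_. u"] by (simp add: mmul_def)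
      also have "(\<Sum>l<d. 2 * (u l * n l) * n k / q) = 2 * (\<Sum>l<d. u l * n l) * n k / q"
        by (simp add: sum_distrib_left sum_distrib_right sum_divide_distrib)
      finally show ?thesis .
    qed
    have Vsym: "mtr V = V" by (auto simp: mtr_def V_def mid_def fun_eq_iff)
    have VV: "mmul d V V i j = mid i j" if "i < d" "j < d" for i j
    proof -
      have Vn: "(\<Sum>l<d. V i l * n l) = - n i"
      proof -
        have "(\<Sum>l<d. V i l * n l) = (\<Sum>l<d. n l * V l i)"
          by (rule sum.cong) (auto simp: V_def mid_def)
        also have "\<dots> = n i - 2 * q * n i / q" unfolding uV[OF that(1)] by (simp add: q_def power2_eq_square)
        finally show ?thesis using False by simp
      qed
      show ?thesis unfolding mmul_def uV[OF that(2)] Vn using False by (simp add: V_def)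
    qed
    have "orthogonal_mat d V" by (simp add: orthogonal_mat_def Vsym VV)
    then have O: "orthogonal_mat d (mmul d U V)" by (rule orthogonal_mat_mmul[OF U])
    have "A f k = mmul d B (mmul d U V) f k" if "f < Suc F" "k < d" for f k
    proof (cases "f < F")
      case True
      have "mmul d B (mmul d U V) f k = (\<Sum>l<d. mmul d B U f l * V l k)"
        unfolding mmul_assoc[symmetric] by (simp add: mmul_def[of d "mmul d B U"])
      also have "\<dots> = (\<Sum>l<d. A f l * V l k)" by (rule sum.cong) (use AU True in auto)
      also have "\<dots> = A f k" unfolding uV[OF that(2)] Ar[OF True] by simp
      finally show ?thesis by simp
    next
      case f: False
      then have "f = F" using that by simp
      then have "mmul d B (mmul d U V) f k = (\<Sum>l<d. r l * V l k)"
        unfolding mmul_assoc[symmetric] by (simp add: mmul_def[of d "mmul d B U"] r_def)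
      also have "\<dots> = r k - n k" unfolding uV[OF that(2)] rn using False by simp
      finally show ?thesis using \<open>f = F\<close> by (simp add: n_def)
    qed
    then show ?thesis using O by blast
  qed
qed

lemma posdef_standardize:
  assumes A: "posdef d A"
    and R: "\<And>f g. f < F \<Longrightarrow> g < F \<Longrightarrow> mmul d R (mtr R) f g = mmul d (mmul d W (minv d A)) (mtr W) f g"
  obtains C E where "\<And>k l. k < d \<Longrightarrow> l < d \<Longrightarrow> mmul d (mmul d C A) (mtr C) k l = mid k l"
    "\<And>i j. i < d \<Longrightarrow> j < d \<Longrightarrow> mmul d E C i j = mid i j"
    "\<And>i j. i < d \<Longrightarrow> j < d \<Longrightarrow> mmul d (mtr C) C i j = minv d A i j"
    "\<And>f k. f < F \<Longrightarrow> k < d \<Longrightarrow> mmul d W (mtr C) f k = R f k"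
proof -
  obtain C0 E0 where C0: "\<And>k l. k < d \<Longrightarrow> l < d \<Longrightarrow> mmul d (mmul d C0 A) (mtr C0) k l = mid k l"
    and E0: "\<And>i j. i < d \<Longrightarrow> j < d \<Longrightarrow> mmul d E0 C0 i j = mid i j"
    and AC: "\<And>i j. i < d \<Longrightarrow> j < d \<Longrightarrow> mmul d A (mmul d (mtr C0) C0) i j = mid i j"
    using posdef_factor[OF A] by blast
  have inv: "mmul d (mtr C0) C0 i j = minv d A i j" if "i < d" "j < d" for i j
    using minv_symmetric(4)[OF posdef_sym[OF A] posdef_nonsingular[OF A] AC that] by simp
  have "mmul d R (mtr R) f g = mmul d (mmul d W (mtr C0)) (mtr (mmul d W (mtr C0))) f g" if "f < F" "g < F" for f g
  proof -
    have "mmul d (mmul d W (mtr C0)) (mtr (mmul d W (mtr C0))) f g = mmul d (mmul d W (mmul d (mtr C0) C0)) (mtr W) f g"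
      by (simp add: mtr_mmul mtr_mtr mmul_assoc)
    also have "\<dots> = mmul d (mmul d W (minv d A)) (mtr W) f g"
      by (intro mmul_cong refl) (use inv in auto)
    finally show ?thesis using R that by simp
  qed
  then obtain U where U: "orthogonal_mat d U" and RU: "\<And>f k. f < F \<Longrightarrow> k < d \<Longrightarrow> R f k = mmul d (mmul d W (mtr C0)) U f k"
    using gram_eq_imp_orthogonal_mat[of F d R "mmul d W (mtr C0)"] by blast
  define C where "C = mmul d (mtr U) C0"
  define E where "E = mmul d E0 U"
  show ?thesis
  proof (rule that[of C E])
    fix k l assume kl: "k < d" "l < d"
    have "mmul d (mmul d C A) (mtr C) k l = mmul d (mtr U) (mmul d (mmul d (mmul d C0 A) (mtr C0)) U) k l"
      by (simp add: C_def mtr_mmul mtr_mtr mmul_assoc)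
    also have "\<dots> = mmul d (mtr U) (mmul d mid U) k l"
      by (intro mmul_cong refl) (use C0 in auto)
    also have "\<dots> = mmul d (mtr U) U k l" by (rule mmul_cong) (auto simp: mmul_mid_left)
    finally show "mmul d (mmul d C A) (mtr C) k l = mid k l" using U kl by (simp add: orthogonal_mat_def)
  next
    fix i j assume ij: "i < d" "j < d"
    have mid': "mmul d X (mmul d (mmul d U (mtr U)) Y) i j = mmul d X Y i j" for X Y
    proof -
      have "mmul d X (mmul d (mmul d U (mtr U)) Y) i j = mmul d X (mmul d mid Y) i j"
        by (intro mmul_cong refl) (use U in \<open>auto simp: orthogonal_mat_def\<close>)
      also have "\<dots> = mmul d X Y i j" by (rule mmul_cong) (auto simp: mmul_mid_left)
      finally show ?thesis .
    qed
    show "mmul d E C i j = mid i j"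
      using mid'[of E0 C0] E0[OF ij] by (simp add: E_def C_def mmul_assoc)
    show "mmul d (mtr C) C i j = minv d A i j"
      using mid'[of "mtr C0" C0] inv[OF ij] by (simp add: C_def mtr_mmul mtr_mtr mmul_assoc)
  next
    fix f k assume "f < F" "k < d"
    then show "mmul d W (mtr C) f k = R f k"
      using RU[of f k] by (simp add: C_def mtr_mmul mtr_mtr mmul_assoc)
  qed
qed

section \<open>Factorial contrasts\<close>

lemma sel_bij: "finite I \<Longrightarrow> bij_betw (sel I) {..<card I} I"
  unfolding sel_def
  using bij_betw_nth[of "sorted_list_of_set I" "{..<card I}" I] by simp

lemma sel_in: "finite I \<Longrightarrow> j < card I \<Longrightarrow> sel I j \<in> I"
  using sel_bij[of I] by (auto simp: bij_betw_def)

lemma sel_inj: "finite I \<Longrightarrow> j < card I \<Longrightarrow> k < card I \<Longrightarrow> sel I j = sel I k \<longleftrightarrow> j = k"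
  using sel_bij[of I] by (auto simp: bij_betw_def inj_on_def)

lemma sel_surj: "finite I \<Longrightarrow> i \<in> I \<Longrightarrow> \<exists>j<card I. i = sel I j"
  using sel_bij[of I] by (auto simp: bij_betw_def)

lemma sum_div_mod: "(\<Sum>i<L * J. f (i div L) (i mod L)) = (\<Sum>j<J. \<Sum>l<L. f j l)" for L :: nat
proof -
  have "(\<Sum>j<J. \<Sum>l<L. f j l) = (\<Sum>(j, l)\<in>{..<J} \<times> {..<L}. f j l)"
    by (rule sum.cartesian_product)
  also have "\<dots> = (\<Sum>i<L * J. f (i div L) (i mod L))"
  proof (rule sum.reindex_bij_witness[of _ "\<lambda>i. (i div L, i mod L)" "\<lambda>(j, l). j * L + l"])
    fix p assume "p \<in> {..<J} \<times> {..<L}"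
    then obtain j l where p: "p = (j, l)" "j < J" "l < L" by auto
    have "j * L + l < Suc j * L" using p by simp
    also have "\<dots> \<le> J * L" using p by (intro mult_le_mono) auto
    finally show "(case p of (j, l) \<Rightarrow> j * L + l) \<in> {..<L * J}" using p by (simp add: mult.commute)
    show "((case p of (j, l) \<Rightarrow> j * L + l) div L, (case p of (j, l) \<Rightarrow> j * L + l) mod L) = p" using p by simp
    show "f ((case p of (j, l) \<Rightarrow> j * L + l) div L) ((case p of (j, l) \<Rightarrow> j * L + l) mod L) = (case p of (j, l) \<Rightarrow> f j l)"
      using p by simp
  next
    fix i assume i: "i \<in> {..<L * J}"
    then have "L > 0" by (cases L) auto
    then show "(i div L, i mod L) \<in> {..<J} \<times> {..<L}" using i by (simp add: less_mult_imp_div_less mult.commute)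
    show "(case (i div L, i mod L) of (j, l) \<Rightarrow> j * L + l) = i" by simp
  qed
  finally show ?thesis ..
qed

lemma sum_lessThan_add: "(\<Sum>k<t + p. f k) = (\<Sum>k<t. f k) + (\<Sum>k<p. f (t + k))" for f :: "nat \<Rightarrow> real"
  by (induction p) (auto simp: add.assoc)

locale factorial_design =
  fixes K H :: nat and iota :: "nat \<Rightarrow> nat \<Rightarrow> real" and eff T :: "nat \<Rightarrow> nat set"
  assumes K: "K \<ge> 1"
    and iota: "bij_betw (\<lambda>q. restrict (iota q) {..<K}) {..<2^K} ({..<K} \<rightarrow>\<^sub>E {-1, 1})"
    and eff: "bij_betw eff {..<2^K - 1} {A. A \<subseteq> {..<K} \<and> A \<noteq> {}}"
    and H: "H \<ge> 1"
    and tiers_cover: "(\<Union>h\<in>{1..H}. T h) = {..<2^K - 1}"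
    and tiers_ne: "\<forall>h\<in>{1..H}. T h \<noteq> {}"
    and tiers_disj: "\<forall>h\<in>{1..H}. \<forall>l\<in>{1..H}. h \<noteq> l \<longrightarrow> T h \<inter> T l = {}"
begin

abbreviation "Q \<equiv> (2::nat) ^ K"
abbreviation "F \<equiv> (2::nat) ^ K - 1"
abbreviation "g \<equiv> geff iota eff"
abbreviation "s \<equiv> (1::real) / 2 ^ (K - 1)"

lemma iota_pm: "q < Q \<Longrightarrow> k < K \<Longrightarrow> iota q k = - 1 \<or> iota q k = 1"
proof -
  assume "q < Q" "k < K"
  then have "restrict (iota q) {..<K} \<in> {..<K} \<rightarrow>\<^sub>E {-1, 1}" using bij_betwE[OF iota] by blast
  then have "restrict (iota q) {..<K} k \<in> {-1, 1}" by (rule PiE_mem) (use \<open>k < K\<close> in simp)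
  then show ?thesis using \<open>k < K\<close> by simp
qed

lemma sum_prod_iota:
  assumes C: "C \<subseteq> {..<K}"
  shows "(\<Sum>q<Q. \<Prod>k\<in>C. iota q k) = (if C = {} then real Q else 0)"
proof (cases "C = {}")
  case False
  then obtain k0 where k0: "k0 \<in> C" by auto
  have "(\<Sum>q<Q. \<Prod>k\<in>C. iota q k) = (\<Sum>q<Q. \<Prod>k\<in>{..<K}. if k \<in> C then restrict (iota q) {..<K} k else 1)"
  proof (rule sum.cong[OF refl])
    fix q
    have "(\<Prod>k\<in>{..<K}. if k \<in> C then restrict (iota q) {..<K} k else 1) = (\<Prod>k\<in>C. restrict (iota q) {..<K} k)"
      using C by (subst prod.inter_restrict[symmetric]) (auto simp: Int_absorb1)
    then show "(\<Prod>k\<in>C. iota q k) = (\<Prod>k\<in>{..<K}. if k \<in> C then restrict (iota q) {..<K} k else 1)"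
      using C by (auto intro!: prod.cong)
  qed
  also have "\<dots> = (\<Sum>x\<in>{..<K} \<rightarrow>\<^sub>E {-1, 1}. \<Prod>k\<in>{..<K}. if k \<in> C then x k else 1)"
    by (rule sum.reindex_bij_betw[OF iota])
  also have "\<dots> = (\<Prod>k\<in>{..<K}. \<Sum>y\<in>{-1, 1::real}. if k \<in> C then y else 1)"
    by (rule prod_sum_PiE[symmetric]) auto
  also have "\<dots> = 0"
    using k0 C by (intro prod_zero) (auto intro!: bexI[of _ k0])
  finally show ?thesis using False by simp
qed simp

lemma eff_sub: "f < F \<Longrightarrow> eff f \<subseteq> {..<K} \<and> eff f \<noteq> {}"
  using eff by (auto simp: bij_betw_def)

lemma g_eq: "g f q = (\<Prod>k\<in>eff f. iota q k)"
  by (simp add: geff_def)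

lemma sum_effect: "f < F \<Longrightarrow> (\<Sum>q<Q. g f q) = 0"
  unfolding g_eq using sum_prod_iota[of "eff f"] eff_sub[of f] by simp

lemma effects_orthogonal:
  assumes f: "f < F" "f' < F"
  shows "(\<Sum>q<Q. g f q * g f' q) = (if f = f' then real Q else 0)"
proof -
  have fin: "finite (eff f)" "finite (eff f')" using eff_sub[OF f(1)] eff_sub[OF f(2)] finite_subset by auto
  let ?C = "(eff f - eff f') \<union> (eff f' - eff f)"
  have "g f q * g f' q = (\<Prod>k\<in>?C. iota q k)" if q: "q < Q" for q
  proof -
    have sq: "(\<Prod>k\<in>eff f \<inter> eff f'. iota q k) * (\<Prod>k\<in>eff f \<inter> eff f'. iota q k) = 1"
      unfolding prod.distrib[symmetric]
      by (rule prod.neutral) (use iota_pm[OF q] eff_sub[OF f(1)] in fastforce)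
    have "g f q = (\<Prod>k\<in>eff f - eff f'. iota q k) * (\<Prod>k\<in>eff f \<inter> eff f'. iota q k)"
      unfolding g_eq using fin by (subst prod.union_disjoint[symmetric]) (auto intro!: prod.cong)
    moreover have "g f' q = (\<Prod>k\<in>eff f' - eff f. iota q k) * (\<Prod>k\<in>eff f \<inter> eff f'. iota q k)"
      unfolding g_eq using fin by (subst prod.union_disjoint[symmetric]) (auto intro!: prod.cong)
    moreover have "(\<Prod>k\<in>?C. iota q k) = (\<Prod>k\<in>eff f - eff f'. iota q k) * (\<Prod>k\<in>eff f' - eff f. iota q k)"
      using fin by (intro prod.union_disjoint) auto
    ultimately show ?thesis using sq by (simp add: mult_ac)
  qed
  then have "(\<Sum>q<Q. g f q * g f' q) = (\<Sum>q<Q. \<Prod>k\<in>?C. iota q k)" by simp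
  also have "\<dots> = (if ?C = {} then real Q else 0)"
    using eff_sub[OF f(1)] eff_sub[OF f(2)] by (intro sum_prod_iota) auto
  also have "?C = {} \<longleftrightarrow> f = f'"
  proof -
    have "?C = {} \<longleftrightarrow> eff f = eff f'" by auto
    also have "\<dots> \<longleftrightarrow> f = f'" using eff f by (auto simp: bij_betw_def inj_on_def)
    finally show ?thesis .
  qed
  finally show ?thesis .
qed

lemma effects_complete:
  assumes q: "q < Q" "r < Q"
  shows "1 + (\<Sum>f<F. g f q * g f r) = (if q = r then real Q else 0)"
proof -
  have "(\<Sum>f<F. g f q * g f r) = (\<Sum>f<F. \<Prod>k\<in>eff f. iota q k * iota r k)"
    by (simp add: g_eq prod.distrib)
  also have "\<dots> = (\<Sum>A\<in>{A. A \<subseteq> {..<K} \<and> A \<noteq> {}}. \<Prod>k\<in>A. iota q k * iota r k)"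
    by (rule sum.reindex_bij_betw[OF eff])
  finally have "1 + (\<Sum>f<F. g f q * g f r) = (\<Sum>A\<in>insert {} {A. A \<subseteq> {..<K} \<and> A \<noteq> {}}. \<Prod>k\<in>A. iota q k * iota r k)"
    by simp
  also have "insert {} {A. A \<subseteq> {..<K} \<and> A \<noteq> {}} = Pow {..<K}" by auto
  also have "(\<Sum>A\<in>Pow {..<K}. \<Prod>k\<in>A. iota q k * iota r k) = (\<Prod>k<K. iota q k * iota r k + 1)"
    by (subst prod_add) auto
  also have "\<dots> = (if q = r then real Q else 0)"
  proof (cases "q = r")
    case True
    have "(\<Prod>k<K. iota q k * iota r k + 1) = (\<Prod>k<K. 2)"
      by (rule prod.cong) (use iota_pm[OF q(1)] True in fastforce)+
    then show ?thesis using True by simp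
  next
    case False
    then have "restrict (iota q) {..<K} \<noteq> restrict (iota r) {..<K}"
      using iota q by (auto simp: bij_betw_def inj_on_def)
    then obtain k where k: "k < K" "iota q k \<noteq> iota r k" by (metis lessThan_iff restrict_ext)
    then have "iota q k * iota r k + 1 = 0" using iota_pm[OF q(1) k(1)] iota_pm[OF q(2) k(1)] by auto
    then show ?thesis using k False by (auto intro: prod_zero)
  qed
  finally show ?thesis .
qed

lemma effects_independent:
  assumes "finite J" "inj_on \<phi> J" "\<phi> ` J \<subseteq> {..<F}" "\<And>q. q < Q \<Longrightarrow> (\<Sum>j\<in>J. v j * g (\<phi> j) q) = 0" "j0 \<in> J"
  shows "v j0 = 0"
proof -
  have "0 = (\<Sum>q<Q. (\<Sum>j\<in>J. v j * g (\<phi> j) q) * g (\<phi> j0) q)" using assms(4) by simp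
  also have "\<dots> = (\<Sum>q<Q. \<Sum>j\<in>J. v j * (g (\<phi> j) q * g (\<phi> j0) q))"
    by (simp add: sum_distrib_right mult.assoc)
  also have "\<dots> = (\<Sum>j\<in>J. \<Sum>q<Q. v j * (g (\<phi> j) q * g (\<phi> j0) q))" by (rule sum.swap)
  also have "\<dots> = (\<Sum>j\<in>J. v j * (\<Sum>q<Q. g (\<phi> j) q * g (\<phi> j0) q))" by (simp only: sum_distrib_left)
  also have "\<dots> = (\<Sum>j\<in>J. if j = j0 then v j0 * real Q else 0)"
  proof (rule sum.cong[OF refl])
    fix j assume "j \<in> J"
    then have "\<phi> j < F" "\<phi> j0 < F" "\<phi> j = \<phi> j0 \<longleftrightarrow> j = j0" using assms by (auto simp: inj_on_def)
    then show "v j * (\<Sum>q<Q. g (\<phi> j) q * g (\<phi> j0) q) = (if j = j0 then v j0 * real Q else 0)"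
      by (simp add: effects_orthogonal)
  qed
  also have "\<dots> = v j0 * real Q" using assms by simp
  finally show ?thesis by simp
qed

lemma T_sub: "h \<in> {1..H} \<Longrightarrow> T h \<subseteq> {..<F}"
  using UN_upper[of h "{1..H}" T] unfolding tiers_cover .

lemma finite_T: "h \<in> {1..H} \<Longrightarrow> finite (T h)"
  by (rule finite_subset[OF T_sub]) auto

lemma Tbar_sub: "h \<le> H \<Longrightarrow> Tbar T h \<subseteq> {..<F}"
  unfolding Tbar_def by (rule UN_least, rule T_sub) simp

lemma finite_Tbar: "h \<le> H \<Longrightarrow> finite (Tbar T h)"
  by (rule finite_subset[OF Tbar_sub]) auto

lemma T_Tbar_disj:
  assumes "h \<in> {1..H}"
  shows "T h \<inter> Tbar T (h - 1) = {}"
proof -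
  have "T h \<inter> T l = {}" if "l \<in> {1..h - 1}" for l
    using tiers_disj[rule_format, of h l] assms that by fastforce
  then show ?thesis unfolding Tbar_def Int_UN_distrib by simp
qed

definition effect_gram :: "(nat \<Rightarrow> real) \<Rightarrow> rmat" where
  "effect_gram w f f' = (1 / 2 ^ (2 * (K - 1))) * (\<Sum>q<Q. w q * g f q * g f' q)"

lemma Btil_effect_gram: "Btil K iota eff nq = effect_gram (\<lambda>q. 1 / real (nq q))"
  by (simp add: Btil_def effect_gram_def fun_eq_iff)

lemma effect_gram_sym: "effect_gram w f f' = effect_gram w f' f"
  by (simp add: effect_gram_def mult_ac)

lemma posdef_effect_gram:
  assumes w: "\<And>q. q < Q \<Longrightarrow> w q > 0" and P: "P \<subseteq> {..<F}"
  shows "posdef (card P) (submat P P (effect_gram w))"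
  unfolding posdef_def
proof (intro conjI allI impI)
  show "submat P P (effect_gram w) i j = submat P P (effect_gram w) j i" for i j by (simp add: submat_def effect_gram_sym)
  have fin: "finite P" using P finite_subset by blast
  fix v :: rvec assume "\<exists>i<card P. v i \<noteq> 0"
  then obtain i where i: "i < card P" "v i \<noteq> 0" by auto
  define u where "u q = (\<Sum>k<card P. v k * g (sel P k) q)" for q
  have "bilin (card P) (submat P P (effect_gram w)) v v =
    (\<Sum>i<card P. \<Sum>j<card P. \<Sum>q<Q. (1 / 2 ^ (2 * (K - 1))) * w q * ((v i * g (sel P i) q) * (v j * g (sel P j) q)))"
    unfolding bilin_def submat_def effect_gram_def sum_distrib_left sum_distrib_right
    by (intro sum.cong refl) (simp add: mult_ac)
  also have "\<dots> = (\<Sum>i<card P. \<Sum>q<Q. \<Sum>j<card P. (1 / 2 ^ (2 * (K - 1))) * w q * ((v i * g (sel P i) q) * (v j * g (sel P j) q)))"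
    by (rule sum.cong[OF refl], rule sum.swap)
  also have "\<dots> = (\<Sum>q<Q. \<Sum>i<card P. \<Sum>j<card P. (1 / 2 ^ (2 * (K - 1))) * w q * ((v i * g (sel P i) q) * (v j * g (sel P j) q)))"
    by (rule sum.swap)
  also have "\<dots> = (\<Sum>q<Q. (1 / 2 ^ (2 * (K - 1))) * w q * (u q)\<^sup>2)"
    unfolding u_def power2_eq_square sum_product by (simp only: sum_distrib_left)
  finally have eq: "bilin (card P) (submat P P (effect_gram w)) v v = (\<Sum>q<Q. (1 / 2 ^ (2 * (K - 1))) * w q * (u q)\<^sup>2)" .
  have "\<exists>q<Q. u q \<noteq> 0"
  proof (rule ccontr)
    assume "\<not> ?thesis"
    then have "v i = 0"
      using effects_independent[of "{..<card P}" "sel P" v i] sel_bij[OF fin] P i by (auto simp: u_def bij_betw_def)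
    then show False using i by simp
  qed
  then obtain q where q: "q < Q" "u q \<noteq> 0" by auto
  have "0 < (1 / 2 ^ (2 * (K - 1))) * w q * (u q)\<^sup>2" using w[OF q(1)] q by simp
  also have "\<dots> \<le> (\<Sum>q<Q. (1 / 2 ^ (2 * (K - 1))) * w q * (u q)\<^sup>2)"
    by (rule member_le_sum) (use q w in \<open>auto intro!: mult_nonneg_nonneg simp: less_imp_le\<close>)
  finally show "bilin (card P) (submat P P (effect_gram w)) v v > 0" unfolding eq .
qed

definition proj :: "(nat \<Rightarrow> real) \<Rightarrow> nat \<Rightarrow> rmat" where
  "proj w h = (let P = Tbar T (h - 1) in mmul (card P) (submat (T h) P (effect_gram w)) (minv (card P) (submat P P (effect_gram w))))"

text \<open>With \<open>w q = 1/n_q\<close> these are the paper's \<open>c_q[h]\<close>; they are invariant under rescaling of \<open>w\<close>, so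
  that \<open>w q = lim n/n_q\<close> gives their limits.\<close>

definition contrast :: "(nat \<Rightarrow> real) \<Rightarrow> nat \<Rightarrow> nat \<Rightarrow> rvec" where
  "contrast w h q j = g (sel (T h) j) q - (\<Sum>k<card (Tbar T (h - 1)). proj w h j k * g (sel (Tbar T (h - 1)) k) q)"

lemma cvec_contrast:
  assumes "h \<ge> 1"
  shows "cvec K iota eff nq T h q = contrast (\<lambda>q. 1 / real (nq q)) h q"
proof (cases "h = 1")
  case True
  then show ?thesis by (simp add: cvec_def contrast_def subvec_def Tbar_def fun_eq_iff)
next
  case False
  then have h: "\<not> h \<le> 1" using assms by simp
  let ?P = "Tbar T (h - 1)" and ?B = "effect_gram (\<lambda>q. 1 / real (nq q))"
  have "(\<Sum>k<card ?P. \<Sum>k'<card ?P. submat (T h) ?P ?B j k * minv (card ?P) (submat ?P ?P ?B) k k' * g (sel ?P k') q)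
     = (\<Sum>k'<card ?P. proj (\<lambda>q. 1 / real (nq q)) h j k' * g (sel ?P k') q)" for j
    unfolding proj_def Let_def mmul_def sum_distrib_right by (rule sum.swap)
  then show ?thesis using h by (simp add: cvec_def Btil_effect_gram contrast_def subvec_def fun_eq_iff Let_def)
qed

lemma sum_contrast:
  assumes h: "h \<in> {1..H}" and j: "j < card (T h)"
  shows "(\<Sum>q<Q. contrast w h q j) = 0"
proof -
  let ?P = "Tbar T (h - 1)"
  have hH: "h - 1 \<le> H" using h by auto
  have P: "finite ?P" "?P \<subseteq> {..<F}" by (rule finite_Tbar[OF hH], rule Tbar_sub[OF hH])
  have "(\<Sum>q<Q. \<Sum>k<card ?P. proj w h j k * g (sel ?P k) q) = (\<Sum>k<card ?P. proj w h j k * (\<Sum>q<Q. g (sel ?P k) q))"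
    by (subst sum.swap) (simp only: sum_distrib_left)
  also have "\<dots> = 0"
  proof (rule sum.neutral, rule)
    fix k assume "k \<in> {..<card ?P}"
    then have "sel ?P k < F" using subsetD[OF P(2) sel_in[OF P(1), of k]] by simp
    then show "proj w h j k * (\<Sum>q<Q. g (sel ?P k) q) = 0" by (simp only: sum_effect mult_zero_right)
  qed
  finally show ?thesis
    using sum_effect[of "sel (T h) j"] subsetD[OF T_sub[OF h] sel_in[OF finite_T[OF h] j]] by (simp add: contrast_def sum_subtractf)
qed

lemma contrast_orthogonal_effect:
  assumes w: "\<And>q. q < Q \<Longrightarrow> w q > 0" and h: "h \<in> {1..H}" and f: "f \<in> Tbar T (h - 1)"
  shows "(\<Sum>q<Q. w q * contrast w h q j * g f q) = 0"
proof -
  let ?P = "Tbar T (h - 1)"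
  let ?p = "card ?P"
  let ?B = "submat ?P ?P (effect_gram w)"
  have hH: "h - 1 \<le> H" using h by auto
  have P: "finite ?P" "?P \<subseteq> {..<F}" by (rule finite_Tbar[OF hH], rule Tbar_sub[OF hH])
  obtain k0 where k0: "k0 < ?p" "f = sel ?P k0" using sel_surj[OF P(1) f] by auto
  have pd: "posdef ?p ?B" by (rule posdef_effect_gram[OF w P(2)])
  have "(1 / 2 ^ (2 * (K - 1))) * (\<Sum>q<Q. w q * contrast w h q j * g f q)
     = effect_gram w (sel (T h) j) f - (\<Sum>k<?p. proj w h j k * effect_gram w (sel ?P k) f)"
  proof -
    have "(\<Sum>q<Q. w q * contrast w h q j * g f q) = (\<Sum>q<Q. w q * g (sel (T h) j) q * g f q) - (\<Sum>q<Q. \<Sum>k<?p. proj w h j k * (w q * g (sel ?P k) q * g f q))"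
      by (simp add: contrast_def algebra_simps sum_subtractf sum_distrib_left sum_distrib_right)
    also have "(\<Sum>q<Q. \<Sum>k<?p. proj w h j k * (w q * g (sel ?P k) q * g f q)) = (\<Sum>k<?p. \<Sum>q<Q. proj w h j k * (w q * g (sel ?P k) q * g f q))"
      by (rule sum.swap)
    finally show ?thesis
      by (simp add: effect_gram_def right_diff_distrib sum_distrib_left mult_ac)
  qed
  also have "(\<Sum>k<?p. proj w h j k * effect_gram w (sel ?P k) f) = mmul ?p (proj w h) ?B j k0"
    by (simp add: mmul_def submat_def k0)
  also have "\<dots> = mmul ?p (submat (T h) ?P (effect_gram w)) (mmul ?p (minv ?p ?B) ?B) j k0"
    by (simp add: proj_def Let_def mmul_assoc)
  also have "\<dots> = mmul ?p (submat (T h) ?P (effect_gram w)) mid j k0"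
    by (rule mmul_cong) (use minv_symmetric(2)[OF posdef_sym[OF pd] posdef_nonsingular[OF pd]] k0 in auto)
  also have "\<dots> = effect_gram w (sel (T h) j) f" using k0 by (simp add: mmul_mid_right submat_def)
  finally show ?thesis by simp
qed

lemma contrast_orthogonal:
  assumes w: "\<And>q. q < Q \<Longrightarrow> w q > 0" and h: "h \<in> {1..H}" "l \<in> {1..H}" "h \<noteq> l"
    and j: "j < card (T h)" "i < card (T l)"
  shows "(\<Sum>q<Q. w q * contrast w h q j * contrast w l q i) = 0"
proof -
  have *: "(\<Sum>q<Q. w q * contrast w h q j * contrast w l q i) = 0"
    if h: "h \<in> {1..H}" "l \<in> {1..H}" "l < h" and j: "j < card (T h)" "i < card (T l)" for h l i j
  proof -
    let ?P = "Tbar T (l - 1)"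
    have P: "finite ?P" using finite_Tbar[of "l - 1"] h by auto
    have in1: "sel (T l) i \<in> Tbar T (h - 1)"
      using sel_in[OF finite_T[OF h(2)] j(2)] h unfolding Tbar_def by (auto intro!: bexI[of _ l])
    have in2: "sel ?P k \<in> Tbar T (h - 1)" if "k < card ?P" for k
    proof -
      have "?P \<subseteq> Tbar T (h - 1)" unfolding Tbar_def by (rule UN_mono) (use h in auto)
      then show ?thesis using sel_in[OF P that] by auto
    qed
    have "(\<Sum>q<Q. w q * contrast w h q j * contrast w l q i) = (\<Sum>q<Q. w q * contrast w h q j * g (sel (T l) i) q)
      - (\<Sum>q<Q. \<Sum>k<card ?P. proj w l i k * (w q * contrast w h q j * g (sel ?P k) q))"
      unfolding contrast_def[of w l] by (simp add: right_diff_distrib sum_subtractf sum_distrib_left mult_ac)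
    also have "(\<Sum>q<Q. \<Sum>k<card ?P. proj w l i k * (w q * contrast w h q j * g (sel ?P k) q))
       = (\<Sum>k<card ?P. \<Sum>q<Q. proj w l i k * (w q * contrast w h q j * g (sel ?P k) q))" by (rule sum.swap)
    also have "\<dots> = (\<Sum>k<card ?P. proj w l i k * (\<Sum>q<Q. w q * contrast w h q j * g (sel ?P k) q))" by (simp only: sum_distrib_left)
    also have "\<dots> = 0" using contrast_orthogonal_effect[OF w h(1) in2] by simp
    also have "(\<Sum>q<Q. w q * contrast w h q j * g (sel (T l) i) q) = 0" by (rule contrast_orthogonal_effect[OF w h(1) in1])
    finally show ?thesis by simp
  qed
  show ?thesis
  proof (cases "l < h")
    case True
    then show ?thesis using *[of h l j i] h j by auto
  next
    case False
    then have "(\<Sum>q<Q. w q * contrast w l q i * contrast w h q j) = 0" using *[of l h i j] h j by auto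
    then show ?thesis by (simp add: mult_ac)
  qed
qed

lemma contrast_independent:
  assumes h: "h \<in> {1..H}" and 0: "\<And>q. q < Q \<Longrightarrow> (\<Sum>j<card (T h). v j * contrast w h q j) = 0" and j: "j < card (T h)"
  shows "v j = 0"
proof -
  let ?P = "Tbar T (h - 1)"
  let ?p = "card ?P" and ?t = "card (T h)"
  have hH: "h - 1 \<le> H" using h by auto
  have P: "finite ?P" "?P \<subseteq> {..<F}" by (rule finite_Tbar[OF hH], rule Tbar_sub[OF hH])
  define \<phi> where "\<phi> k = (if k < ?t then sel (T h) k else sel ?P (k - ?t))" for k
  define u where "u k = (if k < ?t then v k else - (\<Sum>j<?t. v j * proj w h j (k - ?t)))" for k
  have "u j = 0"
  proof (rule effects_independent[of "{..<?t + ?p}" \<phi> u])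
    show "inj_on \<phi> {..<?t + ?p}"
    proof (rule inj_onI)
      fix x y assume xy: "x \<in> {..<?t + ?p}" "y \<in> {..<?t + ?p}" "\<phi> x = \<phi> y"
      have t: "\<phi> z \<in> T h" if "z < ?t" for z using sel_in[OF finite_T[OF h]] that by (simp add: \<phi>_def)
      have p: "\<phi> z \<in> ?P" if "\<not> z < ?t" "z < ?t + ?p" for z using sel_in[OF P(1)] that by (simp add: \<phi>_def)
      consider "x < ?t" "y < ?t" | "\<not> x < ?t" "\<not> y < ?t" using t p xy T_Tbar_disj[OF h] by fastforce
      then show "x = y"
      proof cases
        case 1
        then show ?thesis using xy sel_inj[OF finite_T[OF h]] by (simp add: \<phi>_def)
      next
        case 2
        then have "x - ?t = y - ?t" using xy sel_inj[OF P(1), of "x - ?t" "y - ?t"] by (simp add: \<phi>_def)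
        then show ?thesis using 2 by simp
      qed
    qed
    show "\<phi> ` {..<?t + ?p} \<subseteq> {..<F}"
    proof (rule image_subsetI)
      fix z assume "z \<in> {..<?t + ?p}"
      then show "\<phi> z \<in> {..<F}"
      proof (cases "z < ?t")
        case True
        then show ?thesis using subsetD[OF T_sub[OF h] sel_in[OF finite_T[OF h] True]] by (simp add: \<phi>_def)
      next
        case False
        then have "z - ?t < ?p" using \<open>z \<in> {..<?t + ?p}\<close> by auto
        then show ?thesis using subsetD[OF P(2) sel_in[OF P(1)]] False by (simp add: \<phi>_def)
      qed
    qed
    fix q assume q: "q < Q"
    have "(\<Sum>k<?t + ?p. u k * g (\<phi> k) q) = (\<Sum>k<?t. v k * g (sel (T h) k) q) - (\<Sum>k<?p. (\<Sum>j<?t. v j * proj w h j k) * g (sel ?P k) q)"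
      unfolding sum_lessThan_add by (simp add: u_def \<phi>_def sum_negf)
    also have "(\<Sum>k<?p. (\<Sum>j<?t. v j * proj w h j k) * g (sel ?P k) q) = (\<Sum>j<?t. v j * (\<Sum>k<?p. proj w h j k * g (sel ?P k) q))"
      unfolding sum_distrib_right sum_distrib_left by (subst sum.swap) (simp add: mult.assoc)
    also have "(\<Sum>k<?t. v k * g (sel (T h) k) q) - \<dots> = (\<Sum>j<?t. v j * contrast w h q j)"
      by (simp add: contrast_def right_diff_distrib sum_subtractf)
    finally show "(\<Sum>k<?t + ?p. u k * g (\<phi> k) q) = 0" using 0[OF q] by simp
  qed (use j in auto)
  then show ?thesis using j by (simp add: u_def)
qed

lemma effect_in_span_contrasts:
  assumes "f < F"
  shows "\<exists>\<alpha>. \<forall>q. g f q = (\<Sum>h\<in>{1..H}. \<Sum>j<card (T h). \<alpha> h j * contrast w h q j)"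
proof -
  have span: "\<forall>f\<in>T h. \<exists>\<alpha>. \<forall>q. g f q = (\<Sum>h\<in>{1..H}. \<Sum>j<card (T h). \<alpha> h j * contrast w h q j)" if "h \<in> {1..H}" for h
    using that
  proof (induction h rule: less_induct)
    case (less h)
    let ?P = "Tbar T (h - 1)"
    have P: "finite ?P" using finite_Tbar[of "h - 1"] less.prems by auto
    have IH: "\<exists>\<alpha>. \<forall>q. g f q = (\<Sum>h\<in>{1..H}. \<Sum>j<card (T h). \<alpha> h j * contrast w h q j)" if f: "f \<in> ?P" for f
    proof -
      obtain l where "l \<in> {1..h - 1}" "f \<in> T l" using f by (auto simp: Tbar_def)
      then show ?thesis using less.IH[of l] less.prems by auto
    qed
    show ?case
    proof
      fix f assume "f \<in> T h"
      then obtain j0 where j0: "j0 < card (T h)" "f = sel (T h) j0" using sel_surj[OF finite_T[OF less.prems]] by blast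
      have "\<forall>k. \<exists>\<alpha>. k < card ?P \<longrightarrow> (\<forall>q. g (sel ?P k) q = (\<Sum>h\<in>{1..H}. \<Sum>j<card (T h). \<alpha> h j * contrast w h q j))"
        using IH[OF sel_in[OF P]] by simp
      from choice[OF this] obtain \<beta> where \<beta>: "\<And>k q. k < card ?P \<Longrightarrow> g (sel ?P k) q = (\<Sum>h\<in>{1..H}. \<Sum>j<card (T h). \<beta> k h j * contrast w h q j)"
        by auto
      define \<alpha> where "\<alpha> l j = (if l = h \<and> j = j0 then 1 else 0) + (\<Sum>k<card ?P. proj w h j0 k * \<beta> k l j)" for l j
      have "g f q = (\<Sum>l\<in>{1..H}. \<Sum>j<card (T l). \<alpha> l j * contrast w l q j)" for q
      proof -
        have "g f q = contrast w h q j0 + (\<Sum>k<card ?P. proj w h j0 k * g (sel ?P k) q)" by (simp add: contrast_def j0)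
        also have "(\<Sum>k<card ?P. proj w h j0 k * g (sel ?P k) q)
           = (\<Sum>k<card ?P. \<Sum>l\<in>{1..H}. \<Sum>j<card (T l). proj w h j0 k * \<beta> k l j * contrast w l q j)"
        proof (rule sum.cong[OF refl])
          fix k assume "k \<in> {..<card ?P}"
          then have k: "k < card ?P" by (rule lessThan_iff[THEN iffD1])
          show "proj w h j0 k * g (sel ?P k) q = (\<Sum>l\<in>{1..H}. \<Sum>j<card (T l). proj w h j0 k * \<beta> k l j * contrast w l q j)"
            unfolding \<beta>[OF k] by (simp only: sum_distrib_left mult.assoc)
        qed
        also have "\<dots> = (\<Sum>l\<in>{1..H}. \<Sum>k<card ?P. \<Sum>j<card (T l). proj w h j0 k * \<beta> k l j * contrast w l q j)"
          by (rule sum.swap)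
        also have "\<dots> = (\<Sum>l\<in>{1..H}. \<Sum>j<card (T l). \<Sum>k<card ?P. proj w h j0 k * \<beta> k l j * contrast w l q j)"
          by (rule sum.cong[OF refl], rule sum.swap)
        also have "\<dots> = (\<Sum>l\<in>{1..H}. \<Sum>j<card (T l). (\<Sum>k<card ?P. proj w h j0 k * \<beta> k l j) * contrast w l q j)"
          by (simp only: sum_distrib_right)
        also have "contrast w h q j0 = (\<Sum>l\<in>{1..H}. \<Sum>j<card (T l). (if l = h \<and> j = j0 then 1 else 0) * contrast w l q j)"
        proof -
          have "(\<Sum>j<card (T l). (if l = h \<and> j = j0 then 1 else 0) * contrast w l q j) = (if l = h then contrast w h q j0 else 0)" for l
          proof (cases "l = h")
            case True
            have "(\<Sum>j<card (T l). (if l = h \<and> j = j0 then 1 else 0) * contrast w l q j) = (\<Sum>j<card (T h). if j = j0 then contrast w h q j else 0)"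
              using True by (intro sum.cong) auto
            then show ?thesis using True j0 by simp
          qed simp
          then show ?thesis using less.prems by simp
        qed
        finally show ?thesis by (simp only: \<alpha>_def distrib_right sum.distrib)
      qed
      then show "\<exists>\<alpha>. \<forall>q. g f q = (\<Sum>h\<in>{1..H}. \<Sum>j<card (T h). \<alpha> h j * contrast w h q j)" by blast
    qed
  qed
  have "f \<in> (\<Union>h\<in>{1..H}. T h)" unfolding tiers_cover using assms by simp
  then obtain h where h: "h \<in> {1..H}" "f \<in> T h" by (rule UN_E)
  show ?thesis using bspec[OF span[OF h(1)] h(2)] .
qed

lemma contrasts_and_sizes_span:
  fixes \<nu> :: "nat \<Rightarrow> real"
  assumes \<nu>: "(\<Sum>q<Q. \<nu> q) \<noteq> 0"
  shows "\<exists>\<alpha>. \<forall>q<Q. \<phi> q = (\<Sum>h\<in>{1..H}. \<Sum>j<card (T h). \<alpha> h j * contrast w h q j) + (\<Sum>r<Q. \<phi> r) / (\<Sum>r<Q. \<nu> r) * \<nu> q"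
proof -
  have exp: "\<phi> q = (\<Sum>r<Q. \<phi> r) / real Q + (\<Sum>f<F. (\<Sum>r<Q. \<phi> r * g f r) / real Q * g f q)" if q: "q < Q" for \<phi> q
  proof -
    have "real Q * \<phi> q = (\<Sum>r<Q. \<phi> r * (1 + (\<Sum>f<F. g f q * g f r)))"
    proof -
      have "(\<Sum>r<Q. \<phi> r * (1 + (\<Sum>f<F. g f q * g f r))) = (\<Sum>r<Q. if r = q then \<phi> q * real Q else 0)"
        by (rule sum.cong) (use effects_complete q in auto)
      then show ?thesis using q by simp
    qed
    also have "\<dots> = (\<Sum>r<Q. \<phi> r) + (\<Sum>r<Q. \<Sum>f<F. \<phi> r * g f r * g f q)"
      by (simp add: distrib_left sum.distrib sum_distrib_left mult_ac)
    also have "(\<Sum>r<Q. \<Sum>f<F. \<phi> r * g f r * g f q) = (\<Sum>f<F. \<Sum>r<Q. \<phi> r * g f r * g f q)" by (rule sum.swap)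
    also have "\<dots> = (\<Sum>f<F. (\<Sum>r<Q. \<phi> r * g f r) * g f q)" by (simp only: sum_distrib_right)
    finally have "real Q * \<phi> q = (\<Sum>r<Q. \<phi> r) + (\<Sum>f<F. (\<Sum>r<Q. \<phi> r * g f r) * g f q)" .
    then have "\<phi> q = ((\<Sum>r<Q. \<phi> r) + (\<Sum>f<F. (\<Sum>r<Q. \<phi> r * g f r) * g f q)) / real Q" by (simp add: field_simps)
    moreover have "(\<Sum>f<F. X f * g f q) / real Q = (\<Sum>f<F. X f / real Q * g f q)" for X
      by (simp add: sum_divide_distrib)
    ultimately show ?thesis by (simp only: add_divide_distrib)
  qed
  define c where "c = (\<Sum>r<Q. \<phi> r) / (\<Sum>r<Q. \<nu> r)"
  define \<gamma> where "\<gamma> f = (\<Sum>r<Q. (\<phi> r - c * \<nu> r) * g f r) / real Q" for f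
  have \<phi>q: "\<phi> q - c * \<nu> q = (\<Sum>f<F. \<gamma> f * g f q)" if "q < Q" for q
  proof -
    have "(\<Sum>r<Q. \<phi> r - c * \<nu> r) = (\<Sum>r<Q. \<phi> r) - c * (\<Sum>r<Q. \<nu> r)" by (simp add: sum_subtractf sum_distrib_left)
    then have "(\<Sum>r<Q. \<phi> r - c * \<nu> r) = 0" using \<nu> by (simp add: c_def)
    then show ?thesis using exp[OF that, of "\<lambda>r. \<phi> r - c * \<nu> r"] by (simp add: \<gamma>_def)
  qed
  have "\<forall>f. \<exists>\<alpha>. f < F \<longrightarrow> (\<forall>q. g f q = (\<Sum>h\<in>{1..H}. \<Sum>j<card (T h). \<alpha> h j * contrast w h q j))"
    using effect_in_span_contrasts by simp
  from choice[OF this] obtain \<beta> where \<beta>: "\<And>f q. f < F \<Longrightarrow> g f q = (\<Sum>h\<in>{1..H}. \<Sum>j<card (T h). \<beta> f h j * contrast w h q j)"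
    by auto
  have "(\<Sum>f<F. \<gamma> f * g f q) = (\<Sum>h\<in>{1..H}. \<Sum>j<card (T h). (\<Sum>f<F. \<gamma> f * \<beta> f h j) * contrast w h q j)" for q
  proof -
    have "(\<Sum>f<F. \<gamma> f * g f q) = (\<Sum>f<F. \<Sum>h\<in>{1..H}. \<Sum>j<card (T h). \<gamma> f * \<beta> f h j * contrast w h q j)"
      by (simp add: \<beta> sum_distrib_left mult.assoc)
    also have "\<dots> = (\<Sum>h\<in>{1..H}. \<Sum>f<F. \<Sum>j<card (T h). \<gamma> f * \<beta> f h j * contrast w h q j)" by (rule sum.swap)
    also have "\<dots> = (\<Sum>h\<in>{1..H}. \<Sum>j<card (T h). \<Sum>f<F. \<gamma> f * \<beta> f h j * contrast w h q j)"
      by (rule sum.cong[OF refl], rule sum.swap)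
    finally show ?thesis by (simp only: sum_distrib_right)
  qed
  then have "\<phi> q = (\<Sum>h\<in>{1..H}. \<Sum>j<card (T h). (\<Sum>f<F. \<gamma> f * \<beta> f h j) * contrast w h q j) + c * \<nu> q" if "q < Q" for q
    using \<phi>q[OF that] by simp
  then show ?thesis unfolding c_def[symmetric]
    by (intro exI[of _ "\<lambda>h j. \<Sum>f<F. \<gamma> f * \<beta> f h j"]) blast
qed

definition contrast_cov :: "(nat \<Rightarrow> real) \<Rightarrow> nat \<Rightarrow> rmat \<Rightarrow> nat \<Rightarrow> rmat" where
  "contrast_cov w L S h i j = (1 / 2 ^ (2 * (K - 1))) * (\<Sum>q<Q. w q *
     (contrast w h q (i div L) * contrast w h q (j div L) * S (i mod L) (j mod L)))"

lemma posdef_contrast_cov: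
  assumes w: "\<And>q. q < Q \<Longrightarrow> w q > 0" and S: "posdef L S" and h: "h \<in> {1..H}"
  shows "posdef (L * card (T h)) (contrast_cov w L S h)"
  unfolding posdef_def
proof (intro conjI allI impI)
  let ?t = "card (T h)" and ?c = "contrast w h"
  let ?k = "1 / 2 ^ (2 * (K - 1)) :: real"
  fix i j assume "i < L * ?t" "j < L * ?t"
  then have "L > 0" by (cases L) auto
  then have "S (i mod L) (j mod L) = S (j mod L) (i mod L)" using posdef_sym[OF S] by simp
  then show "contrast_cov w L S h i j = contrast_cov w L S h j i" by (simp add: contrast_cov_def mult_ac)
next
  let ?t = "card (T h)" and ?c = "contrast w h"
  let ?k = "1 / 2 ^ (2 * (K - 1)) :: real"
  fix v :: rvec assume "\<exists>i<L * ?t. v i \<noteq> 0"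
  then obtain i0 where i0: "i0 < L * ?t" "v i0 \<noteq> 0" by auto
  then have L: "L > 0" by (cases L) auto
  define u where "u q l = (\<Sum>j<?t. v (j * L + l) * ?c q j)" for q l
  have vi: "(\<Sum>i<L * ?t. v i * f (i div L) (i mod L)) = (\<Sum>j<?t. \<Sum>l<L. v (j * L + l) * f j l)" for f
    using sum_div_mod[of "\<lambda>j l. v (j * L + l) * f j l" L ?t] by simp
  have eq: "bilin (L * ?t) (contrast_cov w L S h) v v = (\<Sum>q<Q. ?k * w q * bilin L S (u q) (u q))"
  proof -
    have "bilin (L * ?t) (contrast_cov w L S h) v v = (\<Sum>i<L * ?t. \<Sum>j<L * ?t. \<Sum>q<Q. ?k * w q * ((v i * ?c q (i div L)) * S (i mod L) (j mod L) * (v j * ?c q (j div L))))"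
      unfolding bilin_def contrast_cov_def sum_distrib_left sum_distrib_right
      by (intro sum.cong refl) (simp add: mult_ac)
    also have "\<dots> = (\<Sum>i<L * ?t. \<Sum>q<Q. \<Sum>j<L * ?t. ?k * w q * ((v i * ?c q (i div L)) * S (i mod L) (j mod L) * (v j * ?c q (j div L))))"
      by (rule sum.cong[OF refl], rule sum.swap)
    also have "\<dots> = (\<Sum>q<Q. \<Sum>i<L * ?t. \<Sum>j<L * ?t. ?k * w q * ((v i * ?c q (i div L)) * S (i mod L) (j mod L) * (v j * ?c q (j div L))))"
      by (rule sum.swap)
    also have "\<dots> = (\<Sum>q<Q. ?k * w q * bilin L S (u q) (u q))"
    proof (rule sum.cong[OF refl])
      fix q
      have "(\<Sum>i<L * ?t. \<Sum>j<L * ?t. (v i * ?c q (i div L)) * S (i mod L) (j mod L) * (v j * ?c q (j div L)))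
         = (\<Sum>i<L * ?t. v i * (?c q (i div L) * (\<Sum>j<L * ?t. v j * (?c q (j div L) * S (i mod L) (j mod L)))))"
        by (simp add: sum_distrib_left mult_ac)
      also have "\<dots> = (\<Sum>j<?t. \<Sum>l<L. v (j * L + l) * (?c q j * (\<Sum>j'<?t. \<Sum>l'<L. v (j' * L + l') * (?c q j' * S l l'))))"
        using vi[of "\<lambda>j l. ?c q j * (\<Sum>j'<?t. \<Sum>l'<L. v (j' * L + l') * (?c q j' * S l l'))"]
          vi[of "\<lambda>j' l'. ?c q j' * S _ l'"] by simp
      also have "\<dots> = (\<Sum>j<?t. \<Sum>l<L. (v (j * L + l) * ?c q j) * (\<Sum>l'<L. S l l' * u q l'))"
      proof -
        have "(\<Sum>j'<?t. \<Sum>l'<L. v (j' * L + l') * (?c q j' * S l l')) = (\<Sum>l'<L. S l l' * u q l')" for l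
          unfolding u_def sum_distrib_left by (subst sum.swap) (simp add: mult_ac)
        then show ?thesis by (simp add: mult.assoc)
      qed
      also have "\<dots> = (\<Sum>l<L. \<Sum>j<?t. (v (j * L + l) * ?c q j) * (\<Sum>l'<L. S l l' * u q l'))"
        by (rule sum.swap)
      also have "\<dots> = (\<Sum>l<L. u q l * (\<Sum>l'<L. S l l' * u q l'))"
        by (simp only: u_def[of q] sum_distrib_right)
      also have "\<dots> = bilin L S (u q) (u q)"
        by (simp add: bilin_def sum_distrib_left mult.assoc)
      finally have "(\<Sum>i<L * ?t. \<Sum>j<L * ?t. (v i * ?c q (i div L)) * S (i mod L) (j mod L) * (v j * ?c q (j div L))) = bilin L S (u q) (u q)" .
      then show "(\<Sum>i<L * ?t. \<Sum>j<L * ?t. ?k * w q * ((v i * ?c q (i div L)) * S (i mod L) (j mod L) * (v j * ?c q (j div L)))) = ?k * w q * bilin L S (u q) (u q)"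
        by (simp only: sum_distrib_left[symmetric])
    qed
    finally show ?thesis .
  qed
  have "\<exists>q<Q. \<exists>l<L. u q l \<noteq> 0"
  proof (rule ccontr)
    assume "\<not> ?thesis"
    then have u0: "u q (i0 mod L) = 0" if "q < Q" for q using that L by auto
    have "i0 div L < ?t" using i0 by (simp add: less_mult_imp_div_less mult.commute)
    then have "v (i0 div L * L + i0 mod L) = 0"
      using contrast_independent[OF h, of "\<lambda>j. v (j * L + i0 mod L)" w "i0 div L"] u0 by (simp add: u_def)
    then show False using i0 by simp
  qed
  then obtain q l where q: "q < Q" "l < L" "u q l \<noteq> 0" by auto
  have psd: "bilin L S (u r) (u r) \<ge> 0" for r
  proof (cases "\<exists>l<L. u r l \<noteq> 0")
    case True
    then show ?thesis using S by (auto simp: posdef_def intro: less_imp_le)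
  next
    case False
    then show ?thesis by (simp add: bilin_def)
  qed
  have "0 < ?k * w q * bilin L S (u q) (u q)" using S q w[OF q(1)] by (auto simp: posdef_def)
  also have "\<dots> \<le> (\<Sum>q<Q. ?k * w q * bilin L S (u q) (u q))"
    by (rule member_le_sum) (use q w psd in \<open>auto intro!: mult_nonneg_nonneg simp: less_imp_le\<close>)
  finally show "bilin (L * ?t) (contrast_cov w L S h) v v > 0" unfolding eq .
qed

end

section \<open>Covariances in a finite population\<close>

lemma sum_group_assigned:
  assumes "Z \<in> assignments Q n nq"
  shows "(\<Sum>i<n. f i (Z i)) = (\<Sum>q<Q. \<Sum>i\<in>{i. i < n \<and> Z i = q}. f i q)"
proof -
  have "(\<Sum>i<n. f i (Z i)) = (\<Sum>q<Q. \<Sum>i\<in>{i\<in>{..<n}. Z i = q}. f i (Z i))"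
    by (rule sum.group[symmetric]) (use assms in \<open>auto simp: assignments_def\<close>)
  also have "\<dots> = (\<Sum>q<Q. \<Sum>i\<in>{i. i < n \<and> Z i = q}. f i q)"
    by (intro sum.cong refl) auto
  finally show ?thesis .
qed

lemma sum_centred: "n > 0 \<Longrightarrow> (\<Sum>i<n. u i - pmean n u) = 0"
  by (simp add: sum_subtractf pmean_def)

locale factorial_population = factorial_design +
  fixes n L :: nat and nq :: "nat \<Rightarrow> nat" and Y x :: "nat \<Rightarrow> nat \<Rightarrow> real"
  assumes nq_pos: "\<forall>q<2^K. nq q \<ge> 1" and nq_sum: "(\<Sum>q<2^K. nq q) = n"
    and ns: "nonsingular L (Sxx n x)"
begin

abbreviation "w \<equiv> (\<lambda>q. 1 / real (nq q))"
abbreviation "c \<equiv> contrast w"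
abbreviation "kk \<equiv> (1::real) / 2 ^ (2 * (K - 1))"
abbreviation "S \<equiv> Sxx n x"

definition yc :: "nat \<Rightarrow> nat \<Rightarrow> real" where "yc i q = Y i q - pmean n (\<lambda>i. Y i q)"
definition xc :: "nat \<Rightarrow> nat \<Rightarrow> real" where "xc i l = x i l - pmean n (\<lambda>i. x i l)"

definition scaled_array :: "(nat \<Rightarrow> real) \<Rightarrow> (nat \<Rightarrow> nat \<Rightarrow> real) \<Rightarrow> nat \<Rightarrow> nat \<Rightarrow> real" where
  "scaled_array \<alpha> u i q = sqrt (real n) * s * \<alpha> q * u i q / real (nq q)"

definition effect_array :: "nat \<Rightarrow> nat \<Rightarrow> nat \<Rightarrow> real" where
  "effect_array f = scaled_array (g f) yc"

definition covariate_array :: "nat \<Rightarrow> nat \<Rightarrow> nat \<Rightarrow> nat \<Rightarrow> real" where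
  "covariate_array h j = scaled_array (\<lambda>q. c h q (j div L)) (\<lambda>i q. xc i (j mod L))"

lemma ss: "s * s = kk"
proof -
  have "(2::real) ^ (2 * (K - 1)) = 2 ^ (K - 1) * 2 ^ (K - 1)"
    unfolding power_add[symmetric] mult_2 ..
  then show ?thesis by simp
qed

lemma nq0: "q < Q \<Longrightarrow> real (nq q) > 0"
proof -
  assume "q < Q"
  then have "nq q \<ge> 1" using nq_pos by blast
  then show ?thesis by linarith
qed

lemma wpos: "q < Q \<Longrightarrow> w q > 0"
  using nq0[of q] by simp

lemma n2: "n \<ge> 2"
proof -
  have "2 \<le> Q" using K power_increasing[of 1 K "2::nat"] by simp
  also have "Q = (\<Sum>q<Q. 1::nat)" by simp
  also have "\<dots> \<le> (\<Sum>q<Q. nq q)" by (rule sum_mono) (use nq_pos in simp)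
  finally show ?thesis using nq_sum by simp
qed

lemma n0: "real n > 0" "real n - 1 > 0" "n > 0"
  using n2 by auto

lemma sum_yc: "(\<Sum>i<n. yc i q) = 0"
  unfolding yc_def by (rule sum_centred[OF n0(3)])

lemma sum_xc: "(\<Sum>i<n. xc i l) = 0"
  unfolding xc_def by (rule sum_centred[OF n0(3)])

lemma cov_yy: "(\<Sum>i<n. yc i q * yc i r) = (real n - 1) * pcov n (\<lambda>i. Y i q) (\<lambda>i. Y i r)"
  using n0 by (simp add: pcov_def yc_def)

lemma cov_xx: "(\<Sum>i<n. xc i l * xc i l') = (real n - 1) * S l l'"
  using n0 by (simp add: Sxx_def pcov_def xc_def)

lemma cov_yx: "(\<Sum>i<n. yc i q * xc i l) = (real n - 1) * Sqx n Y x q l"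
  using n0 by (simp add: Sqx_def pcov_def xc_def yc_def)

lemma sum_scaled_array:
  assumes "\<And>q. q < Q \<Longrightarrow> (\<Sum>i<n. u i q) = 0" "q < Q"
  shows "(\<Sum>i<n. scaled_array \<alpha> u i q) = 0"
proof -
  have "(\<Sum>i<n. scaled_array \<alpha> u i q) = sqrt (real n) * s * \<alpha> q * (\<Sum>i<n. u i q) / real (nq q)"
    unfolding scaled_array_def by (simp only: sum_distrib_left sum_divide_distrib)
  then show ?thesis using assms by simp
qed

lemma cov_form_scaled_array:
  "cov_form n Q nq (scaled_array \<alpha> u) (scaled_array \<beta> v) =
    kk * (\<Sum>q<Q. w q * (\<alpha> q * \<beta> q) * (\<Sum>i<n. u i q * v i q))
    - kk / real n * (\<Sum>i<n. (\<Sum>q<Q. \<alpha> q * u i q) * (\<Sum>q<Q. \<beta> q * v i q))"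
proof -
  have 1: "(\<Sum>q<Q. real (nq q) / real n * scaled_array \<alpha> u i q * scaled_array \<beta> v i q) = (\<Sum>q<Q. kk * (w q * (\<alpha> q * \<beta> q) * (u i q * v i q)))" for i
  proof (rule sum.cong[OF refl])
    fix q assume "q \<in> {..<Q}"
    then have q: "real (nq q) > 0" by (intro nq0) simp
    have r: "sqrt (real n) * sqrt (real n) = real n" by simp
    have "real (nq q) / real n * scaled_array \<alpha> u i q * scaled_array \<beta> v i q
      = (sqrt (real n) * sqrt (real n)) / real n * (s * s) * (\<alpha> q * \<beta> q) * (u i q * v i q) / real (nq q)"
      using q by (simp add: scaled_array_def field_simps)
    also have "\<dots> = kk * (w q * (\<alpha> q * \<beta> q) * (u i q * v i q))"
      unfolding ss r using n0 q by simp
    finally show "real (nq q) / real n * scaled_array \<alpha> u i q * scaled_array \<beta> v i q = kk * (w q * (\<alpha> q * \<beta> q) * (u i q * v i q))" .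
  qed
  have 2: "(\<Sum>q<Q. real (nq q) / real n * scaled_array \<alpha> u i q) = s * sqrt (real n) / real n * (\<Sum>q<Q. \<alpha> q * u i q)" for \<alpha> u i
    unfolding sum_distrib_left
  proof (rule sum.cong[OF refl])
    fix q assume "q \<in> {..<Q}"
    then have q: "real (nq q) > 0" by (intro nq0) simp
    then show "real (nq q) / real n * scaled_array \<alpha> u i q = s * sqrt (real n) / real n * (\<alpha> q * u i q)"
      by (simp add: scaled_array_def)
  qed
  have 3: "(s * sqrt (real n) / real n * a) * (s * sqrt (real n) / real n * b) = kk / real n * (a * b)" for a b
  proof -
    have gen: "(t * r / m * a) * (t * r / m * b) = (t * t) * ((r * r) / (m * m)) * (a * b)" for t r m :: real
      by simp
    have "(sqrt (real n) * sqrt (real n)) / (real n * real n) = 1 / real n" using n0 by simp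
    then show ?thesis unfolding gen ss by simp
  qed
  have "cov_form n Q nq (scaled_array \<alpha> u) (scaled_array \<beta> v) =
      (\<Sum>i<n. (\<Sum>q<Q. kk * (w q * (\<alpha> q * \<beta> q) * (u i q * v i q))) - kk / real n * ((\<Sum>q<Q. \<alpha> q * u i q) * (\<Sum>q<Q. \<beta> q * v i q)))"
    unfolding cov_form_def 1 2 3 ..
  also have "\<dots> = (\<Sum>i<n. \<Sum>q<Q. kk * (w q * (\<alpha> q * \<beta> q) * (u i q * v i q)))
      - kk / real n * (\<Sum>i<n. (\<Sum>q<Q. \<alpha> q * u i q) * (\<Sum>q<Q. \<beta> q * v i q))"
    by (simp only: sum_subtractf sum_distrib_left)
  also have "(\<Sum>i<n. \<Sum>q<Q. kk * (w q * (\<alpha> q * \<beta> q) * (u i q * v i q)))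
     = (\<Sum>q<Q. \<Sum>i<n. kk * (w q * (\<alpha> q * \<beta> q) * (u i q * v i q)))" by (rule sum.swap)
  also have "\<dots> = kk * (\<Sum>q<Q. w q * (\<alpha> q * \<beta> q) * (\<Sum>i<n. u i q * v i q))"
    by (simp only: sum_distrib_left)
  finally show ?thesis .
qed

lemma Wxx_contrast_cov: "h \<ge> 1 \<Longrightarrow> Wxx K iota eff nq T L n x h = contrast_cov w L S h"
  unfolding Wxx_def contrast_cov_def kron_def outer_def cvec_contrast by (simp add: fun_eq_iff cvec_contrast)

lemma Wtx_eq: "h \<ge> 1 \<Longrightarrow> Wtx K iota eff nq T L n Y x h f j = kk * (\<Sum>q<Q. w q * (g f q * c h q (j div L)) * Sqx n Y x q (j mod L))"
  unfolding Wtx_def kron_def outer_def by (simp add: cvec_contrast mult.assoc)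

lemma idx_div: "j < L * t \<Longrightarrow> j div L < t"
  by (simp add: less_mult_imp_div_less mult.commute)

lemma idx_mod: "j < L * t \<Longrightarrow> j mod L < L"
  by (cases L) auto

lemma sum_c_scaled: "h \<in> {1..H} \<Longrightarrow> j < card (T h) \<Longrightarrow> (\<Sum>q<Q. c h q j * (b::real)) = 0"
  using sum_contrast[of h j w] by (simp only: sum_distrib_right[symmetric] mult_zero_left)

lemma cov_form_covariates:
  assumes h: "h \<in> {1..H}" "h' \<in> {1..H}" and j: "j < L * card (T h)" "j' < L * card (T h')"
  shows "cov_form n Q nq (covariate_array h j) (covariate_array h' j') = (if h = h' then (real n - 1) * contrast_cov w L S h j j' else 0)"
proof -
  have "cov_form n Q nq (covariate_array h j) (covariate_array h' j') = kk * (\<Sum>q<Q. w q * (c h q (j div L) * c h' q (j' div L)) * ((real n - 1) * S (j mod L) (j' mod L)))"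
    unfolding covariate_array_def cov_form_scaled_array cov_xx sum_c_scaled[OF h(1) idx_div[OF j(1)]] by simp
  also have "\<dots> = (real n - 1) * S (j mod L) (j' mod L) * kk * (\<Sum>q<Q. w q * c h q (j div L) * c h' q (j' div L))"
    by (simp add: sum_distrib_left mult_ac)
  finally have eq: "cov_form n Q nq (covariate_array h j) (covariate_array h' j') = (real n - 1) * S (j mod L) (j' mod L) * kk * (\<Sum>q<Q. w q * c h q (j div L) * c h' q (j' div L))" .
  show ?thesis
  proof (cases "h = h'")
    case True
    have "(\<Sum>q<Q. w q * (c h q (j div L) * c h q (j' div L) * S (j mod L) (j' mod L)))
      = S (j mod L) (j' mod L) * (\<Sum>q<Q. w q * c h q (j div L) * c h q (j' div L))"
      by (simp add: sum_distrib_left mult_ac)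
    then show ?thesis using True eq by (simp add: contrast_cov_def)
  next
    case False
    have "(\<Sum>q<Q. w q * c h q (j div L) * c h' q (j' div L)) = 0"
      by (rule contrast_orthogonal) (use wpos h False idx_div[OF j(1)] idx_div[OF j(2)] in auto)
    then show ?thesis using False eq by simp
  qed
qed

lemma cov_form_effect_covariate:
  assumes h: "h \<in> {1..H}" and j: "j < L * card (T h)"
  shows "cov_form n Q nq (effect_array f) (covariate_array h j) = (real n - 1) * Wtx K iota eff nq T L n Y x h f j"
proof -
  have h1: "h \<ge> 1" using h by simp
  have "cov_form n Q nq (effect_array f) (covariate_array h j) = kk * (\<Sum>q<Q. w q * (g f q * c h q (j div L)) * ((real n - 1) * Sqx n Y x q (j mod L)))"
    unfolding effect_array_def covariate_array_def cov_form_scaled_array cov_yx sum_c_scaled[OF h idx_div[OF j]] by simp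
  also have "\<dots> = (real n - 1) * (kk * (\<Sum>q<Q. w q * (g f q * c h q (j div L)) * Sqx n Y x q (j mod L)))"
    by (simp add: sum_distrib_left mult_ac)
  finally show ?thesis unfolding Wtx_eq[OF h1] .
qed

abbreviation "Sy q r \<equiv> pcov n (\<lambda>i. Y i q) (\<lambda>i. Y i r)"

definition Vtt :: rmat where
  "Vtt f f' = kk * (\<Sum>q<Q. w q * (g f q * g f' q) * Sy q q) - kk / real n * (\<Sum>q<Q. \<Sum>r<Q. g f q * g f' r * Sy q r)"

lemma sum_product_linear:
  fixes \<alpha> \<beta> :: "nat \<Rightarrow> real" and u v :: "nat \<Rightarrow> nat \<Rightarrow> real"
  shows
  "(\<Sum>i<n. (\<Sum>q<Q. \<alpha> q * u i q) * (\<Sum>r<Q. \<beta> r * v i r)) = (\<Sum>q<Q. \<Sum>r<Q. \<alpha> q * \<beta> r * (\<Sum>i<n. u i q * v i r))"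
proof -
  have "(\<Sum>i<n. (\<Sum>q<Q. \<alpha> q * u i q) * (\<Sum>r<Q. \<beta> r * v i r)) = (\<Sum>i<n. \<Sum>q<Q. \<Sum>r<Q. \<alpha> q * \<beta> r * (u i q * v i r))"
    unfolding sum_product by (intro sum.cong refl) (simp only: mult_ac)
  also have "\<dots> = (\<Sum>q<Q. \<Sum>i<n. \<Sum>r<Q. \<alpha> q * \<beta> r * (u i q * v i r))" by (rule sum.swap)
  also have "\<dots> = (\<Sum>q<Q. \<Sum>r<Q. \<Sum>i<n. \<alpha> q * \<beta> r * (u i q * v i r))" by (rule sum.cong[OF refl], rule sum.swap)
  finally show ?thesis by (simp only: sum_distrib_left)
qed

lemma cov_form_effects: "cov_form n Q nq (effect_array f) (effect_array f') = (real n - 1) * Vtt f f'"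
proof -
  have "cov_form n Q nq (effect_array f) (effect_array f') = kk * (\<Sum>q<Q. w q * (g f q * g f' q) * ((real n - 1) * Sy q q))
     - kk / real n * (\<Sum>q<Q. \<Sum>r<Q. g f q * g f' r * ((real n - 1) * Sy q r))"
    unfolding effect_array_def cov_form_scaled_array sum_product_linear cov_yy ..
  also have "(\<Sum>q<Q. w q * (g f q * g f' q) * ((real n - 1) * Sy q q)) = (real n - 1) * (\<Sum>q<Q. w q * (g f q * g f' q) * Sy q q)"
    unfolding sum_distrib_left by (intro sum.cong refl) (simp only: mult_ac)
  also have "(\<Sum>q<Q. \<Sum>r<Q. g f q * g f' r * ((real n - 1) * Sy q r)) = (real n - 1) * (\<Sum>q<Q. \<Sum>r<Q. g f q * g f' r * Sy q r)"
    unfolding sum_distrib_left by (intro sum.cong refl) (simp only: mult_ac)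
  finally show ?thesis by (simp only: Vtt_def right_diff_distrib mult.left_commute)
qed

lemma S_sym: "S l l' = S l' l"
  by (simp add: Sxx_def pcov_def mult.commute)

lemma posdef_S: "posdef L S"
proof (rule psd_nonsingular_posdef[OF S_sym _ ns])
  fix v
  have "(real n - 1) * bilin L S v v = (\<Sum>i<n. (\<Sum>l<L. v l * xc i l)\<^sup>2)"
  proof -
    have "(real n - 1) * bilin L S v v = (\<Sum>l<L. \<Sum>l'<L. \<Sum>i<n. (v l * xc i l) * (v l' * xc i l'))"
    proof -
      have "v l * S l l' * v l' * (real n - 1) = (\<Sum>i<n. (v l * xc i l) * (v l' * xc i l'))" for l l'
      proof -
        have "v l * S l l' * v l' * (real n - 1) = v l * v l' * (\<Sum>i<n. xc i l * xc i l')"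
          unfolding cov_xx by simp
        also have "\<dots> = (\<Sum>i<n. (v l * xc i l) * (v l' * xc i l'))"
          unfolding sum_distrib_left by (intro sum.cong refl) simp
        finally show ?thesis .
      qed
      then show ?thesis unfolding bilin_def by (simp add: sum_distrib_left mult.commute[of "real n - 1"])
    qed
    also have "\<dots> = (\<Sum>l<L. \<Sum>i<n. \<Sum>l'<L. (v l * xc i l) * (v l' * xc i l'))"
      by (rule sum.cong[OF refl], rule sum.swap)
    also have "\<dots> = (\<Sum>i<n. \<Sum>l<L. \<Sum>l'<L. (v l * xc i l) * (v l' * xc i l'))" by (rule sum.swap)
    finally show ?thesis by (simp add: power2_eq_square sum_product)
  qed
  moreover have "(\<Sum>i<n. (\<Sum>l<L. v l * xc i l)\<^sup>2) \<ge> 0" by (intro sum_nonneg) auto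
  ultimately show "bilin L S v v \<ge> 0" using n0(2) by (metis mult.commute mult_neg_pos not_less)
qed

definition beta :: "nat \<Rightarrow> nat \<Rightarrow> real" where
  "beta q l = (\<Sum>l'<L. Sqx n Y x q l' * minv L S l' l)"

lemma beta_S: "l' < L \<Longrightarrow> (\<Sum>l<L. beta q l * S l l') = Sqx n Y x q l'"
proof -
  assume l': "l' < L"
  let ?q = "\<lambda>_::nat. Sqx n Y x q"
  have "(\<Sum>l<L. beta q l * S l l') = mmul L (mmul L ?q (minv L S)) S 0 l'"
    by (simp add: mmul_def beta_def)
  also have "\<dots> = mmul L ?q (mmul L (minv L S) S) 0 l'" by (simp only: mmul_assoc)
  also have "\<dots> = mmul L ?q mid 0 l'"
    by (rule mmul_cong) (use minv_symmetric(2)[OF S_sym ns] l' in auto)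
  also have "\<dots> = Sqx n Y x q l'" by (rule mmul_mid_right[OF l'])
  finally show ?thesis .
qed

definition Pq :: "nat \<Rightarrow> nat \<Rightarrow> real" where
  "Pq q r = (\<Sum>l<L. beta q l * Sqx n Y x r l)"

lemma Yperp_eq: "Yperp n L Y x i q = yc i q - (\<Sum>l<L. beta q l * xc i l)"
proof -
  have "(\<Sum>l<L. \<Sum>l'<L. Sqx n Y x q l * minv L S l l' * (x i l' - pmean n (\<lambda>i. x i l')))
    = (\<Sum>l'<L. \<Sum>l<L. Sqx n Y x q l * minv L S l l' * xc i l')"
    unfolding xc_def by (rule sum.swap)
  also have "\<dots> = (\<Sum>l<L. beta q l * xc i l)" by (simp only: beta_def sum_distrib_right)
  finally show ?thesis by (simp add: Yperp_def yc_def)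
qed

lemma sum_Yperp: "(\<Sum>i<n. Yperp n L Y x i q) = 0"
proof -
  have "(\<Sum>i<n. \<Sum>l<L. beta q l * xc i l) = (\<Sum>l<L. beta q l * (\<Sum>i<n. xc i l))"
    by (subst sum.swap) (simp only: sum_distrib_left)
  then show ?thesis by (simp add: Yperp_eq sum_subtractf sum_yc sum_xc)
qed

lemma pcov_centred:
  assumes "(\<Sum>i<n. u i) = 0" "(\<Sum>i<n. v i) = 0"
  shows "(real n - 1) * pcov n u v = (\<Sum>i<n. u i * v i)"
  using assms n0 by (simp add: pcov_def pmean_def)

lemma Yperp_x: "l < L \<Longrightarrow> (\<Sum>i<n. Yperp n L Y x i q * xc i l) = 0"
proof -
  assume l: "l < L"
  have "(\<Sum>i<n. (\<Sum>l'<L. beta q l' * xc i l') * xc i l) = (\<Sum>l'<L. beta q l' * (\<Sum>i<n. xc i l' * xc i l))"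
    by (simp only: sum_distrib_right sum_distrib_left mult.assoc) (rule sum.swap)
  also have "\<dots> = (real n - 1) * (\<Sum>l'<L. beta q l' * S l' l)" unfolding cov_xx sum_distrib_left by (intro sum.cong refl) simp
  also have "\<dots> = (\<Sum>i<n. yc i q * xc i l)" unfolding beta_S[OF l] cov_yx ..
  finally show ?thesis by (simp add: Yperp_eq left_diff_distrib sum_subtractf)
qed

lemma pcov_Yperp: "pcov n (\<lambda>i. Yperp n L Y x i q) (\<lambda>i. Yperp n L Y x i r) = Sy q r - Pq q r"
proof -
  have "(\<Sum>i<n. Yperp n L Y x i q * (\<Sum>l<L. beta r l * xc i l)) = (\<Sum>l<L. beta r l * (\<Sum>i<n. Yperp n L Y x i q * xc i l))"
    unfolding sum_distrib_left by (subst sum.swap) (simp only: mult_ac)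
  also have "\<dots> = 0" using Yperp_x by simp
  finally have 0: "(\<Sum>i<n. Yperp n L Y x i q * (\<Sum>l<L. beta r l * xc i l)) = 0" .
  have "(\<Sum>i<n. Yperp n L Y x i q * Yperp n L Y x i r)
     = (\<Sum>i<n. Yperp n L Y x i q * yc i r - Yperp n L Y x i q * (\<Sum>l<L. beta r l * xc i l))"
    unfolding Yperp_eq[of _ r] by (simp only: right_diff_distrib)
  also have "\<dots> = (\<Sum>i<n. Yperp n L Y x i q * yc i r)" unfolding sum_subtractf 0 by simp
  also have "\<dots> = (\<Sum>i<n. yc i q * yc i r) - (\<Sum>i<n. (\<Sum>l<L. beta q l * xc i l) * yc i r)"
    unfolding Yperp_eq left_diff_distrib sum_subtractf ..
  also have "(\<Sum>i<n. (\<Sum>l<L. beta q l * xc i l) * yc i r) = (\<Sum>l<L. beta q l * (\<Sum>i<n. yc i r * xc i l))"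
    unfolding sum_distrib_left sum_distrib_right by (subst sum.swap) (simp only: mult_ac)
  also have "\<dots> = (real n - 1) * Pq q r" unfolding cov_yx Pq_def sum_distrib_left by (intro sum.cong refl) simp
  also have "(\<Sum>i<n. yc i q * yc i r) = (real n - 1) * Sy q r" by (rule cov_yy)
  finally have "(real n - 1) * pcov n (\<lambda>i. Yperp n L Y x i q) (\<lambda>i. Yperp n L Y x i r) = (real n - 1) * (Sy q r - Pq q r)"
    unfolding pcov_centred[OF sum_Yperp sum_Yperp] by (simp only: right_diff_distrib)
  then show ?thesis using n0(2) by simp
qed

lemma pcov_tauperp:
  "pcov n (\<lambda>i. tauperp K iota eff n L Y x i f) (\<lambda>i. tauperp K iota eff n L Y x i f')
    = kk * (\<Sum>q<Q. \<Sum>r<Q. g f q * g f' r * (Sy q r - Pq q r))"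
proof -
  let ?u = "\<lambda>f i. \<Sum>q<Q. g f q * Yperp n L Y x i q"
  have z: "(\<Sum>i<n. s * ?u f i) = 0" for f
  proof -
    have "(\<Sum>i<n. ?u f i) = (\<Sum>q<Q. g f q * (\<Sum>i<n. Yperp n L Y x i q))"
      by (subst sum.swap) (simp only: sum_distrib_left)
    then show ?thesis by (simp only: sum_distrib_left[symmetric] sum_Yperp) simp
  qed
  have "(real n - 1) * pcov n (\<lambda>i. tauperp K iota eff n L Y x i f) (\<lambda>i. tauperp K iota eff n L Y x i f')
     = (\<Sum>i<n. (s * ?u f i) * (s * ?u f' i))"
    unfolding tauperp_def by (rule pcov_centred[OF z z])
  also have "\<dots> = (s * s) * (\<Sum>i<n. ?u f i * ?u f' i)"
    unfolding sum_distrib_left[of "s * s"] by (intro sum.cong refl) (simp only: mult_ac)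
  also have "(\<Sum>i<n. ?u f i * ?u f' i) = (\<Sum>q<Q. \<Sum>r<Q. g f q * g f' r * ((real n - 1) * (Sy q r - Pq q r)))"
    unfolding sum_product_linear pcov_centred[OF sum_Yperp sum_Yperp, symmetric] pcov_Yperp ..
  also have "\<dots> = (real n - 1) * (\<Sum>q<Q. \<Sum>r<Q. g f q * g f' r * (Sy q r - Pq q r))"
    unfolding sum_distrib_left by (intro sum.cong refl) (simp only: mult_ac)
  finally have "(real n - 1) * pcov n (\<lambda>i. tauperp K iota eff n L Y x i f) (\<lambda>i. tauperp K iota eff n L Y x i f')
     = (real n - 1) * (kk * (\<Sum>q<Q. \<Sum>r<Q. g f q * g f' r * (Sy q r - Pq q r)))" unfolding ss by simp
  then show ?thesis using n0(2) by (simp only: mult_cancel_left) auto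
qed

definition Ppar :: rmat where
  "Ppar f f' = kk * (\<Sum>q<Q. w q * (g f q * g f' q) * Pq q q) - kk / real n * (\<Sum>q<Q. \<Sum>r<Q. g f q * g f' r * Pq q r)"

lemma Vperp_eq: "Vperp K iota eff nq n L Y x f f' = Vtt f f' - Ppar f f'"
proof -
  have 1: "(\<Sum>q<Q. w q * g f q * g f' q * (Sy q q - Pq q q)) = (\<Sum>q<Q. w q * (g f q * g f' q) * Sy q q) - (\<Sum>q<Q. w q * (g f q * g f' q) * Pq q q)"
    by (simp only: right_diff_distrib sum_subtractf mult.assoc)
  have 2: "(\<Sum>q<Q. \<Sum>r<Q. g f q * g f' r * (Sy q r - Pq q r)) = (\<Sum>q<Q. \<Sum>r<Q. g f q * g f' r * Sy q r) - (\<Sum>q<Q. \<Sum>r<Q. g f q * g f' r * Pq q r)"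
    by (simp only: right_diff_distrib sum_subtractf)
  show ?thesis
    unfolding Vperp_def pcov_Yperp pcov_tauperp 1 2 Vtt_def Ppar_def
    by (simp add: algebra_simps diff_divide_distrib)
qed

lemma Wpar_sum: "f < F \<Longrightarrow> f' < F \<Longrightarrow> (\<Sum>h\<in>{1..H}. Wpar K iota eff nq T L n Y x h f f') = Ppar f f'"
proof -
  let ?Sq = "Sqx n Y x"
  define lam where "lam l = (\<Sum>r<Q. g f r * beta r l) / real n" for l
  have "\<forall>l. \<exists>\<alpha>. \<forall>q<Q. g f q * beta q l = (\<Sum>h\<in>{1..H}. \<Sum>j<card (T h). \<alpha> h j * c h q j) + lam l * real (nq q)"
  proof
    fix l
    have "(\<Sum>q<Q. real (nq q)) = real n" using nq_sum by (simp flip: of_nat_sum)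
    then show "\<exists>\<alpha>. \<forall>q<Q. g f q * beta q l = (\<Sum>h\<in>{1..H}. \<Sum>j<card (T h). \<alpha> h j * c h q j) + lam l * real (nq q)"
      using contrasts_and_sizes_span[of "\<lambda>q. real (nq q)" "\<lambda>q. g f q * beta q l" w] n0 unfolding lam_def by simp
  qed
  from choice[OF this] obtain \<alpha> where
    \<alpha>: "\<And>l q. q < Q \<Longrightarrow> g f q * beta q l = (\<Sum>h\<in>{1..H}. \<Sum>j<card (T h). \<alpha> l h j * c h q j) + lam l * real (nq q)" by auto
  define zz where "zz l q = (\<Sum>h\<in>{1..H}. \<Sum>j<card (T h). \<alpha> l h j * c h q j)" for l q
  have zz: "w q * zz l q = w q * (g f q * beta q l) - lam l" if "q < Q" for l q
  proof -
    have "zz l q = g f q * beta q l - lam l * real (nq q)" using \<alpha>[OF that, of l] by (simp add: zz_def)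
    then show ?thesis using nq0[OF that] by (simp add: field_simps)
  qed
  have orth: "(\<Sum>q<Q. w q * c h q j' * zz l q) = (\<Sum>q<Q. w q * c h q j' * (\<Sum>j<card (T h). \<alpha> l h j * c h q j))"
    if h: "h \<in> {1..H}" "j' < card (T h)" for h j' l
  proof -
    have "(\<Sum>q<Q. w q * c h q j' * zz l q) = (\<Sum>q<Q. \<Sum>h'\<in>{1..H}. w q * c h q j' * (\<Sum>j<card (T h'). \<alpha> l h' j * c h' q j))"
      by (simp only: zz_def sum_distrib_left)
    also have "\<dots> = (\<Sum>h'\<in>{1..H}. \<Sum>q<Q. w q * c h q j' * (\<Sum>j<card (T h'). \<alpha> l h' j * c h' q j))" by (rule sum.swap)
    also have "\<dots> = (\<Sum>h'\<in>{1..H}. if h' = h then (\<Sum>q<Q. w q * c h q j' * (\<Sum>j<card (T h). \<alpha> l h j * c h q j)) else 0)"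
    proof (rule sum.cong[OF refl])
      fix h' assume h': "h' \<in> {1..H}"
      show "(\<Sum>q<Q. w q * c h q j' * (\<Sum>j<card (T h'). \<alpha> l h' j * c h' q j))
        = (if h' = h then (\<Sum>q<Q. w q * c h q j' * (\<Sum>j<card (T h). \<alpha> l h j * c h q j)) else 0)"
      proof (cases "h' = h")
        case False
        have "(\<Sum>q<Q. w q * c h q j' * (\<Sum>j<card (T h'). \<alpha> l h' j * c h' q j))
          = (\<Sum>j<card (T h'). \<alpha> l h' j * (\<Sum>q<Q. w q * c h q j' * c h' q j))"
          unfolding sum_distrib_left by (subst sum.swap) (simp only: mult_ac)
        also have "\<dots> = 0"
        proof (rule sum.neutral, rule)
          fix j assume "j \<in> {..<card (T h')}"
          then have "(\<Sum>q<Q. w q * c h q j' * c h' q j) = 0"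
            by (intro contrast_orthogonal) (use wpos h h' False in auto)
          then show "\<alpha> l h' j * (\<Sum>q<Q. w q * c h q j' * c h' q j) = 0" by (simp only: mult_zero_right)
        qed
        finally show ?thesis using False by simp
      qed simp
    qed
    also have "\<dots> = (\<Sum>q<Q. w q * c h q j' * (\<Sum>j<card (T h). \<alpha> l h j * c h q j))" using h by simp
    finally show ?thesis .
  qed
  define A where "A h i = \<alpha> (i mod L) h (i div L)" for h i
  have WA: "Wtx K iota eff nq T L n Y x h f i' = (\<Sum>i<L * card (T h). A h i * contrast_cov w L S h i i')"
    if h: "h \<in> {1..H}" and i': "i' < L * card (T h)" for h i'
  proof -
    have h1: "h \<ge> 1" using h by simp
    let ?t = "card (T h)" and ?j = "i' div L" and ?l = "i' mod L"
    have jl: "?j < ?t" "?l < L" by (rule idx_div[OF i'], rule idx_mod[OF i'])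
    have "(\<Sum>i<L * ?t. A h i * contrast_cov w L S h i i') = (\<Sum>j<?t. \<Sum>l<L. \<alpha> l h j * (kk * (\<Sum>q<Q. w q * (c h q j * c h q ?j * S l ?l))))"
      unfolding A_def contrast_cov_def
      by (rule sum_div_mod[of "\<lambda>j l. \<alpha> l h j * (kk * (\<Sum>q<Q. w q * (c h q j * c h q ?j * S l ?l)))"])
    also have "\<dots> = (\<Sum>l<L. \<Sum>j<?t. \<alpha> l h j * (kk * (\<Sum>q<Q. w q * (c h q j * c h q ?j * S l ?l))))" by (rule sum.swap)
    also have "\<dots> = (\<Sum>l<L. kk * S l ?l * (\<Sum>q<Q. w q * c h q ?j * zz l q))"
    proof (rule sum.cong[OF refl])
      fix l
      have "(\<Sum>j<?t. \<alpha> l h j * (kk * (\<Sum>q<Q. w q * (c h q j * c h q ?j * S l ?l))))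
        = (\<Sum>j<?t. \<Sum>q<Q. kk * S l ?l * (w q * c h q ?j * (\<alpha> l h j * c h q j)))"
        unfolding sum_distrib_left by (intro sum.cong refl) (simp only: mult_ac)
      also have "\<dots> = (\<Sum>q<Q. \<Sum>j<?t. kk * S l ?l * (w q * c h q ?j * (\<alpha> l h j * c h q j)))" by (rule sum.swap)
      also have "\<dots> = kk * S l ?l * (\<Sum>q<Q. w q * c h q ?j * (\<Sum>j<?t. \<alpha> l h j * c h q j))" by (simp only: sum_distrib_left)
      finally show "(\<Sum>j<?t. \<alpha> l h j * (kk * (\<Sum>q<Q. w q * (c h q j * c h q ?j * S l ?l)))) = kk * S l ?l * (\<Sum>q<Q. w q * c h q ?j * zz l q)"
        unfolding orth[OF h jl(1)] .
    qed
    also have "\<dots> = (\<Sum>l<L. \<Sum>q<Q. kk * (w q * (g f q * c h q ?j)) * (beta q l * S l ?l))"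
    proof (rule sum.cong[OF refl])
      fix l
      have "(\<Sum>q<Q. w q * c h q ?j * zz l q) = (\<Sum>q<Q. w q * c h q ?j * (g f q * beta q l) - c h q ?j * lam l)"
      proof (rule sum.cong[OF refl])
        fix q assume "q \<in> {..<Q}"
        then have "q < Q" by (rule lessThan_iff[THEN iffD1])
        have "w q * c h q ?j * zz l q = c h q ?j * (w q * zz l q)" by (simp only: mult_ac)
        also have "\<dots> = c h q ?j * (w q * (g f q * beta q l) - lam l)" unfolding zz[OF \<open>q < Q\<close>] ..
        also have "\<dots> = w q * c h q ?j * (g f q * beta q l) - c h q ?j * lam l" by (simp only: right_diff_distrib mult_ac)
        finally show "w q * c h q ?j * zz l q = w q * c h q ?j * (g f q * beta q l) - c h q ?j * lam l" .
      qed
      also have "\<dots> = (\<Sum>q<Q. w q * c h q ?j * (g f q * beta q l))"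
        unfolding sum_subtractf sum_c_scaled[OF h jl(1)] by simp
      finally have "(\<Sum>q<Q. w q * c h q ?j * zz l q) = (\<Sum>q<Q. w q * c h q ?j * (g f q * beta q l))" .
      then show "kk * S l ?l * (\<Sum>q<Q. w q * c h q ?j * zz l q) = (\<Sum>q<Q. kk * (w q * (g f q * c h q ?j)) * (beta q l * S l ?l))"
        by (simp only: sum_distrib_left mult_ac)
    qed
    also have "\<dots> = (\<Sum>q<Q. \<Sum>l<L. kk * (w q * (g f q * c h q ?j)) * (beta q l * S l ?l))" by (rule sum.swap)
    also have "\<dots> = (\<Sum>q<Q. kk * (w q * (g f q * c h q ?j)) * ?Sq q ?l)"
      unfolding sum_distrib_left[symmetric] beta_S[OF jl(2)] ..
    also have "\<dots> = Wtx K iota eff nq T L n Y x h f i'"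
      unfolding Wtx_eq[OF h1] by (simp only: sum_distrib_left mult.assoc)
    finally show ?thesis ..
  qed
  have Wpar_A: "Wpar K iota eff nq T L n Y x h f f' = (\<Sum>i<L * card (T h). A h i * Wtx K iota eff nq T L n Y x h f' i)"
    if h: "h \<in> {1..H}" for h
  proof -
    let ?d = "L * card (T h)" and ?W = "Wtx K iota eff nq T L n Y x h" and ?X = "contrast_cov w L S h"
    have h1: "h \<ge> 1" using h by simp
    have pd: "posdef ?d ?X" by (rule posdef_contrast_cov[OF wpos posdef_S h])
    have "mmul ?d ?W (minv ?d ?X) f i = A h i" if i: "i < ?d" for i
    proof -
      have "mmul ?d ?W (minv ?d ?X) f i = mmul ?d (mmul ?d (\<lambda>_. A h) ?X) (minv ?d ?X) f i"
        by (rule mmul_cong) (use WA[OF h] in \<open>simp_all add: mmul_def\<close>)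
      also have "\<dots> = mmul ?d (\<lambda>_. A h) (mmul ?d ?X (minv ?d ?X)) f i" by (simp only: mmul_assoc)
      also have "\<dots> = mmul ?d (\<lambda>_. A h) mid f i"
        by (rule mmul_cong) (use minv_symmetric(1)[OF posdef_sym[OF pd] posdef_nonsingular[OF pd]] i in auto)
      also have "\<dots> = A h i" by (rule mmul_mid_right[OF i])
      finally show ?thesis .
    qed
    then show ?thesis
      unfolding Wpar_def Let_def Wxx_contrast_cov[OF h1] mmul_def[of ?d "mmul ?d ?W (minv ?d ?X)"] by (simp add: mtr_def)
  qed
  have "(\<Sum>h\<in>{1..H}. Wpar K iota eff nq T L n Y x h f f')
     = (\<Sum>h\<in>{1..H}. \<Sum>l<L. \<Sum>q<Q. kk * g f' q * ?Sq q l * (w q * (\<Sum>j<card (T h). \<alpha> l h j * c h q j)))"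
  proof (rule sum.cong[OF refl])
    fix h assume h: "h \<in> {1..H}"
    then have h1: "h \<ge> 1" by simp
    let ?t = "card (T h)"
    have "Wpar K iota eff nq T L n Y x h f f' = (\<Sum>i<L * ?t. \<alpha> (i mod L) h (i div L) * (kk * (\<Sum>q<Q. w q * (g f' q * c h q (i div L)) * ?Sq q (i mod L))))"
      unfolding Wpar_A[OF h] A_def Wtx_eq[OF h1] ..
    also have "\<dots> = (\<Sum>j<?t. \<Sum>l<L. \<alpha> l h j * (kk * (\<Sum>q<Q. w q * (g f' q * c h q j) * ?Sq q l)))"
      by (rule sum_div_mod[of "\<lambda>j l. \<alpha> l h j * (kk * (\<Sum>q<Q. w q * (g f' q * c h q j) * ?Sq q l))"])
    also have "\<dots> = (\<Sum>l<L. \<Sum>j<?t. \<alpha> l h j * (kk * (\<Sum>q<Q. w q * (g f' q * c h q j) * ?Sq q l)))" by (rule sum.swap)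
    also have "\<dots> = (\<Sum>l<L. \<Sum>j<?t. \<Sum>q<Q. kk * g f' q * ?Sq q l * (w q * (\<alpha> l h j * c h q j)))"
      unfolding sum_distrib_left by (intro sum.cong refl) (simp only: mult_ac)
    also have "\<dots> = (\<Sum>l<L. \<Sum>q<Q. \<Sum>j<?t. kk * g f' q * ?Sq q l * (w q * (\<alpha> l h j * c h q j)))"
      by (rule sum.cong[OF refl], rule sum.swap)
    finally show "Wpar K iota eff nq T L n Y x h f f' = (\<Sum>l<L. \<Sum>q<Q. kk * g f' q * ?Sq q l * (w q * (\<Sum>j<?t. \<alpha> l h j * c h q j)))"
      by (simp only: sum_distrib_left)
  qed
  also have "\<dots> = (\<Sum>l<L. \<Sum>h\<in>{1..H}. \<Sum>q<Q. kk * g f' q * ?Sq q l * (w q * (\<Sum>j<card (T h). \<alpha> l h j * c h q j)))" by (rule sum.swap)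
  also have "\<dots> = (\<Sum>l<L. \<Sum>q<Q. \<Sum>h\<in>{1..H}. kk * g f' q * ?Sq q l * (w q * (\<Sum>j<card (T h). \<alpha> l h j * c h q j)))"
    by (rule sum.cong[OF refl], rule sum.swap)
  also have "\<dots> = (\<Sum>l<L. \<Sum>q<Q. kk * g f' q * ?Sq q l * (w q * zz l q))"
    by (simp only: zz_def sum_distrib_left)
  also have "\<dots> = (\<Sum>l<L. \<Sum>q<Q. kk * (w q * (g f q * g f' q)) * (beta q l * ?Sq q l) - kk * (lam l * (g f' q * ?Sq q l)))"
  proof (intro sum.cong refl)
    fix l q assume "q \<in> {..<Q}"
    then have q: "q < Q" by (rule lessThan_iff[THEN iffD1])
    show "kk * g f' q * ?Sq q l * (w q * zz l q) = kk * (w q * (g f q * g f' q)) * (beta q l * ?Sq q l) - kk * (lam l * (g f' q * ?Sq q l))"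
      unfolding zz[OF q] by (simp only: right_diff_distrib mult_ac)
  qed
  also have "\<dots> = (\<Sum>l<L. \<Sum>q<Q. kk * (w q * (g f q * g f' q)) * (beta q l * ?Sq q l)) - (\<Sum>l<L. \<Sum>q<Q. kk * (lam l * (g f' q * ?Sq q l)))"
    by (simp only: sum_subtractf)
  also have "(\<Sum>l<L. \<Sum>q<Q. kk * (w q * (g f q * g f' q)) * (beta q l * ?Sq q l)) = (\<Sum>q<Q. \<Sum>l<L. kk * (w q * (g f q * g f' q)) * (beta q l * ?Sq q l))"
    by (rule sum.swap)
  also have "\<dots> = kk * (\<Sum>q<Q. w q * (g f q * g f' q) * Pq q q)"
    by (simp only: Pq_def sum_distrib_left mult.assoc)
  also have "(\<Sum>l<L. \<Sum>q<Q. kk * (lam l * (g f' q * ?Sq q l))) = kk / real n * (\<Sum>q<Q. \<Sum>r<Q. g f q * g f' r * Pq q r)"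
  proof -
    have "(\<Sum>l<L. \<Sum>r<Q. kk * (lam l * (g f' r * ?Sq r l))) = (\<Sum>l<L. \<Sum>r<Q. \<Sum>q<Q. kk / real n * (g f q * g f' r * (beta q l * ?Sq r l)))"
      unfolding lam_def sum_divide_distrib sum_distrib_left sum_distrib_right
      by (intro sum.cong refl) (simp add: mult_ac)
    also have "\<dots> = (\<Sum>r<Q. \<Sum>l<L. \<Sum>q<Q. kk / real n * (g f q * g f' r * (beta q l * ?Sq r l)))" by (rule sum.swap)
    also have "\<dots> = (\<Sum>r<Q. \<Sum>q<Q. \<Sum>l<L. kk / real n * (g f q * g f' r * (beta q l * ?Sq r l)))" by (rule sum.cong[OF refl], rule sum.swap)
    also have "\<dots> = (\<Sum>q<Q. \<Sum>r<Q. \<Sum>l<L. kk / real n * (g f q * g f' r * (beta q l * ?Sq r l)))" by (rule sum.swap)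
    finally show ?thesis by (simp only: Pq_def sum_distrib_left)
  qed
  finally show ?thesis unfolding Ppar_def .
qed

lemma Vtt_decomposition:
  "f < F \<Longrightarrow> f' < F \<Longrightarrow> Vtt f f' = Vperp K iota eff nq n L Y x f f' + (\<Sum>h\<in>{1..H}. Wpar K iota eff nq T L n Y x h f f')"
  by (simp only: Wpar_sum Vperp_eq diff_add_cancel)

lemma linear_stat_effect_array:
  assumes Z: "Z \<in> assignments Q n nq"
  shows "linear_stat n (effect_array f) Z = sqrt (real n) * (tauhat K iota eff n Y nq Z f - taupop K iota eff n Y f)"
proof -
  have grp: "(\<Sum>i\<in>{i. i < n \<and> Z i = q}. scaled_array (g f) yc i q) = sqrt (real n) * s * (g f q * (Yhat n Y nq Z q - pmean n (\<lambda>i. Y i q)))" if q: "q < Q" for q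
  proof -
    have card: "card {i. i < n \<and> Z i = q} = nq q" using Z q by (simp add: assignments_def)
    have "(\<Sum>i\<in>{i. i < n \<and> Z i = q}. scaled_array (g f) yc i q) = sqrt (real n) * s * g f q * (\<Sum>i\<in>{i. i < n \<and> Z i = q}. yc i q) / real (nq q)"
      unfolding scaled_array_def by (simp only: sum_distrib_left sum_divide_distrib)
    also have "(\<Sum>i\<in>{i. i < n \<and> Z i = q}. yc i q) = (\<Sum>i\<in>{i. i < n \<and> Z i = q}. Y i q) - real (nq q) * pmean n (\<lambda>i. Y i q)"
      unfolding yc_def sum_subtractf by (simp add: card)
    also have "(\<Sum>i\<in>{i. i < n \<and> Z i = q}. Y i q) = (\<Sum>i\<in>{i. i < n \<and> Z i = q}. Y i (Z i))"
      by (rule sum.cong) auto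
    finally show ?thesis using nq0[OF q] by (simp add: Yhat_def field_simps)
  qed
  have "linear_stat n (effect_array f) Z = (\<Sum>q<Q. \<Sum>i\<in>{i. i < n \<and> Z i = q}. scaled_array (g f) yc i q)"
    unfolding linear_stat_def effect_array_def by (rule sum_group_assigned[OF Z])
  also have "\<dots> = (\<Sum>q<Q. sqrt (real n) * s * (g f q * (Yhat n Y nq Z q - pmean n (\<lambda>i. Y i q))))"
    by (rule sum.cong[OF refl], rule grp) simp
  also have "\<dots> = sqrt (real n) * s * ((\<Sum>q<Q. g f q * Yhat n Y nq Z q) - (\<Sum>q<Q. g f q * pmean n (\<lambda>i. Y i q)))"
    by (simp only: sum_distrib_left[symmetric] right_diff_distrib sum_subtractf)
  finally show ?thesis by (simp add: tauhat_def taupop_def right_diff_distrib)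
qed

lemma linear_stat_covariate_array:
  assumes Z: "Z \<in> assignments Q n nq" and h: "h \<in> {1..H}" and j: "j < L * card (T h)"
  shows "linear_stat n (covariate_array h j) Z = sqrt (real n) * thetax K iota eff nq T L n x Z h j"
proof -
  let ?c = "\<lambda>q. c h q (j div L)" and ?l = "j mod L"
  have h1: "h \<ge> 1" using h by simp
  have grp: "(\<Sum>i\<in>{i. i < n \<and> Z i = q}. scaled_array ?c (\<lambda>i q. xc i ?l) i q) = sqrt (real n) * s * (?c q * xhat n x nq Z q ?l - ?c q * pmean n (\<lambda>i. x i ?l))" if q: "q < Q" for q
  proof -
    have card: "card {i. i < n \<and> Z i = q} = nq q" using Z q by (simp add: assignments_def)
    have "(\<Sum>i\<in>{i. i < n \<and> Z i = q}. scaled_array ?c (\<lambda>i q. xc i ?l) i q) = sqrt (real n) * s * ?c q * (\<Sum>i\<in>{i. i < n \<and> Z i = q}. xc i ?l) / real (nq q)"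
      unfolding scaled_array_def by (simp only: sum_distrib_left sum_divide_distrib)
    also have "(\<Sum>i\<in>{i. i < n \<and> Z i = q}. xc i ?l) = (\<Sum>i\<in>{i. i < n \<and> Z i = q}. x i ?l) - real (nq q) * pmean n (\<lambda>i. x i ?l)"
      unfolding xc_def sum_subtractf by (simp add: card)
    finally show ?thesis using nq0[OF q] by (simp add: xhat_def field_simps)
  qed
  have "linear_stat n (covariate_array h j) Z = (\<Sum>q<Q. \<Sum>i\<in>{i. i < n \<and> Z i = q}. scaled_array ?c (\<lambda>i q. xc i ?l) i q)"
    unfolding linear_stat_def covariate_array_def by (rule sum_group_assigned[OF Z])
  also have "\<dots> = (\<Sum>q<Q. sqrt (real n) * s * (?c q * xhat n x nq Z q ?l - ?c q * pmean n (\<lambda>i. x i ?l)))"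
    by (rule sum.cong[OF refl], rule grp) simp
  also have "\<dots> = sqrt (real n) * s * ((\<Sum>q<Q. ?c q * xhat n x nq Z q ?l) - (\<Sum>q<Q. ?c q * pmean n (\<lambda>i. x i ?l)))"
    by (simp only: sum_distrib_left[symmetric] sum_subtractf)
  also have "(\<Sum>q<Q. ?c q * pmean n (\<lambda>i. x i ?l)) = 0" by (rule sum_c_scaled[OF h idx_div[OF j]])
  finally show ?thesis by (simp add: thetax_def kronv_def cvec_contrast[OF h1])
qed

end

section \<open>Limits along a sequence of populations\<close>

context factorial_design
begin

lemma effect_gram_tendsto:
  assumes "\<And>q. q < Q \<Longrightarrow> (\<lambda>m. t m * w m q) \<longlonglongrightarrow> w' q"
  shows "(\<lambda>m. t m * effect_gram (w m) f f') \<longlonglongrightarrow> effect_gram w' f f'"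
proof -
  have "(\<lambda>m. (1 / 2 ^ (2 * (K - 1))) * (\<Sum>q<Q. (t m * w m q) * g f q * g f' q)) \<longlonglongrightarrow> effect_gram w' f f'"
    unfolding effect_gram_def by (intro tendsto_mult_left tendsto_sum tendsto_mult_right assms) simp
  moreover have "t m * effect_gram (w m) f f' = (1 / 2 ^ (2 * (K - 1))) * (\<Sum>q<Q. (t m * w m q) * g f q * g f' q)" for m
    unfolding effect_gram_def mult.left_commute[of "t m"] by (simp only: sum_distrib_left mult.assoc)
  ultimately show ?thesis by (simp only:)
qed

lemma scaled_minv_tendsto:
  assumes A: "\<And>i j. i < d \<Longrightarrow> j < d \<Longrightarrow> (\<lambda>m. t m * A m i j) \<longlonglongrightarrow> A' i j" and t: "\<And>m. t m \<noteq> 0"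
    and pd: "\<And>m. posdef d (A m)" and pd': "posdef d A'" and ij: "i < d" "j < d"
  shows "(\<lambda>m. minv d (A m) i j / t m) \<longlonglongrightarrow> minv d A' i j"
proof (rule inverse_tendsto[where A = "\<lambda>m i j. t m * A m i j" and A' = A' and B = "\<lambda>m i j. minv d (A m) i j / t m"])
  show "mmul d (\<lambda>i j. t m * A m i j) (\<lambda>i j. minv d (A m) i j / t m) i j = mid i j" if "i < d" "j < d" for m i j
  proof -
    have "mmul d (\<lambda>i j. t m * A m i j) (\<lambda>i j. minv d (A m) i j / t m) i j = mmul d (A m) (minv d (A m)) i j"
      unfolding mmul_def using t[of m] by (intro sum.cong refl) simp
    then show ?thesis using minv_symmetric(1)[OF posdef_sym[OF pd] posdef_nonsingular[OF pd]] that by simp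
  qed
  show "mmul d (minv d A') A' i j = mid i j" if "i < d" "j < d" for i j
    using minv_symmetric(2)[OF posdef_sym[OF pd'] posdef_nonsingular[OF pd']] that by simp
qed (use A ij in auto)

lemma contrast_tendsto:
  assumes w: "\<And>q. q < Q \<Longrightarrow> (\<lambda>m. t m * w m q) \<longlonglongrightarrow> w' q" and t: "\<And>m. t m \<noteq> 0"
    and wp: "\<And>m q. q < Q \<Longrightarrow> w m q > 0" and wp': "\<And>q. q < Q \<Longrightarrow> w' q > 0" and h: "h \<in> {1..H}"
  shows "(\<lambda>m. contrast (w m) h q j) \<longlonglongrightarrow> contrast w' h q j"
proof -
  let ?P = "Tbar T (h - 1)"
  let ?p = "card ?P"
  have hH: "h - 1 \<le> H" using h by auto
  have P: "?P \<subseteq> {..<F}" by (rule Tbar_sub[OF hH])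
  have proj: "(\<lambda>m. proj (w m) h j k) \<longlonglongrightarrow> proj w' h j k" if k: "k < ?p" for k
  proof -
    have "(\<lambda>m. \<Sum>i<?p. (t m * submat (T h) ?P (effect_gram (w m)) j i) * (minv ?p (submat ?P ?P (effect_gram (w m))) i k / t m))
       \<longlonglongrightarrow> (\<Sum>i<?p. submat (T h) ?P (effect_gram w') j i * minv ?p (submat ?P ?P (effect_gram w')) i k)"
    proof (intro tendsto_sum tendsto_mult)
      show "(\<lambda>m. t m * submat (T h) ?P (effect_gram (w m)) j i) \<longlonglongrightarrow> submat (T h) ?P (effect_gram w') j i" for i
        unfolding submat_def by (rule effect_gram_tendsto[OF w])
      fix i assume "i \<in> {..<?p}"
      then show "(\<lambda>m. minv ?p (submat ?P ?P (effect_gram (w m))) i k / t m) \<longlonglongrightarrow> minv ?p (submat ?P ?P (effect_gram w')) i k"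
        by (intro scaled_minv_tendsto posdef_effect_gram P wp wp' t k) (auto simp: submat_def intro!: effect_gram_tendsto w)
    qed
    moreover have "(\<Sum>i<?p. (t m * submat (T h) ?P (effect_gram (w m)) j i) * (minv ?p (submat ?P ?P (effect_gram (w m))) i k / t m)) = proj (w m) h j k" for m
      unfolding proj_def Let_def mmul_def using t[of m] by (intro sum.cong refl) simp
    moreover have "(\<Sum>i<?p. submat (T h) ?P (effect_gram w') j i * minv ?p (submat ?P ?P (effect_gram w')) i k) = proj w' h j k"
      unfolding proj_def Let_def mmul_def ..
    ultimately show ?thesis by (simp only:)
  qed
  show ?thesis unfolding contrast_def
    by (intro tendsto_diff tendsto_const tendsto_sum tendsto_mult_right proj) simp
qed

lemma contrast_cov_tendsto:
  assumes w: "\<And>q. q < Q \<Longrightarrow> (\<lambda>m. t m * w m q) \<longlonglongrightarrow> w' q" and t: "\<And>m. t m \<noteq> 0"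
    and wp: "\<And>m q. q < Q \<Longrightarrow> w m q > 0" and wp': "\<And>q. q < Q \<Longrightarrow> w' q > 0" and h: "h \<in> {1..H}"
    and S: "\<And>l l'. l < L \<Longrightarrow> l' < L \<Longrightarrow> (\<lambda>m. S m l l') \<longlonglongrightarrow> S' l l'"
    and ij: "i < L * card (T h)" "j < L * card (T h)"
  shows "(\<lambda>m. t m * contrast_cov (w m) L (S m) h i j) \<longlonglongrightarrow> contrast_cov w' L S' h i j"
proof -
  have L: "L > 0" using ij by (cases L) auto
  have "(\<lambda>m. (1 / 2 ^ (2 * (K - 1))) * (\<Sum>q<Q. (t m * w m q) * (contrast (w m) h q (i div L) * contrast (w m) h q (j div L) * S m (i mod L) (j mod L))))
     \<longlonglongrightarrow> contrast_cov w' L S' h i j"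
    unfolding contrast_cov_def
    by (intro tendsto_mult_left tendsto_sum tendsto_mult w contrast_tendsto[OF w t wp wp' h] S) (use L in auto)
  moreover have "t m * contrast_cov (w m) L (S m) h i j = (1 / 2 ^ (2 * (K - 1))) * (\<Sum>q<Q. (t m * w m q) * (contrast (w m) h q (i div L) * contrast (w m) h q (j div L) * S m (i mod L) (j mod L)))" for m
    unfolding contrast_cov_def mult.left_commute[of "t m"] by (simp only: sum_distrib_left mult.assoc)
  ultimately show ?thesis by (simp only:)
qed

end

locale factorial_sequence = factorial_design +
  fixes L :: nat and a :: "nat \<Rightarrow> real" and N :: "nat \<Rightarrow> nat" and nq :: "nat \<Rightarrow> nat \<Rightarrow> nat"
    and Y x :: "nat \<Rightarrow> nat \<Rightarrow> nat \<Rightarrow> real"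
  assumes thresholds: "\<forall>h\<in>{1..H}. a h > 0"
    and nq_pos: "\<forall>m. \<forall>q<2^K. nq m q \<ge> 1"
    and nq_sum: "\<forall>m. (\<Sum>q<2^K. nq m q) = N m"
    and N_lim: "filterlim N at_top sequentially"
    and reg_i: "\<forall>q<2^K. \<exists>c>0. (\<lambda>m. real (nq m q) / real (N m)) \<longlonglongrightarrow> c"
    and reg_ii_Y: "\<forall>q<2^K. \<forall>k<2^K. convergent (\<lambda>m. pcov (N m) (\<lambda>i. Y m i q) (\<lambda>i. Y m i k))"
    and reg_ii_xx: "\<forall>m. nonsingular L (Sxx (N m) (x m))"
    and reg_ii_xx_lim: "\<exists>S. (\<forall>l<L. \<forall>l'<L. (\<lambda>m. Sxx (N m) (x m) l l') \<longlonglongrightarrow> S l l') \<and> nonsingular L S"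
    and reg_ii_qx: "\<forall>q<2^K. \<forall>l<L. convergent (\<lambda>m. Sqx (N m) (Y m) (x m) q l)"
    and reg_iii_Y: "\<forall>q<2^K. (\<lambda>m. Max ((\<lambda>i. (Y m i q - pmean (N m) (\<lambda>j. Y m j q))\<^sup>2) ` {..<N m})
                                / real (N m)) \<longlonglongrightarrow> 0"
    and reg_iii_x: "(\<lambda>m. Max ((\<lambda>i. \<Sum>l<L. (x m i l - pmean (N m) (\<lambda>j. x m j l))\<^sup>2) ` {..<N m})
                                / real (N m)) \<longlonglongrightarrow> 0"
begin

sublocale P: factorial_population K H iota eff T "N m" L "nq m" "Y m" "x m" for m
  by unfold_locales (use nq_pos nq_sum reg_ii_xx in auto)

abbreviation "wm m \<equiv> (\<lambda>q. 1 / real (nq m q))"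
abbreviation "kk \<equiv> (1::real) / 2 ^ (2 * (K - 1))"

definition wl :: "nat \<Rightarrow> real" where
  "wl q = lim (\<lambda>m. real (N m) * wm m q)"

definition Sl :: rmat where
  "Sl = (SOME S. (\<forall>l<L. \<forall>l'<L. (\<lambda>m. Sxx (N m) (x m) l l') \<longlonglongrightarrow> S l l') \<and> nonsingular L S)"

definition Sql :: "nat \<Rightarrow> nat \<Rightarrow> real" where
  "Sql q l = lim (\<lambda>m. Sqx (N m) (Y m) (x m) q l)"

definition Syl :: "nat \<Rightarrow> nat \<Rightarrow> real" where
  "Syl q r = lim (\<lambda>m. pcov (N m) (\<lambda>i. Y m i q) (\<lambda>i. Y m i r))"

lemma wl: "q < Q \<Longrightarrow> (\<lambda>m. real (N m) * wm m q) \<longlonglongrightarrow> wl q" "q < Q \<Longrightarrow> wl q > 0"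
proof -
  assume q: "q < Q"
  obtain c where c: "c > 0" "(\<lambda>m. real (nq m q) / real (N m)) \<longlonglongrightarrow> c" using reg_i q by blast
  have "(\<lambda>m. inverse (real (nq m q) / real (N m))) \<longlonglongrightarrow> inverse c" using c by (intro tendsto_inverse) auto
  then have l: "(\<lambda>m. real (N m) * wm m q) \<longlonglongrightarrow> inverse c" by (simp add: field_simps)
  then have "wl q = inverse c" unfolding wl_def by (rule limI)
  then show "(\<lambda>m. real (N m) * wm m q) \<longlonglongrightarrow> wl q" "wl q > 0" using l c by auto
qed

lemma Sl: "l < L \<Longrightarrow> l' < L \<Longrightarrow> (\<lambda>m. Sxx (N m) (x m) l l') \<longlonglongrightarrow> Sl l l'" "nonsingular L Sl"
  using someI_ex[OF reg_ii_xx_lim] unfolding Sl_def by blast+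

lemma Sql: "q < Q \<Longrightarrow> l < L \<Longrightarrow> (\<lambda>m. Sqx (N m) (Y m) (x m) q l) \<longlonglongrightarrow> Sql q l"
  using reg_ii_qx unfolding Sql_def by (simp add: convergent_LIMSEQ_iff)

lemma Syl: "q < Q \<Longrightarrow> r < Q \<Longrightarrow> (\<lambda>m. pcov (N m) (\<lambda>i. Y m i q) (\<lambda>i. Y m i r)) \<longlonglongrightarrow> Syl q r"
  using reg_ii_Y unfolding Syl_def by (simp add: convergent_LIMSEQ_iff)

lemma posdef_Sl: "posdef L Sl"
proof (rule psd_nonsingular_posdef[OF _ _ Sl(2)])
  fix l l' assume l: "l < L" "l' < L"
  have "(\<lambda>m. Sxx (N m) (x m) l l') \<longlonglongrightarrow> Sl l' l" using Sl(1)[OF l(2,1)] by (subst P.S_sym)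
  then show "Sl l l' = Sl l' l" using Sl(1)[OF l] LIMSEQ_unique by blast
next
  fix v
  have "(\<lambda>m. bilin L (Sxx (N m) (x m)) v v) \<longlonglongrightarrow> bilin L Sl v v"
    unfolding bilin_def by (intro tendsto_sum tendsto_mult_right tendsto_mult_left Sl(1)) auto
  moreover have "bilin L (Sxx (N m) (x m)) v v \<ge> 0" for m
  proof (cases "\<exists>l<L. v l \<noteq> 0")
    case True
    then show ?thesis using P.posdef_S[of m] by (auto simp: posdef_def intro: less_imp_le)
  qed (simp add: bilin_def)
  ultimately show "bilin L Sl v v \<ge> 0" by (intro LIMSEQ_le_const) auto
qed

lemma Npos: "real (N m) > 0" "real (N m) \<noteq> 0"
  using P.n0[of m] by auto

definition Al :: "nat \<Rightarrow> rmat" where "Al h = contrast_cov wl L Sl h"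

lemma posdef_Al: "h \<in> {1..H} \<Longrightarrow> posdef (L * card (T h)) (Al h)"
  unfolding Al_def by (rule posdef_contrast_cov[OF wl(2) posdef_Sl])

abbreviation "Xm m h \<equiv> contrast_cov (wm m) L (Sxx (N m) (x m)) h"

lemma posdef_Xm: "h \<in> {1..H} \<Longrightarrow> posdef (L * card (T h)) (Xm m h)"
  by (rule posdef_contrast_cov[OF P.wpos P.posdef_S])

lemma Xm_lim:
  assumes "h \<in> {1..H}" "i < L * card (T h)" "j < L * card (T h)"
  shows "(\<lambda>m. real (N m) * Xm m h i j) \<longlonglongrightarrow> Al h i j"
  unfolding Al_def by (rule contrast_cov_tendsto[OF wl(1) Npos(2) P.wpos wl(2) assms(1) Sl(1) assms(2,3)])

lemma minv_Xm_lim: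
  assumes "h \<in> {1..H}" "i < L * card (T h)" "j < L * card (T h)"
  shows "(\<lambda>m. minv (L * card (T h)) (Xm m h) i j / real (N m)) \<longlonglongrightarrow> minv (L * card (T h)) (Al h) i j"
  by (rule scaled_minv_tendsto[OF Xm_lim[OF assms(1)] Npos(2) posdef_Xm[OF assms(1)] posdef_Al[OF assms(1)] assms(2,3)])

lemma c_lim: "h \<in> {1..H} \<Longrightarrow> (\<lambda>m. contrast (wm m) h q j) \<longlonglongrightarrow> contrast wl h q j"
  by (rule contrast_tendsto[OF wl(1) Npos(2) P.wpos wl(2)])

abbreviation "Wm m h \<equiv> Wtx K iota eff (nq m) T L (N m) (Y m) (x m) h"
abbreviation "Wpm m h \<equiv> Wpar K iota eff (nq m) T L (N m) (Y m) (x m) h"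
abbreviation "Vpm m \<equiv> Vperp K iota eff (nq m) (N m) L (Y m) (x m)"

definition Wl :: "nat \<Rightarrow> rmat" where
  "Wl h f j = kk * (\<Sum>q<Q. wl q * (g f q * contrast wl h q (j div L)) * Sql q (j mod L))"

lemma Wm_lim:
  assumes h: "h \<in> {1..H}" and j: "j < L * card (T h)"
  shows "(\<lambda>m. real (N m) * Wm m h f j) \<longlonglongrightarrow> Wl h f j"
proof -
  have h1: "h \<ge> 1" using h by simp
  have "(\<lambda>m. kk * (\<Sum>q<Q. (real (N m) * wm m q) * (g f q * contrast (wm m) h q (j div L)) * Sqx (N m) (Y m) (x m) q (j mod L))) \<longlonglongrightarrow> Wl h f j"
    unfolding Wl_def
    by (intro tendsto_mult_left tendsto_sum tendsto_mult wl(1) c_lim[OF h] Sql tendsto_const)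
      (use P.idx_mod[OF j] in auto)
  moreover have "real (N m) * Wm m h f j = kk * (\<Sum>q<Q. (real (N m) * wm m q) * (g f q * contrast (wm m) h q (j div L)) * Sqx (N m) (Y m) (x m) q (j mod L))" for m
    unfolding P.Wtx_eq[OF h1] mult.left_commute[of "real (N m)"] by (simp only: sum_distrib_left mult.assoc)
  ultimately show ?thesis by (simp only:)
qed

definition Pl :: "nat \<Rightarrow> rmat" where
  "Pl h = (let d = L * card (T h) in mmul d (mmul d (Wl h) (minv d (Al h))) (mtr (Wl h)))"

lemma Wpm_lim:
  assumes h: "h \<in> {1..H}"
  shows "(\<lambda>m. real (N m) * Wpm m h f f') \<longlonglongrightarrow> Pl h f f'"
proof -
  let ?d = "L * card (T h)"
  have h1: "h \<ge> 1" using h by simp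
  have "(\<lambda>m. \<Sum>j<?d. (\<Sum>i<?d. (real (N m) * Wm m h f i) * (minv ?d (Xm m h) i j / real (N m))) * (real (N m) * Wm m h f' j))
     \<longlonglongrightarrow> (\<Sum>j<?d. (\<Sum>i<?d. Wl h f i * minv ?d (Al h) i j) * Wl h f' j)"
    by (intro tendsto_sum tendsto_mult Wm_lim[OF h] minv_Xm_lim[OF h]) auto
  moreover have "(\<Sum>j<?d. (\<Sum>i<?d. (real (N m) * Wm m h f i) * (minv ?d (Xm m h) i j / real (N m))) * (real (N m) * Wm m h f' j))
     = real (N m) * Wpm m h f f'" for m
  proof -
    have "(\<Sum>i<?d. (real (N m) * Wm m h f i) * (minv ?d (Xm m h) i j / real (N m))) = (\<Sum>i<?d. Wm m h f i * minv ?d (Xm m h) i j)" for j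
      using Npos(2)[of m] by (intro sum.cong refl) simp
    then show ?thesis
      unfolding Wpar_def Let_def P.Wxx_contrast_cov[OF h1] mmul_def mtr_def sum_distrib_left[of "real (N m)"]
      by (intro sum.cong refl) (simp add: mult_ac)
  qed
  moreover have "(\<Sum>j<?d. (\<Sum>i<?d. Wl h f i * minv ?d (Al h) i j) * Wl h f' j) = Pl h f f'"
    unfolding Pl_def Let_def mmul_def mtr_def ..
  ultimately show ?thesis by (simp only:)
qed

definition Vttl :: rmat where
  "Vttl f f' = kk * (\<Sum>q<Q. wl q * (g f q * g f' q) * Syl q q) - kk * (\<Sum>q<Q. \<Sum>r<Q. g f q * g f' r * Syl q r)"

lemma Vtt_lim: "(\<lambda>m. real (N m) * P.Vtt m f f') \<longlonglongrightarrow> Vttl f f'"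
proof -
  have "(\<lambda>m. kk * (\<Sum>q<Q. (real (N m) * wm m q) * (g f q * g f' q) * pcov (N m) (\<lambda>i. Y m i q) (\<lambda>i. Y m i q))
      - kk * (\<Sum>q<Q. \<Sum>r<Q. g f q * g f' r * pcov (N m) (\<lambda>i. Y m i q) (\<lambda>i. Y m i r))) \<longlonglongrightarrow> Vttl f f'"
    unfolding Vttl_def
    by (intro tendsto_diff tendsto_mult_left tendsto_sum tendsto_mult wl(1) Syl tendsto_const) auto
  moreover have "real (N m) * P.Vtt m f f' = kk * (\<Sum>q<Q. (real (N m) * wm m q) * (g f q * g f' q) * pcov (N m) (\<lambda>i. Y m i q) (\<lambda>i. Y m i q))
      - kk * (\<Sum>q<Q. \<Sum>r<Q. g f q * g f' r * pcov (N m) (\<lambda>i. Y m i q) (\<lambda>i. Y m i r))" for m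
  proof -
    have n: "real (N m) * (kk / real (N m) * b) = kk * b" for b using Npos(2)[of m] by simp
    show ?thesis
      unfolding P.Vtt_def right_diff_distrib[of "real (N m)"] n mult.left_commute[of "real (N m)" kk]
      by (simp only: sum_distrib_left mult.assoc)
  qed
  ultimately show ?thesis by (simp only:)
qed

definition Vpl :: rmat where
  "Vpl f f' = Vttl f f' - (\<Sum>h\<in>{1..H}. Pl h f f')"

lemma Vpm_lim:
  assumes "f < F" "f' < F"
  shows "(\<lambda>m. real (N m) * Vpm m f f') \<longlonglongrightarrow> Vpl f f'"
proof -
  have "(\<lambda>m. real (N m) * P.Vtt m f f' - (\<Sum>h\<in>{1..H}. real (N m) * Wpm m h f f')) \<longlonglongrightarrow> Vpl f f'"
    unfolding Vpl_def by (intro tendsto_diff Vtt_lim tendsto_sum Wpm_lim)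
  moreover have "real (N m) * Vpm m f f' = real (N m) * P.Vtt m f f' - (\<Sum>h\<in>{1..H}. real (N m) * Wpm m h f f')" for m
    unfolding P.Vtt_decomposition[OF assms] by (simp add: distrib_left sum_distrib_left)
  ultimately show ?thesis by (simp only:)
qed

lemma ratio_lim: "(\<lambda>m. (real (N m) - 1) / real (N m)) \<longlonglongrightarrow> 1"
proof -
  have "(\<lambda>m. 1 - inverse (real (N m))) \<longlonglongrightarrow> 1 - 0"
    by (intro tendsto_diff tendsto_const filterlim_compose[OF lim_inverse_n N_lim])
  moreover have "(real (N m) - 1) / real (N m) = 1 - inverse (real (N m))" for m
    using Npos(2)[of m] by (simp add: field_simps)
  ultimately show ?thesis by simp
qed

lemma scale_lim:
  assumes "(\<lambda>m. real (N m) * b m) \<longlonglongrightarrow> b'"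
  shows "(\<lambda>m. (real (N m) - 1) * b m) \<longlonglongrightarrow> b'"
proof -
  have "(\<lambda>m. (real (N m) - 1) / real (N m) * (real (N m) * b m)) \<longlonglongrightarrow> 1 * b'"
    by (intro tendsto_mult ratio_lim assms)
  moreover have "(real (N m) - 1) / real (N m) * (real (N m) * b m) = (real (N m) - 1) * b m" for m
    using Npos(2)[of m] by simp
  ultimately show ?thesis by simp
qed

lemma scaled_array_bound:
  assumes \<alpha>: "\<And>q. q < Q \<Longrightarrow> convergent (\<lambda>m. \<alpha> m q)"
    and u: "\<And>m i q. i < N m \<Longrightarrow> q < Q \<Longrightarrow> (u m i q)\<^sup>2 \<le> mx m" and mx: "(\<lambda>m. mx m / real (N m)) \<longlonglongrightarrow> 0"
  shows "\<exists>b. b \<longlonglongrightarrow> 0 \<and> (\<forall>m i q. i < N m \<longrightarrow> q < Q \<longrightarrow> \<bar>P.scaled_array m (\<alpha> m) (u m) i q\<bar> \<le> b m)"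
proof -
  define b where "b m = (\<Sum>q<Q. s * \<bar>\<alpha> m q\<bar> * (real (N m) * wm m q) * sqrt (mx m / real (N m)))" for m
  have "b \<longlonglongrightarrow> (\<Sum>q<Q. s * \<bar>lim (\<lambda>m. \<alpha> m q)\<bar> * wl q * sqrt 0)"
    unfolding b_def[abs_def]
    by (intro tendsto_sum tendsto_mult tendsto_const tendsto_rabs wl(1) tendsto_real_sqrt mx)
      (use \<alpha> in \<open>auto simp: convergent_LIMSEQ_iff\<close>)
  then have b0: "b \<longlonglongrightarrow> 0" by simp
  have "\<bar>P.scaled_array m (\<alpha> m) (u m) i q\<bar> \<le> b m" if iq: "i < N m" "q < Q" for m i q
  proof -
    let ?n = "real (N m)"
    have n: "?n > 0" "sqrt ?n * sqrt ?n = ?n" using Npos[of m] by auto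
    have "mx m \<ge> 0" using u[OF iq] by (meson order_trans zero_le_power2)
    have "P.scaled_array m (\<alpha> m) (u m) i q = s * \<alpha> m q * (?n * wm m q) * (u m i q / sqrt ?n)"
    proof -
      have "s * \<alpha> m q * (?n * wm m q) * (u m i q / sqrt ?n) = (?n / sqrt ?n) * s * \<alpha> m q * u m i q / real (nq m q)" by (simp add: mult_ac)
      also have "?n / sqrt ?n = sqrt ?n" using n by (intro real_div_sqrt) simp
      finally show ?thesis unfolding P.scaled_array_def ..
    qed
    then have "\<bar>P.scaled_array m (\<alpha> m) (u m) i q\<bar> = s * \<bar>\<alpha> m q\<bar> * (?n * wm m q) * \<bar>u m i q / sqrt ?n\<bar>"
      by (simp add: abs_mult)
    also have "\<dots> \<le> s * \<bar>\<alpha> m q\<bar> * (?n * wm m q) * sqrt (mx m / ?n)"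
    proof (rule mult_left_mono)
      have "\<bar>u m i q\<bar> \<le> sqrt (mx m)" using u[OF iq] by (metis real_sqrt_abs real_sqrt_le_iff)
      then show "\<bar>u m i q / sqrt ?n\<bar> \<le> sqrt (mx m / ?n)"
        using n by (simp add: real_sqrt_divide divide_right_mono)
    qed simp
    also have "\<dots> \<le> b m"
      unfolding b_def
      by (rule member_le_sum[where f = "\<lambda>q. s * \<bar>\<alpha> m q\<bar> * (?n * wm m q) * sqrt (mx m / ?n)"])
        (use iq \<open>mx m \<ge> 0\<close> in auto)
    finally show ?thesis .
  qed
  with b0 show ?thesis by blast
qed

lemma scaled_array_square_bound:
  assumes \<alpha>: "\<And>q. q < Q \<Longrightarrow> convergent (\<lambda>m. \<alpha> m q)"
    and u: "\<And>m q. q < Q \<Longrightarrow> (\<Sum>i<N m. (u m i q)\<^sup>2) = (real (N m) - 1) * v m q"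
    and v: "\<And>q. q < Q \<Longrightarrow> convergent (\<lambda>m. v m q)"
  shows "\<exists>A. \<forall>m. (\<Sum>i<N m. \<Sum>q<Q. (P.scaled_array m (\<alpha> m) (u m) i q)\<^sup>2) \<le> A"
proof -
  have eq: "(\<Sum>i<N m. \<Sum>q<Q. (P.scaled_array m (\<alpha> m) (u m) i q)\<^sup>2)
    = (\<Sum>q<Q. s\<^sup>2 * (\<alpha> m q)\<^sup>2 * (real (N m) * wm m q)\<^sup>2 * ((real (N m) - 1) / real (N m) * v m q))" for m
  proof -
    let ?n = "real (N m)"
    have n: "?n > 0" "(sqrt ?n)\<^sup>2 = ?n" using Npos[of m] by auto
    have "(\<Sum>i<N m. \<Sum>q<Q. (P.scaled_array m (\<alpha> m) (u m) i q)\<^sup>2) = (\<Sum>q<Q. \<Sum>i<N m. (P.scaled_array m (\<alpha> m) (u m) i q)\<^sup>2)" by (rule sum.swap)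
    also have "\<dots> = (\<Sum>q<Q. ?n * s\<^sup>2 * (\<alpha> m q)\<^sup>2 * (wm m q)\<^sup>2 * (\<Sum>i<N m. (u m i q)\<^sup>2))"
    proof (rule sum.cong[OF refl])
      fix q
      have "(P.scaled_array m (\<alpha> m) (u m) i q)\<^sup>2 = ?n * s\<^sup>2 * (\<alpha> m q)\<^sup>2 * (wm m q)\<^sup>2 * (u m i q)\<^sup>2" for i
        unfolding P.scaled_array_def power_mult_distrib power_divide n(2) by simp
      then show "(\<Sum>i<N m. (P.scaled_array m (\<alpha> m) (u m) i q)\<^sup>2) = ?n * s\<^sup>2 * (\<alpha> m q)\<^sup>2 * (wm m q)\<^sup>2 * (\<Sum>i<N m. (u m i q)\<^sup>2)"
        by (simp only: sum_distrib_left)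
    qed
    also have "\<dots> = (\<Sum>q<Q. s\<^sup>2 * (\<alpha> m q)\<^sup>2 * (?n * wm m q)\<^sup>2 * ((?n - 1) / ?n * v m q))"
    proof (rule sum.cong[OF refl])
      fix q assume "q \<in> {..<Q}"
      then have q: "q < Q" by (rule lessThan_iff[THEN iffD1])
      have nn: "?n * ((?n - 1) * b) = ?n\<^sup>2 * ((?n - 1) / ?n * b)" for b
        using n by (simp add: power2_eq_square)
      have "?n * s\<^sup>2 * (\<alpha> m q)\<^sup>2 * (wm m q)\<^sup>2 * (\<Sum>i<N m. (u m i q)\<^sup>2) = s\<^sup>2 * (\<alpha> m q)\<^sup>2 * (wm m q)\<^sup>2 * (?n * ((?n - 1) * v m q))"
        unfolding u[OF q] by (simp only: mult_ac)
      also have "\<dots> = s\<^sup>2 * (\<alpha> m q)\<^sup>2 * (?n * wm m q)\<^sup>2 * ((?n - 1) / ?n * v m q)"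
        unfolding nn power_mult_distrib by (simp only: mult_ac)
      finally show "?n * s\<^sup>2 * (\<alpha> m q)\<^sup>2 * (wm m q)\<^sup>2 * (\<Sum>i<N m. (u m i q)\<^sup>2) = s\<^sup>2 * (\<alpha> m q)\<^sup>2 * (?n * wm m q)\<^sup>2 * ((?n - 1) / ?n * v m q)" .
    qed
    finally show ?thesis .
  qed
  have "(\<lambda>m. \<Sum>q<Q. s\<^sup>2 * (\<alpha> m q)\<^sup>2 * (real (N m) * wm m q)\<^sup>2 * ((real (N m) - 1) / real (N m) * v m q))
     \<longlonglongrightarrow> (\<Sum>q<Q. s\<^sup>2 * (lim (\<lambda>m. \<alpha> m q))\<^sup>2 * (wl q)\<^sup>2 * (1 * lim (\<lambda>m. v m q)))"
    by (intro tendsto_sum tendsto_mult tendsto_power tendsto_const wl(1) ratio_lim)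
      (use \<alpha> v in \<open>auto simp: convergent_LIMSEQ_iff\<close>)
  then have "Bseq (\<lambda>m. \<Sum>i<N m. \<Sum>q<Q. (P.scaled_array m (\<alpha> m) (u m) i q)\<^sup>2)"
    unfolding eq by (intro convergent_imp_Bseq convergentI)
  then obtain A where "\<And>m. norm (\<Sum>i<N m. \<Sum>q<Q. (P.scaled_array m (\<alpha> m) (u m) i q)\<^sup>2) \<le> A" by (auto simp: Bseq_def)
  then show ?thesis by (intro exI[of _ A]) (simp add: abs_le_iff)
qed

lemma Max_ge_image: "i < N m \<Longrightarrow> f i \<le> Max (f ` {..<N m})" for f :: "nat \<Rightarrow> real"
  by (rule Max_ge) auto

lemma effect_array_bound: "\<exists>b. b \<longlonglongrightarrow> 0 \<and> (\<forall>m i q. i < N m \<longrightarrow> q < Q \<longrightarrow> \<bar>P.effect_array m f i q\<bar> \<le> b m)"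
  unfolding P.effect_array_def
proof (rule scaled_array_bound)
  show "convergent (\<lambda>m. g f q)" for q by (rule convergent_const)
  let ?M = "\<lambda>m q. Max ((\<lambda>i. (Y m i q - pmean (N m) (\<lambda>j. Y m j q))\<^sup>2) ` {..<N m})"
  have ge: "(P.yc m i q)\<^sup>2 \<le> ?M m q" if "i < N m" for m i q
    unfolding P.yc_def by (rule Max_ge_image[OF that, of "\<lambda>i. (Y m i q - pmean (N m) (\<lambda>j. Y m j q))\<^sup>2"])
  have M0: "?M m q \<ge> 0" for m q
    using ge[of 0 m q] P.n0(3)[of m] by (meson order_trans zero_le_power2)
  show "(P.yc m i q)\<^sup>2 \<le> (\<Sum>q<Q. ?M m q)" if "i < N m" "q < Q" for m i q
    by (rule order_trans[OF ge[OF that(1)] member_le_sum[where f = "?M m"]]) (use that M0 in auto)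
  have "(\<lambda>m. \<Sum>q<Q. ?M m q / real (N m)) \<longlonglongrightarrow> (\<Sum>q<Q. 0)"
    by (intro tendsto_sum) (use reg_iii_Y in auto)
  then show "(\<lambda>m. (\<Sum>q<Q. ?M m q) / real (N m)) \<longlonglongrightarrow> 0" by (simp add: sum_divide_distrib)
qed

lemma effect_array_square_bound: "\<exists>A. \<forall>m. (\<Sum>i<N m. \<Sum>q<Q. (P.effect_array m f i q)\<^sup>2) \<le> A"
  unfolding P.effect_array_def
proof (rule scaled_array_square_bound)
  show "convergent (\<lambda>m. g f q)" for q by (rule convergent_const)
  show "(\<Sum>i<N m. (P.yc m i q)\<^sup>2) = (real (N m) - 1) * pcov (N m) (\<lambda>i. Y m i q) (\<lambda>i. Y m i q)" for m q
    unfolding power2_eq_square by (rule P.cov_yy)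
qed (use reg_ii_Y in auto)

lemma covariate_array_bound:
  assumes h: "h \<in> {1..H}" and j: "j < L * card (T h)"
  shows "\<exists>b. b \<longlonglongrightarrow> 0 \<and> (\<forall>m i q. i < N m \<longrightarrow> q < Q \<longrightarrow> \<bar>P.covariate_array m h j i q\<bar> \<le> b m)"
  unfolding P.covariate_array_def
proof (rule scaled_array_bound)
  show "convergent (\<lambda>m. contrast (wm m) h q (j div L))" for q using c_lim[OF h] convergentI by blast
  let ?M = "\<lambda>m. Max ((\<lambda>i. \<Sum>l<L. (x m i l - pmean (N m) (\<lambda>j. x m j l))\<^sup>2) ` {..<N m})"
  show "(P.xc m i (j mod L))\<^sup>2 \<le> ?M m" if "i < N m" for m i
  proof -
    have "(P.xc m i (j mod L))\<^sup>2 \<le> (\<Sum>l<L. (P.xc m i l)\<^sup>2)"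
      by (rule member_le_sum) (use P.idx_mod[OF j] in auto)
    also have "\<dots> \<le> ?M m"
      unfolding P.xc_def by (rule Max_ge_image[OF that, of "\<lambda>i. \<Sum>l<L. (x m i l - pmean (N m) (\<lambda>j. x m j l))\<^sup>2"])
    finally show ?thesis .
  qed
  show "(\<lambda>m. ?M m / real (N m)) \<longlonglongrightarrow> 0" by (rule reg_iii_x)
qed

lemma covariate_array_square_bound:
  assumes h: "h \<in> {1..H}" and j: "j < L * card (T h)"
  shows "\<exists>A. \<forall>m. (\<Sum>i<N m. \<Sum>q<Q. (P.covariate_array m h j i q)\<^sup>2) \<le> A"
  unfolding P.covariate_array_def
proof (rule scaled_array_square_bound)
  show "convergent (\<lambda>m. contrast (wm m) h q (j div L))" for q using c_lim[OF h] convergentI by blast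
  show "(\<Sum>i<N m. (P.xc m i (j mod L))\<^sup>2) = (real (N m) - 1) * Sxx (N m) (x m) (j mod L) (j mod L)" for m
    unfolding power2_eq_square by (rule P.cov_xx)
  show "convergent (\<lambda>m. Sxx (N m) (x m) (j mod L) (j mod L))"
    using Sl(1)[OF P.idx_mod[OF j] P.idx_mod[OF j]] convergentI by blast
qed

end

section \<open>The limit under rerandomization\<close>

context factorial_sequence
begin

definition block_dim :: "nat \<Rightarrow> nat" where
  "block_dim h = (if h = 0 then F else L * card (T h))"

definition limit_map :: "rmat \<Rightarrow> (nat \<Rightarrow> rmat) \<Rightarrow> (nat \<Rightarrow> nat \<Rightarrow> real) \<Rightarrow> rvec" where
  "limit_map R Rt \<omega> f = (if f < F then (\<Sum>j<F. R f j * \<omega> 0 j) + (\<Sum>h\<in>{1..H}. \<Sum>j<L * card (T h). Rt h f j * \<omega> h j) else 0)"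

abbreviation "accm m \<equiv> accepted K iota eff (nq m) T H a L (N m) (x m)"

lemma sum_block_index_dim: "(\<Sum>p\<in>block_index H block_dim. u (fst p) (snd p)) = (\<Sum>j<F. u 0 j) + (\<Sum>h\<in>{1..H}. \<Sum>j<L * card (T h). u h j)"
proof -
  have "{..H} = insert 0 {1..H}" by auto
  then have "(\<Sum>h\<le>H. \<Sum>j<block_dim h. u h j) = (\<Sum>j<block_dim 0. u 0 j) + (\<Sum>h\<in>{1..H}. \<Sum>j<block_dim h. u h j)" by simp
  also have "(\<Sum>h\<in>{1..H}. \<Sum>j<block_dim h. u h j) = (\<Sum>h\<in>{1..H}. \<Sum>j<L * card (T h). u h j)"
    by (rule sum.cong) (auto simp: block_dim_def)
  finally show ?thesis unfolding sum_block_index by (simp add: block_dim_def)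
qed

lemma block_index_cases:
  assumes "k \<in> block_index H block_dim"
  obtains f where "k = (0, f)" "f < F" | h j where "k = (h, j)" "h \<in> {1..H}" "j < L * card (T h)"
proof -
  obtain h j where k: "k = (h, j)" "h \<le> H" "j < block_dim h" using assms by (cases k) (auto simp: block_index_iff)
  show ?thesis
  proof (cases "h = 0")
    case True
    then show ?thesis using k that(1) by (simp add: block_dim_def)
  next
    case False
    then show ?thesis using k that(2)[of h j] by (simp add: block_dim_def)
  qed
qed

lemma refmt_limit:
  assumes R: "\<And>f f'. f < F \<Longrightarrow> f' < F \<Longrightarrow> mmul F R (mtr R) f f' = Vpl f f'"
    and Rt: "\<And>h f f'. h \<in> {1..H} \<Longrightarrow> f < F \<Longrightarrow> f' < F \<Longrightarrow> mmul (L * card (T h)) (Rt h) (mtr (Rt h)) f f' = Pl h f f'"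
    and cont: "continuous_on UNIV (\<phi> :: rvec \<Rightarrow> real)" and B: "\<And>v. \<bar>\<phi> v\<bar> \<le> B"
  shows "(\<lambda>m. \<integral>z. \<phi> z \<partial>distr (measure_pmf (refmt_pmf K iota eff (nq m) T H a L (N m) (x m))) borel
             (\<lambda>Z f. if f < F then sqrt (real (N m)) * (tauhat K iota eff (N m) (Y m) (nq m) Z f
                                               - taupop K iota eff (N m) (Y m) f) else 0))
    \<longlonglongrightarrow> (\<integral>\<omega>. \<phi> (limit_map R Rt \<omega>) \<partial>limit_joint F L T H a)"
proof -
  let ?d = "\<lambda>h. L * card (T h)"
  define std where "std h C E \<longleftrightarrow>
      (\<forall>k<?d h. \<forall>l<?d h. mmul (?d h) (mmul (?d h) C (Al h)) (mtr C) k l = mid k l) \<and>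
      (\<forall>i<?d h. \<forall>j<?d h. mmul (?d h) E C i j = mid i j) \<and>
      (\<forall>i<?d h. \<forall>j<?d h. mmul (?d h) (mtr C) C i j = minv (?d h) (Al h) i j) \<and>
      (\<forall>f<F. \<forall>k<?d h. mmul (?d h) (Wl h) (mtr C) f k = Rt h f k)" for h C E
  have "\<exists>CE. h \<in> {1..H} \<longrightarrow> std h (fst CE) (snd CE)" for h
  proof (cases "h \<in> {1..H}")
    case h: True
    have R: "mmul (?d h) (Rt h) (mtr (Rt h)) f f' = mmul (?d h) (mmul (?d h) (Wl h) (minv (?d h) (Al h))) (mtr (Wl h)) f f'"
      if "f < F" "f' < F" for f f' using Rt[OF h that] by (simp add: Pl_def Let_def)
    show ?thesis
    proof (rule posdef_standardize[OF posdef_Al[OF h] R])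
      fix C E
      assume 1: "\<And>k l. k < ?d h \<Longrightarrow> l < ?d h \<Longrightarrow> mmul (?d h) (mmul (?d h) C (Al h)) (mtr C) k l = mid k l"
        and 2: "\<And>i j. i < ?d h \<Longrightarrow> j < ?d h \<Longrightarrow> mmul (?d h) E C i j = mid i j"
        and 3: "\<And>i j. i < ?d h \<Longrightarrow> j < ?d h \<Longrightarrow> mmul (?d h) (mtr C) C i j = minv (?d h) (Al h) i j"
        and 4: "\<And>f k. f < F \<Longrightarrow> k < ?d h \<Longrightarrow> mmul (?d h) (Wl h) (mtr C) f k = Rt h f k"
      have "std h C E" unfolding std_def by (intro conjI allI impI 1 2 3 4)
      then show ?thesis by (intro exI[of _ "(C, E)"]) simp
    qed
  qed auto
  then have "\<forall>h. \<exists>CE. h \<in> {1..H} \<longrightarrow> std h (fst CE) (snd CE)" ..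
  from choice[OF this] obtain CE where CE: "\<And>h. h \<in> {1..H} \<Longrightarrow> std h (fst (CE h)) (snd (CE h))" by blast
  define C where "C h = fst (CE h)" for h
  define E where "E h = snd (CE h)" for h
  have CA: "mmul (?d h) (mmul (?d h) (C h) (Al h)) (mtr (C h)) k l = mid k l"
    if "h \<in> {1..H}" "k < ?d h" "l < ?d h" for h k l
    using CE[OF that(1)] that unfolding std_def C_def by blast
  have EC: "mmul (?d h) (E h) (C h) i j = mid i j" if "h \<in> {1..H}" "i < ?d h" "j < ?d h" for h i j
    using CE[OF that(1)] that unfolding std_def C_def E_def by blast
  have CC: "mmul (?d h) (mtr (C h)) (C h) i j = minv (?d h) (Al h) i j" if "h \<in> {1..H}" "i < ?d h" "j < ?d h" for h i j
    using CE[OF that(1)] that unfolding std_def C_def by blast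
  have WC: "mmul (?d h) (Wl h) (mtr (C h)) f k = Rt h f k" if "h \<in> {1..H}" "f < F" "k < ?d h" for h f k
    using CE[OF that(1)] that unfolding std_def C_def by blast
  define av where "av m k = (if fst k = 0 then P.effect_array m (snd k)
      else (\<lambda>i q. \<Sum>j<?d (fst k). C (fst k) (snd k) j * P.covariate_array m (fst k) j i q))" for m and k :: "nat \<times> nat"
  define Lc where "Lc k p = (if fst k = 0 then (if fst p = 0 then R (snd k) (snd p) else Rt (fst p) (snd k) (snd p))
      else (if p = k then 1 else 0))" for k p :: "nat \<times> nat"
  let ?I = "block_index H block_dim"
  have av0: "av m (0, f) = P.effect_array m f" for m f by (simp add: av_def)
  have avh: "av m (h, k) = (\<lambda>i q. \<Sum>j<?d h. C h k j * P.covariate_array m h j i q)" if "h \<in> {1..H}" for m h k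
    using that by (simp add: av_def)
  have Lc_delta: "(\<Sum>p\<in>?I. u p * Lc k p) = u k" if "k \<in> ?I" "fst k \<noteq> 0" for u k
  proof -
    have "(\<Sum>p\<in>?I. u p * Lc k p) = (\<Sum>p\<in>?I. if p = k then u k else 0)"
      by (rule sum.cong) (use that in \<open>auto simp: Lc_def\<close>)
    then show ?thesis using that by (simp add: finite_block_index)
  qed
  have bnd: "\<exists>b. b \<longlonglongrightarrow> 0 \<and> (\<forall>m i q. i < N m \<longrightarrow> q < Q \<longrightarrow> \<bar>av m k i q\<bar> \<le> b m)" if "k \<in> ?I" for k
    using that
  proof (cases rule: block_index_cases)
    case (1 f)
    then show ?thesis using effect_array_bound[of f] by (simp only: av0)
  next
    case (2 h k')
    have "\<forall>j. \<exists>b. j < ?d h \<longrightarrow> b \<longlonglongrightarrow> 0 \<and> (\<forall>m i q. i < N m \<longrightarrow> q < Q \<longrightarrow> \<bar>P.covariate_array m h j i q\<bar> \<le> b m)"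
      using covariate_array_bound[OF 2(2)] by blast
    from choice[OF this] obtain b where b: "\<And>j. j < ?d h \<Longrightarrow> b j \<longlonglongrightarrow> 0"
      "\<And>j m i q. j < ?d h \<Longrightarrow> i < N m \<Longrightarrow> q < Q \<Longrightarrow> \<bar>P.covariate_array m h j i q\<bar> \<le> b j m" by blast
    have "(\<lambda>m. \<Sum>j<?d h. \<bar>C h k' j\<bar> * b j m) \<longlonglongrightarrow> (\<Sum>j<?d h. \<bar>C h k' j\<bar> * 0)"
      by (intro tendsto_sum tendsto_mult_left b(1)) auto
    moreover have "\<bar>av m k i q\<bar> \<le> (\<Sum>j<?d h. \<bar>C h k' j\<bar> * b j m)" if iq: "i < N m" "q < Q" for m i q
      unfolding 2(1) avh[OF 2(2)]
      by (rule order_trans[OF sum_abs]) (use b(2) iq in \<open>auto simp: abs_mult intro!: sum_mono mult_left_mono\<close>)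
    ultimately show ?thesis by (intro exI[of _ "\<lambda>m. \<Sum>j<?d h. \<bar>C h k' j\<bar> * b j m"]) simp
  qed
  have sqb: "\<exists>A. \<forall>m. (\<Sum>i<N m. \<Sum>q<Q. (av m k i q)\<^sup>2) \<le> A" if "k \<in> ?I" for k
    using that
  proof (cases rule: block_index_cases)
    case (1 f)
    then show ?thesis using effect_array_square_bound[of f] by (simp only: av0)
  next
    case (2 h k')
    have "\<forall>j. \<exists>A. j < ?d h \<longrightarrow> (\<forall>m. (\<Sum>i<N m. \<Sum>q<Q. (P.covariate_array m h j i q)\<^sup>2) \<le> A)"
      using covariate_array_square_bound[OF 2(2)] by blast
    from choice[OF this] obtain A where A: "\<And>j m. j < ?d h \<Longrightarrow> (\<Sum>i<N m. \<Sum>q<Q. (P.covariate_array m h j i q)\<^sup>2) \<le> A j" by blast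
    have "(\<Sum>i<N m. \<Sum>q<Q. (av m k i q)\<^sup>2) \<le> real (?d h) * (\<Sum>j<?d h. (C h k' j)\<^sup>2 * A j)" for m
    proof -
      have "(\<Sum>i<N m. \<Sum>q<Q. (av m k i q)\<^sup>2) \<le> (\<Sum>i<N m. \<Sum>q<Q. real (?d h) * (\<Sum>j<?d h. (C h k' j)\<^sup>2 * (P.covariate_array m h j i q)\<^sup>2))"
      proof (intro sum_mono)
        fix i q
        show "(av m k i q)\<^sup>2 \<le> real (?d h) * (\<Sum>j<?d h. (C h k' j)\<^sup>2 * (P.covariate_array m h j i q)\<^sup>2)"
          using sum_sq_le_card[of "\<lambda>j. C h k' j * P.covariate_array m h j i q" "{..<?d h}"]
          unfolding 2(1) avh[OF 2(2)] power_mult_distrib card_lessThan .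
      qed
      also have "\<dots> = real (?d h) * (\<Sum>i<N m. \<Sum>q<Q. \<Sum>j<?d h. (C h k' j)\<^sup>2 * (P.covariate_array m h j i q)\<^sup>2)"
        by (simp only: sum_distrib_left)
      also have "(\<Sum>i<N m. \<Sum>q<Q. \<Sum>j<?d h. (C h k' j)\<^sup>2 * (P.covariate_array m h j i q)\<^sup>2) = (\<Sum>i<N m. \<Sum>j<?d h. \<Sum>q<Q. (C h k' j)\<^sup>2 * (P.covariate_array m h j i q)\<^sup>2)"
        by (rule sum.cong[OF refl], rule sum.swap)
      also have "\<dots> = (\<Sum>j<?d h. \<Sum>i<N m. \<Sum>q<Q. (C h k' j)\<^sup>2 * (P.covariate_array m h j i q)\<^sup>2)" by (rule sum.swap)
      also have "\<dots> = (\<Sum>j<?d h. (C h k' j)\<^sup>2 * (\<Sum>i<N m. \<Sum>q<Q. (P.covariate_array m h j i q)\<^sup>2))" by (simp only: sum_distrib_left)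
      also have "real (?d h) * \<dots> \<le> real (?d h) * (\<Sum>j<?d h. (C h k' j)\<^sup>2 * A j)"
        using A by (intro mult_left_mono sum_mono) auto
      finally show ?thesis .
    qed
    then show ?thesis by blast
  qed
  have "\<forall>k. \<exists>b. k \<in> ?I \<longrightarrow> b \<longlonglongrightarrow> 0 \<and> (\<forall>m i q. i < N m \<longrightarrow> q < Q \<longrightarrow> \<bar>av m k i q\<bar> \<le> b m)"
    using bnd by blast
  from choice[OF this] obtain bM where bM: "\<And>k. k \<in> ?I \<Longrightarrow> bM k \<longlonglongrightarrow> 0"
    "\<And>k m i q. k \<in> ?I \<Longrightarrow> i < N m \<Longrightarrow> q < Q \<Longrightarrow> \<bar>av m k i q\<bar> \<le> bM k m" by blast
  have "\<forall>k. \<exists>A. k \<in> ?I \<longrightarrow> (\<forall>m. (\<Sum>i<N m. \<Sum>q<Q. (av m k i q)\<^sup>2) \<le> A)" using sqb by blast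
  from choice[OF this] obtain bA where bA: "\<And>k m. k \<in> ?I \<Longrightarrow> (\<Sum>i<N m. \<Sum>q<Q. (av m k i q)\<^sup>2) \<le> bA k" by blast
  have bA0: "bA k \<ge> 0" if "k \<in> ?I" for k
    by (rule order_trans[OF _ bA[OF that, of 0]]) (auto intro!: sum_nonneg)
  interpret AL: array_limit Q N nq H block_dim av Lc "\<lambda>m. \<Sum>k\<in>?I. \<bar>bM k m\<bar>" "\<Sum>k\<in>?I. bA k"
  proof
    fix m k q assume k: "k \<in> ?I" and q: "q < Q"
    from k show "(\<Sum>i<N m. av m k i q) = 0"
    proof (cases rule: block_index_cases)
      case (1 f)
      show ?thesis unfolding 1 av0 P.effect_array_def by (rule P.sum_scaled_array[OF P.sum_yc q])
    next
      case (2 h k')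
      have "(\<Sum>i<N m. av m k i q) = (\<Sum>j<?d h. C h k' j * (\<Sum>i<N m. P.covariate_array m h j i q))"
        unfolding 2(1) avh[OF 2(2)] sum_distrib_left by (rule sum.swap)
      also have "\<dots> = 0" unfolding P.covariate_array_def using P.sum_scaled_array[OF P.sum_xc q] by simp
      finally show ?thesis .
    qed
  next
    show "(\<Sum>q<Q. nq m q) = N m" for m using nq_sum by blast
    show "filterlim N at_top sequentially" by (rule N_lim)
  next
    fix m k i q assume k: "k \<in> ?I" and iq: "i < N m" "q < Q"
    have "\<bar>av m k i q\<bar> \<le> \<bar>bM k m\<bar>" using bM(2)[OF k iq] by simp
    also have "\<dots> \<le> (\<Sum>k\<in>?I. \<bar>bM k m\<bar>)" by (rule member_le_sum) (use k finite_block_index in auto)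
    finally show "\<bar>av m k i q\<bar> \<le> (\<Sum>k\<in>?I. \<bar>bM k m\<bar>)" .
  next
    have "(\<lambda>m. \<Sum>k\<in>?I. \<bar>bM k m\<bar>) \<longlonglongrightarrow> (\<Sum>k\<in>?I. 0)"
      by (intro tendsto_sum tendsto_rabs_zero bM(1))
    then show "(\<lambda>m. \<Sum>k\<in>?I. \<bar>bM k m\<bar>) \<longlonglongrightarrow> 0" by simp
  next
    fix m k assume k: "k \<in> ?I"
    have "bA k \<le> (\<Sum>k\<in>?I. bA k)" by (rule member_le_sum) (use k finite_block_index bA0 in auto)
    then show "(\<Sum>i<N m. \<Sum>q<Q. (av m k i q)\<^sup>2) \<le> (\<Sum>k\<in>?I. bA k)" using bA[OF k, of m] by (rule order_trans[rotated])
  next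
    have TX: "(\<lambda>m. cov_form (N m) Q (nq m) (av m (0, f)) (av m (h, k))) \<longlonglongrightarrow> (\<Sum>p\<in>?I. Lc (0, f) p * Lc (h, k) p)"
      if f: "f < F" and h: "h \<in> {1..H}" and k: "k < ?d h" for f h k
    proof -
      have "cov_form (N m) Q (nq m) (av m (0, f)) (av m (h, k)) = (\<Sum>j<?d h. C h k j * ((real (N m) - 1) * Wm m h f j))" for m
      proof -
        have "cov_form (N m) Q (nq m) (av m (0, f)) (av m (h, k)) = (\<Sum>j<?d h. C h k j * cov_form (N m) Q (nq m) (P.effect_array m f) (P.covariate_array m h j))"
          unfolding av0 avh[OF h] cov_form_commute[of _ _ _ "P.effect_array m f"] by (rule cov_form_sum_left)
        also have "\<dots> = (\<Sum>j<?d h. C h k j * ((real (N m) - 1) * Wm m h f j))"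
          by (rule sum.cong[OF refl]) (simp add: P.cov_form_effect_covariate[OF h])
        finally show ?thesis .
      qed
      moreover have "(\<lambda>m. \<Sum>j<?d h. C h k j * ((real (N m) - 1) * Wm m h f j)) \<longlonglongrightarrow> (\<Sum>j<?d h. C h k j * Wl h f j)"
        by (intro tendsto_sum tendsto_mult_left scale_lim Wm_lim[OF h]) auto
      moreover have "(\<Sum>j<?d h. C h k j * Wl h f j) = Rt h f k"
        using WC[OF h f k] by (simp add: mmul_def mtr_def mult.commute)
      moreover have "(\<Sum>p\<in>?I. Lc (0, f) p * Lc (h, k) p) = Rt h f k"
      proof -
        have "(h, k) \<in> ?I" using h k by (simp add: block_index_iff block_dim_def)
        from Lc_delta[OF this, of "Lc (0, f)"] show ?thesis using h by (simp add: Lc_def)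
      qed
      ultimately show ?thesis by simp
    qed
    fix k l assume kl: "k \<in> ?I" "l \<in> ?I"
    from kl(1) show "(\<lambda>m. cov_form (N m) Q (nq m) (av m k) (av m l)) \<longlonglongrightarrow> (\<Sum>p\<in>?I. Lc k p * Lc l p)"
    proof (cases rule: block_index_cases)
      case k: (1 f)
      from kl(2) show ?thesis
      proof (cases rule: block_index_cases)
        case l: (1 f')
        have "(\<lambda>m. (real (N m) - 1) * P.Vtt m f f') \<longlonglongrightarrow> Vttl f f'" by (rule scale_lim[OF Vtt_lim])
        moreover have "(\<Sum>p\<in>?I. Lc k p * Lc l p) = Vttl f f'"
        proof -
          have "(\<Sum>p\<in>?I. Lc k p * Lc l p) = (\<Sum>p\<in>?I. (\<lambda>h j. Lc k (h, j) * Lc l (h, j)) (fst p) (snd p))" by simp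
          also have "\<dots> = (\<Sum>j<F. Lc k (0, j) * Lc l (0, j)) + (\<Sum>h\<in>{1..H}. \<Sum>j<?d h. Lc k (h, j) * Lc l (h, j))"
            by (rule sum_block_index_dim)
          also have "(\<Sum>j<F. Lc k (0, j) * Lc l (0, j)) = Vpl f f'"
            using R[OF k(2) l(2)] by (simp add: Lc_def k(1) l(1) mmul_def mtr_def)
          also have "(\<Sum>h\<in>{1..H}. \<Sum>j<?d h. Lc k (h, j) * Lc l (h, j)) = (\<Sum>h\<in>{1..H}. Pl h f f')"
          proof (rule sum.cong[OF refl])
            fix h assume h: "h \<in> {1..H}"
            then have "h \<noteq> 0" by simp
            then show "(\<Sum>j<?d h. Lc k (h, j) * Lc l (h, j)) = Pl h f f'"
              using Rt[OF h k(2) l(2)] by (simp add: Lc_def k(1) l(1) mmul_def mtr_def)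
          qed
          finally show ?thesis by (simp add: Vpl_def)
        qed
        ultimately show ?thesis unfolding k(1) l(1) av0 P.cov_form_effects by simp
      next
        case l: (2 h j)
        show ?thesis unfolding k(1) l(1) by (rule TX[OF k(2) l(2,3)])
      qed
    next
      case k: (2 h j)
      from kl(2) show ?thesis
      proof (cases rule: block_index_cases)
        case l: (1 f')
        show ?thesis unfolding k(1) l(1) cov_form_commute[of _ _ _ "av _ (h, j)"] mult.commute[of "Lc (h, j) _"]
          by (rule TX[OF l(2) k(2,3)])
      next
        case l: (2 h' j')
        have kf: "cov_form (N m) Q (nq m) (av m k) (av m l)
          = (\<Sum>i<?d h. \<Sum>i'<?d h'. C h j i * C h' j' i' * cov_form (N m) Q (nq m) (P.covariate_array m h i) (P.covariate_array m h' i'))" for m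
          unfolding k(1) l(1) avh[OF k(2)] avh[OF l(2)] by (rule cov_form_sum)
        have rhs: "(\<Sum>p\<in>?I. Lc k p * Lc l p) = (if k = l then 1 else 0)"
          using Lc_delta[OF kl(2), of "Lc k"] k l by (auto simp: Lc_def)
        show ?thesis
        proof (cases "h = h'")
          case False
          have "cov_form (N m) Q (nq m) (av m k) (av m l) = 0" for m
            unfolding kf using P.cov_form_covariates[OF k(2) l(2)] False by (intro sum.neutral ballI) simp
          then show ?thesis unfolding rhs using False k l by simp
        next
          case True
          have "(\<lambda>m. \<Sum>i<?d h. \<Sum>i'<?d h. C h j i * C h j' i' * ((real (N m) - 1) * Xm m h i i'))
             \<longlonglongrightarrow> (\<Sum>i<?d h. \<Sum>i'<?d h. C h j i * C h j' i' * Al h i i')"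
            by (intro tendsto_sum tendsto_mult_left scale_lim Xm_lim[OF k(2)]) auto
          moreover have "cov_form (N m) Q (nq m) (av m k) (av m l) = (\<Sum>i<?d h. \<Sum>i'<?d h. C h j i * C h j' i' * ((real (N m) - 1) * Xm m h i i'))" for m
            unfolding kf True[symmetric] using P.cov_form_covariates[OF k(2) k(2)] by (intro sum.cong refl) simp
          moreover have "(\<Sum>i<?d h. \<Sum>i'<?d h. C h j i * C h j' i' * Al h i i') = mid j j'"
          proof -
            have "(\<Sum>i<?d h. \<Sum>i'<?d h. C h j i * C h j' i' * Al h i i') = bilin (?d h) (Al h) (C h j) (C h j')"
              unfolding bilin_def by (intro sum.cong refl) (simp only: mult_ac)
            also have "\<dots> = mid j j'" unfolding bilin_mmul by (rule CA[OF k(2,3)]) (use l True in simp)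
            finally show ?thesis .
          qed
          ultimately show ?thesis unfolding rhs using k l True by (simp add: mid_def)
        qed
      qed
    qed
  qed
  have thr: "\<forall>h\<in>{1..H}. a h > 0" by (rule thresholds)
  have Vh: "AL.V m Z (h, k) = (\<Sum>j<?d h. C h k j * (sqrt (real (N m)) * thetax K iota eff (nq m) T L (N m) (x m) Z h j))"
    if Z: "Z \<in> AL.W m" and h: "h \<in> {1..H}" and k: "k < ?d h" for m Z h k
  proof -
    have "(h, k) \<in> ?I" using h k by (simp add: block_index_iff block_dim_def)
    then have "AL.V m Z (h, k) = (\<Sum>j<?d h. C h k j * linear_stat (N m) (P.covariate_array m h j) Z)"
      unfolding AL.V_def avh[OF h] linear_stat_sum by simp
    also have "\<dots> = (\<Sum>j<?d h. C h k j * (sqrt (real (N m)) * thetax K iota eff (nq m) T L (N m) (x m) Z h j))"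
      by (rule sum.cong[OF refl]) (simp add: P.linear_stat_covariate_array[OF Z h])
    finally show ?thesis .
  qed
  txt \<open>The imbalances are standardised by the limiting covariance, so the Mahalanobis statistic equals
    their squared norm only up to a relative error \<open>e m\<close>.\<close>
  define eta where "eta m h = (\<Sum>i<?d h. \<Sum>j<?d h. \<bar>minv (?d h) (Xm m h) i j / real (N m) - minv (?d h) (Al h) i j\<bar>)" for m h
  define Es where "Es h = (\<Sum>i<?d h. \<Sum>k<?d h. \<bar>E h i k\<bar>)" for h
  define e where "e m = (\<Sum>h\<in>{1..H}. eta m h * (Es h)\<^sup>2)" for m
  have Ms: "\<bar>Mstat K iota eff (nq m) T L (N m) (x m) Z h - AL.block_square h (AL.V m Z)\<bar> \<le> e m * AL.block_square h (AL.V m Z)"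
    if Z: "Z \<in> AL.W m" and h: "h \<in> {1..H}" for m Z h
  proof -
    let ?n = "real (N m)" and ?block_dim = "?d h"
    have h1: "h \<ge> 1" using h by simp
    have ddh: "block_dim h = ?block_dim" using h by (simp add: block_dim_def)
    define th where "th = thetax K iota eff (nq m) T L (N m) (x m) Z h"
    define y where "y j = sqrt ?n * th j" for j
    define v where "v k = AL.V m Z (h, k)" for k
    have v: "v k = (\<Sum>j<?block_dim. C h k j * y j)" if "k < ?block_dim" for k
      unfolding v_def y_def th_def by (rule Vh[OF Z h that])
    have yv: "y i = (\<Sum>k<?block_dim. E h i k * v k)" if i: "i < ?block_dim" for i
    proof -
      have "(\<Sum>k<?block_dim. E h i k * v k) = mmul ?block_dim (E h) (mmul ?block_dim (C h) (\<lambda>j _. y j)) i 0"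
        using v by (simp add: mmul_def)
      also have "\<dots> = mmul ?block_dim (mmul ?block_dim (E h) (C h)) (\<lambda>j _. y j) i 0" by (simp only: mmul_assoc)
      also have "\<dots> = mmul ?block_dim mid (\<lambda>j _. y j) i 0"
        by (rule mmul_cong) (use EC[OF h] i in auto)
      also have "\<dots> = y i" by (rule mmul_mid_left[OF i])
      finally show ?thesis ..
    qed
    have rr: "AL.block_square h (AL.V m Z) = (\<Sum>k<?block_dim. (v k)\<^sup>2)" unfolding AL.block_square_def ddh v_def ..
    have rr0: "AL.block_square h (AL.V m Z) \<ge> 0" unfolding rr by (intro sum_nonneg) auto
    have rry: "AL.block_square h (AL.V m Z) = (\<Sum>i<?block_dim. \<Sum>j<?block_dim. y i * minv ?block_dim (Al h) i j * y j)"
    proof -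
      have "(\<Sum>k<?block_dim. (v k)\<^sup>2) = (\<Sum>k<?block_dim. \<Sum>i<?block_dim. \<Sum>j<?block_dim. y i * (C h k i * C h k j) * y j)"
      proof (rule sum.cong[OF refl])
        fix k assume "k \<in> {..<?block_dim}"
        then have k: "k < ?block_dim" by (rule lessThan_iff[THEN iffD1])
        show "(v k)\<^sup>2 = (\<Sum>i<?block_dim. \<Sum>j<?block_dim. y i * (C h k i * C h k j) * y j)"
          unfolding v[OF k] power2_eq_square sum_product by (intro sum.cong refl) (simp only: mult_ac)
      qed
      also have "\<dots> = (\<Sum>i<?block_dim. \<Sum>k<?block_dim. \<Sum>j<?block_dim. y i * (C h k i * C h k j) * y j)" by (rule sum.swap)
      also have "\<dots> = (\<Sum>i<?block_dim. \<Sum>j<?block_dim. \<Sum>k<?block_dim. y i * (C h k i * C h k j) * y j)" by (rule sum.cong[OF refl], rule sum.swap)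
      also have "\<dots> = (\<Sum>i<?block_dim. \<Sum>j<?block_dim. y i * minv ?block_dim (Al h) i j * y j)"
      proof (intro sum.cong refl)
        fix i j assume "i \<in> {..<?block_dim}" "j \<in> {..<?block_dim}"
        then have "minv ?block_dim (Al h) i j = (\<Sum>k<?block_dim. C h k i * C h k j)"
          using CC[OF h, of i j] by (simp add: mmul_def mtr_def)
        then show "(\<Sum>k<?block_dim. y i * (C h k i * C h k j) * y j) = y i * minv ?block_dim (Al h) i j * y j"
          by (simp only: sum_distrib_left sum_distrib_right)
      qed
      finally show ?thesis unfolding rr .
    qed
    have My: "Mstat K iota eff (nq m) T L (N m) (x m) Z h = (\<Sum>i<?block_dim. \<Sum>j<?block_dim. y i * (minv ?block_dim (Xm m h) i j / ?n) * y j)"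
    proof -
      have "th i * b * th j = y i * (b / ?n) * y j" for i j b
      proof -
        have gen: "(r * u) * (b / k) * (r * v) = (r * r) / k * (u * b * v)" for r k u v :: real by simp
        have "y i * (b / ?n) * y j = (sqrt ?n * sqrt ?n) / ?n * (th i * b * th j)" unfolding y_def by (rule gen)
        also have "(sqrt ?n * sqrt ?n) / ?n = 1" using Npos[of m] by simp
        finally show ?thesis by simp
      qed
      then show ?thesis unfolding Mstat_def Let_def P.Wxx_contrast_cov[OF h1] th_def[symmetric] by simp
    qed
    have diff: "Mstat K iota eff (nq m) T L (N m) (x m) Z h - AL.block_square h (AL.V m Z)
      = (\<Sum>i<?block_dim. \<Sum>j<?block_dim. y i * (minv ?block_dim (Xm m h) i j / ?n - minv ?block_dim (Al h) i j) * y j)"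
      unfolding My rry by (simp only: right_diff_distrib left_diff_distrib sum_subtractf)
    have "\<bar>Mstat K iota eff (nq m) T L (N m) (x m) Z h - AL.block_square h (AL.V m Z)\<bar>
      \<le> (\<Sum>i<?block_dim. \<Sum>j<?block_dim. \<bar>minv ?block_dim (Xm m h) i j / ?n - minv ?block_dim (Al h) i j\<bar> * ((Es h)\<^sup>2 * AL.block_square h (AL.V m Z)))"
      unfolding diff
    proof (rule order_trans[OF sum_abs sum_mono], rule order_trans[OF sum_abs sum_mono])
      fix i j assume "i \<in> {..<?block_dim}" "j \<in> {..<?block_dim}"
      then have ij: "i < ?block_dim" "j < ?block_dim" by auto
      define r where "r = sqrt (AL.block_square h (AL.V m Z))"
      have r: "r \<ge> 0" "r * r = AL.block_square h (AL.V m Z)" unfolding r_def using rr0 by auto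
      have yb: "\<bar>y i\<bar> \<le> Es h * r" if i: "i < ?block_dim" for i
      proof -
        have "\<bar>y i\<bar> \<le> (\<Sum>k<?block_dim. \<bar>E h i k\<bar> * \<bar>v k\<bar>)"
          unfolding yv[OF i] by (rule order_trans[OF sum_abs]) (simp add: abs_mult)
        also have "\<dots> \<le> (\<Sum>k<?block_dim. \<bar>E h i k\<bar> * r)"
        proof (intro sum_mono mult_left_mono)
          fix k assume "k \<in> {..<?block_dim}"
          then have "(v k)\<^sup>2 \<le> AL.block_square h (AL.V m Z)" unfolding rr by (intro member_le_sum) auto
          then show "\<bar>v k\<bar> \<le> r" unfolding r_def by (metis real_sqrt_abs real_sqrt_le_iff)
        qed simp
        also have "\<dots> = (\<Sum>k<?block_dim. \<bar>E h i k\<bar>) * r" by (simp only: sum_distrib_right)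
        also have "\<dots> \<le> Es h * r"
          unfolding Es_def using r(1) i
          by (intro mult_right_mono member_le_sum[where f = "\<lambda>i. \<Sum>k<?block_dim. \<bar>E h i k\<bar>"]) (auto intro: sum_nonneg)
        finally show ?thesis .
      qed
      have Es0: "Es h \<ge> 0" by (auto simp: Es_def intro!: sum_nonneg)
      have "\<bar>y i\<bar> * \<bar>y j\<bar> \<le> (Es h * r) * (Es h * r)"
        using yb[OF ij(1)] yb[OF ij(2)] Es0 r(1) by (intro mult_mono) auto
      also have "\<dots> = (Es h)\<^sup>2 * (r * r)" by (simp add: power2_eq_square)
      finally have yy: "\<bar>y i\<bar> * \<bar>y j\<bar> \<le> (Es h)\<^sup>2 * AL.block_square h (AL.V m Z)" unfolding r(2) .
      have "\<bar>y i * b * y j\<bar> = \<bar>b\<bar> * (\<bar>y i\<bar> * \<bar>y j\<bar>)" for b by (simp add: abs_mult)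
      then show "\<bar>y i * (minv ?block_dim (Xm m h) i j / ?n - minv ?block_dim (Al h) i j) * y j\<bar>
        \<le> \<bar>minv ?block_dim (Xm m h) i j / ?n - minv ?block_dim (Al h) i j\<bar> * ((Es h)\<^sup>2 * AL.block_square h (AL.V m Z))"
        using mult_left_mono[OF yy abs_ge_zero] by simp
    qed
    also have "\<dots> = eta m h * (Es h)\<^sup>2 * AL.block_square h (AL.V m Z)"
      by (simp only: eta_def sum_distrib_right mult.assoc)
    also have "\<dots> \<le> e m * AL.block_square h (AL.V m Z)"
    proof (rule mult_right_mono[OF _ rr0])
      show "eta m h * (Es h)\<^sup>2 \<le> e m"
        unfolding e_def
        by (rule member_le_sum[where f = "\<lambda>h. eta m h * (Es h)\<^sup>2", OF h])
          (auto simp: eta_def intro!: mult_nonneg_nonneg sum_nonneg)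
    qed
    finally show ?thesis .
  qed
  have e0: "e m \<ge> 0" for m by (auto simp: e_def eta_def intro!: sum_nonneg mult_nonneg_nonneg)
  have elim: "e \<longlonglongrightarrow> 0"
  proof -
    have "(\<lambda>m. eta m h) \<longlonglongrightarrow> 0" if h: "h \<in> {1..H}" for h
    proof -
      have "(\<lambda>m. eta m h) \<longlonglongrightarrow> (\<Sum>i<?d h. \<Sum>j<?d h. 0)"
        unfolding eta_def
        by (intro tendsto_sum tendsto_rabs_zero LIM_zero minv_Xm_lim[OF h]) auto
      then show ?thesis by simp
    qed
    then have "e \<longlonglongrightarrow> (\<Sum>h\<in>{1..H}. 0 * (Es h)\<^sup>2)"
      unfolding e_def[abs_def] by (intro tendsto_sum tendsto_mult tendsto_const)
    then show ?thesis by simp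
  qed
  have accm: "accm m = {Z \<in> AL.W m. \<forall>h\<in>{1..H}. Mstat K iota eff (nq m) T L (N m) (x m) Z h \<le> a h}" for m
    by (simp add: accepted_def)
  have Lh: "Lc (h, j) p = (if p = (h, j) then 1 else 0)" if "h \<in> {1..H}" for h j p
    using that by (simp add: Lc_def)
  define \<phi>' where "\<phi>' v = \<phi> (\<lambda>f. v (0, f))" for v :: "nat \<times> nat \<Rightarrow> real"
  have cont': "continuous_on UNIV \<phi>'"
    unfolding \<phi>'_def
    by (rule continuous_on_compose2[OF cont])
      (auto intro!: continuous_on_coordinatewise_then_product continuous_on_product_coordinates)
  have B': "\<bar>\<phi>' v\<bar> \<le> B" for v unfolding \<phi>'_def by (rule B)
  have cond: "(\<lambda>m. (\<Sum>Z\<in>accm m. \<phi>' (AL.V m Z)) / real (card (accm m)))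
      \<longlonglongrightarrow> (\<integral>\<omega>. \<phi>' (AL.VL \<omega>) \<partial>uniform_measure (gauss_joint H block_dim) (gauss_acc H block_dim a))"
    "eventually (\<lambda>m. accm m \<noteq> {}) sequentially"
    unfolding accm
    by (rule AL.conditional_clt[OF thr Lh Ms elim e0 cont' B'], assumption+)+
  have "limit_joint F L T H a = uniform_measure (gauss_joint H block_dim) (gauss_acc H block_dim a)"
    by (rule limit_joint_eq[OF thr]) (auto simp: block_dim_def)
  moreover have "\<phi>' (AL.VL \<omega>) = \<phi> (limit_map R Rt \<omega>)" for \<omega>
  proof -
    have "AL.VL \<omega> (0, f) = limit_map R Rt \<omega> f" for f
    proof (cases "f < F")
      case True
      then have "(0, f) \<in> ?I" by (simp add: block_index_iff block_dim_def)
      then have "AL.VL \<omega> (0, f) = (\<Sum>p\<in>?I. (\<lambda>h j. Lc (0, f) (h, j) * \<omega> h j) (fst p) (snd p))" by (simp add: AL.VL_def)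
      also have "\<dots> = (\<Sum>j<F. Lc (0, f) (0, j) * \<omega> 0 j) + (\<Sum>h\<in>{1..H}. \<Sum>j<?d h. Lc (0, f) (h, j) * \<omega> h j)"
        by (rule sum_block_index_dim)
      also have "(\<Sum>h\<in>{1..H}. \<Sum>j<?d h. Lc (0, f) (h, j) * \<omega> h j) = (\<Sum>h\<in>{1..H}. \<Sum>j<?d h. Rt h f j * \<omega> h j)"
        by (intro sum.cong refl) (auto simp: Lc_def)
      also have "(\<Sum>j<F. Lc (0, f) (0, j) * \<omega> 0 j) = (\<Sum>j<F. R f j * \<omega> 0 j)"
        by (intro sum.cong refl) (simp add: Lc_def)
      finally show ?thesis using True by (simp only: limit_map_def if_True)
    next
      case False
      then have "(0, f) \<notin> ?I" by (simp add: block_index_iff block_dim_def)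
      then show ?thesis using False by (simp add: limit_map_def AL.VL_def)
    qed
    then show ?thesis unfolding \<phi>'_def by (simp only:)
  qed
  ultimately have lim: "(\<lambda>m. (\<Sum>Z\<in>accm m. \<phi>' (AL.V m Z)) / real (card (accm m))) \<longlonglongrightarrow> (\<integral>\<omega>. \<phi> (limit_map R Rt \<omega>) \<partial>limit_joint F L T H a)"
    using cond(1) by simp
  have "eventually (\<lambda>m. (\<Sum>Z\<in>accm m. \<phi>' (AL.V m Z)) / real (card (accm m)) =
     (\<integral>z. \<phi> z \<partial>distr (measure_pmf (refmt_pmf K iota eff (nq m) T H a L (N m) (x m))) borel
             (\<lambda>Z f. if f < F then sqrt (real (N m)) * (tauhat K iota eff (N m) (Y m) (nq m) Z f
                                               - taupop K iota eff (N m) (Y m) f) else 0))) sequentially"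
    using cond(2)
  proof eventually_elim
    case (elim m)
    let ?t = "\<lambda>Z f. if f < F then sqrt (real (N m)) * (tauhat K iota eff (N m) (Y m) (nq m) Z f - taupop K iota eff (N m) (Y m) f) else 0"
    have fin: "finite (accm m)" unfolding accm by (rule finite_subset[OF _ finite_assignments]) auto
    have "(\<integral>z. \<phi> z \<partial>distr (measure_pmf (refmt_pmf K iota eff (nq m) T H a L (N m) (x m))) borel ?t)
      = (\<integral>Z. \<phi> (?t Z) \<partial>measure_pmf (refmt_pmf K iota eff (nq m) T H a L (N m) (x m)))"
      by (rule integral_distr) (auto intro: borel_measurable_continuous_onI[OF cont])
    also have "\<dots> = (\<Sum>Z\<in>accm m. \<phi> (?t Z)) / real (card (accm m))"
      unfolding refmt_pmf_def by (rule integral_pmf_of_set[OF elim fin])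
    also have "(\<Sum>Z\<in>accm m. \<phi> (?t Z)) = (\<Sum>Z\<in>accm m. \<phi>' (AL.V m Z))"
    proof (rule sum.cong[OF refl])
      fix Z assume "Z \<in> accm m"
      then have Z: "Z \<in> AL.W m" unfolding accm by simp
      have "AL.V m Z (0, f) = ?t Z f" for f
      proof (cases "f < F")
        case True
        then have "(0, f) \<in> ?I" by (simp add: block_index_iff block_dim_def)
        then show ?thesis using True P.linear_stat_effect_array[OF Z, of f] by (simp add: AL.V_def av0)
      next
        case False
        then have "(0, f) \<notin> ?I" by (simp add: block_index_iff block_dim_def)
        then show ?thesis using False by (simp add: AL.V_def)
      qed
      then show "\<phi> (?t Z) = \<phi>' (AL.V m Z)" unfolding \<phi>'_def by (simp only:)
    qed
    finally show ?case ..
  qed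
  from Lim_transform_eventually[OF lim this] show ?thesis .
qed

end

lemma tendsto_subseqI:
  fixes u :: "nat \<Rightarrow> real"
  assumes "\<And>r :: nat \<Rightarrow> nat. strict_mono r \<Longrightarrow> \<exists>r' :: nat \<Rightarrow> nat. strict_mono r' \<and> (\<lambda>k. u (r (r' k))) \<longlonglongrightarrow> c"
  shows "u \<longlonglongrightarrow> c"
proof (rule ccontr)
  assume "\<not> ?thesis"
  then obtain e where e: "e > 0" "\<forall>n0. \<exists>m\<ge>n0. \<bar>u m - c\<bar> \<ge> e"
    unfolding LIMSEQ_iff by (force simp: not_less)
  then have "infinite {m. \<bar>u m - c\<bar> \<ge> e}"
    unfolding infinite_nat_iff_unbounded_le by auto
  from infinite_enumerate[OF this] obtain r :: "nat \<Rightarrow> nat" where r: "strict_mono r" "\<forall>k. r k \<in> {m. \<bar>u m - c\<bar> \<ge> e}" by blast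
  obtain r' :: "nat \<Rightarrow> nat" where r': "(\<lambda>k. u (r (r' k))) \<longlonglongrightarrow> c" using assms[OF r(1)] by blast
  obtain k where "\<bar>u (r (r' k)) - c\<bar> < e" using LIMSEQ_D[OF r' e(1)] by auto
  moreover have "\<bar>u (r (r' k)) - c\<bar> \<ge> e" using r(2) by blast
  ultimately show False by linarith
qed

lemma bounded_family_subseq:
  fixes X :: "nat \<Rightarrow> 'i::countable \<Rightarrow> real"
  assumes "\<And>m p. \<bar>X m p\<bar> \<le> b p"
  shows "\<exists>l r. strict_mono (r :: nat \<Rightarrow> nat) \<and> (\<forall>p. (\<lambda>k. X (r k) p) \<longlonglongrightarrow> l p)"
proof -
  have "compactin (product_topology (\<lambda>_. euclidean) UNIV) (PiE UNIV (\<lambda>p. {- b p..b p}))"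
    by (auto simp: compactin_PiE)
  then have "compact (PiE UNIV (\<lambda>p. {- b p..b p}))" by (simp add: euclidean_product_topology)
  then have "seq_compact (PiE UNIV (\<lambda>p. {- b p..b p}))" by (rule compact_imp_seq_compact)
  moreover have "\<forall>m. X m \<in> PiE UNIV (\<lambda>p. {- b p..b p})"
    using assms by (auto simp: PiE_UNIV_domain abs_le_iff minus_le_iff)
  ultimately obtain l r where r: "strict_mono r" "(X \<circ> r) \<longlonglongrightarrow> l" by (meson seq_compactE)
  have "(\<lambda>k. X (r k) p) \<longlonglongrightarrow> l p" for p
  proof -
    have "continuous_on UNIV (\<lambda>x :: 'i \<Rightarrow> real. x p)" by (rule continuous_on_product_coordinates)
    from continuous_on_tendsto_compose[OF this r(2)] show ?thesis by (simp add: o_def)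
  qed
  then show ?thesis using r(1) by blast
qed

lemma tendsto_coordinatewise_fun:
  fixes X :: "nat \<Rightarrow> 'i \<Rightarrow> real"
  assumes "\<And>p. (\<lambda>k. X k p) \<longlonglongrightarrow> l p"
  shows "X \<longlonglongrightarrow> l"
proof -
  have "limitin (product_topology (\<lambda>_. euclidean) UNIV) X l sequentially"
    unfolding limitin_componentwise using assms by auto
  then show ?thesis by (simp add: euclidean_product_topology)
qed

context factorial_sequence
begin

abbreviation "JJ \<equiv> limit_joint F L T H a"

lemma JJ_eq: "JJ = uniform_measure (gauss_joint H block_dim) (gauss_acc H block_dim a)"
  by (rule limit_joint_eq[OF thresholds]) (auto simp: block_dim_def)

lemma prob_space_JJ: "prob_space JJ"
proof -
  interpret G: prob_space "gauss_joint H block_dim" by (rule prob_space_gauss_joint)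
  show ?thesis unfolding JJ_eq
    by (rule prob_space_uniform_measure)
      (use gauss_acc_pos[OF thresholds, of block_dim] in \<open>auto simp: G.emeasure_eq_measure\<close>)
qed

lemma limit_map_measurable: "limit_map R Rt \<in> borel_measurable JJ"
proof (rule measurable_coordinatewise_then_product)
  fix f
  have m: "(\<lambda>\<omega>. \<omega> h j) \<in> borel_measurable JJ" if "h \<le> H" "j < block_dim h" for h j
    using measurable_gauss_joint_coord[of h H j block_dim, OF that] unfolding JJ_eq by simp
  have "(\<lambda>\<omega>. (\<Sum>j<F. R f j * \<omega> 0 j) + (\<Sum>h\<in>{1..H}. \<Sum>j<L * card (T h). Rt h f j * \<omega> h j)) \<in> borel_measurable JJ"
    by (intro borel_measurable_add borel_measurable_sum borel_measurable_times borel_measurable_const m)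
      (auto simp: block_dim_def)
  then show "(\<lambda>\<omega>. limit_map R Rt \<omega> f) \<in> borel_measurable JJ" unfolding limit_map_def by (cases "f < F") simp_all
qed

lemma root_bound:
  fixes R :: "nat \<Rightarrow> nat \<Rightarrow> real" and d :: nat
  assumes "\<And>m. (\<Sum>j<d. R m j * R m j) = V m" "(\<lambda>m. real (N m) * V m) \<longlonglongrightarrow> v"
  shows "\<exists>b. \<forall>m j. j < d \<longrightarrow> \<bar>sqrt (real (N m)) * R m j\<bar> \<le> b"
proof -
  have "Bseq (\<lambda>m. real (N m) * V m)" using assms(2) by (intro convergent_imp_Bseq convergentI)
  then obtain b where b: "\<And>m. \<bar>real (N m) * V m\<bar> \<le> b" by (auto simp: Bseq_def)
  have "\<bar>sqrt (real (N m)) * R m j\<bar> \<le> sqrt b" if "j < d" for m j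
  proof -
    have "(R m j)\<^sup>2 \<le> V m"
      unfolding assms(1)[symmetric] power2_eq_square
      by (rule member_le_sum[where f = "\<lambda>j. R m j * R m j"]) (use that in auto)
    then have "real (N m) * (R m j)\<^sup>2 \<le> real (N m) * V m" by (rule mult_left_mono) simp
    also have "\<dots> \<le> b" using b[of m] by linarith
    finally have "(sqrt (real (N m)) * R m j)\<^sup>2 \<le> b" by (simp add: power_mult_distrib)
    then show ?thesis by (metis real_sqrt_abs real_sqrt_le_iff)
  qed
  then show ?thesis by blast
qed

lemma refmt_same_limit:
  assumes R_sym: "\<And>m i j. i < F \<Longrightarrow> j < F \<Longrightarrow> R m i j = R m j i"
    and R_root: "\<And>m i j. i < F \<Longrightarrow> j < F \<Longrightarrow> mmul F (R m) (R m) i j = Vpm m i j"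
    and Rt_root: "\<And>m h i j. h \<in> {1..H} \<Longrightarrow> i < F \<Longrightarrow> j < F \<Longrightarrow>
      mmul (L * card (T h)) (Rt m h) (mtr (Rt m h)) i j = Wpm m h i j"
  shows "same_weak_limit
     (\<lambda>m. distr (measure_pmf (refmt_pmf K iota eff (nq m) T H a L (N m) (x m))) borel
             (\<lambda>Z f. if f < F then sqrt (real (N m)) * (tauhat K iota eff (N m) (Y m) (nq m) Z f
                                               - taupop K iota eff (N m) (Y m) f) else 0))
     (\<lambda>m. distr JJ borel (limit_map (\<lambda>f j. sqrt (real (N m)) * R m f j) (\<lambda>h f j. sqrt (real (N m)) * Rt m h f j)))"
proof -
  let ?d = "\<lambda>h. L * card (T h)"
  let ?sq = "\<lambda>m. sqrt (real (N m))"
  let ?Ms = "\<lambda>m. distr (measure_pmf (refmt_pmf K iota eff (nq m) T H a L (N m) (x m))) borel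
             (\<lambda>Z f. if f < F then sqrt (real (N m)) * (tauhat K iota eff (N m) (Y m) (nq m) Z f
                                               - taupop K iota eff (N m) (Y m) f) else 0)"
  let ?Ns = "\<lambda>m. distr JJ borel (limit_map (\<lambda>f j. ?sq m * R m f j) (\<lambda>h f j. ?sq m * Rt m h f j))"
  interpret J: prob_space JJ by (rule prob_space_JJ)
  have RR: "(\<Sum>j<F. R m f j * R m f' j) = Vpm m f f'" if "f < F" "f' < F" for m f f'
  proof -
    have "(\<Sum>j<F. R m f j * R m f' j) = mmul F (R m) (R m) f f'"
      unfolding mmul_def by (rule sum.cong[OF refl]) (use R_sym that in simp)
    then show ?thesis using R_root that by simp
  qed
  have RtRt: "(\<Sum>j<?d h. Rt m h f j * Rt m h f' j) = Wpm m h f f'" if "h \<in> {1..H}" "f < F" "f' < F" for m h f f'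
    using Rt_root[OF that, of m] by (simp add: mmul_def mtr_def)
  define X where "X m p = (case p of (h, f, j) \<Rightarrow>
      if f < F \<and> h = 0 \<and> j < F then ?sq m * R m f j
      else if f < F \<and> h \<in> {1..H} \<and> j < ?d h then ?sq m * Rt m h f j else 0)" for m and p :: "nat \<times> nat \<times> nat"
  have "\<exists>b. \<forall>m. \<bar>X m p\<bar> \<le> b" for p
  proof -
    obtain h f j where p: "p = (h, f, j)" by (cases p) auto
    consider "f < F" "h = 0" "j < F" | "f < F" "h \<in> {1..H}" "j < ?d h" | "\<forall>m. X m p = 0"
      unfolding p X_def by fastforce
    then show ?thesis
    proof cases
      case 1
      obtain b where "\<forall>m j. j < F \<longrightarrow> \<bar>?sq m * R m f j\<bar> \<le> b"
        using root_bound[where d = F and R = "\<lambda>m. R m f" and V = "\<lambda>m. Vpm m f f", OF RR[OF 1(1) 1(1)] Vpm_lim[OF 1(1) 1(1)]] by blast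
      then show ?thesis using 1 by (intro exI[of _ b]) (simp add: p X_def)
    next
      case 2
      obtain b where b: "\<forall>m j. j < ?d h \<longrightarrow> \<bar>?sq m * Rt m h f j\<bar> \<le> b"
        using root_bound[where d = "?d h" and R = "\<lambda>m. Rt m h f" and V = "\<lambda>m. Wpm m h f f", OF RtRt[OF 2(2,1,1)] Wpm_lim[OF 2(2)]] by blast
      have "X m p = ?sq m * Rt m h f j" for m using 2 by (simp add: p X_def)
      then show ?thesis using 2 b by (intro exI[of _ b]) simp
    next
      case 3
      then show ?thesis by (intro exI[of _ 0]) simp
    qed
  qed
  then obtain b where b: "\<And>m p. \<bar>X m p\<bar> \<le> b p" by metis
  define Rl where "Rl l f j = l (0, f, j)" for l :: "nat \<times> nat \<times> nat \<Rightarrow> real" and f j :: nat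
  define Rtl where "Rtl l h f j = l (h, f, j)" for l :: "nat \<times> nat \<times> nat \<Rightarrow> real" and h f j :: nat
  have XR: "X m (0, f, j) = ?sq m * R m f j" if "f < F" "j < F" for m f j using that by (simp add: X_def)
  have XRt: "X m (h, f, j) = ?sq m * Rt m h f j" if "h \<in> {1..H}" "f < F" "j < ?d h" for m h f j
    using that by (simp add: X_def)
  have sq2: "(?sq m * u) * (?sq m * v) = real (N m) * (u * v)" for m u v
  proof -
    have "(?sq m * u) * (?sq m * v) = (?sq m * ?sq m) * (u * v)" by (simp only: mult_ac)
    then show ?thesis by simp
  qed
  have limits: "(\<forall>\<phi> :: rvec \<Rightarrow> real. continuous_on UNIV \<phi> \<longrightarrow> bounded (range \<phi>) \<longrightarrow>
        (\<lambda>m. \<integral>z. \<phi> z \<partial>?Ms m) \<longlonglongrightarrow> (\<integral>\<omega>. \<phi> (limit_map (Rl l) (Rtl l) \<omega>) \<partial>JJ)) \<and>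
      (\<forall>\<phi> :: rvec \<Rightarrow> real. continuous_on UNIV \<phi> \<longrightarrow> bounded (range \<phi>) \<longrightarrow>
        (\<lambda>k. \<integral>z. \<phi> z \<partial>?Ns (r k)) \<longlonglongrightarrow> (\<integral>\<omega>. \<phi> (limit_map (Rl l) (Rtl l) \<omega>) \<partial>JJ))"
    if r: "strict_mono r" and l: "\<And>p. (\<lambda>k. X (r k) p) \<longlonglongrightarrow> l p" for l and r :: "nat \<Rightarrow> nat"
  proof -
    have root1: "mmul F (Rl l) (mtr (Rl l)) f f' = Vpl f f'" if ff: "f < F" "f' < F" for f f'
    proof -
      have "(\<lambda>k. \<Sum>j<F. X (r k) (0, f, j) * X (r k) (0, f', j)) \<longlonglongrightarrow> (\<Sum>j<F. l (0, f, j) * l (0, f', j))"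
        by (intro tendsto_sum tendsto_mult l)
      moreover have "(\<Sum>j<F. X m (0, f, j) * X m (0, f', j)) = real (N m) * Vpm m f f'" for m
      proof -
        have "(\<Sum>j<F. X m (0, f, j) * X m (0, f', j)) = (\<Sum>j<F. real (N m) * (R m f j * R m f' j))"
          by (rule sum.cong[OF refl]) (use ff in \<open>simp only: XR sq2 lessThan_iff\<close>)
        then show ?thesis unfolding RR[OF ff, symmetric] sum_distrib_left .
      qed
      moreover have "(\<lambda>k. real (N (r k)) * Vpm (r k) f f') \<longlonglongrightarrow> Vpl f f'"
        using LIMSEQ_subseq_LIMSEQ[OF Vpm_lim[OF ff] r] by (simp add: o_def)
      ultimately have "(\<Sum>j<F. l (0, f, j) * l (0, f', j)) = Vpl f f'" using LIMSEQ_unique by simp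
      then show ?thesis by (simp add: mmul_def mtr_def Rl_def)
    qed
    have root2: "mmul (?d h) (Rtl l h) (mtr (Rtl l h)) f f' = Pl h f f'" if h: "h \<in> {1..H}" and ff: "f < F" "f' < F" for h f f'
    proof -
      have "(\<lambda>k. \<Sum>j<?d h. X (r k) (h, f, j) * X (r k) (h, f', j)) \<longlonglongrightarrow> (\<Sum>j<?d h. l (h, f, j) * l (h, f', j))"
        by (intro tendsto_sum tendsto_mult l)
      moreover have "(\<Sum>j<?d h. X m (h, f, j) * X m (h, f', j)) = real (N m) * Wpm m h f f'" for m
      proof -
        have "(\<Sum>j<?d h. X m (h, f, j) * X m (h, f', j)) = (\<Sum>j<?d h. real (N m) * (Rt m h f j * Rt m h f' j))"
          by (rule sum.cong[OF refl]) (use ff h in \<open>simp only: XRt sq2 lessThan_iff\<close>)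
        then show ?thesis unfolding RtRt[OF h ff, symmetric] sum_distrib_left .
      qed
      moreover have "(\<lambda>k. real (N (r k)) * Wpm (r k) h f f') \<longlonglongrightarrow> Pl h f f'"
        using LIMSEQ_subseq_LIMSEQ[OF Wpm_lim[OF h] r] by (simp add: o_def)
      ultimately have "(\<Sum>j<?d h. l (h, f, j) * l (h, f', j)) = Pl h f f'" using LIMSEQ_unique by simp
      then show ?thesis by (simp add: mmul_def mtr_def Rtl_def)
    qed
    show ?thesis
    proof (intro conjI allI impI)
      fix \<phi> :: "rvec \<Rightarrow> real" assume \<phi>: "continuous_on UNIV \<phi>" "bounded (range \<phi>)"
      obtain B where B: "\<And>v. \<bar>\<phi> v\<bar> \<le> B" using \<phi>(2) by (auto simp: bounded_iff)
      show "(\<lambda>m. \<integral>z. \<phi> z \<partial>?Ms m) \<longlonglongrightarrow> (\<integral>\<omega>. \<phi> (limit_map (Rl l) (Rtl l) \<omega>) \<partial>JJ)"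
        by (rule refmt_limit[OF root1 root2 \<phi>(1) B])
      have \<phi>m: "\<phi> \<in> borel_measurable borel" by (rule borel_measurable_continuous_onI[OF \<phi>(1)])
      let ?limit_map = "\<lambda>m. limit_map (\<lambda>f j. ?sq m * R m f j) (\<lambda>h f j. ?sq m * Rt m h f j)"
      have "(\<lambda>k. \<integral>\<omega>. \<phi> (?limit_map (r k) \<omega>) \<partial>JJ) \<longlonglongrightarrow> (\<integral>\<omega>. \<phi> (limit_map (Rl l) (Rtl l) \<omega>) \<partial>JJ)"
      proof (rule integral_dominated_convergence[where w = "\<lambda>_. B"])
        show "(\<lambda>\<omega>. \<phi> (limit_map (Rl l) (Rtl l) \<omega>)) \<in> borel_measurable JJ"
          by (rule measurable_compose[OF limit_map_measurable \<phi>m])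
        show "(\<lambda>\<omega>. \<phi> (?limit_map (r k) \<omega>)) \<in> borel_measurable JJ" for k
          by (rule measurable_compose[OF limit_map_measurable \<phi>m])
        show "integrable JJ (\<lambda>_. B)" by (rule J.integrable_const)
        show "AE \<omega> in JJ. (\<lambda>k. \<phi> (?limit_map (r k) \<omega>)) \<longlonglongrightarrow> \<phi> (limit_map (Rl l) (Rtl l) \<omega>)"
        proof (rule AE_I2)
          fix \<omega>
          have "(\<lambda>k. ?limit_map (r k) \<omega>) \<longlonglongrightarrow> limit_map (Rl l) (Rtl l) \<omega>"
          proof (rule tendsto_coordinatewise_fun)
            fix f
            show "(\<lambda>k. ?limit_map (r k) \<omega> f) \<longlonglongrightarrow> limit_map (Rl l) (Rtl l) \<omega> f"
            proof (cases "f < F")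
              case f: True
              have "(\<lambda>k. (\<Sum>j<F. X (r k) (0, f, j) * \<omega> 0 j) + (\<Sum>h\<in>{1..H}. \<Sum>j<?d h. X (r k) (h, f, j) * \<omega> h j))
                \<longlonglongrightarrow> (\<Sum>j<F. l (0, f, j) * \<omega> 0 j) + (\<Sum>h\<in>{1..H}. \<Sum>j<?d h. l (h, f, j) * \<omega> h j)"
                by (intro tendsto_add tendsto_sum tendsto_mult_right l)
              moreover have "(\<Sum>j<F. X m (0, f, j) * \<omega> 0 j) = (\<Sum>j<F. ?sq m * R m f j * \<omega> 0 j)" for m
                by (rule sum.cong[OF refl]) (use f in \<open>simp only: XR lessThan_iff\<close>)
              moreover have "(\<Sum>h\<in>{1..H}. \<Sum>j<?d h. X m (h, f, j) * \<omega> h j) = (\<Sum>h\<in>{1..H}. \<Sum>j<?d h. ?sq m * Rt m h f j * \<omega> h j)" for m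
                by (intro sum.cong refl) (use f in \<open>simp only: XRt lessThan_iff\<close>)
              ultimately show ?thesis using f by (simp only: limit_map_def if_True Rl_def Rtl_def)
            qed (simp add: limit_map_def)
          qed
          moreover have "isCont \<phi> (limit_map (Rl l) (Rtl l) \<omega>)" using \<phi>(1) by (simp add: continuous_on_eq_continuous_at)
          ultimately show "(\<lambda>k. \<phi> (?limit_map (r k) \<omega>)) \<longlonglongrightarrow> \<phi> (limit_map (Rl l) (Rtl l) \<omega>)"
            by (rule isCont_tendsto_compose[rotated])
        qed
      qed (use B in auto)
      moreover have "(\<integral>z. \<phi> z \<partial>?Ns m) = (\<integral>\<omega>. \<phi> (?limit_map m \<omega>) \<partial>JJ)" for m
        by (rule integral_distr[OF limit_map_measurable \<phi>m])
      ultimately show "(\<lambda>k. \<integral>z. \<phi> z \<partial>?Ns (r k)) \<longlonglongrightarrow> (\<integral>\<omega>. \<phi> (limit_map (Rl l) (Rtl l) \<omega>) \<partial>JJ)" by simp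
    qed
  qed
  obtain l0 r0 where r0: "strict_mono r0" and l0: "\<And>p. (\<lambda>k. X (r0 k) p) \<longlonglongrightarrow> l0 p"
    using bounded_family_subseq[of X b] b by blast
  define \<mu> where "\<mu> = distr JJ borel (limit_map (Rl l0) (Rtl l0))"
  have \<mu>: "(\<integral>z. \<phi> z \<partial>\<mu>) = (\<integral>\<omega>. \<phi> (limit_map (Rl l0) (Rtl l0) \<omega>) \<partial>JJ)" if "continuous_on UNIV \<phi>" for \<phi> :: "rvec \<Rightarrow> real"
    unfolding \<mu>_def by (rule integral_distr[OF limit_map_measurable borel_measurable_continuous_onI[OF that]])
  show ?thesis
    unfolding same_weak_limit_def
  proof (intro exI[of _ \<mu>] conjI)
    show "prob_space \<mu>" unfolding \<mu>_def by (rule J.prob_space_distr[OF limit_map_measurable])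
    show "sets \<mu> = sets borel" by (simp add: \<mu>_def)
    show "weak_conv_to ?Ms \<mu>"
      unfolding weak_conv_to_def using limits[OF r0 l0] \<mu> by auto
    show "weak_conv_to ?Ns \<mu>"
      unfolding weak_conv_to_def
    proof (intro allI impI)
      fix \<phi> :: "rvec \<Rightarrow> real" assume \<phi>: "continuous_on UNIV \<phi>" "bounded (range \<phi>)"
      have Ms0: "(\<lambda>m. \<integral>z. \<phi> z \<partial>?Ms m) \<longlonglongrightarrow> (\<integral>z. \<phi> z \<partial>\<mu>)" using limits[OF r0 l0] \<phi> \<mu>[OF \<phi>(1)] by auto
      show "(\<lambda>m. \<integral>z. \<phi> z \<partial>?Ns m) \<longlonglongrightarrow> (\<integral>z. \<phi> z \<partial>\<mu>)"
      proof (rule tendsto_subseqI)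
        fix r :: "nat \<Rightarrow> nat" assume r: "strict_mono r"
        obtain l r' where r': "strict_mono r'" and l: "\<And>p. (\<lambda>k. X (r (r' k)) p) \<longlonglongrightarrow> l p"
          using bounded_family_subseq[of "\<lambda>k. X (r k)" b] b by blast
        have rr': "strict_mono (\<lambda>k. r (r' k))" using strict_mono_o[OF r r'] by (simp add: o_def)
        have "(\<lambda>m. \<integral>z. \<phi> z \<partial>?Ms m) \<longlonglongrightarrow> (\<integral>\<omega>. \<phi> (limit_map (Rl l) (Rtl l) \<omega>) \<partial>JJ)" using limits[OF rr' l] \<phi> by blast
        then have "(\<integral>\<omega>. \<phi> (limit_map (Rl l) (Rtl l) \<omega>) \<partial>JJ) = (\<integral>z. \<phi> z \<partial>\<mu>)" using Ms0 LIMSEQ_unique by blast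
        moreover have "(\<lambda>k. \<integral>z. \<phi> z \<partial>?Ns (r (r' k))) \<longlonglongrightarrow> (\<integral>\<omega>. \<phi> (limit_map (Rl l) (Rtl l) \<omega>) \<partial>JJ)"
          using limits[OF rr' l] \<phi> by blast
        ultimately show "\<exists>r'. strict_mono r' \<and> (\<lambda>k. \<integral>z. \<phi> z \<partial>?Ns (r (r' k))) \<longlonglongrightarrow> (\<integral>z. \<phi> z \<partial>\<mu>)"
          using r' by auto
      qed
    qed
  qed
qed

end

theorem theorem7:
  fixes K L H :: nat
    and iota :: "nat \<Rightarrow> nat \<Rightarrow> real"
    and eff :: "nat \<Rightarrow> nat set"
    and T :: "nat \<Rightarrow> nat set"
    and a :: "nat \<Rightarrow> real"
    and N :: "nat \<Rightarrow> nat"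
    and nq :: "nat \<Rightarrow> nat \<Rightarrow> nat"
    and Y :: "nat \<Rightarrow> nat \<Rightarrow> nat \<Rightarrow> real"
    and x :: "nat \<Rightarrow> nat \<Rightarrow> nat \<Rightarrow> real"
    and R :: "nat \<Rightarrow> rmat"
    and Rt :: "nat \<Rightarrow> nat \<Rightarrow> rmat"
  assumes K: "K \<ge> 1"
    and iota: "bij_betw (\<lambda>q. restrict (iota q) {..<K}) {..<2^K} ({..<K} \<rightarrow>\<^sub>E {-1, 1})"
    and eff: "bij_betw eff {..<2^K - 1} {A. A \<subseteq> {..<K} \<and> A \<noteq> {}}"
    and H: "H \<ge> 1"
    and tiers_cover: "(\<Union>h\<in>{1..H}. T h) = {..<2^K - 1}"
    and tiers_ne: "\<forall>h\<in>{1..H}. T h \<noteq> {}"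
    and tiers_disj: "\<forall>h\<in>{1..H}. \<forall>l\<in>{1..H}. h \<noteq> l \<longrightarrow> T h \<inter> T l = {}"
    and thresholds: "\<forall>h\<in>{1..H}. a h > 0"
    and nq_pos: "\<forall>m. \<forall>q<2^K. nq m q \<ge> 1"
    and nq_sum: "\<forall>m. (\<Sum>q<2^K. nq m q) = N m"
    and N_lim: "filterlim N at_top sequentially"
    and reg_i: "\<forall>q<2^K. \<exists>c>0. (\<lambda>m. real (nq m q) / real (N m)) \<longlonglongrightarrow> c"
    and reg_ii_Y: "\<forall>q<2^K. \<forall>k<2^K. convergent (\<lambda>m. pcov (N m) (\<lambda>i. Y m i q) (\<lambda>i. Y m i k))"
    and reg_ii_xx: "\<forall>m. nonsingular L (Sxx (N m) (x m))"
    and reg_ii_xx_lim: "\<exists>S. (\<forall>l<L. \<forall>l'<L. (\<lambda>m. Sxx (N m) (x m) l l') \<longlonglongrightarrow> S l l') \<and> nonsingular L S"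
    and reg_ii_qx: "\<forall>q<2^K. \<forall>l<L. convergent (\<lambda>m. Sqx (N m) (Y m) (x m) q l)"
    and reg_iii_Y: "\<forall>q<2^K. (\<lambda>m. Max ((\<lambda>i. (Y m i q - pmean (N m) (\<lambda>j. Y m j q))\<^sup>2) ` {..<N m})
                                / real (N m)) \<longlonglongrightarrow> 0"
    and reg_iii_x: "(\<lambda>m. Max ((\<lambda>i. \<Sum>l<L. (x m i l - pmean (N m) (\<lambda>j. x m j l))\<^sup>2) ` {..<N m})
                                / real (N m)) \<longlonglongrightarrow> 0"
    and R_root: "\<forall>m. (\<forall>i<2^K - 1. \<forall>j<2^K - 1. R m i j = R m j i)
                    \<and> (\<forall>v. (\<Sum>i<2^K - 1. \<Sum>j<2^K - 1. v i * R m i j * v j) \<ge> 0)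
                    \<and> (\<forall>i<2^K - 1. \<forall>j<2^K - 1.
                          mmul (2^K - 1) (R m) (R m) i j = Vperp K iota eff (nq m) (N m) L (Y m) (x m) i j)"
    and Rt_root: "\<forall>m. \<forall>h\<in>{1..H}. \<forall>i<2^K - 1. \<forall>j<2^K - 1.
                    mmul (L * card (T h)) (Rt m h) (mtr (Rt m h)) i j
                      = Wpar K iota eff (nq m) T L (N m) (Y m) (x m) h i j"
  shows "same_weak_limit
     (\<lambda>m. distr (measure_pmf (refmt_pmf K iota eff (nq m) T H a L (N m) (x m))) borel
             (\<lambda>Z f. if f < 2^K - 1
                    then sqrt (real (N m)) * (tauhat K iota eff (N m) (Y m) (nq m) Z f
                                               - taupop K iota eff (N m) (Y m) f)
                    else 0))
     (\<lambda>m. distr (limit_joint (2^K - 1) L T H a) borel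
             (\<lambda>\<omega> f. if f < 2^K - 1
                    then sqrt (real (N m)) *
                           ((\<Sum>j<2^K - 1. R m f j * \<omega> 0 j)
                            + (\<Sum>h\<in>{1..H}. \<Sum>j<L * card (T h). Rt m h f j * \<omega> h j))
                    else 0))"
proof -
  interpret factorial_sequence K H iota eff T L a N nq Y x
    by unfold_locales (fact K iota eff H tiers_cover tiers_ne tiers_disj thresholds nq_pos nq_sum N_lim
        reg_i reg_ii_Y reg_ii_xx reg_ii_xx_lim reg_ii_qx reg_iii_Y reg_iii_x)+
  have "limit_map (\<lambda>f j. sqrt (real (N m)) * R m f j) (\<lambda>h f j. sqrt (real (N m)) * Rt m h f j)
    = (\<lambda>\<omega> f. if f < 2^K - 1
                    then sqrt (real (N m)) *
                           ((\<Sum>j<2^K - 1. R m f j * \<omega> 0 j)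
                            + (\<Sum>h\<in>{1..H}. \<Sum>j<L * card (T h). Rt m h f j * \<omega> h j))
                    else 0)" for m
    by (intro ext) (simp only: limit_map_def distrib_left sum_distrib_left mult.assoc)
  moreover have "same_weak_limit
     (\<lambda>m. distr (measure_pmf (refmt_pmf K iota eff (nq m) T H a L (N m) (x m))) borel
             (\<lambda>Z f. if f < 2^K - 1
                    then sqrt (real (N m)) * (tauhat K iota eff (N m) (Y m) (nq m) Z f
                                               - taupop K iota eff (N m) (Y m) f)
                    else 0))
     (\<lambda>m. distr JJ borel (limit_map (\<lambda>f j. sqrt (real (N m)) * R m f j) (\<lambda>h f j. sqrt (real (N m)) * Rt m h f j)))"
    by (rule refmt_same_limit) (use R_root Rt_root in auto)
  ultimately show ?thesis by (simp only:)
qed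

end
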